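(* Let $U\subset X$ be $1$-finely open and let $x\in U$. Then there exist a $1$-finely open set $W$ with $x\in W\subset U$ and a function $w\in N_0^{1,1}(U)$ such that $0\le w\le 1$ on $X$, $w=1$ on $W$, and $\operatorname{supp} w\Subset U$ (i.e. $\operatorname{supp} w$ is a compact subset of $U$). Moreover, if $\mathrm{Cap}_1(\{x\})=0$, then $W$ and $w$ can be chosen so that in addition $\|w\|_{N^{1,1}(X)}$ is smaller than any prescribed $\varepsilon>0$.
   Context: Standing assumptions: $(X,d,\mu)$ is a complete metric space with at least two points, $\mu$ is a Borel regular outer measure that is doubling ($0<\mu(B(y,2r))\le C_d\mu(B(y,r))<\infty$ for all balls), and $X$ supports a $(1,1)$-Poincaré inequality: there are $C_P>0$, $\lambda\ge1$ such that for every ball $B(y,r)$, every $u\in L^1_{\mathrm{loc}}(X)$ and every upper gradient $g$ of $u$, the mean of $|u-u_{B(y,r)}|$ over $B(y,r)$ is at most $C_P r$ times the mean of $g$ over $B(y,\lambda r)$. A nonnegative Borel $g$ is an upper gradient of $u$ if $|u(a)-u(b)|\le\int_\gamma g\,ds$ for every nonconstant rectifiable curve $\gamma$ with endpoints $a,b$; $g$ is a $1$-weak upper gradient if this holds for all curves outside a family of zero $1$-modulus (a family has zero $1$-modulus if some nonnegative Borel $\rho\in L^1(X)$ has $\int_\gamma\rho\,ds=\infty$ on each of its curves). For $\mu$-measurable $D$, $N^{1,1}(D)$ is the space of everywhere defined functions $u$ on $D$ with $\|u\|_{N^{1,1}(D)}:=\|u\|_{L^1(D)}+\inf_g\|g\|_{L^1(D)}<\infty$,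 infimum over $1$-weak upper gradients of $u$ in $D$; $g_u$ is the minimal one. $N_0^{1,1}(D)$ consists of restrictions to $D$ of $u\in N^{1,1}(X)$ with $u=0$ on $X\setminus D$. The $1$-capacity is $\mathrm{Cap}_1(A):=\inf\|u\|_{N^{1,1}(X)}$ over $u\in N^{1,1}(X)$ with $u\ge1$ on $A$. The variational capacity is $\mathrm{cap}_1(A,D):=\inf\int_X g_u\,d\mu$ over $u\in N^{1,1}_0(D)$ with $u\ge1$ on $A$. A set $A$ is $1$-thin at $x$ if $\lim_{r\to0} r\,\mathrm{cap}_1(A\cap B(x,r),B(x,2r))/\mu(B(x,r))=0$; a set $U$ is $1$-finely open if $X\setminus U$ is $1$-thin at every point of $U$. *)

theory Defs
  imports "HOL-Analysis.Analysis"
begin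

definition curve_length :: "(real \<Rightarrow> 'a::metric_space) \<Rightarrow> real \<Rightarrow> real \<Rightarrow> ennreal" where
  "curve_length \<gamma> a b =
     (SUP p \<in> {(n, t). t 0 = a \<and> t n = b \<and> (\<forall>i<n. t i \<le> t (Suc i))}.
        (\<Sum>i<fst p. ennreal (dist (\<gamma> (snd p i)) (\<gamma> (snd p (Suc i))))))"

definition rect_curve :: "(real \<Rightarrow> 'a::metric_space) \<Rightarrow> real \<Rightarrow> real \<Rightarrow> bool" where
  "rect_curve \<gamma> a b \<longleftrightarrow> a < b \<and> continuous_on {a..b} \<gamma> \<and> curve_length \<gamma> a b < \<infinity>
     \<and> (\<exists>t\<in>{a..b}. \<gamma> t \<noteq> \<gamma> a)"

definition arclen_param :: "(real \<Rightarrow> 'a::metric_space) \<Rightarrow> real \<Rightarrow> real \<Rightarrow> real \<Rightarrow> 'a" where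
  "arclen_param \<gamma> a b s = \<gamma> (SOME t. t \<in> {a..b} \<and> curve_length \<gamma> a t = ennreal s)"

definition line_integral :: "('a::metric_space \<Rightarrow> ennreal) \<Rightarrow> (real \<Rightarrow> 'a) \<Rightarrow> real \<Rightarrow> real \<Rightarrow> ennreal" where
  "line_integral g \<gamma> a b =
     (\<integral>\<^sup>+ s. g (arclen_param \<gamma> a b s) * indicator {0..enn2real (curve_length \<gamma> a b)} s \<partial>lborel)"

definition upper_gradient :: "('a::metric_space \<Rightarrow> real) \<Rightarrow> ('a \<Rightarrow> ennreal) \<Rightarrow> bool" where
  "upper_gradient u g \<longleftrightarrow> g \<in> borel_measurable borel \<and>
     (\<forall>\<gamma> a b. rect_curve \<gamma> a b \<longrightarrow>
        ennreal \<bar>u (\<gamma> a) - u (\<gamma> b)\<bar> \<le> line_integral g \<gamma> a b)"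

definition zero_mod1 :: "'a::metric_space measure \<Rightarrow> ((real \<Rightarrow> 'a) \<times> real \<times> real) set \<Rightarrow> bool" where
  "zero_mod1 M \<Gamma> \<longleftrightarrow> (\<exists>\<rho>::'a \<Rightarrow> ennreal. \<rho> \<in> borel_measurable borel \<and>
      (\<integral>\<^sup>+ z. \<rho> z \<partial>M) < \<infinity> \<and>
      (\<forall>(\<gamma>, a, b) \<in> \<Gamma>. line_integral \<rho> \<gamma> a b = \<infinity>))"

definition weak_ug :: "'a::metric_space measure \<Rightarrow> 'a set \<Rightarrow> ('a \<Rightarrow> real) \<Rightarrow> ('a \<Rightarrow> ennreal) \<Rightarrow> bool" where
  "weak_ug M D u g \<longleftrightarrow> g \<in> borel_measurable borel \<and>
     zero_mod1 M {(\<gamma>, a, b). rect_curve \<gamma> a b \<and> \<gamma> ` {a..b} \<subseteq> D \<and>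
        \<not> (ennreal \<bar>u (\<gamma> a) - u (\<gamma> b)\<bar> \<le> line_integral g \<gamma> a b)}"

text \<open>The measure mu is represented by a Borel measure M; mu-measurable sets and
  functions are those of the completion of M.\<close>

definition N11_norm :: "'a::metric_space measure \<Rightarrow> 'a set \<Rightarrow> ('a \<Rightarrow> real) \<Rightarrow> ennreal" where
  "N11_norm M D u = (\<integral>\<^sup>+ z. ennreal \<bar>u z\<bar> * indicator D z \<partial>completion M)
      + (INF g \<in> {g. weak_ug M D u g}. \<integral>\<^sup>+ z. g z * indicator D z \<partial>M)"

definition in_N11 :: "'a::metric_space measure \<Rightarrow> 'a set \<Rightarrow> ('a \<Rightarrow> real) \<Rightarrow> bool" where
  "in_N11 M D u \<longleftrightarrow> (\<lambda>z. u z * indicator D z) \<in> borel_measurable (completion M)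
      \<and> N11_norm M D u < \<infinity>"

text \<open>N_0^{1,1}(D), represented by the zero extensions to X.\<close>
definition in_N11_0 :: "'a::metric_space measure \<Rightarrow> 'a set \<Rightarrow> ('a \<Rightarrow> real) \<Rightarrow> bool" where
  "in_N11_0 M D u \<longleftrightarrow> in_N11 M UNIV u \<and> (\<forall>z. z \<notin> D \<longrightarrow> u z = 0)"

definition Cap1 :: "'a::metric_space measure \<Rightarrow> 'a set \<Rightarrow> ennreal" where
  "Cap1 M A = (INF u \<in> {u. in_N11 M UNIV u \<and> (\<forall>z\<in>A. 1 \<le> u z)}. N11_norm M UNIV u)"

text \<open>Variational capacity; the integral of the minimal 1-weak upper gradient g_u
  equals the infimum of the integrals of all 1-weak upper gradients of u.\<close>
definition cap1 :: "'a::metric_space measure \<Rightarrow> 'a set \<Rightarrow> 'a set \<Rightarrow> ennreal" where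
  "cap1 M A D = (INF u \<in> {u. in_N11_0 M D u \<and> (\<forall>z\<in>A. 1 \<le> u z)}.
                   INF g \<in> {g. weak_ug M UNIV u g}. \<integral>\<^sup>+ z. g z \<partial>M)"

definition thin1 :: "'a::metric_space measure \<Rightarrow> 'a set \<Rightarrow> 'a \<Rightarrow> bool" where
  "thin1 M A x \<longleftrightarrow>
     ((\<lambda>r. ennreal r * cap1 M (A \<inter> ball x r) (ball x (2 * r)) / emeasure M (ball x r))
        \<longlongrightarrow> 0) (at_right 0)"

definition finely_open1 :: "'a::metric_space measure \<Rightarrow> 'a set \<Rightarrow> bool" where
  "finely_open1 M U \<longleftrightarrow> (\<forall>x\<in>U. thin1 M (- U) x)"

definition L1_loc :: "'a::metric_space measure \<Rightarrow> ('a \<Rightarrow> real) \<Rightarrow> bool" where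
  "L1_loc M u \<longleftrightarrow> u \<in> borel_measurable (completion M) \<and>
     (\<forall>x. \<exists>r>0. set_integrable (completion M) (ball x r) u)"

definition doubling :: "'a::metric_space measure \<Rightarrow> bool" where
  "doubling M \<longleftrightarrow> (\<exists>Cd. \<forall>y r. r > 0 \<longrightarrow>
      0 < emeasure M (ball y (2 * r)) \<and>
      emeasure M (ball y (2 * r)) \<le> ennreal Cd * emeasure M (ball y r) \<and>
      emeasure M (ball y (2 * r)) < \<infinity>)"

definition poincare_11 :: "'a::metric_space measure \<Rightarrow> bool" where
  "poincare_11 M \<longleftrightarrow> (\<exists>CP lam. CP > 0 \<and> lam \<ge> (1::real) \<and>
     (\<forall>y r u g. r > 0 \<longrightarrow> L1_loc M u \<longrightarrow> upper_gradient u g \<longrightarrow>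
        (\<integral>\<^sup>+ z. ennreal \<bar>u z - (\<integral>w\<in>ball y r. u w \<partial>completion M) / measure M (ball y r)\<bar>
              * indicator (ball y r) z \<partial>completion M) / emeasure M (ball y r)
        \<le> ennreal (CP * r) * ((\<integral>\<^sup>+ z. g z * indicator (ball y (lam * r)) z \<partial>M)
              / emeasure M (ball y (lam * r)))))"

definition supp :: "('a::topological_space \<Rightarrow> real) \<Rightarrow> 'a set" where
  "supp w = closure {z. w z \<noteq> 0}"

end

theory Submission
  imports Defs
begin

text \<open>
  Let \<open>A\<close> be the complement of \<open>U\<close>. By a boxing inequality, a set of small variational capacity is
  covered by balls \<open>B(p, s)\<close> with small \<open>\<Sum> \<mu>(B(p, s)) / s\<close>. To reach every point of the set, including
  points in exceptional sets of zero capacity, the admissible function is first replaced by the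
  lower semicontinuous function \<open>v(y) = inf \<integral> g ds\<close> over curves from \<open>y\<close> to the complement of the
  ball, realised as a limit of infima over discrete chains; the superlevel sets of \<open>v\<close> are open,
  so the relative isoperimetric inequality for a well-chosen level set can be used at each point.

  Covers of \<open>A\<close> at the dyadic scales around \<open>x\<close> are glued into one family \<open>\<F>\<close> of finite total
  cost that has density zero at \<open>x\<close>. Then \<open>w\<close> is a cutoff at \<open>x\<close> minus the cutoffs of the balls
  of \<open>\<F>\<close>, and \<open>W\<close> consists of the points near \<open>x\<close> outside all closed doubled balls at which
  \<open>\<F>\<close> has density zero. The set where the density does not vanish has zero capacity, since it is
  governed by arbitrarily small tails of \<open>\<F>\<close>; this makes \<open>W\<close> finely open. If \<open>x\<close> has zero
  capacity, then \<open>\<mu>(B(x, r)) / r\<close> is small along a sequence of radii, which makes the norm of \<open>w\<close> small.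
\<close>

section \<open>Arc length\<close>

text \<open>The covers at the dyadic scales r_i cannot simply be united: their costs are controlled
  by m_i = \<epsilon>_i \<mu>(B(x, r_i)) / r_i, and \<mu>(B(x, r)) / r may stay bounded away from
  zero as r tends to 0, as on the real line, so the m_i need not be summable. One cover is therefore
  kept in force over several scales, until m has halved. Its balls may then be much larger than the
  annulus where they are used. Small \<epsilon> still keeps x out of the closed doubled balls: a
  ball B(p, s) whose closed double contains x costs a fixed fraction of \<mu>(B(x, r_j)) / r_j at
  some scale r_j comparable to s. At a point y of W a similar dichotomy works: a doubled ball close
  to y is either one of finitely many large ones, at positive distance from y, or small compared
  with the ball around y that it meets. The Poincare inequality enters twice: on indicators it
  yields reverse doubling, so that a level set inside B(x, 2r) fills at most half of a larger ball;
  on truncations of v it bounds \<mu>(B) / rad(B) by the energy in a thin strip of levels.\<close>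

lemma sum_lessThan_plus:
  fixes f :: "nat \<Rightarrow> 'b::comm_monoid_add"
  shows "(\<Sum>i<n + m. f i) = (\<Sum>i<n. f i) + (\<Sum>i<m. f (n + i))"
  by (induction m) (auto simp: add.assoc)

definition mesh :: "real \<Rightarrow> real \<Rightarrow> nat \<Rightarrow> (nat \<Rightarrow> real) \<Rightarrow> bool" where
  "mesh a b n t \<longleftrightarrow> t 0 = a \<and> t n = b \<and> (\<forall>i<n. t i \<le> t (Suc i))"

lemma mesh_le: "mesh a b n t \<Longrightarrow> i \<le> j \<Longrightarrow> j \<le> n \<Longrightarrow> t i \<le> t j"
proof (induction j)
  case (Suc j)
  show ?case
  proof (cases "i = Suc j")
    case False
    then have "t i \<le> t j" using Suc by simp
    also have "t j \<le> t (Suc j)" using Suc.prems by (simp add: mesh_def)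
    finally show ?thesis .
  qed simp
qed simp

lemma mesh_ends_le: "mesh a b n t \<Longrightarrow> a \<le> b"
  using mesh_le[of a b n t 0 n] by (auto simp: mesh_def)

lemma mesh_butlast: "mesh a b (Suc n) t \<Longrightarrow> mesh a (t n) n t \<and> t n \<le> b"
  by (auto simp: mesh_def)

definition mesh_sum :: "(real \<Rightarrow> 'a::metric_space) \<Rightarrow> nat \<Rightarrow> (nat \<Rightarrow> real) \<Rightarrow> ennreal" where
  "mesh_sum \<gamma> n t = (\<Sum>i<n. ennreal (dist (\<gamma> (t i)) (\<gamma> (t (Suc i)))))"

lemma curve_length_alt:
  "curve_length \<gamma> a b = (SUP p\<in>{p. mesh a b (fst p) (snd p)}. mesh_sum \<gamma> (fst p) (snd p))"
  unfolding curve_length_def mesh_def mesh_sum_def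
  by (rule SUP_cong) auto

lemma mesh_sum_le_length: "mesh a b n t \<Longrightarrow> mesh_sum \<gamma> n t \<le> curve_length \<gamma> a b"
  unfolding curve_length_alt by (rule SUP_upper2[of "(n, t)"]) auto

lemma length_le_bound:
  "(\<And>n t. mesh a b n t \<Longrightarrow> mesh_sum \<gamma> n t \<le> B) \<Longrightarrow> curve_length \<gamma> a b \<le> B"
  unfolding curve_length_alt by (rule SUP_least) auto

lemma dist_le_length: "a \<le> b \<Longrightarrow> ennreal (dist (\<gamma> a) (\<gamma> b)) \<le> curve_length \<gamma> a b"
  using mesh_sum_le_length[of a b 1 "\<lambda>i. if i = 0 then a else b" \<gamma>]
  by (auto simp: mesh_def mesh_sum_def)

lemma length_refl [simp]: "curve_length \<gamma> a a = 0"
proof -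
  have "mesh_sum \<gamma> n t \<le> 0" if m: "mesh a a n t" for n t
  proof -
    have "t i = a" if "i \<le> n" for i
      using mesh_le[OF m, of 0 i] mesh_le[OF m, of i n] that m by (auto simp: mesh_def)
    then show ?thesis by (auto simp: mesh_sum_def)
  qed
  then have "curve_length \<gamma> a a \<le> 0" by (rule length_le_bound)
  then show ?thesis by simp
qed

lemma mesh_sum_join:
  assumes "mesh a b n t" "mesh b c m s"
  obtains r where "mesh a c (n + m) r" "mesh_sum \<gamma> (n + m) r = mesh_sum \<gamma> n t + mesh_sum \<gamma> m s"
proof
  let ?r = "\<lambda>i. if i \<le> n then t i else s (i - n)"
  have r2: "?r (n + i) = s i" for i
    using assms by (auto simp: mesh_def)
  have step: "?r i \<le> ?r (Suc i)" if "i < n + m" for i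
  proof (cases "i < n")
    case True
    then show ?thesis using assms by (auto simp: mesh_def)
  next
    case False
    then obtain j where "i = n + j" by (metis le_iff_add not_less)
    then show ?thesis
      using r2[of j] r2[of "Suc j"] assms(2) that by (auto simp: mesh_def)
  qed
  show "mesh a c (n + m) ?r"
    using assms step r2[of m] by (auto simp: mesh_def)
  show "mesh_sum \<gamma> (n + m) ?r = mesh_sum \<gamma> n t + mesh_sum \<gamma> m s"
    unfolding mesh_sum_def sum_lessThan_plus
    using r2 by (intro arg_cong2[where f = "(+)"] sum.cong) (auto simp flip: add_Suc_right)
qed

lemma length_superadd:
  assumes "a \<le> b" "b \<le> c"
  shows "curve_length \<gamma> a b + curve_length \<gamma> b c \<le> curve_length \<gamma> a c"
proof -
  have "curve_length \<gamma> a b + mesh_sum \<gamma> m s \<le> curve_length \<gamma> a c" if s: "mesh b c m s" for m s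
  proof -
    have ne: "{p. mesh a b (fst p) (snd p)} \<noteq> {}"
      using \<open>a \<le> b\<close> by (auto simp: mesh_def intro!: exI[of _ 1] exI[of _ "\<lambda>i. if i = 0 then a else b"])
    have "curve_length \<gamma> a b + mesh_sum \<gamma> m s =
        (SUP p\<in>{p. mesh a b (fst p) (snd p)}. mesh_sum \<gamma> (fst p) (snd p) + mesh_sum \<gamma> m s)"
      unfolding curve_length_alt using ne by (rule ennreal_SUP_add_left[symmetric])
    also have "\<dots> \<le> curve_length \<gamma> a c"
    proof (rule SUP_least)
      fix p assume "p \<in> {p. mesh a b (fst p) (snd p)}"
      then have "mesh a b (fst p) (snd p)" by simp
      then obtain r where "mesh a c (fst p + m) r"
        "mesh_sum \<gamma> (fst p + m) r = mesh_sum \<gamma> (fst p) (snd p) + mesh_sum \<gamma> m s"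
        using s by (rule mesh_sum_join)
      then show "mesh_sum \<gamma> (fst p) (snd p) + mesh_sum \<gamma> m s \<le> curve_length \<gamma> a c"
        using mesh_sum_le_length by metis
    qed
    finally show ?thesis .
  qed
  moreover have ne: "{p. mesh b c (fst p) (snd p)} \<noteq> {}"
    using \<open>b \<le> c\<close> by (auto simp: mesh_def intro!: exI[of _ 1] exI[of _ "\<lambda>i. if i = 0 then b else c"])
  have "curve_length \<gamma> a b + curve_length \<gamma> b c =
      (SUP p\<in>{p. mesh b c (fst p) (snd p)}. curve_length \<gamma> a b + mesh_sum \<gamma> (fst p) (snd p))"
    unfolding curve_length_alt[of \<gamma> b c] using ne by (rule ennreal_SUP_add_right)
  ultimately show ?thesis
    by (auto intro: SUP_least)
qed

text \<open>Inserting \<open>b\<close> into a mesh can only increase its sum, by the triangle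
  inequality. The induction peels off the last mesh point, so that \<open>b\<close> has to be
  inserted only when it falls into the last interval.\<close>

lemma mesh_sum_split:
  "mesh a c n t \<Longrightarrow> a \<le> b \<Longrightarrow> b \<le> c \<Longrightarrow> mesh_sum \<gamma> n t \<le> curve_length \<gamma> a b + curve_length \<gamma> b c"
proof (induction n arbitrary: c)
  case 0
  then show ?case by (auto simp: mesh_sum_def)
next
  case (Suc n)
  let ?d = "ennreal (dist (\<gamma> (t n)) (\<gamma> c))"
  have m: "mesh a (t n) n t" "t n \<le> c" using mesh_butlast[OF Suc.prems(1)] by auto
  have eq: "mesh_sum \<gamma> (Suc n) t = mesh_sum \<gamma> n t + ?d"
    using Suc.prems(1) by (simp add: mesh_sum_def mesh_def)
  show ?case
  proof (cases "b \<le> t n")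
    case True
    have "mesh_sum \<gamma> (Suc n) t \<le> curve_length \<gamma> a b + curve_length \<gamma> b (t n) + curve_length \<gamma> (t n) c"
      unfolding eq using Suc.IH[OF m(1) Suc.prems(2) True] dist_le_length[OF m(2), of \<gamma>]
      by (rule add_mono)
    also have "\<dots> \<le> curve_length \<gamma> a b + curve_length \<gamma> b c"
      using length_superadd[OF True m(2), of \<gamma>] by (simp add: add.assoc add_left_mono)
    finally show ?thesis .
  next
    case False
    have "?d \<le> ennreal (dist (\<gamma> (t n)) (\<gamma> b) + dist (\<gamma> b) (\<gamma> c))"
      by (intro ennreal_leI dist_triangle)
    also have "\<dots> \<le> curve_length \<gamma> (t n) b + curve_length \<gamma> b c"
      using dist_le_length[of "t n" b \<gamma>] dist_le_length[of b c \<gamma>] False Suc.prems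
      by (auto simp: ennreal_plus intro!: add_mono)
    finally have "mesh_sum \<gamma> (Suc n) t \<le> curve_length \<gamma> a (t n) + (curve_length \<gamma> (t n) b + curve_length \<gamma> b c)"
      unfolding eq by (intro add_mono mesh_sum_le_length m)
    also have "\<dots> \<le> curve_length \<gamma> a b + curve_length \<gamma> b c"
      using length_superadd[of a "t n" b \<gamma>] mesh_ends_le[OF m(1)] False
      by (simp add: add.assoc[symmetric] add_right_mono)
    finally show ?thesis .
  qed
qed

lemma length_add:
  assumes "a \<le> b" "b \<le> c"
  shows "curve_length \<gamma> a c = curve_length \<gamma> a b + curve_length \<gamma> b c"
  using assms by (intro antisym length_superadd length_le_bound mesh_sum_split)

lemma length_mono: "a \<le> a' \<Longrightarrow> a' \<le> b' \<Longrightarrow> b' \<le> b \<Longrightarrow> curve_length \<gamma> a' b' \<le> curve_length \<gamma> a b"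
  using length_add[of a a' b \<gamma>] length_add[of a' b' b \<gamma>]
  by (simp add: add_increasing2 add_increasing)

lemma length_reverse_le: "curve_length \<gamma> a b \<le> curve_length (\<lambda>t. \<gamma> (- t)) (- b) (- a)"
proof (rule length_le_bound)
  fix n t assume m: "mesh a b n t"
  let ?s = "\<lambda>i. - t (n - i)"
  have "?s i \<le> ?s (Suc i)" if "i < n" for i
    using m that by (auto simp: mesh_def Suc_diff_Suc dest!: spec[of _ "n - Suc i"])
  then have "mesh (- b) (- a) n ?s" using m by (auto simp: mesh_def)
  moreover have "mesh_sum (\<lambda>t. \<gamma> (- t)) n ?s = (\<Sum>i<n. ennreal (dist (\<gamma> (t (n - Suc i))) (\<gamma> (t (Suc (n - Suc i))))))"
    unfolding mesh_sum_def by (intro sum.cong refl) (auto simp: dist_commute Suc_diff_Suc)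
  then have "mesh_sum (\<lambda>t. \<gamma> (- t)) n ?s = mesh_sum \<gamma> n t"
    using sum.nat_diff_reindex[of "\<lambda>j. ennreal (dist (\<gamma> (t j)) (\<gamma> (t (Suc j))))" n]
    by (simp add: mesh_sum_def)
  ultimately show "mesh_sum \<gamma> n t \<le> curve_length (\<lambda>t. \<gamma> (- t)) (- b) (- a)"
    by (metis mesh_sum_le_length)
qed

lemma length_reverse: "curve_length (\<lambda>t. \<gamma> (- t)) (- b) (- a) = curve_length \<gamma> a b"
  using length_reverse_le[of \<gamma> a b] length_reverse_le[of "\<lambda>t. \<gamma> (- t)" "- b" "- a"] by auto

text \<open>Replacing the first nontrivial mesh point by one close to the start shows that the length
  cannot concentrate at the start.\<close>

lemma mesh_sum_near_start:
  "mesh a b n t \<Longrightarrow> a < b \<Longrightarrow>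
    \<exists>\<tau>. a < \<tau> \<and> \<tau> \<le> b \<and> (\<forall>s. a < s \<and> s \<le> \<tau> \<longrightarrow>
      mesh_sum \<gamma> n t \<le> ennreal (dist (\<gamma> a) (\<gamma> s)) + curve_length \<gamma> s b)"
proof (induction n arbitrary: b)
  case 0
  then show ?case by (auto simp: mesh_def)
next
  case (Suc n)
  have m: "mesh a (t n) n t" "t n \<le> b" using mesh_butlast[OF Suc.prems(1)] by auto
  have eq: "mesh_sum \<gamma> (Suc n) t = mesh_sum \<gamma> n t + ennreal (dist (\<gamma> (t n)) (\<gamma> b))"
    using Suc.prems(1) by (simp add: mesh_sum_def mesh_def)
  show ?case
  proof (cases "t n = a")
    case True
    then have "mesh_sum \<gamma> n t = 0"
      using mesh_sum_le_length[OF m(1), of \<gamma>] by simp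
    moreover have "ennreal (dist (\<gamma> a) (\<gamma> b)) \<le> ennreal (dist (\<gamma> a) (\<gamma> s)) + curve_length \<gamma> s b"
      if "s \<le> b" for s
    proof -
      have "ennreal (dist (\<gamma> a) (\<gamma> b)) \<le> ennreal (dist (\<gamma> a) (\<gamma> s) + dist (\<gamma> s) (\<gamma> b))"
        by (intro ennreal_leI dist_triangle)
      also have "\<dots> \<le> ennreal (dist (\<gamma> a) (\<gamma> s)) + curve_length \<gamma> s b"
        using dist_le_length[OF that, of \<gamma>] by (auto simp: ennreal_plus intro!: add_left_mono)
      finally show ?thesis .
    qed
    ultimately show ?thesis
      using Suc.prems(2) by (intro exI[of _ b]) (auto simp: eq True)
  next
    case False
    then have "a < t n" using mesh_ends_le[OF m(1)] by simp
    from Suc.IH[OF m(1) this] obtain \<tau> where t: "a < \<tau>" "\<tau> \<le> t n"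
      "\<And>s. a < s \<Longrightarrow> s \<le> \<tau> \<Longrightarrow> mesh_sum \<gamma> n t \<le> ennreal (dist (\<gamma> a) (\<gamma> s)) + curve_length \<gamma> s (t n)"
      by blast
    have "mesh_sum \<gamma> (Suc n) t \<le> ennreal (dist (\<gamma> a) (\<gamma> s)) + curve_length \<gamma> s b"
      if s: "a < s" "s \<le> \<tau>" for s
    proof -
      have "mesh_sum \<gamma> (Suc n) t \<le> ennreal (dist (\<gamma> a) (\<gamma> s)) + curve_length \<gamma> s (t n) + curve_length \<gamma> (t n) b"
        unfolding eq by (intro add_mono t(3) s dist_le_length m(2))
      also have "\<dots> = ennreal (dist (\<gamma> a) (\<gamma> s)) + curve_length \<gamma> s b"
        using length_add[of s "t n" b \<gamma>] s t(2) m(2) by (simp add: add.assoc)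
      finally show ?thesis .
    qed
    then show ?thesis
      using t m(2) by (intro exI[of _ \<tau>]) auto
  qed
qed

text \<open>A mesh sum within \<open>e/2\<close> of the total length is at most the chord from
  \<open>a\<close> to \<open>s\<close> plus the length on \<open>{s..b}\<close>. By additivity the
  length on \<open>{a..s}\<close> is then at most the chord plus \<open>e/2\<close>, and the chord
  is small by continuity.\<close>

lemma length_right_small:
  assumes cont: "continuous_on {a..b} \<gamma>" and fin: "curve_length \<gamma> a b < \<infinity>" and "a < b" "0 < e"
  shows "\<exists>\<tau>>a. \<tau> \<le> b \<and> curve_length \<gamma> a \<tau> \<le> ennreal e"
proof -
  have "\<exists>p\<in>{p. mesh a b (fst p) (snd p)}. curve_length \<gamma> a b < mesh_sum \<gamma> (fst p) (snd p) + ennreal (e/2)"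
  proof (cases "curve_length \<gamma> a b < ennreal (e/2)")
    case True
    then show ?thesis
      using assms by (intro bexI[of _ "(1, \<lambda>i. if i = 0 then a else b)"])
        (auto simp: mesh_def intro: add_increasing less_le_trans)
  next
    case False
    then have "curve_length \<gamma> a b \<noteq> 0" using \<open>0 < e\<close> by auto
    then have "curve_length \<gamma> a b - ennreal (e/2) < curve_length \<gamma> a b"
      using fin \<open>0 < e\<close> by (intro ennreal_between) (auto simp: less_top zero_less_iff_neq_zero)
    then obtain p where "mesh a b (fst p) (snd p)" "curve_length \<gamma> a b - ennreal (e/2) < mesh_sum \<gamma> (fst p) (snd p)"
      unfolding curve_length_alt less_SUP_iff by auto
    then show ?thesis
      using False by (intro bexI[of _ p]) (auto simp: minus_less_iff_ennreal add.commute)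
  qed
  then obtain n t where nt: "mesh a b n t" "curve_length \<gamma> a b < mesh_sum \<gamma> n t + ennreal (e/2)"
    by auto
  obtain \<tau> where tau: "a < \<tau>" "\<tau> \<le> b"
    "\<And>s. a < s \<Longrightarrow> s \<le> \<tau> \<Longrightarrow> mesh_sum \<gamma> n t \<le> ennreal (dist (\<gamma> a) (\<gamma> s)) + curve_length \<gamma> s b"
    using mesh_sum_near_start[OF nt(1) \<open>a < b\<close>, of \<gamma>] by blast
  obtain d where d: "d > 0" "\<And>s. s \<in> {a..b} \<Longrightarrow> dist s a < d \<Longrightarrow> dist (\<gamma> s) (\<gamma> a) < e/2"
    using cont \<open>a < b\<close> \<open>0 < e\<close> unfolding continuous_on_iff
    by (metis atLeastAtMost_iff half_gt_zero less_eq_real_def)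
  define s where "s = min \<tau> (a + d/2)"
  have s: "a < s" "s \<le> \<tau>" "s \<le> b" "dist s a < d"
    using tau d \<open>a < b\<close> by (auto simp: s_def dist_real_def)
  have "curve_length \<gamma> a s + curve_length \<gamma> s b < mesh_sum \<gamma> n t + ennreal (e/2)"
    using nt(2) length_add[of a s b \<gamma>] s by auto
  also have "\<dots> \<le> ennreal (dist (\<gamma> a) (\<gamma> s)) + curve_length \<gamma> s b + ennreal (e/2)"
    using tau(3)[OF s(1,2)] by (intro add_right_mono)
  also have "\<dots> \<le> ennreal (e/2) + curve_length \<gamma> s b + ennreal (e/2)"
    using d(2)[of s] s by (intro add_right_mono ennreal_leI) (auto simp: dist_commute)
  also have "\<dots> = ennreal e + curve_length \<gamma> s b"
    using \<open>0 < e\<close> by (simp add: ac_simps flip: ennreal_plus)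
  finally have "curve_length \<gamma> s b + curve_length \<gamma> a s < curve_length \<gamma> s b + ennreal e"
    by (simp add: ac_simps)
  then have "curve_length \<gamma> a s \<le> ennreal e"
    by (meson add_left_mono leD le_less_linear less_imp_le)
  then show ?thesis using s by auto
qed

lemma length_left_small:
  assumes cont: "continuous_on {a..b} \<gamma>" and fin: "curve_length \<gamma> a b < \<infinity>" and "a < b" "0 < e"
  shows "\<exists>\<tau><b. a \<le> \<tau> \<and> curve_length \<gamma> \<tau> b \<le> ennreal e"
proof -
  have "continuous_on {- b..- a} (\<lambda>t. \<gamma> (- t))"
    using cont by (intro continuous_on_compose2[OF cont]) (auto intro!: continuous_intros)
  then obtain \<tau> where "\<tau> > - b" "\<tau> \<le> - a" "curve_length (\<lambda>t. \<gamma> (- t)) (- b) \<tau> \<le> ennreal e"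
    using length_right_small[of "- b" "- a" "\<lambda>t. \<gamma> (- t)" e] assms by (auto simp: length_reverse)
  then show ?thesis
    using length_reverse[of \<gamma> b "- \<tau>"] by (intro exI[of _ "- \<tau>"]) auto
qed

lemma continuous_on_length:
  assumes cont: "continuous_on {a..b} \<gamma>" and fin: "curve_length \<gamma> a b < \<infinity>"
  shows "continuous_on {a..b} (\<lambda>t. enn2real (curve_length \<gamma> a t))"
  unfolding continuous_on_iff
proof safe
  fix x e :: real assume x: "x \<in> {a..b}" and e: "0 < e"
  let ?L = "\<lambda>t. enn2real (curve_length \<gamma> a t)"
  have finite: "curve_length \<gamma> s t < \<infinity>" if "a \<le> s" "s \<le> t" "t \<le> b" for s t
    using length_mono[OF that, of \<gamma>] fin by (auto intro: le_less_trans)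
  have diff: "\<bar>?L t - ?L s\<bar> \<le> e/2" if "a \<le> s" "s \<le> t" "t \<le> b" "curve_length \<gamma> s t \<le> ennreal (e/2)" for s t
  proof -
    have "?L t = ?L s + enn2real (curve_length \<gamma> s t)"
      using length_add[of a s t \<gamma>] that finite[of a s] finite[of s t] by (simp add: enn2real_plus)
    moreover have "enn2real (curve_length \<gamma> s t) \<le> e/2"
      using that(4) e by (intro enn2real_leI) auto
    ultimately show ?thesis by simp
  qed
  have "\<exists>d>0. \<forall>t\<in>{a..b}. x \<le> t \<longrightarrow> t < x + d \<longrightarrow> \<bar>?L t - ?L x\<bar> \<le> e/2"
  proof (cases "x < b")
    case True
    obtain \<tau> where tau: "\<tau> > x" "\<tau> \<le> b" "curve_length \<gamma> x \<tau> \<le> ennreal (e/2)"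
      using length_right_small[of x b \<gamma> "e/2"] True x e finite[of x b]
        continuous_on_subset[OF cont, of "{x..b}"] by auto
    have "\<bar>?L t - ?L x\<bar> \<le> e/2" if "t \<in> {a..b}" "x \<le> t" "t < \<tau>" for t
      using that x tau length_mono[of x x t \<tau> \<gamma>] by (intro diff) auto
    then show ?thesis
      using tau by (intro exI[of _ "\<tau> - x"]) auto
  next
    case False
    then show ?thesis using x e by (intro exI[of _ 1]) auto
  qed
  then obtain d1 where d1: "d1 > 0" "\<And>t. t \<in> {a..b} \<Longrightarrow> x \<le> t \<Longrightarrow> t < x + d1 \<Longrightarrow> \<bar>?L t - ?L x\<bar> \<le> e/2"
    by blast
  have "\<exists>d>0. \<forall>t\<in>{a..b}. t \<le> x \<longrightarrow> x < t + d \<longrightarrow> \<bar>?L x - ?L t\<bar> \<le> e/2"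
  proof (cases "a < x")
    case True
    obtain \<tau> where tau: "\<tau> < x" "a \<le> \<tau>" "curve_length \<gamma> \<tau> x \<le> ennreal (e/2)"
      using length_left_small[of a x \<gamma> "e/2"] True x e finite[of a x]
        continuous_on_subset[OF cont, of "{a..x}"] by auto
    have "\<bar>?L x - ?L t\<bar> \<le> e/2" if "t \<in> {a..b}" "t \<le> x" "\<tau> < t" for t
      using that x tau length_mono[of \<tau> t x x \<gamma>] by (intro diff) auto
    then show ?thesis
      using tau by (intro exI[of _ "x - \<tau>"]) auto
  next
    case False
    then show ?thesis using x e by (intro exI[of _ 1]) auto
  qed
  then obtain d2 where d2: "d2 > 0" "\<And>t. t \<in> {a..b} \<Longrightarrow> t \<le> x \<Longrightarrow> x < t + d2 \<Longrightarrow> \<bar>?L x - ?L t\<bar> \<le> e/2"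
    by blast
  show "\<exists>d>0. \<forall>t\<in>{a..b}. dist t x < d \<longrightarrow> dist (?L t) (?L x) < e"
  proof (intro exI[of _ "min d1 d2"] conjI ballI impI)
    fix t assume t: "t \<in> {a..b}" "dist t x < min d1 d2"
    show "dist (?L t) (?L x) < e"
      using d1(2)[OF t(1)] d2(2)[OF t(1)] t(2) e
      by (cases "x \<le> t") (auto simp: dist_real_def abs_minus_commute)
  qed (use d1 d2 in auto)
qed

lemma Lipschitz_continuous_on:
  fixes c :: "'b::metric_space \<Rightarrow> 'c::metric_space"
  assumes "\<And>s t. s \<in> S \<Longrightarrow> t \<in> S \<Longrightarrow> dist (c s) (c t) \<le> K * dist s t"
  shows "continuous_on S c"
  unfolding continuous_on_iff
proof safe
  fix x e assume x: "x \<in> S" and e: "(0::real) < e"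
  show "\<exists>d>0. \<forall>x'\<in>S. dist x' x < d \<longrightarrow> dist (c x') (c x) < e"
  \<comment> \<open>\<open>K\<close> may be zero or negative, hence the denominator.\<close>
  proof (intro exI[of _ "e / (\<bar>K\<bar> + 1)"] conjI ballI impI)
    fix y assume y: "y \<in> S" "dist y x < e / (\<bar>K\<bar> + 1)"
    have "dist (c y) (c x) \<le> K * dist y x" using assms x y by auto
    also have "\<dots> \<le> (\<bar>K\<bar> + 1) * dist y x" by (intro mult_right_mono) auto
    also have "\<dots> < e" using y(2) by (simp add: field_simps add_pos_nonneg)
    finally show "dist (c y) (c x) < e" .
  qed (use e in \<open>auto simp: add_nonneg_pos\<close>)
qed

lemma length_Lipschitz:
  assumes lip: "\<And>s t. s \<in> {a..b} \<Longrightarrow> t \<in> {a..b} \<Longrightarrow> dist (c s) (c t) \<le> \<bar>s - t\<bar>" and "a \<le> b"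
  shows "curve_length c a b \<le> ennreal (b - a)"
proof (rule length_le_bound)
  fix n t assume m: "mesh a b n t"
  have tin: "t i \<in> {a..b}" if "i \<le> n" for i
    using mesh_le[OF m, of 0 i] mesh_le[OF m, of i n] that m by (auto simp: mesh_def)
  have "mesh_sum c n t \<le> (\<Sum>i<n. ennreal (t (Suc i) - t i))"
    unfolding mesh_sum_def
  proof (intro sum_mono ennreal_leI)
    fix i assume i: "i \<in> {..<n}"
    then have "dist (c (t i)) (c (t (Suc i))) \<le> \<bar>t i - t (Suc i)\<bar>"
      by (intro lip tin) auto
    then show "dist (c (t i)) (c (t (Suc i))) \<le> t (Suc i) - t i"
      using m i by (auto simp: mesh_def)
  qed
  also have "\<dots> = ennreal (\<Sum>i<n. t (Suc i) - t i)"
    using m by (intro sum_ennreal) (auto simp: mesh_def)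
  also have "\<dots> = ennreal (b - a)"
    using m by (simp add: sum_lessThan_telescope mesh_def)
  finally show "mesh_sum c n t \<le> ennreal (b - a)" .
qed

text \<open>Here \<open>c\<close> is the arc-length parametrization,
  extended to be constant outside \<open>{0..l}\<close>, and \<open>\<phi>\<close> is the length function.\<close>

lemma arc_length_parametrization:
  assumes rc: "rect_curve \<gamma> a b"
  obtains c l \<phi> where "0 < l" "\<And>s t. dist (c s) (c t) \<le> \<bar>s - t\<bar>" "c 0 = \<gamma> a" "c l = \<gamma> b"
    "range c \<subseteq> \<gamma> ` {a..b}"
    "\<And>g. line_integral g \<gamma> a b = (\<integral>\<^sup>+ s. g (c s) * indicator {0..l} s \<partial>lborel)"
    "\<And>s t. 0 \<le> s \<Longrightarrow> s < t \<Longrightarrow> t \<le> l \<Longrightarrow> rect_curve c s t"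
    "\<And>g s t. g \<in> borel_measurable borel \<Longrightarrow> 0 \<le> s \<Longrightarrow> s < t \<Longrightarrow> t \<le> l \<Longrightarrow>
       line_integral g c s t = (\<integral>\<^sup>+ r. g (c r) * indicator {s..t} r \<partial>lborel)"
    "\<phi> a = 0" "\<phi> b = l" "\<And>t. t \<in> {a..b} \<Longrightarrow> c (\<phi> t) = \<gamma> t"
    "\<And>s t. a \<le> s \<Longrightarrow> s \<le> t \<Longrightarrow> t \<le> b \<Longrightarrow> \<phi> s \<le> \<phi> t \<and> ennreal (\<phi> t - \<phi> s) = curve_length \<gamma> s t"
proof -
  have ab: "a < b" and cont: "continuous_on {a..b} \<gamma>" and fin: "curve_length \<gamma> a b < \<infinity>"
    and nonconst: "\<exists>t\<in>{a..b}. \<gamma> t \<noteq> \<gamma> a"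
    using rc by (auto simp: rect_curve_def)
  define \<phi> where "\<phi> t = enn2real (curve_length \<gamma> a t)" for t
  define l where "l = \<phi> b"
  have fin': "curve_length \<gamma> s t < \<infinity>" if "a \<le> s" "s \<le> t" "t \<le> b" for s t
    using length_mono[OF that, of \<gamma>] fin by (auto intro: le_less_trans)
  have phi: "ennreal (\<phi> t) = curve_length \<gamma> a t" if "t \<in> {a..b}" for t
    using fin'[of a t] that by (auto simp: \<phi>_def)
  have phi_diff: "\<phi> s \<le> \<phi> t \<and> ennreal (\<phi> t - \<phi> s) = curve_length \<gamma> s t" if "a \<le> s" "s \<le> t" "t \<le> b" for s t
  proof -
    have "\<phi> t = \<phi> s + enn2real (curve_length \<gamma> s t)"
      using length_add[of a s t \<gamma>] that fin'[of a s] fin'[of s t] by (simp add: enn2real_plus \<phi>_def)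
    then show ?thesis using fin'[of s t] that by (simp add: ennreal_enn2real)
  qed
  have dist_phi: "dist (\<gamma> s) (\<gamma> t) \<le> \<bar>\<phi> s - \<phi> t\<bar>" if "s \<in> {a..b}" "t \<in> {a..b}" for s t
  proof -
    have *: "dist (\<gamma> s) (\<gamma> t) \<le> \<phi> t - \<phi> s" if "a \<le> s" "s \<le> t" "t \<le> b" for s t
      using dist_le_length[OF that(2), of \<gamma>] phi_diff[OF that] by (metis diff_ge_0_iff_ge ennreal_le_iff)
    show ?thesis using *[of s t] *[of t s] that by (cases "s \<le> t") (auto simp: dist_commute)
  qed
  have phi_cont: "continuous_on {a..b} \<phi>"
    unfolding \<phi>_def by (rule continuous_on_length[OF cont fin])
  have phi_ab: "\<phi> a = 0" "\<phi> b = l" by (auto simp: \<phi>_def l_def)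
  have phi_surj: "\<exists>t\<in>{a..b}. \<phi> t = s" if "0 \<le> s" "s \<le> l" for s
    using IVT'[of \<phi> a s b] phi_cont ab that phi_ab by auto
  have l_pos: "0 < l"
  proof -
    obtain t where t: "t \<in> {a..b}" "\<gamma> t \<noteq> \<gamma> a" using nonconst by blast
    have "0 < dist (\<gamma> t) (\<gamma> a)" using t by simp
    also have "\<dots> \<le> \<phi> t" using dist_phi[of t a] t ab phi_ab phi_diff[of a t] by auto
    also have "\<dots> \<le> l" using phi_diff[of t b] t phi_ab by auto
    finally show ?thesis .
  qed
  \<comment> \<open>Beyond \<open>l\<close> the \<open>SOME\<close> in \<open>arclen_param\<close>
    has no witness; clamping makes \<open>c\<close> well behaved and 1-Lipschitz on the whole
    line.\<close>
  define c where "c s = arclen_param \<gamma> a b (max 0 (min l s))" for s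
  have c_ex: "\<exists>t\<in>{a..b}. \<phi> t = max 0 (min l s) \<and> c s = \<gamma> t" for s
  proof -
    let ?s = "max 0 (min l s)"
    have s: "0 \<le> ?s" "?s \<le> l" using l_pos by auto
    let ?t = "SOME t. t \<in> {a..b} \<and> curve_length \<gamma> a t = ennreal ?s"
    have "\<exists>t. t \<in> {a..b} \<and> curve_length \<gamma> a t = ennreal ?s"
      using phi_surj[OF s] phi by metis
    then have t: "?t \<in> {a..b} \<and> curve_length \<gamma> a ?t = ennreal ?s"
      by (rule someI_ex)
    then have "\<phi> ?t = ?s"
      using s(1) by (simp add: \<phi>_def)
    then show ?thesis
      using t by (intro bexI[of _ ?t]) (auto simp: c_def arclen_param_def)
  qed
  \<comment> \<open>The parameter picked by \<open>SOME\<close> may differ from \<open>t\<close>,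
    since \<open>\<phi>\<close> is constant where the curve rests; equal lengths force equal
    points.\<close>
  have c_phi: "c (\<phi> t) = \<gamma> t" if t: "t \<in> {a..b}" for t
  proof -
    have "max 0 (min l (\<phi> t)) = \<phi> t"
      using phi_diff[of a t] phi_diff[of t b] t phi_ab by auto
    then obtain t' where t': "t' \<in> {a..b}" "\<phi> t' = \<phi> t" "c (\<phi> t) = \<gamma> t'"
      using c_ex[of "\<phi> t"] by auto
    then have "dist (\<gamma> t') (\<gamma> t) \<le> 0" using dist_phi[OF t'(1) t] by simp
    then show ?thesis using t' by simp
  qed
  have lip: "dist (c s) (c t) \<le> \<bar>s - t\<bar>" for s t
  proof -
    obtain s' t' where *: "s' \<in> {a..b}" "\<phi> s' = max 0 (min l s)" "c s = \<gamma> s'"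
        "t' \<in> {a..b}" "\<phi> t' = max 0 (min l t)" "c t = \<gamma> t'"
      using c_ex[of s] c_ex[of t] by blast
    have "dist (c s) (c t) \<le> \<bar>max 0 (min l s) - max 0 (min l t)\<bar>"
      using dist_phi[of s' t'] * by simp
    also have "\<dots> \<le> \<bar>s - t\<bar>" by auto
    finally show ?thesis .
  qed
  have cont_c: "continuous_on S c" for S
    using lip by (intro Lipschitz_continuous_on[where K = 1]) (auto simp: dist_real_def)
  have len_c: "curve_length c s t = ennreal (t - s)" if st: "0 \<le> s" "s \<le> t" "t \<le> l" for s t
  proof (rule antisym)
    show "curve_length c s t \<le> ennreal (t - s)"
      by (intro length_Lipschitz lip that)
    obtain s' t' where s': "s' \<in> {a..b}" "\<phi> s' = s" and t': "t' \<in> {a..b}" "\<phi> t' = t"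
      using phi_surj[of s] phi_surj[of t] st by auto
    show "ennreal (t - s) \<le> curve_length c s t"
    proof (cases "s' \<le> t'")
      case True
      \<comment> \<open>A mesh of \<open>\<gamma>\<close> between the two preimages is carried by
        \<open>\<phi>\<close> to a mesh of \<open>c\<close> with the same sum, so \<open>c\<close>
        is at least as long there.\<close>
      have "ennreal (t - s) = curve_length \<gamma> s' t'"
        using phi_diff[of s' t'] s' t' True by auto
      also have "\<dots> \<le> curve_length c s t"
      proof (rule length_le_bound)
        fix n r assume m: "mesh s' t' n r"
        have rin: "r i \<in> {a..b}" if "i \<le> n" for i
          using mesh_le[OF m, of 0 i] mesh_le[OF m, of i n] that m s' t' by (auto simp: mesh_def)
        have "mesh s t n (\<lambda>i. \<phi> (r i))"
          using m s' t' rin phi_diff by (auto simp: mesh_def)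
        moreover have "mesh_sum \<gamma> n r = mesh_sum c n (\<lambda>i. \<phi> (r i))"
          unfolding mesh_sum_def using rin c_phi by (intro sum.cong refl) (auto simp: Suc_leI)
        ultimately show "mesh_sum \<gamma> n r \<le> curve_length c s t"
          using mesh_sum_le_length by metis
      qed
      finally show ?thesis .
    next
      case False
      then have "t \<le> s" using phi_diff[of t' s'] s' t' by auto
      then show ?thesis by (simp add: ennreal_neg)
    qed
  qed
  have range: "range c \<subseteq> \<gamma> ` {a..b}" using c_ex by fast
  have line: "line_integral g \<gamma> a b = (\<integral>\<^sup>+ s. g (c s) * indicator {0..l} s \<partial>lborel)" for g
    unfolding line_integral_def
    by (intro nn_integral_cong) (auto simp: c_def l_def \<phi>_def indicator_def)
  have rect: "rect_curve c s t" if st: "0 \<le> s" "s < t" "t \<le> l" for s t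
  proof -
    have "\<exists>r\<in>{s..t}. c r \<noteq> c s"
    proof (rule ccontr)
      assume "\<not> ?thesis"
      then have eq: "c r = c s" if "r \<in> {s..t}" for r using that by blast
      have "curve_length c s t \<le> 0"
      proof (rule length_le_bound)
        fix n r assume m: "mesh s t n r"
        have "r i \<in> {s..t}" if "i \<le> n" for i
          using mesh_le[OF m, of 0 i] mesh_le[OF m, of i n] that m by (auto simp: mesh_def)
        then have "c (r i) = c s" if "i \<le> n" for i using that eq by blast
        then show "mesh_sum c n r \<le> 0" by (auto simp: mesh_sum_def)
      qed
      then show False using len_c[of s t] st by simp
    qed
    then show ?thesis
      using st cont_c[of "{s..t}"] len_c[of s t] by (auto simp: rect_curve_def)
  qed
  have line_c: "line_integral g c s t = (\<integral>\<^sup>+ r. g (c r) * indicator {s..t} r \<partial>lborel)"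
    if g: "g \<in> borel_measurable borel" and st: "0 \<le> s" "s < t" "t \<le> l" for g s t
  proof -
    have param: "arclen_param c s t r = c (s + r)" if r: "r \<in> {0..t - s}" for r
    proof -
      have "(SOME u. u \<in> {s..t} \<and> curve_length c s u = ennreal r) = s + r"
      proof (rule some_equality)
        show "s + r \<in> {s..t} \<and> curve_length c s (s + r) = ennreal r"
          using r st len_c[of s "s + r"] by auto
        fix u assume u: "u \<in> {s..t} \<and> curve_length c s u = ennreal r"
        then have "ennreal (u - s) = ennreal r" using len_c[of s u] st by auto
        then show "u = s + r" using u r by auto
      qed
      then show ?thesis by (simp add: arclen_param_def)
    qed
    have [measurable]: "(\<lambda>r. g (c r)) \<in> borel_measurable borel"
      using g borel_measurable_continuous_onI[OF cont_c] by (rule measurable_compose_rev)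
    have "line_integral g c s t = (\<integral>\<^sup>+ r. g (c (s + 1 * r)) * indicator {s..t} (s + 1 * r) \<partial>lborel)"
      unfolding line_integral_def using len_c[of s t] st param
      by (intro nn_integral_cong) (auto simp: indicator_def)
    also have "\<dots> = (\<integral>\<^sup>+ r. g (c r) * indicator {s..t} r \<partial>lborel)"
      using nn_integral_real_affine[of "\<lambda>r. g (c r) * indicator {s..t} r" 1 s] by simp
    finally show ?thesis .
  qed
  show thesis
    using that[OF l_pos lip _ _ range line rect line_c phi_ab c_phi phi_diff]
      c_phi[of a] c_phi[of b] phi_ab ab by auto
qed

section \<open>Upper gradients\<close>

text \<open>The properties of an arc-length parametrization that are used later. They are required
  on every subinterval, so that upper gradient inequalities can be applied to pieces of the curve,
  with line integrals written as plain Lebesgue integrals of \<open>g \<circ> c\<close>.\<close>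

definition arc_param :: "(real \<Rightarrow> 'a::metric_space) \<Rightarrow> real \<Rightarrow> bool" where
  "arc_param c l \<longleftrightarrow> 0 < l \<and> (\<forall>s t. dist (c s) (c t) \<le> \<bar>s - t\<bar>) \<and>
     (\<forall>s t. 0 \<le> s \<longrightarrow> s < t \<longrightarrow> t \<le> l \<longrightarrow> rect_curve c s t \<and>
        (\<forall>g\<in>borel_measurable borel.
          line_integral g c s t = (\<integral>\<^sup>+ r. g (c r) * indicator {s..t} r \<partial>lborel)))"

lemma arc_param_exists:
  assumes "rect_curve \<gamma> a b"
  obtains c l where "arc_param c l" "c 0 = \<gamma> a" "c l = \<gamma> b" "range c \<subseteq> \<gamma> ` {a..b}"
    "\<And>g. line_integral g \<gamma> a b = (\<integral>\<^sup>+ s. g (c s) * indicator {0..l} s \<partial>lborel)"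
  using assms
proof (rule arc_length_parametrization)
  fix c l \<phi>
  assume *: "0 < l" "\<And>s t. dist (c s) (c t) \<le> \<bar>s - t\<bar>" "c 0 = \<gamma> a" "c l = \<gamma> b" "range c \<subseteq> \<gamma> ` {a..b}"
    "\<And>g. line_integral g \<gamma> a b = (\<integral>\<^sup>+ s. g (c s) * indicator {0..l} s \<partial>lborel)"
    "\<And>s t. 0 \<le> s \<Longrightarrow> s < t \<Longrightarrow> t \<le> l \<Longrightarrow> rect_curve c s t"
    "\<And>g s t. g \<in> borel_measurable borel \<Longrightarrow> 0 \<le> s \<Longrightarrow> s < t \<Longrightarrow> t \<le> l \<Longrightarrow>
       line_integral g c s t = (\<integral>\<^sup>+ r. g (c r) * indicator {s..t} r \<partial>lborel)"
  show thesis
    by (rule that[of c l]) (use * in \<open>auto simp: arc_param_def\<close>)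
qed

lemma arc_param_continuous: "arc_param c l \<Longrightarrow> continuous_on S c"
  by (intro Lipschitz_continuous_on[where K = 1]) (auto simp: arc_param_def dist_real_def)

lemma arc_param_measurable: "arc_param c l \<Longrightarrow> c \<in> borel_measurable borel"
  by (intro borel_measurable_continuous_onI arc_param_continuous)

lemma arc_param_dist: "arc_param c l \<Longrightarrow> dist (c s) (c t) \<le> \<bar>s - t\<bar>"
  by (auto simp: arc_param_def)

lemma arc_paramD:
  assumes "arc_param c l" "0 \<le> s" "s < t" "t \<le> l"
  shows "rect_curve c s t"
    and "g \<in> borel_measurable borel \<Longrightarrow>
      line_integral g c s t = (\<integral>\<^sup>+ r. g (c r) * indicator {s..t} r \<partial>lborel)"
  using assms by (auto simp: arc_param_def)

lemma upper_gradientI: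
  assumes "g \<in> borel_measurable borel"
    and "\<And>c l. arc_param c l \<Longrightarrow>
      ennreal \<bar>u (c 0) - u (c l)\<bar> \<le> (\<integral>\<^sup>+ s. g (c s) * indicator {0..l} s \<partial>lborel)"
  shows "upper_gradient u g"
  unfolding upper_gradient_def
proof (intro conjI allI impI assms(1))
  fix \<gamma> :: "real \<Rightarrow> 'a" and a b assume "rect_curve \<gamma> a b"
  then obtain c l where "arc_param c l" "c 0 = \<gamma> a" "c l = \<gamma> b" "range c \<subseteq> \<gamma> ` {a..b}"
    "\<And>g. line_integral g \<gamma> a b = (\<integral>\<^sup>+ s. g (c s) * indicator {0..l} s \<partial>lborel)"
    by (metis (no_types) arc_param_exists)
  then show "ennreal \<bar>u (\<gamma> a) - u (\<gamma> b)\<bar> \<le> line_integral g \<gamma> a b"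
    using assms(2)[of c l] by simp
qed

lemma upper_gradientD:
  assumes "upper_gradient u g" "arc_param c l" "0 \<le> s" "s \<le> t" "t \<le> l"
  shows "ennreal \<bar>u (c s) - u (c t)\<bar> \<le> (\<integral>\<^sup>+ r. g (c r) * indicator {s..t} r \<partial>lborel)"
proof (cases "s = t")
  case False
  then have *: "rect_curve c s t" "line_integral g c s t = (\<integral>\<^sup>+ r. g (c r) * indicator {s..t} r \<partial>lborel)"
    using assms arc_paramD(1)[of c l s t] arc_paramD(2)[of c l s t g] by (auto simp: upper_gradient_def)
  show ?thesis
    using assms(1) *(1) unfolding upper_gradient_def *(2)[symmetric] by blast
qed simp

lemma upper_gradient_borel: "upper_gradient u g \<Longrightarrow> g \<in> borel_measurable borel"
  by (simp add: upper_gradient_def)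

text \<open>A substitute for differentiation: over each piece of a fine uniform partition the
  increment of \<open>h\<close> is at most \<open>(k s + e) * \<delta>\<close>, and uniform
  continuity of \<open>k\<close> compares \<open>k s * \<delta>\<close> with the integral of
  \<open>k\<close> over that piece. Adding up the pieces leaves an error proportional to
  \<open>e\<close>.\<close>

lemma growth_bound:
  fixes h k :: "real \<Rightarrow> real"
  assumes ab: "a < b" and cont: "continuous_on {a..b} k"
    and loc: "\<And>e. e > 0 \<Longrightarrow> \<exists>d>0. \<forall>s\<in>{a..b}. \<forall>t\<in>{a..b}. s \<le> t \<longrightarrow> t - s < d \<longrightarrow>
        \<bar>h s - h t\<bar> \<le> (k s + e) * (t - s)"
  shows "\<bar>h a - h b\<bar> \<le> integral {a..b} k"
proof (rule field_le_epsilon)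
  fix e' :: real assume e': "e' > 0"
  \<comment> \<open>Each piece loses \<open>e * \<delta>\<close> in the hypothesis and
    \<open>e * \<delta>\<close> in the oscillation of \<open>k\<close>, hence
    \<open>2 * e * (b - a)\<close> in total.\<close>
  define e where "e = e' / (2 * (b - a))"
  have e: "e > 0" using e' ab by (simp add: e_def)
  obtain d1 where d1: "d1 > 0" "\<And>s t. s \<in> {a..b} \<Longrightarrow> t \<in> {a..b} \<Longrightarrow> s \<le> t \<Longrightarrow> t - s < d1 \<Longrightarrow>
        \<bar>h s - h t\<bar> \<le> (k s + e) * (t - s)"
    using loc[OF e] by blast
  have "uniformly_continuous_on {a..b} k"
    using cont by (simp add: compact_uniformly_continuous)
  then obtain d2 where d2: "d2 > 0" "\<And>s t. s \<in> {a..b} \<Longrightarrow> t \<in> {a..b} \<Longrightarrow> dist t s < d2 \<Longrightarrow> dist (k t) (k s) < e"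
    using e unfolding uniformly_continuous_on_def by blast
  obtain N :: nat where N: "(b - a) / min d1 d2 < real N" using reals_Archimedean2 by blast
  have "0 < (b - a) / min d1 d2" using ab d1 d2 by simp
  with N have N0: "N > 0" by (metis gr0I less_asym of_nat_0)
  define \<delta> where "\<delta> = (b - a) / N"
  have \<delta>: "0 < \<delta>" "\<delta> < d1" "\<delta> < d2"
  proof -
    show "0 < \<delta>" using ab N0 by (simp add: \<delta>_def)
    have "b - a < real N * min d1 d2" using N d1 d2 by (simp add: pos_divide_less_eq)
    moreover have "real N * min d1 d2 \<le> real N * d1" "real N * min d1 d2 \<le> real N * d2"
      by (intro mult_left_mono; simp)+
    ultimately have "b - a < d1 * real N \<and> b - a < d2 * real N" by (simp only: mult.commute) linarith
    then show "\<delta> < d1" "\<delta> < d2"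
      using N0 by (simp_all add: \<delta>_def pos_divide_less_eq)
  qed
  have claim: "\<bar>h a - h (a + m * \<delta>)\<bar> \<le> integral {a..a + m * \<delta>} k + 2 * e * (m * \<delta>)" if "m \<le> N" for m :: nat
    using that
  proof (induction m)
    case (Suc m)
    let ?s = "a + m * \<delta>" let ?t = "a + Suc m * \<delta>"
    have "Suc m * \<delta> \<le> N * \<delta>" using Suc.prems \<delta> by (intro mult_right_mono) auto
    then have tb: "?t \<le> b" using N0 by (simp add: \<delta>_def)
    have st: "?s \<in> {a..b}" "?t \<in> {a..b}" "?s \<le> ?t" "?t - ?s = \<delta>"
      using tb \<delta> by (auto simp: algebra_simps add_increasing)
    have int: "k integrable_on {a..?t}"
      using continuous_on_subset[OF cont] st by (intro integrable_continuous_real) auto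
    have int2: "k integrable_on {?s..?t}"
      using continuous_on_subset[OF cont] st by (intro integrable_continuous_real) auto
    have "integral {?s..?t} (\<lambda>_. k ?s - e) \<le> integral {?s..?t} k"
    proof (rule integral_le[OF _ int2])
      fix r assume "r \<in> {?s..?t}"
      then have "r \<in> {a..b}" "dist r ?s < d2"
        using st(1) tb \<delta>(1,3) st(4) unfolding atLeastAtMost_iff dist_real_def by linarith+
      then have "dist (k r) (k ?s) < e"
        using st(1) by (intro d2)
      then show "k ?s - e \<le> k r" by (auto simp: dist_real_def)
    qed auto
    then have "(k ?s - e) * \<delta> \<le> integral {?s..?t} k" using st \<delta> by (simp add: mult.commute)
    moreover have "\<bar>h ?s - h ?t\<bar> \<le> (k ?s + e) * \<delta>"
      using d1(2)[OF st(1,2,3)] st(4) \<delta> by simp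
    moreover have "integral {a..?s} k + integral {?s..?t} k = integral {a..?t} k"
      using st int by (intro Henstock_Kurzweil_Integration.integral_combine) auto
    moreover have "\<bar>h a - h ?s\<bar> \<le> integral {a..?s} k + 2 * e * (m * \<delta>)"
      using Suc by simp
    moreover have "2 * e * (Suc m * \<delta>) = 2 * e * (m * \<delta>) + 2 * (e * \<delta>)"
      by (simp add: algebra_simps)
    moreover have "(k ?s + e) * \<delta> = (k ?s - e) * \<delta> + 2 * (e * \<delta>)" by (simp add: algebra_simps)
    ultimately show ?case by linarith
  qed simp
  have Nd: "a + N * \<delta> = b" using N0 by (simp add: \<delta>_def)
  have "2 * (e' / (2 * w)) * w = e'" if "w > 0" for w :: real using that by simp
  then have "2 * e * (b - a) = e'" using ab unfolding e_def by (metis diff_gt_0_iff_gt)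
  moreover have "N * \<delta> = b - a" using Nd by simp
  ultimately have "2 * e * (N * \<delta>) = e'" by metis
  then show "\<bar>h a - h b\<bar> \<le> integral {a..b} k + e'" using claim[of N] Nd by simp
qed

lemma nn_integral_continuous_Icc:
  fixes k :: "real \<Rightarrow> real"
  assumes "continuous_on {a..b} k" "\<And>s. s \<in> {a..b} \<Longrightarrow> 0 \<le> k s"
  shows "(\<integral>\<^sup>+ s. ennreal (k s) * indicator {a..b} s \<partial>lborel) = ennreal (integral {a..b} k)"
  using assms by (intro nn_integral_has_integral_lebesgue' integrable_integral integrable_continuous_real) auto

text \<open>The maximum over the two end points is the form in which chain functions and cutoffs
  satisfy a local Lipschitz bound. Along a curve, continuity of \<open>g\<close> replaces the
  maximum by \<open>g (c s) + e\<close>, which is what \<open>growth_bound\<close> accepts.\<close>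

lemma local_Lipschitz_upper_gradient:
  fixes f g :: "'a::metric_space \<Rightarrow> real"
  assumes g: "continuous_on UNIV g" "\<And>z. 0 \<le> g z" and "\<delta> > 0"
    and lip: "\<And>y z. dist y z < \<delta> \<Longrightarrow> \<bar>f y - f z\<bar> \<le> max (g y) (g z) * dist y z"
  shows "upper_gradient f (\<lambda>z. ennreal (g z))"
proof (rule upper_gradientI)
  show "(\<lambda>z. ennreal (g z)) \<in> borel_measurable borel"
    using borel_measurable_continuous_onI[OF g(1)] by measurable
  fix c :: "real \<Rightarrow> 'a" and l assume c: "arc_param c l"
  then have l: "0 < l" by (simp add: arc_param_def)
  have cont: "continuous_on {0..l} (\<lambda>s. g (c s))"
    by (rule continuous_on_compose2[OF g(1) arc_param_continuous[OF c]]) auto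
  have "\<bar>f (c 0) - f (c l)\<bar> \<le> integral {0..l} (\<lambda>s. g (c s))"
  proof (rule growth_bound[OF l cont, of "\<lambda>s. f (c s)"])
    fix e :: real assume e: "e > 0"
    have "uniformly_continuous_on {0..l} (\<lambda>s. g (c s))"
      using cont by (simp add: compact_uniformly_continuous)
    then obtain d where d: "d > 0"
      "\<And>s t. s \<in> {0..l} \<Longrightarrow> t \<in> {0..l} \<Longrightarrow> dist t s < d \<Longrightarrow> dist (g (c t)) (g (c s)) < e"
      using e unfolding uniformly_continuous_on_def by blast
    show "\<exists>d>0. \<forall>s\<in>{0..l}. \<forall>t\<in>{0..l}. s \<le> t \<longrightarrow> t - s < d \<longrightarrow> \<bar>f (c s) - f (c t)\<bar> \<le> (g (c s) + e) * (t - s)"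
    proof (intro exI[of _ "min d \<delta>"] conjI ballI impI)
      fix s t assume st: "s \<in> {0..l}" "t \<in> {0..l}" "s \<le> t" "t - s < min d \<delta>"
      have dst: "dist (c s) (c t) \<le> t - s" using arc_param_dist[OF c, of s t] st by simp
      have "\<bar>f (c s) - f (c t)\<bar> \<le> max (g (c s)) (g (c t)) * dist (c s) (c t)"
        using lip dst st by simp
      also have "\<dots> \<le> (g (c s) + e) * (t - s)"
        using d(2)[OF st(1,2)] st dst g(2)[of "c s"] e by (intro mult_mono) (auto simp: dist_real_def)
      finally show "\<bar>f (c s) - f (c t)\<bar> \<le> (g (c s) + e) * (t - s)" .
    qed (use d \<open>\<delta> > 0\<close> in auto)
  qed
  then have "ennreal \<bar>f (c 0) - f (c l)\<bar> \<le> ennreal (integral {0..l} (\<lambda>s. g (c s)))"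
    by (rule ennreal_leI)
  then show "ennreal \<bar>f (c 0) - f (c l)\<bar> \<le> (\<integral>\<^sup>+ s. ennreal (g (c s)) * indicator {0..l} s \<partial>lborel)"
    using nn_integral_continuous_Icc[OF cont] g(2) by simp
qed

text \<open>Take \<open>t\<close> as the first time at which \<open>\<beta>\<close> is reached and
  \<open>s\<close> as the last time before \<open>t\<close> at which \<open>k\<close> is at most
  \<open>\<alpha>\<close>. The extremality of both forces \<open>k\<close> strictly between the
  levels on the open interval.\<close>

lemma crossing_interval:
  fixes k :: "real \<Rightarrow> real"
  assumes cont: "continuous_on {0..l} k" and "0 \<le> l" "\<alpha> < \<beta>" "k 0 \<le> \<alpha>" "\<beta> \<le> k l"
  shows "\<exists>s t. 0 \<le> s \<and> s < t \<and> t \<le> l \<and> k s = \<alpha> \<and> k t = \<beta> \<and> (\<forall>r\<in>{s<..<t}. \<alpha> < k r \<and> k r < \<beta>)"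
proof -
  define T where "T = {r\<in>{0..l}. \<beta> \<le> k r}"
  have "closed T" unfolding T_def
    by (intro continuous_on_closed_Collect_le cont continuous_intros)
  moreover have "l \<in> T" using assms by (auto simp: T_def)
  moreover have bdd: "bdd_below T" by (auto simp: T_def)
  ultimately have t: "Inf T \<in> T" by (intro closed_contains_Inf) auto
  define t where "t = Inf T"
  have t1: "0 \<le> t" "t \<le> l" "\<beta> \<le> k t" using t by (auto simp: T_def t_def)
  have t_least: "t \<le> r" if "r \<in> {0..l}" "\<beta> \<le> k r" for r
    using that bdd by (auto simp: t_def T_def intro!: cInf_lower)
  have ct: "continuous_on {0..t} k" using cont t1 by (auto elim: continuous_on_subset)
  obtain r where "r \<ge> 0" "r \<le> t" "k r = \<beta>"
    using IVT'[of k 0 \<beta> t] ct t1 assms by auto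
  then have kt: "k t = \<beta>" using t_least[of r] t1 by auto
  define S where "S = {r\<in>{0..t}. k r \<le> \<alpha>}"
  have "closed S" unfolding S_def
    by (intro continuous_on_closed_Collect_le ct continuous_intros)
  moreover have "0 \<in> S" using assms t1 by (auto simp: S_def)
  moreover have bddS: "bdd_above S" by (auto simp: S_def)
  ultimately have s: "Sup S \<in> S" by (intro closed_contains_Sup) auto
  define s where "s = Sup S"
  have s1: "0 \<le> s" "s \<le> t" "k s \<le> \<alpha>" using s by (auto simp: S_def s_def)
  have s_greatest: "r \<le> s" if "r \<in> {0..t}" "k r \<le> \<alpha>" for r
    using that bddS by (auto simp: s_def S_def intro!: cSup_upper)
  have "continuous_on {s..t} k" using ct s1 by (auto elim: continuous_on_subset)
  then obtain r where "r \<ge> s" "r \<le> t" "k r = \<alpha>"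
    using IVT'[of k s \<alpha> t] s1 kt assms by auto
  then have ks: "k s = \<alpha>" using s_greatest[of r] s1 by auto
  have "s \<noteq> t" using ks kt assms by auto
  moreover have "\<alpha> < k r \<and> k r < \<beta>" if "r \<in> {s<..<t}" for r
    using s_greatest[of r] t_least[of r] that s1 t1 by force
  ultimately show ?thesis using s1 t1 ks kt by (intro exI[of _ s] exI[of _ t]) auto
qed

text \<open>This is absolute continuity of the integral. A finite line integral makes
  \<open>G \<circ> c\<close> finite almost everywhere, so it may be replaced by the real function
  \<open>F\<close>, whose indefinite integral is continuous and dominates the increments of
  \<open>v\<close> along the curve.\<close>

lemma upper_gradient_continuous_along:
  assumes ug: "upper_gradient v G" and c: "arc_param c l"
    and fin: "(\<integral>\<^sup>+ s. G (c s) * indicator {0..l} s \<partial>lborel) < \<infinity>"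
  shows "continuous_on {0..l} (\<lambda>s. v (c s))"
proof -
  note [measurable] = upper_gradient_borel[OF ug] arc_param_measurable[OF c]
  let ?H = "\<lambda>s. G (c s) * indicator {0..l} s"
  define F where "F s = enn2real (?H s)" for s
  have [measurable]: "F \<in> borel_measurable borel" by (simp add: F_def[abs_def])
  have F_nonneg: "0 \<le> F s" for s by (simp add: F_def)
  have "AE s in lborel. ?H s \<noteq> \<infinity>"
    using fin by (intro nn_integral_PInf_AE) auto
  then have AE: "AE s in lborel. ?H s = ennreal (F s)"
    by eventually_elim (auto simp: F_def less_top)
  have "(\<integral>\<^sup>+ s. ennreal (F s) \<partial>lborel) = (\<integral>\<^sup>+ s. ?H s \<partial>lborel)"
    using AE by (intro nn_integral_cong_AE) auto
  then have "(F has_integral enn2real (\<integral>\<^sup>+ s. ?H s \<partial>lborel)) UNIV"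
    using fin by (intro nn_integral_has_integral) (auto simp: F_nonneg)
  then have "F integrable_on UNIV" by blast
  then have F: "F integrable_on {0..l}" by (rule integrable_on_subinterval) auto
  have bound: "\<bar>v (c s) - v (c t)\<bar> \<le> integral {s..t} F" if st: "0 \<le> s" "s \<le> t" "t \<le> l" for s t
  proof -
    have Fst: "F integrable_on {s..t}" using F by (rule integrable_on_subinterval) (use st in auto)
    have "ennreal \<bar>v (c s) - v (c t)\<bar> \<le> (\<integral>\<^sup>+ r. G (c r) * indicator {s..t} r \<partial>lborel)"
      using upper_gradientD[OF ug c st] .
    also have "\<dots> = (\<integral>\<^sup>+ r. ennreal (F r) * indicator {s..t} r \<partial>lborel)"
      using AE st by (intro nn_integral_cong_AE) (auto simp: indicator_def)
    also have "\<dots> = ennreal (integral {s..t} F)"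
      using Fst by (intro nn_integral_has_integral_lebesgue' integrable_integral) (auto simp: F_nonneg)
    finally show ?thesis
      using Fst by (subst (asm) ennreal_le_iff) (auto intro!: Henstock_Kurzweil_Integration.integral_nonneg simp: F_nonneg)
  qed
  show ?thesis unfolding continuous_on_iff
  proof safe
    fix s e :: real assume s: "s \<in> {0..l}" and e: "0 < e"
    obtain d where d: "d > 0" "\<And>c' d'. c' \<in> cbox 0 l \<Longrightarrow> d' \<in> cbox 0 l \<Longrightarrow> norm (c' - s) \<le> d \<Longrightarrow> norm (d' - s) \<le> d \<Longrightarrow>
        norm (integral (cbox c' d') F - integral (cbox s s) F) < e"
      using indefinite_integral_continuous[of F 0 l s s e] F s e by (auto simp: cbox_interval)
    show "\<exists>d>0. \<forall>t\<in>{0..l}. dist t s < d \<longrightarrow> dist (v (c t)) (v (c s)) < e"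
    proof (intro exI[of _ d] conjI ballI impI)
      fix t assume t: "t \<in> {0..l}" "dist t s < d"
      show "dist (v (c t)) (v (c s)) < e"
        using d(2)[of s t] d(2)[of t s] bound[of s t] bound[of t s] s t d(1)
        by (cases "s \<le> t") (auto simp: dist_real_def cbox_interval abs_minus_commute)
    qed (rule d)
  qed
qed

text \<open>Both sides are the length of the overlap of the interval from \<open>t\<close> to
  \<open>u\<close> with the interval between \<open>p\<close> and \<open>q\<close>.\<close>

lemma abs_diff_clip:
  fixes p q t u :: real
  assumes "t < u"
  shows "\<bar>min u (max t p) - min u (max t q)\<bar> =
    (if max t (min p q) < min u (max p q) then min u (max p q) - max t (min p q) else 0)"
  using assms by (cases "p \<le> q") (simp_all add: min_def max_def)

lemma clip_rescale:
  fixes a h t :: real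
  assumes "0 < h"
  shows "min 1 (max 0 ((a - t) / h)) = (min (t + h) (max t a) - t) / h"
proof (cases "a \<le> t")
  case True
  then have "(a - t) / h \<le> 0" using assms by (simp add: divide_le_0_iff)
  then show ?thesis using True assms by simp
next
  case False
  then have "0 \<le> (a - t) / h" using assms by simp
  then show ?thesis
    using False assms by (cases "a \<le> t + h") (auto simp: min_def pos_divide_le_eq pos_le_divide_eq)
qed

text \<open>The second summand of the gradient only serves to make curves with infinite integral harmless,
  so that \<open>v\<close> may be assumed continuous along the curve.\<close>

lemma truncation_upper_gradient:
  assumes ug: "upper_gradient v G" and [measurable]: "v \<in> borel_measurable borel" and h: "0 < h"
  shows "upper_gradient (\<lambda>z. min 1 (max 0 ((v z - t0) / h)))
    (\<lambda>z. ennreal (1/h) * (G z * indicator {z. t0 < v z \<and> v z < t0 + h} z) + G z)"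
proof (rule upper_gradientI)
  note [measurable] = upper_gradient_borel[OF ug]
  let ?S = "{z. t0 < v z \<and> v z < t0 + h}"
  let ?f = "\<lambda>z. min 1 (max 0 ((v z - t0) / h))"
  have [measurable]: "?S \<in> sets borel" by measurable
  let ?g = "\<lambda>z. ennreal (1/h) * (G z * indicator ?S z) + G z"
  show "?g \<in> borel_measurable borel" by measurable
  fix c :: "real \<Rightarrow> 'a" and l assume c: "arc_param c l"
  then have l: "0 < l" by (simp add: arc_param_def)
  note [measurable] = arc_param_measurable[OF c]
  show "ennreal \<bar>?f (c 0) - ?f (c l)\<bar> \<le> (\<integral>\<^sup>+ s. ?g (c s) * indicator {0..l} s \<partial>lborel)"
  proof (cases "(\<integral>\<^sup>+ s. G (c s) * indicator {0..l} s \<partial>lborel) < \<infinity>")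
    case False
    have "(\<integral>\<^sup>+ s. G (c s) * indicator {0..l} s \<partial>lborel) \<le> (\<integral>\<^sup>+ s. ?g (c s) * indicator {0..l} s \<partial>lborel)"
      by (intro nn_integral_mono mult_right_mono) auto
    with False show ?thesis by (simp add: not_less top_unique)
  next
    case True
    define k where "k s = v (c s)" for s
    have k: "continuous_on {0..l} k"
      unfolding k_def by (rule upper_gradient_continuous_along[OF ug c True])
    \<comment> \<open>The levels from \<open>\<alpha>\<close> to \<open>\<beta>\<close> are the part
      of the strip that lies between the two end values. On the crossing subcurve \<open>v\<close>
      runs inside the open strip, so there only the restriction of \<open>G\<close> to the strip is
      charged.\<close>
    define \<alpha> where "\<alpha> = max t0 (min (k 0) (k l))"
    define \<beta> where "\<beta> = min (t0 + h) (max (k 0) (k l))"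
    have clip: "\<bar>?f (c 0) - ?f (c l)\<bar> = (if \<alpha> < \<beta> then (\<beta> - \<alpha>) / h else 0)"
    proof -
      have "\<bar>?f (c 0) - ?f (c l)\<bar> = \<bar>min (t0 + h) (max t0 (k 0)) - min (t0 + h) (max t0 (k l))\<bar> / h"
        unfolding clip_rescale[OF h] k_def using h by (simp add: diff_divide_distrib[symmetric])
      also have "\<dots> = (if \<alpha> < \<beta> then (\<beta> - \<alpha>) / h else 0)"
        unfolding \<alpha>_def \<beta>_def abs_diff_clip[of t0 "t0 + h" "k 0" "k l", OF less_add_same_cancel1[THEN iffD2, OF h]]
        by (rule if_distrib[where f = "\<lambda>x. x / h", THEN trans]) (simp only: div_0)
      finally show ?thesis .
    qed
    show ?thesis
    proof (cases "\<alpha> < \<beta>")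
      case ab: True
      have "\<exists>s t. 0 \<le> s \<and> s < t \<and> t \<le> l \<and> \<bar>k s - k t\<bar> = \<beta> - \<alpha> \<and> (\<forall>r\<in>{s<..<t}. \<alpha> < k r \<and> k r < \<beta>)"
      proof (cases "k 0 \<le> k l")
        case True
        then have k0: "k 0 \<le> \<alpha>" "\<beta> \<le> k l" unfolding \<alpha>_def \<beta>_def by simp_all
        obtain s t where "0 \<le> s" "s < t" "t \<le> l" "k s = \<alpha>" "k t = \<beta>" "\<forall>r\<in>{s<..<t}. \<alpha> < k r \<and> k r < \<beta>"
          using crossing_interval[OF k less_imp_le[OF l] ab k0] by blast
        then show ?thesis using ab by (intro exI[of _ s] exI[of _ t]) simp
      next
        case False
        then have k0: "- k 0 \<le> - \<beta>" "- \<alpha> \<le> - k l" unfolding \<alpha>_def \<beta>_def by simp_all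
        have nk: "continuous_on {0..l} (\<lambda>s. - k s)" using k by (rule continuous_on_minus)
        have nab: "- \<beta> < - \<alpha>" using ab by simp
        obtain s t where "0 \<le> s" "s < t" "t \<le> l" "- k s = - \<beta>" "- k t = - \<alpha>"
          "\<forall>r\<in>{s<..<t}. - \<beta> < - k r \<and> - k r < - \<alpha>"
          using crossing_interval[OF nk less_imp_le[OF l] nab k0] by blast
        then show ?thesis using ab by (intro exI[of _ s] exI[of _ t]) simp
      qed
      then obtain s t where st: "0 \<le> s" "s < t" "t \<le> l" "\<bar>k s - k t\<bar> = \<beta> - \<alpha>"
        "\<And>r. r \<in> {s<..<t} \<Longrightarrow> \<alpha> < k r \<and> k r < \<beta>" by blast
      \<comment> \<open>At the two end times \<open>v\<close> may sit on the boundary of the open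
        strip, where the indicator vanishes; these times form a null set.\<close>
      have "AE r in lborel. r \<noteq> s \<and> r \<noteq> t"
        using AE_lborel_singleton[of s] AE_lborel_singleton[of t] by eventually_elim auto
      then have AE: "AE r in lborel. G (c r) * indicator {s..t} r \<le> G (c r) * indicator ?S (c r) * indicator {0..l} r"
      proof eventually_elim
        fix r assume r: "r \<noteq> s \<and> r \<noteq> t"
        show "G (c r) * indicator {s..t} r \<le> G (c r) * indicator ?S (c r) * indicator {0..l} r"
        proof (cases "r \<in> {s<..<t}")
          case True
          then have "t0 < v (c r) \<and> v (c r) < t0 + h"
            using st(5)[of r] by (auto simp: \<alpha>_def \<beta>_def k_def)
          then show ?thesis using True st by (auto simp: indicator_def)
        qed (use r in \<open>auto simp: indicator_def\<close>)
      qed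
      have "ennreal (\<beta> - \<alpha>) \<le> (\<integral>\<^sup>+ r. G (c r) * indicator {s..t} r \<partial>lborel)"
        using upper_gradientD[OF ug c, of s t] st by (simp add: k_def)
      also have "\<dots> \<le> (\<integral>\<^sup>+ r. G (c r) * indicator ?S (c r) * indicator {0..l} r \<partial>lborel)"
        using AE by (rule nn_integral_mono_AE)
      finally have "ennreal (1/h) * ennreal (\<beta> - \<alpha>) \<le> ennreal (1/h) * \<dots>"
        by (rule mult_left_mono) simp
      also have "\<dots> = (\<integral>\<^sup>+ r. ennreal (1/h) * (G (c r) * indicator ?S (c r) * indicator {0..l} r) \<partial>lborel)"
        by (rule nn_integral_cmult[symmetric]) measurable
      also have "\<dots> \<le> (\<integral>\<^sup>+ s. ?g (c s) * indicator {0..l} s \<partial>lborel)"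
        by (intro nn_integral_mono) (auto simp: indicator_def)
      finally show ?thesis
        using clip ab h by (simp add: ennreal_mult[symmetric])
    qed (use clip in auto)
  qed
qed

section \<open>Doubling measures and the Poincare inequality\<close>

locale doubling_measure =
  fixes M :: "'a::{metric_space, complete_space} measure" and Cd :: real
  assumes sets_M [measurable_cong]: "sets M = sets borel"
    and emeasure_ball_pos: "r > 0 \<Longrightarrow> 0 < emeasure M (ball y (2 * r))"
    and emeasure_ball_doubling: "r > 0 \<Longrightarrow> emeasure M (ball y (2 * r)) \<le> ennreal Cd * emeasure M (ball y r)"
    and emeasure_ball_finite': "r > 0 \<Longrightarrow> emeasure M (ball y (2 * r)) < \<infinity>"
begin

lemma space_M [simp]: "space M = UNIV"
  using sets_eq_imp_space_eq[OF sets_M] by simp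

definition vol :: "'a \<Rightarrow> real \<Rightarrow> real" where
  "vol y r = measure M (ball y r)"

lemma emeasure_ball_finite: "emeasure M (ball y r) < \<infinity>"
proof (cases "r > 0")
  case True
  then show ?thesis using emeasure_ball_finite'[of "r/2" y] by simp
next
  case False
  then show ?thesis by (simp add: ball_empty)
qed

lemma emeasure_ball: "emeasure M (ball y r) = ennreal (vol y r)"
  unfolding vol_def using emeasure_ball_finite[of y r] by (intro emeasure_eq_ennreal_measure) auto

lemma vol_nonneg [simp]: "0 \<le> vol y r" by (simp add: vol_def)

lemma vol_pos: "r > 0 \<Longrightarrow> 0 < vol y r"
  using emeasure_ball_pos[of "r/2" y] emeasure_ball[of y r] by simp

lemma sets_ball [measurable, simp]: "ball y r \<in> sets M" "cball y r \<in> sets M"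
  by (auto simp: sets_M)

lemma measure_le_vol:
  assumes "A \<subseteq> ball y r"
  shows "measure M A \<le> vol y r"
proof (cases "A \<in> sets M")
  case True
  then show ?thesis
    unfolding vol_def using assms emeasure_ball_finite[of y r]
    by (intro measure_mono_fmeasurable) (auto simp: fmeasurable_def)
next
  case False
  then show ?thesis by (simp add: measure_notin_sets)
qed

lemma vol_mono: "ball z s \<subseteq> ball y r \<Longrightarrow> vol z s \<le> vol y r"
  using measure_le_vol[of "ball z s" y r] by (simp add: vol_def)

lemma Cd_ge_1: "1 \<le> Cd"
proof -
  obtain y :: 'a where True by simp
  have "ennreal (vol y 2) \<le> ennreal Cd * ennreal (vol y 1)"
    using emeasure_ball_doubling[of 1 y] by (simp add: emeasure_ball)
  moreover have "vol y 1 \<le> vol y 2" "0 < vol y 1" by (auto intro!: vol_mono vol_pos)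
  moreover have "0 \<le> Cd"
  proof (rule ccontr)
    assume "\<not> 0 \<le> Cd"
    then have "ennreal Cd = 0" by (simp add: ennreal_neg)
    with emeasure_ball_doubling[of 1 y] emeasure_ball_pos[of 1 y] show False by simp
  qed
  ultimately have "vol y 2 \<le> Cd * vol y 1" "vol y 1 \<le> vol y 2" "0 < vol y 1"
    by (simp_all add: ennreal_mult[symmetric])
  then have "1 * vol y 1 \<le> Cd * vol y 1" by linarith
  then show ?thesis using \<open>0 < vol y 1\<close> by (rule mult_right_le_imp_le)
qed

lemma vol_double: "r > 0 \<Longrightarrow> vol y (2 * r) \<le> Cd * vol y r"
  using emeasure_ball_doubling[of r y] Cd_ge_1 by (simp add: emeasure_ball ennreal_mult[symmetric])

lemma vol_double_pow: "r > 0 \<Longrightarrow> vol y (2 ^ n * r) \<le> Cd ^ n * vol y r"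
proof (induction n)
  case (Suc n)
  have "vol y (2 ^ Suc n * r) \<le> Cd * vol y (2 ^ n * r)"
    using vol_double[of "2 ^ n * r" y] Suc.prems by (simp add: mult.assoc)
  also have "\<dots> \<le> Cd * (Cd ^ n * vol y r)"
    using Suc Cd_ge_1 by (intro mult_left_mono) auto
  finally show ?case by simp
qed simp

text \<open>All comparisons of balls with different centres go through this inclusion in
  \<open>ball z (2 ^ n * r)\<close>; the powers of \<open>Cd\<close> below record how many doublings
  each of them takes.\<close>

lemma vol_compare:
  assumes "dist y z + R \<le> 2 ^ n * r" "r > 0"
  shows "vol y R \<le> Cd ^ n * vol z r"
proof -
  have "vol y R \<le> vol z (2 ^ n * r)"
  proof (intro vol_mono subsetI)
    fix x assume "x \<in> ball y R"
    then show "x \<in> ball z (2 ^ n * r)" using assms(1) dist_triangle[of z x y] by (simp add: dist_commute)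
  qed
  also have "\<dots> \<le> Cd ^ n * vol z r" by (rule vol_double_pow) fact
  finally show ?thesis .
qed

lemma sum_vol_disjoint_le:
  assumes "finite K" "disjoint_family_on (\<lambda>i. ball (c i) (\<rho> i)) K" "\<And>i. i \<in> K \<Longrightarrow> ball (c i) (\<rho> i) \<subseteq> ball y r"
  shows "(\<Sum>i\<in>K. vol (c i) (\<rho> i)) \<le> vol y r"
proof -
  have "(\<Sum>i\<in>K. vol (c i) (\<rho> i)) = measure M (\<Union>i\<in>K. ball (c i) (\<rho> i))"
    unfolding vol_def using assms emeasure_ball_finite by (intro measure_finite_Union[symmetric]) (auto simp: less_top[symmetric])
  also have "\<dots> \<le> vol y r" using assms by (intro measure_le_vol) auto
  finally show ?thesis .
qed

text \<open>The balls of radius \<open>e/2\<close> around a separated set are disjoint, lie in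
  \<open>ball x (R + e)\<close>, and by doubling each carries at least the fraction
  \<open>1 / Cd ^ n\<close> of its measure.\<close>

lemma separated_card_bound:
  fixes x :: 'a
  assumes e: "0 < e" and R: "0 < R"
  shows "\<exists>N::nat. \<forall>S. finite S \<and> S \<subseteq> ball x R \<and>
    (\<forall>a\<in>S. \<forall>b\<in>S. a \<noteq> b \<longrightarrow> e \<le> dist a b) \<longrightarrow> card S \<le> N"
proof -
  obtain n :: nat where n: "2 * (R + (R + e)) / e < 2 ^ n"
    using real_arch_pow[of 2 "2 * (R + (R + e)) / e"] by auto
  have "card S \<le> nat \<lceil>Cd ^ n\<rceil>" if S: "finite S" "S \<subseteq> ball x R"
    "\<forall>a\<in>S. \<forall>b\<in>S. a \<noteq> b \<longrightarrow> e \<le> dist a b" for S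
  proof -
    have "real (card S) * vol x (R + e) = (\<Sum>a\<in>S. vol x (R + e))" by simp
    also have "\<dots> \<le> (\<Sum>a\<in>S. Cd ^ n * vol a (e/2))"
    proof (intro sum_mono vol_compare)
      fix a assume "a \<in> S"
      then have "dist x a < R" using S by auto
      moreover have "R + (R + e) < 2 ^ n * (e / 2)" using n e by (simp add: pos_divide_less_eq)
      ultimately show "dist x a + (R + e) \<le> 2 ^ n * (e / 2)" by linarith
    qed (use e in auto)
    also have "\<dots> = Cd ^ n * (\<Sum>a\<in>S. vol a (e/2))" by (simp add: sum_distrib_left)
    also have "\<dots> \<le> Cd ^ n * vol x (R + e)"
    proof (intro mult_left_mono sum_vol_disjoint_le)
      show "disjoint_family_on (\<lambda>a. ball a (e/2)) S"
        unfolding disjoint_family_on_def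
      proof (intro ballI impI)
        fix a b assume ab: "a \<in> S" "b \<in> S" "a \<noteq> b"
        show "ball a (e/2) \<inter> ball b (e/2) = {}"
        proof (rule ccontr)
          assume "ball a (e/2) \<inter> ball b (e/2) \<noteq> {}"
          then obtain z where "dist a z < e/2" "dist b z < e/2" by auto
          then have "dist a b < e" using dist_triangle[of a b z] by (simp add: dist_commute)
          then show False using S ab by force
        qed
      qed
      fix a assume "a \<in> S"
      then have "dist x a < R" using S by auto
      then show "ball a (e/2) \<subseteq> ball x (R + e)"
      proof (intro subsetI)
        fix z assume "z \<in> ball a (e/2)"
        then show "z \<in> ball x (R + e)"
          using dist_triangle[of x z a] \<open>dist x a < R\<close> e by simp
      qed
    qed (use S Cd_ge_1 in auto)
    finally have "real (card S) \<le> Cd ^ n" using vol_pos[of "R + e" x] e R by simp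
    then show ?thesis by linarith
  qed
  then show ?thesis by blast
qed

text \<open>A separated subset of maximal cardinality is a net, since an uncovered point could be
  added to it. The cardinality bound guarantees that a maximum exists.\<close>

lemma finite_cover_cball:
  fixes x :: 'a
  assumes e: "0 < e" and R: "0 \<le> R"
  shows "\<exists>k. finite k \<and> cball x R \<subseteq> (\<Union>z\<in>k. ball z e)"
proof -
  let ?P = "\<lambda>S. finite S \<and> S \<subseteq> cball x R \<and> (\<forall>a\<in>S. \<forall>b\<in>S. a \<noteq> b \<longrightarrow> e \<le> dist a b)"
  have sub: "cball x R \<subseteq> ball x (R + 1)" by auto
  have R1: "0 < R + 1" using R by simp
  from separated_card_bound[OF e R1, of x]
  obtain N where N: "\<forall>S. finite S \<and> S \<subseteq> ball x (R + 1) \<and>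
      (\<forall>a\<in>S. \<forall>b\<in>S. a \<noteq> b \<longrightarrow> e \<le> dist a b) \<longrightarrow> card S \<le> N"
    by (rule exE)
  have bound: "\<forall>S. ?P S \<longrightarrow> card S < Suc N"
  proof (intro allI impI)
    fix S assume S: "?P S"
    then have "S \<subseteq> ball x (R + 1)" using sub by (elim conjE) (rule subset_trans)
    then show "card S < Suc N" using N[rule_format, of S] S by simp
  qed
  have "?P {}" by simp
  from ex_has_greatest_nat[of ?P, OF this bound]
  obtain S where S_max: "?P S \<and> (\<forall>S'. ?P S' \<longrightarrow> card S' \<le> card S)"
    by (rule exE)
  note S = conjunct1[OF S_max] and max = conjunct2[OF S_max]
  have "cball x R \<subseteq> (\<Union>z\<in>S. ball z e)"
  proof
    fix y assume y: "y \<in> cball x R"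
    show "y \<in> (\<Union>z\<in>S. ball z e)"
    proof (rule ccontr)
      assume "y \<notin> (\<Union>z\<in>S. ball z e)"
      then have far: "e \<le> dist z y" if "z \<in> S" for z using that by (auto simp: not_less)
      then have "y \<notin> S" using e by force
      moreover have "?P (insert y S)"
        using S y far by (auto simp: dist_commute)
      ultimately show False using max[rule_format, of "insert y S"] S by simp
    qed
  qed
  with S show ?thesis by (intro exI[of _ S]) simp
qed

text \<open>Completeness of the space enters here: the closed ball is complete and totally
  bounded.\<close>

lemma compact_cball: "compact (cball (x::'a) R)"
  using finite_cover_cball[of _ R x]
  by (cases "0 \<le> R") (auto simp: compact_eq_totally_bounded complete_eq_closed)

end

text \<open>Turns the Poincare inequality between averages into one between integrals: after
  multiplication by \<open>b\<close> the factor \<open>b / b'\<close> is at most 1.\<close>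

lemma ennreal_div_transfer:
  fixes A I :: ennreal
  assumes le: "A / ennreal b \<le> ennreal c * (I / ennreal b')" and b: "0 < b" "b \<le> b'"
  shows "A \<le> ennreal c * I"
proof -
  have "A = A / ennreal b * ennreal b"
    using b by (simp add: ennreal_divide_times divide_ennreal)
  also have "\<dots> \<le> ennreal c * (I / ennreal b') * ennreal b"
    using le by (rule mult_right_mono) simp
  also have "\<dots> = ennreal c * (I * ennreal (b / b'))"
    using b by (simp add: mult.assoc ennreal_divide_times divide_ennreal)
  also have "\<dots> \<le> ennreal c * (I * ennreal 1)"
    using b by (intro mult_left_mono ennreal_leI) auto
  finally show ?thesis by simp
qed

text \<open>\<open>D0\<close> is the quantitative form of the space having two points; it fixes the
  scale below which reverse doubling holds.\<close>

locale poincare_space = doubling_measure M Cd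
  for M :: "'a::{metric_space, complete_space} measure" and Cd :: real +
  fixes CP lam D0 :: real
  assumes CP_pos: "CP > 0" and lam_ge_1: "lam \<ge> 1" and D0_pos: "D0 > 0"
    and far_point: "\<exists>z. D0 \<le> dist (x::'a) z"
    and poincare: "\<And>y r u g. r > 0 \<Longrightarrow> L1_loc M u \<Longrightarrow> upper_gradient u g \<Longrightarrow>
        (\<integral>\<^sup>+ z. ennreal \<bar>u z - (\<integral>w\<in>ball y r. u w \<partial>completion M) / measure M (ball y r)\<bar>
              * indicator (ball y r) z \<partial>completion M) / emeasure M (ball y r)
        \<le> ennreal (CP * r) * ((\<integral>\<^sup>+ z. g z * indicator (ball y (lam * r)) z \<partial>M)
              / emeasure M (ball y (lam * r)))"
begin

lemma L1_loc_bounded: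
  assumes [measurable]: "v \<in> borel_measurable borel" and v: "\<And>z. \<bar>v z\<bar> \<le> 1"
  shows "L1_loc M v"
proof -
  have "integrable M (\<lambda>z. indicator (ball x 1) z *\<^sub>R v z)" for x
  proof (rule Bochner_Integration.integrable_bound)
    show "integrable M (indicat_real (ball x 1))"
      using emeasure_ball_finite by (intro integrable_real_indicator) auto
    show "AE z in M. norm (indicator (ball x 1) z *\<^sub>R v z) \<le> norm (indicat_real (ball x 1) z)"
      using v by (auto simp: indicator_def)
  qed measurable
  moreover have "v \<in> borel_measurable (completion M)"
    by (intro measurable_completion) measurable
  ultimately show ?thesis
    unfolding L1_loc_def set_integrable_def
    by (auto simp: integrable_completion intro!: exI[of _ 1])
qed

text \<open>Whatever the mean \<open>m\<close> of \<open>v\<close> is, \<open>v\<close> differs from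
  it by at least 1/2 on all of \<open>P\<close> (if \<open>m \<le> 1/2\<close>) or on all of
  \<open>N\<close> (otherwise), so the mean oscillation is bounded below by the smaller of the two
  measures. This is the relative isoperimetric inequality in functional form.\<close>

lemma poincare_sets:
  assumes r: "r > 0" and [measurable]: "v \<in> borel_measurable borel"
    and v: "\<And>z. 0 \<le> v z \<and> v z \<le> 1" and ug: "upper_gradient v g"
    and P: "P \<in> sets borel" "P \<subseteq> ball y r" "\<And>z. z \<in> P \<Longrightarrow> v z = 1"
    and N: "N \<in> sets borel" "N \<subseteq> ball y r" "\<And>z. z \<in> N \<Longrightarrow> v z = 0"
    and \<kappa>: "\<kappa> \<le> measure M P" "\<kappa> \<le> measure M N"
  shows "ennreal (\<kappa> / 2) \<le> ennreal (CP * r) * (\<integral>\<^sup>+ z. g z * indicator (ball y (lam * r)) z \<partial>M)"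
proof -
  define m where "m = (\<integral>w\<in>ball y r. v w \<partial>completion M) / measure M (ball y r)"
  let ?A = "\<integral>\<^sup>+ z. ennreal \<bar>v z - m\<bar> * indicator (ball y r) z \<partial>M"
  have half: "ennreal (\<kappa> / 2) \<le> ?A"
    if Q: "Q \<in> sets borel" "Q \<subseteq> ball y r" "\<And>z. z \<in> Q \<Longrightarrow> 1/2 \<le> \<bar>v z - m\<bar>" "\<kappa> \<le> measure M Q" for Q
  proof -
    have [measurable]: "Q \<in> sets M" using Q by (simp add: sets_M)
    have "emeasure M Q \<le> emeasure M (ball y r)" using Q by (intro emeasure_mono) auto
    then have "emeasure M Q \<noteq> \<infinity>"
      using emeasure_ball_finite[of y r] by (auto simp: top_unique)
    then have eQ: "emeasure M Q = ennreal (measure M Q)" by (intro emeasure_eq_ennreal_measure) auto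
    have "ennreal (\<kappa> / 2) \<le> ennreal (1/2 * measure M Q)" using Q(4) by (intro ennreal_leI) simp
    also have "\<dots> = ennreal (1/2) * emeasure M Q" unfolding eQ by (rule ennreal_mult) auto
    also have "\<dots> = (\<integral>\<^sup>+ z. ennreal (1/2) * indicator Q z \<partial>M)"
      by (simp add: nn_integral_cmult_indicator)
    also have "\<dots> \<le> ?A"
      using Q(2) ennreal_leI[OF Q(3)] by (intro nn_integral_mono) (auto simp: indicator_def)
    finally show ?thesis .
  qed
  have "ennreal (\<kappa> / 2) \<le> ?A"
  proof (cases "m \<le> 1/2")
    case True
    then show ?thesis by (intro half[of P] P \<kappa>) (use P in auto)
  next
    case False
    then show ?thesis by (intro half[of N] N \<kappa>) (use N in auto)
  qed
  also have "?A \<le> ennreal (CP * r) * (\<integral>\<^sup>+ z. g z * indicator (ball y (lam * r)) z \<partial>M)"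
  proof (rule ennreal_div_transfer)
    show "0 < vol y r" by (rule vol_pos[OF r])
    have "1 * r \<le> lam * r" using lam_ge_1 r by (intro mult_right_mono) auto
    then show "vol y r \<le> vol y (lam * r)" by (intro vol_mono) auto
    have "L1_loc M v" using v by (intro L1_loc_bounded) (auto simp: abs_le_iff intro: order_trans[of _ 0])
    from poincare[OF r this ug, of y]
    show "?A / ennreal (vol y r) \<le> ennreal (CP * r) * ((\<integral>\<^sup>+ z. g z * indicator (ball y (lam * r)) z \<partial>M) / ennreal (vol y (lam * r)))"
      unfolding nn_integral_completion m_def[symmetric] emeasure_ball .
  qed
  finally show ?thesis .
qed

text \<open>If the annulus were empty, no curve could leave \<open>ball x \<rho>\<close>, so its
  indicator would have upper gradient 0. That contradicts the Poincare inequality on a ball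
  containing both \<open>ball x \<rho>\<close> and the disjoint \<open>ball z \<rho>\<close>, which
  have positive measure.\<close>

lemma annulus_nonempty:
  fixes x z :: 'a
  assumes \<rho>: "0 < \<rho>" and far: "2 * \<rho> \<le> dist x z"
  shows "\<exists>w. \<rho> \<le> dist x w \<and> dist x w < 2 * \<rho>"
proof (rule ccontr)
  assume none: "\<not> ?thesis"
  let ?v = "indicat_real (ball x \<rho>)"
  have "upper_gradient ?v (\<lambda>_. 0)"
  proof (rule upper_gradientI)
    fix c :: "real \<Rightarrow> 'a" and l assume c: "arc_param c l"
    have l: "0 \<le> l" using c by (simp add: arc_param_def)
    have cont: "continuous_on {0..l} (\<lambda>t. dist x (c t))"
      by (intro continuous_intros arc_param_continuous[OF c])
    have "c 0 \<in> ball x \<rho> \<longleftrightarrow> c l \<in> ball x \<rho>"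
    proof (rule ccontr)
      assume "\<not> ?thesis"
      then consider "dist x (c 0) \<le> \<rho>" "\<rho> \<le> dist x (c l)" | "dist x (c l) \<le> \<rho>" "\<rho> \<le> dist x (c 0)"
        by fastforce
      then obtain t where "dist x (c t) = \<rho>"
        using IVT'[OF _ _ l cont, of \<rho>] IVT2'[OF _ _ l cont, of \<rho>] by cases blast+
      then show False using none \<rho> by (auto dest!: spec[of _ "c t"])
    qed
    then show "ennreal \<bar>?v (c 0) - ?v (c l)\<bar> \<le> (\<integral>\<^sup>+ s. 0 * indicator {0..l} s \<partial>lborel)"
      by (auto simp: indicator_def)
  qed simp
  define R where "R = dist x z + \<rho>"
  have R: "R > 0" using \<rho> by (simp add: R_def add_nonneg_pos)
  define \<kappa> where "\<kappa> = min (vol x \<rho>) (vol z \<rho>)"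
  have "ennreal (\<kappa> / 2) \<le> ennreal (CP * R) * (\<integral>\<^sup>+ z. 0 * indicator (ball x (lam * R)) z \<partial>M)"
  proof (rule poincare_sets[OF R _ _ \<open>upper_gradient ?v (\<lambda>_. 0)\<close>])
    show "ball x \<rho> \<in> sets borel" "ball z \<rho> \<in> sets borel" by auto
    show "ball x \<rho> \<subseteq> ball x R" unfolding R_def by (intro subset_ball) simp
    show "ball z \<rho> \<subseteq> ball x R"
    proof
      fix w assume "w \<in> ball z \<rho>"
      then show "w \<in> ball x R" using dist_triangle[of x w z] by (simp add: R_def)
    qed
    show "?v w = 0" if "w \<in> ball z \<rho>" for w
    proof -
      have "dist x z \<le> dist x w + dist z w" using dist_triangle[of x z w] by (simp add: dist_commute)
      then have "\<rho> < dist x w" using that far by simp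
      then show ?thesis by simp
    qed
  qed (auto simp: \<kappa>_def vol_def)
  then have "\<kappa> \<le> 0" by (simp add: ennreal_eq_0_iff)
  then show False using vol_pos[OF \<rho>, of x] vol_pos[OF \<rho>, of z] by (auto simp: \<kappa>_def)
qed

text \<open>A point \<open>w\<close> of the annulus provides a ball \<open>ball w s\<close> inside
  \<open>ball x (6 * s)\<close>, disjoint from \<open>ball x s\<close>, whose measure is a fixed
  fraction of that of the large ball.\<close>

lemma reverse_doubling_step:
  assumes s: "0 < s" and far: "4 * s \<le> dist x z"
  shows "vol x s \<le> (1 - 1 / Cd ^ 4) * vol x (6 * s)"
proof -
  obtain w where w: "2 * s \<le> dist x w" "dist x w < 4 * s"
    using annulus_nonempty[of "2 * s" x z] assms by auto
  have disj: "ball x s \<inter> ball w s = {}"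
  proof (rule ccontr)
    assume "\<not> ?thesis"
    then obtain u where "dist x u < s" "dist w u < s" by auto
    then show False using w(1) dist_triangle[of x w u] by (simp add: dist_commute)
  qed
  have "ball w s \<subseteq> ball x (6 * s)"
  proof
    fix u assume "u \<in> ball w s"
    then show "u \<in> ball x (6 * s)" using dist_triangle[of x u w] w s by simp
  qed
  moreover have "ball x s \<subseteq> ball x (6 * s)" using s by auto
  ultimately have "(\<Sum>u\<in>{x, w}. vol u s) \<le> vol x (6 * s)"
    using disj by (intro sum_vol_disjoint_le[where \<rho> = "\<lambda>_. s"]) (auto simp: disjoint_family_on_def)
  moreover have "x \<noteq> w" using w s by auto
  ultimately have "vol x s + vol w s \<le> vol x (6 * s)" by simp
  \<comment> \<open>The radius needed around \<open>w\<close> is less than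
    \<open>4 * s + 6 * s\<close>, within four doublings of \<open>s\<close>.\<close>
  moreover have "vol x (6 * s) \<le> Cd ^ 4 * vol w s"
    using w s by (intro vol_compare) auto
  then have "vol x (6 * s) / Cd ^ 4 \<le> vol w s"
    using Cd_ge_1 by (simp add: pos_divide_le_eq mult.commute)
  ultimately show ?thesis by (simp add: left_diff_distrib)
qed

lemma reverse_doubling_iter:
  assumes s: "0 < s" and far: "4 * 6 ^ n * s \<le> dist x z"
  shows "vol x s \<le> (1 - 1 / Cd ^ 4) ^ n * vol x (6 ^ n * s)"
  using far
proof (induction n)
  case (Suc n)
  have th: "0 \<le> 1 - 1 / Cd ^ 4" using Cd_ge_1 by (simp add: one_le_power)
  have "4 * 6 ^ n * s \<le> 4 * 6 ^ Suc n * s" using s by simp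
  then have "vol x s \<le> (1 - 1 / Cd ^ 4) ^ n * vol x (6 ^ n * s)"
    using Suc by linarith
  also have "\<dots> \<le> (1 - 1 / Cd ^ 4) ^ n * ((1 - 1 / Cd ^ 4) * vol x (6 * (6 ^ n * s)))"
  proof (intro mult_left_mono reverse_doubling_step)
    show "4 * (6 ^ n * s) \<le> dist x z"
      using Suc.prems \<open>4 * 6 ^ n * s \<le> 4 * 6 ^ Suc n * s\<close> by linarith
  qed (use s th in auto)
  finally show ?case by (simp add: mult.assoc mult.left_commute)
qed simp

lemma reverse_doubling:
  assumes "0 < \<theta>"
  obtains K r0 where "K \<ge> 1" "r0 > 0"
    "\<And>x y r. 0 < r \<Longrightarrow> r < r0 \<Longrightarrow> y \<in> ball x r \<Longrightarrow> vol x (2 * r) \<le> \<theta> * vol y (K * r)"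
proof -
  have th: "0 \<le> 1 - 1 / Cd ^ 4" "1 - 1 / Cd ^ 4 < 1" using Cd_ge_1 by (auto simp: one_le_power)
  obtain n where n: "(1 - 1 / Cd ^ 4) ^ n < \<theta>"
    using real_arch_pow_inv[OF assms th(2)] by blast
  \<comment> \<open>After \<open>n\<close> steps from radius \<open>2 * r\<close> the ball around
    \<open>x\<close> has radius \<open>2 * 6 ^ n * r\<close>; the extra 1 moves the centre to
    \<open>y\<close>. The bound \<open>r0\<close> makes the far point of \<open>x\<close> distant
    enough for all \<open>n\<close> steps.\<close>
  define K :: real where "K = 2 * 6 ^ n + 1"
  define r0 where "r0 = D0 / (8 * 6 ^ n)"
  show thesis
  proof (rule that[of K r0])
    show "K \<ge> 1" by (simp add: K_def)
    show "r0 > 0" using D0_pos by (simp add: r0_def)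
    fix x y :: 'a and r assume r: "0 < r" "r < r0" and y: "y \<in> ball x r"
    obtain z where z: "D0 \<le> dist x z" using far_point[of x] by auto
    have "r * (8 * 6 ^ n) < D0" using r(2) by (simp add: r0_def pos_less_divide_eq)
    then have "4 * 6 ^ n * (2 * r) \<le> dist x z" using z by (simp add: algebra_simps)
    then have "vol x (2 * r) \<le> (1 - 1 / Cd ^ 4) ^ n * vol x (6 ^ n * (2 * r))"
      using r by (intro reverse_doubling_iter[of _ _ _ z]) auto
    also have "\<dots> \<le> \<theta> * vol y (K * r)"
    proof (intro mult_mono vol_mono subsetI)
      fix w assume "w \<in> ball x (6 ^ n * (2 * r))"
      then show "w \<in> ball y (K * r)"
        using dist_triangle[of y w x] y by (simp add: K_def dist_commute algebra_simps)
    qed (use n assms in auto)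
    finally show "vol x (2 * r) \<le> \<theta> * vol y (K * r)" .
  qed
qed

end

section \<open>Lower semicontinuous majorants\<close>

context doubling_measure
begin

lemma emeasure_inter_ball_finite: "emeasure M (A \<inter> ball y r) < \<infinity>"
proof (cases "A \<inter> ball y r \<in> sets M")
  case True
  then have "emeasure M (A \<inter> ball y r) \<le> emeasure M (ball y r)"
    by (intro emeasure_mono) auto
  then show ?thesis using emeasure_ball_finite[of y r] by (rule le_less_trans)
next
  case False
  then show ?thesis by (simp add: emeasure_notin_sets)
qed

lemma decseq_measure_tendsto_inter:
  assumes "\<And>n::nat. T n \<in> sets borel" "decseq T"
  shows "(\<lambda>n. measure M (T n \<inter> ball y r)) \<longlonglongrightarrow> measure M ((\<Inter>n. T n) \<inter> ball y r)"
proof -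
  have "(\<lambda>n. measure M (T n \<inter> ball y r)) \<longlonglongrightarrow> measure M (\<Inter>n. T n \<inter> ball y r)"
  proof (rule Lim_measure_decseq)
    show "range (\<lambda>n. T n \<inter> ball y r) \<subseteq> sets M" using assms(1) by (auto simp: sets_M)
    show "decseq (\<lambda>n. T n \<inter> ball y r)" using assms(2) by (auto simp: decseq_def)
    show "emeasure M (T n \<inter> ball y r) \<noteq> \<infinity>" for n
      using emeasure_inter_ball_finite[of "T n" y r] by auto
  qed
  moreover have "(\<Inter>n. T n \<inter> ball y r) = (\<Inter>n. T n) \<inter> ball y r" by auto
  ultimately show ?thesis by simp
qed

text \<open>Approximating from inside and outside at once makes the complement step of the induction
  symmetric. Only the part inside a fixed ball is measured, so that all measures are finite and
  decreasing sequences can be passed to the limit.\<close>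

lemma closed_open_approximation:
  assumes "A \<in> sets borel" "0 < e"
  shows "\<exists>C O'. closed C \<and> open O' \<and> C \<subseteq> A \<and> A \<subseteq> O' \<and> measure M ((O' - C) \<inter> ball y r) \<le> e"
proof -
  have "A \<in> sigma_sets UNIV (Collect closed)"
    using assms(1) by (simp add: borel_eq_closed)
  then show ?thesis using assms(2)
  proof (induction arbitrary: e rule: sigma_sets.induct)
    case (Basic S)
    then have S: "closed S" by simp
    show ?case
    proof (cases "S = {}")
      case True
      then show ?thesis using Basic by (intro exI[of _ "{}"]) auto
    next
      case False
      \<comment> \<open>The open neighbourhoods of a closed set shrink to the set itself, so what
        they add tends to measure zero in the ball.\<close>
      define T where "T n = {x. infdist x S < 1 / real (Suc n)} - S" for n
      have op: "open {x. infdist x S < 1 / real (Suc n)}" for n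
        by (intro open_Collect_less continuous_intros)
      have "(\<Inter>n. T n) = {}"
      proof (rule ccontr)
        assume "(\<Inter>n. T n) \<noteq> {}"
        then obtain x where x: "\<And>n. infdist x S < 1 / real (Suc n)" "x \<notin> S" by (auto simp: T_def)
        then have "0 < infdist x S" using infdist_pos_not_in_closed[OF S False] by simp
        then obtain n where "1 / real (Suc n) < infdist x S" using nat_approx_posE by blast
        then show False using x(1)[of n] by simp
      qed
      moreover have "T n \<in> sets borel" for n unfolding T_def using op S by auto
      moreover have "decseq T"
      proof (intro decseq_SucI subsetI)
        fix n x assume "x \<in> T (Suc n)"
        moreover have "1 / real (Suc (Suc n)) \<le> 1 / real (Suc n)" by (simp add: frac_le)
        ultimately show "x \<in> T n" by (auto simp: T_def)
      qed
      ultimately have "(\<lambda>n. measure M (T n \<inter> ball y r)) \<longlonglongrightarrow> 0"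
        using decseq_measure_tendsto_inter[of T y r] by simp
      then have "\<forall>\<^sub>F n in sequentially. measure M (T n \<inter> ball y r) < e"
        using Basic by (auto dest: order_tendstoD)
      then obtain n where "measure M (T n \<inter> ball y r) < e" by (auto simp: eventually_sequentially)
      moreover have "S \<subseteq> {x. infdist x S < 1 / real (Suc n)}"
        using False by auto
      ultimately show ?thesis
        using S op[of n] by (intro exI[of _ S] exI[of _ "{x. infdist x S < 1 / real (Suc n)}"]) (simp add: T_def)
    qed
  next
    case Empty
    then show ?case by (intro exI[of _ "{}"]) auto
  next
    case (Compl A)
    obtain C O' where "closed C" "open O'" "C \<subseteq> A" "A \<subseteq> O'" "measure M ((O' - C) \<inter> ball y r) \<le> e"
      using Compl.IH[OF Compl.prems] by blast
    moreover have "- C - - O' = O' - C" by auto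
    ultimately show ?case
      by (intro exI[of _ "- O'"] exI[of _ "- C"]) (auto simp: closed_Compl open_Compl)
  next
    case (Union A)
    \<comment> \<open>Half of \<open>e\<close> is distributed over the sets \<open>A i\<close>. The
      other half pays for keeping only finitely many of the closed sets, since a countable union of
      them need not be closed.\<close>
    have "\<exists>C O'. closed C \<and> open O' \<and> C \<subseteq> A i \<and> A i \<subseteq> O' \<and> measure M ((O' - C) \<inter> ball y r) \<le> e / 2 * (1/2) ^ Suc i" for i
      using Union.IH[of "e / 2 * (1/2) ^ Suc i" i] Union.prems by simp
    then obtain C O' where CO: "\<And>i. closed (C i)" "\<And>i. open (O' i)" "\<And>i. C i \<subseteq> A i" "\<And>i. A i \<subseteq> O' i"
      "\<And>i. measure M ((O' i - C i) \<inter> ball y r) \<le> e / 2 * (1/2) ^ Suc i"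
      by metis
    let ?U = "\<Union>i. O' i"
    define T where "T n = ?U - (\<Union>i\<le>n. C i)" for n
    have CO_sets: "C i \<in> sets M" "O' i \<in> sets M" for i
      using CO by (auto simp: sets_M)
    have half: "measure M ((\<Inter>n. T n) \<inter> ball y r) \<le> e / 2"
    proof -
      have "(\<Inter>n. T n) \<inter> ball y r \<subseteq> (\<Union>i. (O' i - C i) \<inter> ball y r)" by (auto simp: T_def)
      then have "emeasure M ((\<Inter>n. T n) \<inter> ball y r) \<le> emeasure M (\<Union>i. (O' i - C i) \<inter> ball y r)"
        using CO_sets by (intro emeasure_mono) auto
      also have "\<dots> \<le> (\<Sum>i. emeasure M ((O' i - C i) \<inter> ball y r))"
        using CO_sets by (intro emeasure_subadditive_countably) auto
      also have "\<dots> \<le> (\<Sum>i. ennreal (e / 2 * (1/2) ^ Suc i))"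
      proof (intro suminf_le summableI)
        fix i
        have "emeasure M ((O' i - C i) \<inter> ball y r) = ennreal (measure M ((O' i - C i) \<inter> ball y r))"
          using emeasure_inter_ball_finite[of "O' i - C i" y r] by (intro emeasure_eq_ennreal_measure) auto
        then show "emeasure M ((O' i - C i) \<inter> ball y r) \<le> ennreal (e / 2 * (1/2) ^ Suc i)"
          using CO(5)[of i] by (simp only: ennreal_leI)
      qed
      also have "\<dots> = ennreal (e / 2)"
        using Union.prems sums_mult[OF power_half_series, of "e/2"] by (intro suminf_ennreal_eq) auto
      finally show ?thesis
        using Union.prems unfolding measure_def by (intro enn2real_leI) auto
    qed
    have lim: "(\<lambda>n. measure M (T n \<inter> ball y r)) \<longlonglongrightarrow> measure M ((\<Inter>n. T n) \<inter> ball y r)"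
    proof (rule decseq_measure_tendsto_inter)
      show "T n \<in> sets borel" for n
        unfolding T_def using CO by (auto intro!: borel_open borel_closed sets.Diff)
      show "decseq T"
        unfolding decseq_def T_def by (auto intro: order_trans)
    qed
    have "measure M ((\<Inter>n. T n) \<inter> ball y r) < e" using half Union.prems by simp
    then have "\<forall>\<^sub>F n in sequentially. measure M (T n \<inter> ball y r) < e"
      by (rule order_tendstoD(2)[OF lim])
    then obtain n where "measure M (T n \<inter> ball y r) < e" by (auto simp: eventually_sequentially)
    moreover have "(\<Union>i\<le>n. C i) \<subseteq> (\<Union>i. A i)" using CO(3) by (intro UN_mono) auto
    moreover have "(\<Union>i. A i) \<subseteq> ?U" using CO(4) by (intro UN_mono) auto
    moreover have "closed (\<Union>i\<le>n. C i)" "open ?U" using CO(1,2) by auto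
    ultimately show ?case
      unfolding T_def by (intro exI[of _ "\<Union>i\<le>n. C i"] exI[of _ ?U] conjI) (assumption | rule less_imp_le)+
  qed
qed

lemma outer_regular_in_ball:
  assumes "E \<in> sets borel" "E \<subseteq> ball y r" "0 < e"
  shows "\<exists>O'. open O' \<and> E \<subseteq> O' \<and> O' \<subseteq> ball y r \<and> measure M O' \<le> measure M E + e"
proof -
  obtain C O' where CO: "closed C" "open O'" "C \<subseteq> E" "E \<subseteq> O'" "measure M ((O' - C) \<inter> ball y r) \<le> e"
    using closed_open_approximation[OF assms(1,3), of y r] by (elim exE conjE) (rule that)
  have sets: "C \<in> sets M" "O' \<in> sets M" "E \<in> sets M" using CO assms by (auto simp: sets_M)
  have "E \<inter> ball y r = E" using assms by auto
  then have finE: "emeasure M E < \<infinity>" using emeasure_inter_ball_finite[of E y r] by simp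
  have "measure M (O' \<inter> ball y r) \<le> measure M (E \<union> (O' - C) \<inter> ball y r)"
    using CO(3) sets finE emeasure_inter_ball_finite[of "O' - C" y r]
    by (intro measure_mono_fmeasurable fmeasurable.Un) (auto simp: fmeasurable_def)
  also have "\<dots> \<le> measure M E + measure M ((O' - C) \<inter> ball y r)"
    using sets by (intro measure_Un_le) auto
  finally show ?thesis
    using CO assms by (intro exI[of _ "O' \<inter> ball y r"]) auto
qed

end

text \<open>Lipschitz functions that increase with \<open>m\<close> to the indicator of an open set
  \<open>S\<close>. The whole space is treated apart because \<open>infdist\<close> to the empty set
  is 0, which would give the zero function.\<close>

definition open_cutoff :: "'a::metric_space set \<Rightarrow> nat \<Rightarrow> 'a \<Rightarrow> real" where
  "open_cutoff S m z = (if S = UNIV then 1 else min 1 (real m * infdist z (- S)))"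

lemma open_cutoff_bounds: "0 \<le> open_cutoff S m z" "open_cutoff S m z \<le> 1"
  by (auto simp: open_cutoff_def infdist_nonneg)

lemma open_cutoff_zero: "z \<notin> S \<Longrightarrow> open_cutoff S m z = 0"
  by (auto simp: open_cutoff_def)

lemma open_cutoff_mono: "m \<le> n \<Longrightarrow> open_cutoff S m z \<le> open_cutoff S n z"
  using mult_right_mono[of "real m" "real n" "infdist z (- S)"]
  by (auto simp: open_cutoff_def infdist_nonneg min_le_iff_disj)

lemma open_cutoff_Lipschitz: "\<bar>open_cutoff S m y - open_cutoff S m z\<bar> \<le> real m * dist y z"
proof -
  have "\<bar>min 1 (real m * a) - min 1 (real m * b)\<bar> \<le> real m * \<bar>a - b\<bar>" for a b
  proof -
    have "\<bar>min 1 (real m * a) - min 1 (real m * b)\<bar> \<le> \<bar>real m * a - real m * b\<bar>" by linarith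
    also have "\<dots> = real m * \<bar>a - b\<bar>" by (simp add: abs_mult right_diff_distrib[symmetric])
    finally show ?thesis .
  qed
  from this[of "infdist y (- S)" "infdist z (- S)"] show ?thesis
    using mult_left_mono[OF infdist_triangle_abs[of y "- S" z], of "real m"]
    by (auto simp: open_cutoff_def)
qed

lemma open_cutoff_eventually:
  assumes "open S" "z \<in> S"
  shows "\<exists>m0. \<forall>m\<ge>m0. open_cutoff S m z = 1"
proof (cases "S = UNIV")
  case False
  then have pos: "0 < infdist z (- S)"
    using assms by (intro infdist_pos_not_in_closed) auto
  obtain m0 :: nat where m0: "1 / infdist z (- S) < real m0" using reals_Archimedean2 by blast
  have "open_cutoff S m z = 1" if "m \<ge> m0" for m
  proof -
    have "1 / infdist z (- S) < real m" using m0 that by linarith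
    then have "1 \<le> real m * infdist z (- S)" using pos by (simp add: pos_divide_less_eq)
    then show ?thesis using False by (simp add: open_cutoff_def)
  qed
  then show ?thesis by blast
qed (simp add: open_cutoff_def)

text \<open>If the highest multiple of \<open>a\<close> is at most \<open>t\<close>, the sum does
  not exceed that multiple; otherwise its term is zero and the induction hypothesis applies.\<close>

lemma layer_sum_le:
  fixes t :: ennreal
  assumes "0 \<le> a"
  shows "(\<Sum>k<K. ennreal a * of_bool (ennreal (real (Suc k) * a) \<le> t)) \<le> t"
proof (induction K)
  case (Suc K)
  show ?case
  proof (cases "ennreal (real (Suc K) * a) \<le> t")
    case True
    have "(\<Sum>k<Suc K. ennreal a * of_bool (ennreal (real (Suc k) * a) \<le> t)) \<le> (\<Sum>k<Suc K. ennreal a)"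
      by (intro sum_mono) auto
    also have "\<dots> = ennreal (real (Suc K) * a)"
      using assms by (simp add: ennreal_mult'' ennreal_of_nat_eq_real_of_nat del: of_nat_Suc)
    finally show ?thesis using True by simp
  qed (use Suc in simp)
qed simp

text \<open>A Vitali-Caratheodory argument with layers of height \<open>a\<close>: inside the ball
  \<open>g\<close> is at most \<open>a\<close> plus \<open>a\<close> times the number of superlevel
  sets \<open>E k\<close> containing the point, and each \<open>E k\<close> is enlarged to an open
  set of hardly larger measure. The Lipschitz functions \<open>Gm\<close> are what the discrete
  chains can use, and their lower bound \<open>a\<close> on the ball will bound the lengths of cheap
  chains.\<close>

lemma (in doubling_measure) lsc_majorant:
  assumes r: "0 < r" and g [measurable]: "g \<in> borel_measurable borel"
    and int: "(\<integral>\<^sup>+ z. g z * indicator (ball y r) z \<partial>M) < ennreal c"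
  obtains G :: "'a \<Rightarrow> ennreal" and Gm :: "nat \<Rightarrow> 'a \<Rightarrow> real" and a :: real
  where "0 < a" "\<And>m. \<exists>L. \<forall>y z. \<bar>Gm m y - Gm m z\<bar> \<le> L * dist y z" "\<And>m z. 0 \<le> Gm m z"
    "\<And>m z. Gm m z \<le> Gm (Suc m) z" "\<And>m z. z \<in> ball y r \<Longrightarrow> a \<le> Gm m z"
    "\<And>z. G z = (SUP m. ennreal (Gm m z))" "\<And>z. z \<in> ball y r \<Longrightarrow> g z \<le> G z"
    "(\<integral>\<^sup>+ z. G z \<partial>M) < ennreal c"
proof -
  let ?D = "ball y r"
  define I where "I = enn2real (\<integral>\<^sup>+ z. g z * indicator ?D z \<partial>M)"
  have I: "(\<integral>\<^sup>+ z. g z * indicator ?D z \<partial>M) = ennreal I"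
    unfolding I_def using int by (intro ennreal_enn2real[symmetric]) (auto intro: less_trans)
  have I0: "0 \<le> I" by (simp add: I_def)
  then have Ic: "I < c" using int I by (simp add: ennreal_less_iff)
  \<comment> \<open>The ground term \<open>a * \<eta>\<close> costs at most
    \<open>a * vol y (2 * r)\<close> and the enlargements of all \<open>E k\<close> together cost
    \<open>a\<close>; both are paid by half of the slack \<open>c - I\<close>.\<close>
  define a where "a = (c - I) / (2 * (vol y (2 * r) + 1))"
  have v1: "0 < vol y (2 * r) + 1" using vol_nonneg[of y "2 * r"] by linarith
  have a: "0 < a" using Ic v1 by (simp add: a_def)
  have a_bound: "a * (vol y (2 * r) + 1) = (c - I) / 2"
  proof -
    have "x / (2 * w) * w = x / 2" if "0 < w" for x w :: real using that by simp
    from this[OF v1] show ?thesis unfolding a_def .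
  qed
  define E where "E k = {z\<in>?D. ennreal (real (Suc k) * a) \<le> g z}" for k :: nat
  have E: "E k \<in> sets borel" "E k \<subseteq> ?D" for k
  proof -
    have "{z. ennreal (real (Suc k) * a) \<le> g z} \<in> sets borel" by measurable
    moreover have "E k = ?D \<inter> {z. ennreal (real (Suc k) * a) \<le> g z}" by (auto simp: E_def)
    ultimately show "E k \<in> sets borel" by auto
  qed (auto simp: E_def)
  have "\<exists>O'. open O' \<and> E k \<subseteq> O' \<and> O' \<subseteq> ?D \<and> measure M O' \<le> measure M (E k) + (1/2) ^ Suc k" for k
    by (rule outer_regular_in_ball[OF E]) simp
  then obtain U where U: "\<And>k. open (U k)" "\<And>k. E k \<subseteq> U k" "\<And>k. U k \<subseteq> ?D"
    "\<And>k. measure M (U k) \<le> measure M (E k) + (1/2) ^ Suc k" by metis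
  define \<eta> where "\<eta> z = max 0 (min 1 (2 - dist y z / r))" for z
  have chi: "0 \<le> \<eta> z" "\<eta> z \<le> indicator (ball y (2 * r)) z" "z \<in> ?D \<Longrightarrow> \<eta> z = 1" for z
    using r by (auto simp: \<eta>_def indicator_def field_simps)
  have chi_lip: "\<bar>\<eta> u - \<eta> z\<bar> \<le> 1 / r * dist u z" for u z
  proof -
    have "\<bar>\<eta> u - \<eta> z\<bar> \<le> \<bar>dist y u / r - dist y z / r\<bar>" by (auto simp: \<eta>_def)
    also have "\<dots> = \<bar>dist y u - dist y z\<bar> / r" using r by (simp add: diff_divide_distrib[symmetric])
    also have "\<dots> \<le> dist u z / r"
      using r abs_dist_diff_le[of u y z] by (intro divide_right_mono) (auto simp: dist_commute)
    finally show ?thesis by simp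
  qed
  define Gm where "Gm m z = a * \<eta> z + (\<Sum>k<m. a * open_cutoff (U k) m z)" for m z
  define G where "G z = (SUP m. ennreal (Gm m z))" for z
  have lip: "\<exists>L. \<forall>u z. \<bar>Gm m u - Gm m z\<bar> \<le> L * dist u z" for m
  proof (intro exI allI)
    fix u z
    have "\<bar>Gm m u - Gm m z\<bar> = \<bar>a * (\<eta> u - \<eta> z) + (\<Sum>k<m. a * (open_cutoff (U k) m u - open_cutoff (U k) m z))\<bar>"
      by (simp add: Gm_def sum_subtractf right_diff_distrib)
    also have "\<dots> \<le> a * \<bar>\<eta> u - \<eta> z\<bar> + (\<Sum>k<m. a * \<bar>open_cutoff (U k) m u - open_cutoff (U k) m z\<bar>)"
    proof (rule order_trans[OF abs_triangle_ineq add_mono])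
      have "\<bar>\<Sum>k<m. a * (open_cutoff (U k) m u - open_cutoff (U k) m z)\<bar> \<le> (\<Sum>k<m. \<bar>a * (open_cutoff (U k) m u - open_cutoff (U k) m z)\<bar>)"
        by (rule sum_abs)
      then show "\<bar>\<Sum>k<m. a * (open_cutoff (U k) m u - open_cutoff (U k) m z)\<bar> \<le> (\<Sum>k<m. a * \<bar>open_cutoff (U k) m u - open_cutoff (U k) m z\<bar>)"
        using a by (simp add: abs_mult)
    qed (use a in \<open>simp add: abs_mult\<close>)
    also have "\<dots> \<le> a * (1 / r * dist u z) + (\<Sum>k<m. a * (real m * dist u z))"
      using a by (intro add_mono mult_left_mono sum_mono chi_lip open_cutoff_Lipschitz) auto
    also have "\<dots> = (a / r + real m * (a * real m)) * dist u z" by (simp add: algebra_simps)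
    finally show "\<bar>Gm m u - Gm m z\<bar> \<le> (a / r + real m * (a * real m)) * dist u z" .
  qed
  have nonneg: "0 \<le> Gm m z" for m z
    unfolding Gm_def using a chi open_cutoff_bounds by (intro add_nonneg_nonneg sum_nonneg mult_nonneg_nonneg) auto
  have incr: "Gm m z \<le> Gm (Suc m) z" for m z
  proof -
    have "(\<Sum>k<m. a * open_cutoff (U k) m z) \<le> (\<Sum>k<m. a * open_cutoff (U k) (Suc m) z)"
      using a by (intro sum_mono mult_left_mono open_cutoff_mono) auto
    also have "\<dots> \<le> (\<Sum>k<Suc m. a * open_cutoff (U k) (Suc m) z)"
      using mult_nonneg_nonneg[OF less_imp_le[OF a] open_cutoff_bounds(1)] by simp
    finally show ?thesis by (simp add: Gm_def)
  qed
  have low: "a \<le> Gm m z" if "z \<in> ?D" for m z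
  proof -
    have "0 \<le> (\<Sum>k<m. a * open_cutoff (U k) m z)"
      using a open_cutoff_bounds by (intro sum_nonneg mult_nonneg_nonneg) auto
    then show ?thesis using chi(3)[OF that] by (simp add: Gm_def)
  qed
  \<comment> \<open>The first \<open>K\<close> open sets contain \<open>z\<close> and the ground
    term supplies one more layer, so \<open>G\<close> is one layer ahead of
    \<open>g\<close>.\<close>
  have step: "ennreal (real (Suc K) * a) \<le> G z" if z: "z \<in> ?D" and K: "ennreal (real K * a) \<le> g z" for z K
  proof -
    have "z \<in> U k" if "k < K" for k
    proof -
      have "real (Suc k) * a \<le> real K * a" using that a by (intro mult_right_mono) auto
      then have "ennreal (real (Suc k) * a) \<le> g z" using K by (meson ennreal_leI order_trans)
      then have "z \<in> E k" using z by (simp add: E_def)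
      then show ?thesis using U(2)[of k] by auto
    qed
    then have "\<forall>k. \<exists>m0. k < K \<longrightarrow> (\<forall>m\<ge>m0. open_cutoff (U k) m z = 1)"
      using open_cutoff_eventually[OF U(1)] by blast
    then obtain m0 where m0: "\<And>k m. k < K \<Longrightarrow> m \<ge> m0 k \<Longrightarrow> open_cutoff (U k) m z = 1" by metis
    define m where "m = Max (insert K (m0 ` {..<K}))"
    have m: "K \<le> m" "\<And>k. k < K \<Longrightarrow> m0 k \<le> m" unfolding m_def by (auto intro!: Max_ge)
    have "real (Suc K) * a = a + (\<Sum>k<K. a * open_cutoff (U k) m z)"
      using m0 m by (simp add: algebra_simps)
    also have "\<dots> \<le> a + (\<Sum>k<m. a * open_cutoff (U k) m z)"
      using a m open_cutoff_bounds by (intro add_left_mono sum_mono2 mult_nonneg_nonneg) auto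
    also have "\<dots> = Gm m z" using chi(3)[OF z] by (simp add: Gm_def)
    finally have "ennreal (real (Suc K) * a) \<le> ennreal (Gm m z)" by (rule ennreal_leI)
    also have "\<dots> \<le> G z" unfolding G_def by (rule SUP_upper) simp
    finally show ?thesis .
  qed
  \<comment> \<open>If \<open>G z < g z\<close>, then the gain of one layer repeats itself: by
    induction every multiple of \<open>a\<close> is at most \<open>g z\<close>, hence at most
    \<open>G z\<close>, which contradicts finiteness of \<open>G z\<close>.\<close>
  have dom: "g z \<le> G z" if z: "z \<in> ?D" for z
  proof (rule ccontr)
    assume "\<not> ?thesis"
    then have less: "G z < g z" by simp
    have "ennreal (real K * a) \<le> g z" for K
    proof (induction K)
      case (Suc K)
      then show ?case using step[OF z Suc] less by (meson less_imp_le order_trans)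
    qed simp
    then have all: "ennreal (real (Suc K) * a) \<le> G z" for K using step[OF z] by blast
    have "G z < \<infinity>" using less by (rule less_le_trans) simp
    then obtain w where w: "G z = ennreal w" "0 \<le> w" by (cases "G z") auto
    obtain K :: nat where "w / a < real K" using reals_Archimedean2 by blast
    then have "w < real (Suc K) * a" using a by (simp add: pos_divide_less_eq algebra_simps)
    then show False using all[of K] w by (simp add: ennreal_le_iff)
  qed
  have "(\<integral>\<^sup>+ z. G z \<partial>M) \<le> (\<integral>\<^sup>+ z. ennreal a * indicator (ball y (2 * r)) z + (\<Sum>k. ennreal a * indicator (U k) z) \<partial>M)"
  proof (intro nn_integral_mono)
    fix z
    show "G z \<le> ennreal a * indicator (ball y (2 * r)) z + (\<Sum>k. ennreal a * indicator (U k) z)"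
      unfolding G_def
    proof (rule SUP_least)
      fix m
      have "ennreal (Gm m z) = ennreal (a * \<eta> z) + (\<Sum>k<m. ennreal (a * open_cutoff (U k) m z))"
      proof -
        have ac0: "0 \<le> a * open_cutoff (U k) m z" for k
          using a open_cutoff_bounds(1) by (intro mult_nonneg_nonneg) auto
        have "ennreal (Gm m z) = ennreal (a * \<eta> z) + ennreal (\<Sum>k<m. a * open_cutoff (U k) m z)"
          unfolding Gm_def using a chi(1) by (intro ennreal_plus sum_nonneg ac0) auto
        then show ?thesis using ac0 by (simp add: sum_ennreal)
      qed
      also have "\<dots> \<le> ennreal a * indicator (ball y (2 * r)) z + (\<Sum>k<m. ennreal a * indicator (U k) z)"
      proof (intro add_mono sum_mono)
        show "ennreal (a * \<eta> z) \<le> ennreal a * indicator (ball y (2 * r)) z"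
        proof (cases "z \<in> ball y (2 * r)")
          case True
          then have "\<eta> z \<le> 1" using chi(2)[of z] by simp
          then have "a * \<eta> z \<le> a" using a by (intro mult_left_le) auto
          then show ?thesis using True by (simp add: ennreal_leI)
        next
          case False
          then have "\<eta> z = 0" using chi(1,2)[of z] by simp
          then show ?thesis by simp
        qed
        fix k
        show "ennreal (a * open_cutoff (U k) m z) \<le> ennreal a * indicator (U k) z"
        proof (cases "z \<in> U k")
          case True
          have "a * open_cutoff (U k) m z \<le> a"
            using a open_cutoff_bounds(2) by (intro mult_left_le) auto
          then show ?thesis using True by (simp add: ennreal_leI)
        qed (simp add: open_cutoff_zero)
      qed
      also have "\<dots> \<le> ennreal a * indicator (ball y (2 * r)) z + (\<Sum>k. ennreal a * indicator (U k) z)"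
        by (intro add_left_mono sum_le_suminf) auto
      finally show "ennreal (Gm m z) \<le> \<dots>" .
    qed
  qed
  also have "\<dots> = ennreal a * ennreal (vol y (2 * r)) + (\<Sum>k. ennreal a * emeasure M (U k))"
  proof -
    have [measurable]: "U k \<in> sets M" for k using U(1) by (simp add: sets_M)
    have "(\<integral>\<^sup>+ z. ennreal a * indicator (ball y (2 * r)) z + (\<Sum>k. ennreal a * indicator (U k) z) \<partial>M) =
        (\<integral>\<^sup>+ z. ennreal a * indicator (ball y (2 * r)) z \<partial>M) + (\<integral>\<^sup>+ z. (\<Sum>k. ennreal a * indicator (U k) z) \<partial>M)"
      by (rule nn_integral_add) measurable
    also have "(\<integral>\<^sup>+ z. (\<Sum>k. ennreal a * indicator (U k) z) \<partial>M) = (\<Sum>k. \<integral>\<^sup>+ z. ennreal a * indicator (U k) z \<partial>M)"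
      by (rule nn_integral_suminf) measurable
    also have "(\<lambda>k. \<integral>\<^sup>+ z. ennreal a * indicator (U k) z \<partial>M) = (\<lambda>k. ennreal a * emeasure M (U k))"
      by (intro ext nn_integral_cmult_indicator) measurable
    also have "(\<integral>\<^sup>+ z. ennreal a * indicator (ball y (2 * r)) z \<partial>M) = ennreal a * ennreal (vol y (2 * r))"
      by (simp add: nn_integral_cmult_indicator emeasure_ball)
    finally show ?thesis .
  qed
  also have "\<dots> \<le> ennreal a * ennreal (vol y (2 * r)) + (\<Sum>k. ennreal a * emeasure M (E k) + ennreal (a * (1/2) ^ Suc k))"
  proof (intro add_left_mono suminf_le summableI)
    fix k
    have fin: "emeasure M (U k) < \<infinity>" "emeasure M (E k) < \<infinity>"
      using emeasure_inter_ball_finite[of "U k" y r] emeasure_inter_ball_finite[of "E k" y r] U(3)[of k] E(2)[of k]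
      by (auto simp: Int_absorb2)
    have "emeasure M (U k) = ennreal (measure M (U k))"
      using fin by (intro emeasure_eq_ennreal_measure) auto
    also have "\<dots> \<le> ennreal (measure M (E k) + (1/2) ^ Suc k)" by (intro ennreal_leI U(4))
    also have "\<dots> = emeasure M (E k) + ennreal ((1/2) ^ Suc k)"
      using fin by (subst ennreal_plus) (auto simp: emeasure_eq_ennreal_measure)
    finally have "ennreal a * emeasure M (U k) \<le> ennreal a * (emeasure M (E k) + ennreal ((1/2) ^ Suc k))"
      by (intro mult_left_mono) auto
    then show "ennreal a * emeasure M (U k) \<le> ennreal a * emeasure M (E k) + ennreal (a * (1/2) ^ Suc k)"
      using a by (simp add: distrib_left ennreal_mult del: power_Suc)
  qed
  also have "(\<Sum>k. ennreal a * emeasure M (E k) + ennreal (a * (1/2) ^ Suc k)) =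
      (\<Sum>k. ennreal a * emeasure M (E k)) + (\<Sum>k. ennreal (a * (1/2) ^ Suc k))"
    by (intro suminf_add[symmetric] summableI)
  also have "(\<Sum>k. ennreal (a * (1/2) ^ Suc k)) = ennreal a"
    using a sums_mult[OF power_half_series, of a] by (intro suminf_ennreal_eq) auto
  also have "(\<Sum>k. ennreal a * emeasure M (E k)) \<le> ennreal I"
  proof -
    have [measurable]: "E k \<in> sets M" for k using E by (simp add: sets_M)
    have "(\<Sum>k. ennreal a * emeasure M (E k)) = (\<integral>\<^sup>+ z. (\<Sum>k. ennreal a * indicator (E k) z) \<partial>M)"
    proof -
      have "(\<lambda>k. \<integral>\<^sup>+ z. ennreal a * indicator (E k) z \<partial>M) = (\<lambda>k. ennreal a * emeasure M (E k))"
        by (intro ext nn_integral_cmult_indicator) measurable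
      moreover have "(\<integral>\<^sup>+ z. (\<Sum>k. ennreal a * indicator (E k) z) \<partial>M) = (\<Sum>k. \<integral>\<^sup>+ z. ennreal a * indicator (E k) z \<partial>M)"
        by (rule nn_integral_suminf) measurable
      ultimately show ?thesis by simp
    qed
    also have "\<dots> \<le> (\<integral>\<^sup>+ z. g z * indicator ?D z \<partial>M)"
    proof (intro nn_integral_mono suminf_le_const summableI)
      fix z and K :: nat
      show "(\<Sum>k<K. ennreal a * indicator (E k) z) \<le> g z * indicator ?D z"
      proof (cases "z \<in> ?D")
        case True
        then have "(\<Sum>k<K. ennreal a * indicator (E k) z) = (\<Sum>k<K. ennreal a * of_bool (ennreal (real (Suc k) * a) \<le> g z))"
          by (intro sum.cong refl) (simp add: E_def indicator_def)
        also have "\<dots> \<le> g z" using a by (intro layer_sum_le) simp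
        finally show ?thesis using True by simp
      next
        case False
        then show ?thesis using E(2) by (auto simp: indicator_def E_def)
      qed
    qed
    finally show ?thesis using I by simp
  qed
  finally have "(\<integral>\<^sup>+ z. G z \<partial>M) \<le> ennreal a * ennreal (vol y (2 * r)) + (ennreal I + ennreal a)"
    by (simp add: add_left_mono add_right_mono)
  also have "\<dots> = ennreal (I + a * (vol y (2 * r) + 1))"
    using a I0 by (simp add: ennreal_mult[symmetric] ennreal_plus[symmetric] algebra_simps del: ennreal_plus)
  also have "\<dots> < ennreal c"
    unfolding a_bound using Ic I0 by (intro ennreal_lessI) (auto simp: field_simps)
  finally have "(\<integral>\<^sup>+ z. G z \<partial>M) < ennreal c" .
  then show thesis
    by (intro that[of a Gm G, OF a lip nonneg incr low G_def dom])
qed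

section \<open>Chains and lower semicontinuous capacitary functions\<close>

text \<open>The discrete analogue of integrating \<open>g\<close> over a curve from \<open>y\<close>
  until it leaves \<open>D\<close>: jumps shorter than \<open>\<delta>\<close>, each charged with
  the value of \<open>g\<close> at its starting point. Chains exist without any curves, and the
  infimum of their costs is continuous for continuous \<open>g\<close>.\<close>

inductive chain_cost :: "'a::metric_space set \<Rightarrow> ('a \<Rightarrow> real) \<Rightarrow> real \<Rightarrow> 'a \<Rightarrow> real \<Rightarrow> bool"
  for D g \<delta> where
    leave: "y \<notin> D \<Longrightarrow> chain_cost D g \<delta> y 0"
  | step: "y \<in> D \<Longrightarrow> dist y z < \<delta> \<Longrightarrow> chain_cost D g \<delta> z c \<Longrightarrow> chain_cost D g \<delta> y (g y * dist y z + c)"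

lemma chain_cost_nonneg:
  assumes "chain_cost D g \<delta> y c" "\<And>z. 0 \<le> g z"
  shows "0 \<le> c"
  using assms(1) by induction (auto simp: assms(2))

text \<open>A fine chain for a large weight is admissible, and not more expensive, for a coarser
  scale and a smaller weight. Hence the infima increase as the scale is refined and the weight
  grows.\<close>

lemma chain_cost_mono:
  assumes "chain_cost D g' \<delta>' y c" "\<And>z. g z \<le> g' z" "\<delta>' \<le> \<delta>"
  shows "\<exists>c'\<le>c. chain_cost D g \<delta> y c'"
  using assms(1)
proof induction
  case (leave y)
  then show ?case by (auto intro: chain_cost.leave)
next
  case (step y z c)
  then obtain c' where c': "c' \<le> c" "chain_cost D g \<delta> z c'" by blast
  then have "chain_cost D g \<delta> y (g y * dist y z + c')"
    using step assms(3) by (intro chain_cost.step) auto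
  moreover have "g y * dist y z \<le> g' y * dist y z"
    using assms(2) by (intro mult_right_mono) auto
  ultimately show ?case
    using c' by (intro exI[of _ "g y * dist y z + c'"]) auto
qed

lemma chain_cost_path:
  assumes "chain_cost D g \<delta> y c"
  shows "\<exists>N p. p 0 = y \<and> (\<forall>i<N. p i \<in> D \<and> dist (p i) (p (Suc i)) < \<delta>) \<and> p N \<notin> D \<and>
    c = (\<Sum>i<N. g (p i) * dist (p i) (p (Suc i)))"
  using assms
proof induction
  case (leave y)
  then show ?case by (intro exI[of _ 0] exI[of _ "\<lambda>_. y"]) auto
next
  case (step y z c)
  then obtain N p where p: "p 0 = z" "\<forall>i<N. p i \<in> D \<and> dist (p i) (p (Suc i)) < \<delta>" "p N \<notin> D"
    "c = (\<Sum>i<N. g (p i) * dist (p i) (p (Suc i)))" by blast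
  let ?p = "case_nat y p"
  have "\<forall>i<Suc N. ?p i \<in> D \<and> dist (?p i) (?p (Suc i)) < \<delta>"
    using p step by (auto split: nat.split)
  moreover have "g y * dist y z + c = (\<Sum>i<Suc N. g (?p i) * dist (?p i) (?p (Suc i)))"
    using p by (subst sum.lessThan_Suc_shift) simp
  ultimately show ?case
    using p by (intro exI[of _ "Suc N"] exI[of _ ?p]) auto
qed

text \<open>The inserted 1 truncates the function and keeps the set nonempty when no chain from
  \<open>y\<close> leaves \<open>D\<close>.\<close>

definition chain_inf :: "'a::metric_space set \<Rightarrow> ('a \<Rightarrow> real) \<Rightarrow> real \<Rightarrow> 'a \<Rightarrow> real" where
  "chain_inf D g \<delta> y = Inf (insert 1 {c. chain_cost D g \<delta> y c})"

context
  fixes D :: "'a::metric_space set" and g :: "'a \<Rightarrow> real" and \<delta> :: real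
  assumes g_nonneg: "\<And>z. 0 \<le> g z"
begin

lemma chain_bdd: "bdd_below (insert 1 {c. chain_cost D g \<delta> y c})"
  using chain_cost_nonneg[OF _ g_nonneg] by (intro bdd_belowI[of _ 0]) auto

lemma chain_inf_nonneg: "0 \<le> chain_inf D g \<delta> y"
  unfolding chain_inf_def using chain_cost_nonneg[OF _ g_nonneg] by (intro cInf_greatest) auto

lemma chain_inf_le_1: "chain_inf D g \<delta> y \<le> 1"
  unfolding chain_inf_def by (intro cInf_lower chain_bdd) auto

lemma chain_inf_le: "chain_cost D g \<delta> y c \<Longrightarrow> chain_inf D g \<delta> y \<le> c"
  unfolding chain_inf_def by (intro cInf_lower chain_bdd) auto

lemma chain_inf_outside: "y \<notin> D \<Longrightarrow> chain_inf D g \<delta> y = 0"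
  using chain_inf_le[OF chain_cost.leave, of y] chain_inf_nonneg[of y] by simp

lemma chain_inf_less:
  assumes "chain_inf D g \<delta> y < t" "t \<le> 1"
  obtains c where "chain_cost D g \<delta> y c" "c < t"
proof -
  have "\<exists>c\<in>insert 1 {c. chain_cost D g \<delta> y c}. c < t"
    using assms unfolding chain_inf_def by (intro cInf_lessD) auto
  then show ?thesis using that assms(2) by auto
qed

lemma chain_inf_step:
  assumes "dist y z < \<delta>"
  shows "chain_inf D g \<delta> y \<le> g y * dist y z + chain_inf D g \<delta> z"
proof (cases "y \<in> D")
  case False
  then show ?thesis using chain_inf_outside g_nonneg[of y] chain_inf_nonneg[of z] by simp
next
  case True
  have "chain_inf D g \<delta> y - g y * dist y z \<le> chain_inf D g \<delta> z"
    unfolding chain_inf_def[of _ _ _ z]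
  proof (rule cInf_greatest)
    fix c assume "c \<in> insert 1 {c. chain_cost D g \<delta> z c}"
    then consider "c = 1" | "chain_cost D g \<delta> z c" by auto
    then show "chain_inf D g \<delta> y - g y * dist y z \<le> c"
    proof cases
      case 1
      moreover have "0 \<le> g y * dist y z" using g_nonneg by simp
      ultimately show ?thesis using chain_inf_le_1[of y] by linarith
    next
      case 2
      then show ?thesis using chain_inf_le[OF chain_cost.step[OF True assms 2]] by simp
    qed
  qed simp
  then show ?thesis by simp
qed

text \<open>A chain can be prefixed with a jump in either direction; since a jump is charged at its
  starting point, the maximum of both values appears.\<close>

lemma chain_inf_local:
  assumes "dist y z < \<delta>"
  shows "\<bar>chain_inf D g \<delta> y - chain_inf D g \<delta> z\<bar> \<le> max (g y) (g z) * dist y z"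
proof -
  have "g y * dist y z \<le> max (g y) (g z) * dist y z" "g z * dist z y \<le> max (g y) (g z) * dist y z"
    by (auto simp: dist_commute intro!: mult_right_mono)
  then show ?thesis
    using chain_inf_step[of y z] chain_inf_step[of z y] assms by (auto simp: dist_commute)
qed

lemma chain_inf_upper_gradient:
  "continuous_on UNIV g \<Longrightarrow> 0 < \<delta> \<Longrightarrow> upper_gradient (chain_inf D g \<delta>) (\<lambda>z. ennreal (g z))"
  by (rule local_Lipschitz_upper_gradient) (auto intro: g_nonneg chain_inf_local)

lemma chain_inf_continuous:
  assumes "continuous_on UNIV g" "0 < \<delta>"
  shows "continuous_on UNIV (chain_inf D g \<delta>)"
  unfolding continuous_on_iff
proof safe
  fix y :: 'a and e :: real assume e: "0 < e"
  obtain d where d: "d > 0" "\<And>z. dist z y < d \<Longrightarrow> dist (g z) (g y) < 1"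
    using assms(1) unfolding continuous_on_iff by (metis UNIV_I zero_less_one)
  define d' where "d' = min (min d \<delta>) (e / (g y + 1))"
  have gy: "0 < g y + 1" using g_nonneg[of y] by simp
  show "\<exists>d>0. \<forall>z\<in>UNIV. dist z y < d \<longrightarrow> dist (chain_inf D g \<delta> z) (chain_inf D g \<delta> y) < e"
  proof (intro exI[of _ d'] conjI ballI impI)
    show "0 < d'" using d assms(2) e gy by (simp add: d'_def)
    fix z assume z: "dist z y < d'"
    then have z': "dist z y < d" "dist z y < \<delta>" "dist z y < e / (g y + 1)" by (auto simp: d'_def)
    have "dist (chain_inf D g \<delta> z) (chain_inf D g \<delta> y) \<le> max (g z) (g y) * dist z y"
      using chain_inf_local[OF z'(2)] by (simp add: dist_real_def)
    also have "\<dots> \<le> (g y + 1) * dist z y"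
      using d(2)[OF z'(1)] by (intro mult_right_mono) (auto simp: dist_real_def)
    also have "\<dots> < e" using z'(3) gy by (simp add: pos_less_divide_eq mult.commute)
    finally show "dist (chain_inf D g \<delta> z) (chain_inf D g \<delta> y) < e" .
  qed
qed

end

text \<open>Tychonoff's theorem replaces the Arzela-Ascoli theorem: only closeness at finitely many
  parameters is needed.\<close>

lemma cluster_function:
  fixes F :: "nat \<Rightarrow> 'b \<Rightarrow> 'a::metric_space"
  assumes K: "compact K" and FK: "\<And>n s. F n s \<in> K"
  obtains f where "\<And>s. f s \<in> K"
    "\<And>S e N. finite S \<Longrightarrow> 0 < e \<Longrightarrow> \<exists>n\<ge>N. \<forall>s\<in>S. dist (F n s) (f s) < e"
proof -
  have "compactin (product_topology (\<lambda>_::'b. euclidean::'a topology) UNIV) (PiE UNIV (\<lambda>_. K))"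
    using K by (simp add: compactin_PiE)
  then have "compact (PiE UNIV (\<lambda>_::'b. K))"
    by (simp add: euclidean_product_topology)
  then obtain f where f: "f \<in> PiE UNIV (\<lambda>_. K)" "inf (nhds f) (filtermap F sequentially) \<noteq> bot"
    unfolding compact_filter using FK
    by (metis (no_types, lifting) PiE_UNIV_domain Pi_I always_eventually eventually_filtermap filtermap_bot_iff sequentially_bot)
  have "\<exists>n\<ge>N. \<forall>s\<in>S. dist (F n s) (f s) < e" if S: "finite S" "0 < e" for S e N
  proof (rule ccontr)
    assume neg: "\<not> ?thesis"
    have "\<forall>\<^sub>F h in nhds f. dist (h s) (f s) < e" for s
    proof -
      have "open ((\<lambda>h. h s) -` ball (f s) e)"
        by (intro open_vimage continuous_on_product_coordinates) auto
      then have "\<forall>\<^sub>F h in nhds f. h \<in> (\<lambda>h. h s) -` ball (f s) e"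
        using S by (intro eventually_nhds_in_open) auto
      then show ?thesis by eventually_elim (auto simp: dist_commute)
    qed
    then have "\<forall>\<^sub>F h in nhds f. \<forall>s\<in>S. dist (h s) (f s) < e"
      using S by (intro eventually_ball_finite) auto
    moreover have "\<forall>\<^sub>F h in filtermap F sequentially. \<not> (\<forall>s\<in>S. dist (h s) (f s) < e)"
      unfolding eventually_filtermap eventually_sequentially using neg by blast
    ultimately have "\<forall>\<^sub>F h in inf (nhds f) (filtermap F sequentially). False"
      unfolding eventually_inf by blast
    then show False using f(2) by (simp add: trivial_limit_def)
  qed
  then show thesis using that f(1) by blast
qed

text \<open>The chain is run through at unit speed with respect to its accumulated length
  \<open>\<sigma>\<close>, resting at each point until the next one is due. The path jumps by at
  most \<open>\<delta>\<close>, so it is 1-Lipschitz up to an error \<open>\<delta>\<close>.\<close>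

lemma step_path:
  fixes p :: "nat \<Rightarrow> 'a::metric_space"
  assumes \<delta>: "\<And>i. i < N \<Longrightarrow> dist (p i) (p (Suc i)) \<le> \<delta>" and "0 \<le> \<delta>"
  defines "\<sigma> \<equiv> \<lambda>i. \<Sum>k<i. dist (p k) (p (Suc k))"
  obtains F :: "real \<Rightarrow> 'a" where "range F \<subseteq> p ` {..N}" "\<And>i. i \<le> N \<Longrightarrow> F (\<sigma> i) = p i"
    "\<And>s t. \<bar>s - t\<bar> \<ge> dist (F s) (F t) - \<delta>" "\<And>s. \<sigma> N \<le> s \<Longrightarrow> F s = p N"
proof -
  have mono: "\<sigma> i \<le> \<sigma> j" if "i \<le> j" for i j
    unfolding \<sigma>_def using that by (intro sum_mono2) auto
  have pd: "dist (p i) (p j) \<le> \<sigma> j - \<sigma> i" if "i \<le> j" for i j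
    using that
  proof (induction j)
    case (Suc j)
    show ?case
    proof (cases "i = Suc j")
      case False
      then have "dist (p i) (p (Suc j)) \<le> dist (p i) (p j) + dist (p j) (p (Suc j))" "dist (p i) (p j) \<le> \<sigma> j - \<sigma> i"
        using Suc dist_triangle by auto
      then show ?thesis by (simp add: \<sigma>_def)
    qed simp
  qed simp
  \<comment> \<open>Index of the last chain point reached by time \<open>s\<close>; inserting 0
    takes care of negative times.\<close>
  define I where "I s = Max (insert 0 {i. i \<le> N \<and> \<sigma> i \<le> s})" for s
  have fin: "finite (insert 0 {i. i \<le> N \<and> \<sigma> i \<le> s})" for s by simp
  have I_in: "I s \<in> insert 0 {i. i \<le> N \<and> \<sigma> i \<le> s}" for s
    unfolding I_def by (rule Max_in) auto
  then have I_N: "I s \<le> N" for s by (metis (mono_tags, lifting) insertE le0 mem_Collect_eq)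
  have I_ge: "i \<le> I s" if "i \<le> N" "\<sigma> i \<le> s" for i s
    unfolding I_def using that by (intro Max_ge fin) auto
  have I_next: "s < \<sigma> (Suc (I s))" if "I s < N" for s
    using I_ge[of "Suc (I s)" s] that by (meson Suc_leI not_le lessI)
  have I_mono: "I s \<le> I t" if "s \<le> t" for s t
    unfolding I_def using that by (intro Max_mono) auto
  have I_sig: "\<sigma> (I s) \<le> max 0 s" for s
  proof -
    have "\<sigma> 0 = 0" by (simp add: \<sigma>_def)
    then show ?thesis using I_in[of s] by auto
  qed
  define F where "F s = p (I s)" for s
  have aux: "dist (F s) (F t) - \<delta> \<le> t - s" if "s \<le> t" for s t
  proof (cases "I s < N")
    case True
    then have *: "s < \<sigma> (I s) + dist (p (I s)) (p (Suc (I s)))"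
      using I_next[of s] by (simp add: \<sigma>_def)
    have d: "dist (F s) (F t) \<le> \<sigma> (I t) - \<sigma> (I s)"
      unfolding F_def by (intro pd I_mono that)
    show ?thesis
    proof (cases "0 \<le> t")
      case True
      then show ?thesis using d * \<delta>[OF \<open>I s < N\<close>] I_sig[of t] by simp
    next
      case False
      then have "\<sigma> (I t) \<le> 0" using I_sig[of t] by simp
      moreover have "\<sigma> 0 \<le> \<sigma> (I s)" by (intro mono) simp
      moreover have "\<sigma> 0 = 0" by (simp add: \<sigma>_def)
      ultimately have "dist (F s) (F t) \<le> 0" using d by linarith
      then show ?thesis using that \<open>0 \<le> \<delta>\<close> by simp
    qed
  next
    case False
    then have "I t = I s" using I_mono[OF that] I_N[of t] I_N[of s] by simp
    then show ?thesis using that \<open>0 \<le> \<delta>\<close> by (simp add: F_def)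
  qed
  show thesis
  proof (rule that[of F])
    show "range F \<subseteq> p ` {..N}" using I_N by (auto simp: F_def)
    show "F (\<sigma> i) = p i" if "i \<le> N" for i
    proof -
      have "i \<le> I (\<sigma> i)" by (rule I_ge) (use that in auto)
      moreover have "0 \<le> \<sigma> i" by (simp add: \<sigma>_def sum_nonneg)
      ultimately have "dist (p i) (p (I (\<sigma> i))) \<le> 0"
        using pd[of i "I (\<sigma> i)"] I_sig[of "\<sigma> i"] by linarith
      then show ?thesis by (simp add: F_def)
    qed
    show "\<bar>s - t\<bar> \<ge> dist (F s) (F t) - \<delta>" for s t
      using aux[of s t] aux[of t s] by (cases "s \<le> t") (auto simp: dist_commute)
    show "F s = p N" if "\<sigma> N \<le> s" for s
      using I_ge[of N s] I_N[of s] that by (simp add: F_def)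
  qed
qed

lemma le_of_linear_error:
  fixes I c C :: real
  assumes "\<And>e. 0 < e \<Longrightarrow> e \<le> 1 \<Longrightarrow> I \<le> c + C * e" "0 \<le> C"
  shows "I \<le> c"
proof (rule field_le_epsilon)
  fix \<epsilon> :: real assume "0 < \<epsilon>"
  define e where "e = min 1 (\<epsilon> / (C + 1))"
  have e: "0 < e" "e \<le> 1" using \<open>0 < \<epsilon>\<close> assms(2) by (auto simp: e_def)
  have "C * e \<le> (C + 1) * (\<epsilon> / (C + 1))"
    using assms(2) e by (intro mult_mono) (auto simp: e_def)
  also have "\<dots> = \<epsilon>" using assms(2) by simp
  finally show "I \<le> c + \<epsilon>" using assms(1)[OF e] by simp
qed

text \<open>During the step that starts at \<open>p n\<close>, the curve \<open>f\<close> stays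
  within \<open>5 * e\<close> of \<open>p n\<close>: \<open>4 * e\<close> from the closeness at its
  start and \<open>e\<close> from the duration of the step. So \<open>g\<close> along
  \<open>f\<close> exceeds \<open>g (p n) \<le> G (p n)\<close> by at most
  \<open>5 * L * e\<close>.\<close>

lemma chain_integral_bound:
  fixes p :: "nat \<Rightarrow> 'a::metric_space" and f :: "real \<Rightarrow> 'a" and g G :: "'a \<Rightarrow> real"
  assumes f: "\<And>s t. dist (f s) (f t) \<le> \<bar>s - t\<bar>" and g: "\<And>y z. \<bar>g y - g z\<bar> \<le> L * dist y z" "0 \<le> L"
    and gG: "\<And>z. g z \<le> G z"
    and close: "\<And>i. i < N \<Longrightarrow> dist (f (\<Sum>k<i. dist (p k) (p (Suc k)))) (p i) \<le> 4 * e"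
    and small: "\<And>i. i < N \<Longrightarrow> dist (p i) (p (Suc i)) \<le> e"
    and n: "n \<le> N"
  defines "\<sigma> \<equiv> \<lambda>i. \<Sum>k<i. dist (p k) (p (Suc k))"
  shows "integral {0..\<sigma> n} (\<lambda>s. g (f s)) \<le> (\<Sum>i<n. G (p i) * dist (p i) (p (Suc i))) + 5 * L * e * \<sigma> n"
  using n
proof (induction n)
  case 0
  then show ?case by (simp add: \<sigma>_def)
next
  case (Suc n)
  have "continuous_on UNIV g" using g(1)
    by (intro Lipschitz_continuous_on[where K = L]) (auto simp: dist_real_def)
  moreover have "continuous_on S f" for S
    using f by (intro Lipschitz_continuous_on[where K = 1]) (auto simp: dist_real_def)
  ultimately have cont: "continuous_on S (\<lambda>s. g (f s))" for S
    by (auto intro: continuous_on_compose2)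
  then have int: "(\<lambda>s. g (f s)) integrable_on {u..v}" for u v
    by (rule integrable_continuous_real)
  let ?d = "dist (p n) (p (Suc n))"
  have sig: "\<sigma> (Suc n) = \<sigma> n + ?d" "0 \<le> \<sigma> n" by (auto simp: \<sigma>_def sum_nonneg)
  have "integral {\<sigma> n..\<sigma> (Suc n)} (\<lambda>s. g (f s)) \<le> integral {\<sigma> n..\<sigma> (Suc n)} (\<lambda>_. G (p n) + 5 * L * e)"
  proof (rule integral_le[OF int])
    fix s assume s: "s \<in> {\<sigma> n..\<sigma> (Suc n)}"
    have "dist (f s) (f (\<sigma> n)) \<le> e"
      using f[of s "\<sigma> n"] s sig small[of n] Suc.prems by auto
    then have "dist (f s) (p n) \<le> 5 * e"
      using close[of n] Suc.prems dist_triangle[of "f s" "p n" "f (\<sigma> n)"] by (auto simp: \<sigma>_def)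
    then have "L * dist (f s) (p n) \<le> L * (5 * e)" using g(2) by (rule mult_left_mono)
    then show "g (f s) \<le> G (p n) + 5 * L * e"
      using g(1)[of "f s" "p n"] gG[of "p n"] by simp
  qed auto
  also have "\<dots> = G (p n) * ?d + 5 * L * e * ?d" using sig by (simp add: algebra_simps)
  finally have "integral {\<sigma> n..\<sigma> (Suc n)} (\<lambda>s. g (f s)) \<le> \<dots>" .
  moreover have "integral {0..\<sigma> n} (\<lambda>s. g (f s)) + integral {\<sigma> n..\<sigma> (Suc n)} (\<lambda>s. g (f s)) = integral {0..\<sigma> (Suc n)} (\<lambda>s. g (f s))"
    using sig int by (intro Henstock_Kurzweil_Integration.integral_combine) auto
  moreover have "integral {0..\<sigma> n} (\<lambda>s. g (f s)) \<le> (\<Sum>i<n. G (p i) * dist (p i) (p (Suc i))) + 5 * L * e * \<sigma> n"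
    using Suc by simp
  ultimately show ?case using sig by (simp add: distrib_left)
qed

text \<open>The chains have length at most \<open>c / a\<close> because the weights are at least
  \<open>a\<close> on \<open>D\<close>; so their step paths live on a bounded time interval and in
  the compact set \<open>K\<close>, and have a cluster function \<open>f\<close>, which is
  1-Lipschitz since the jumps shrink. For fixed \<open>m\<close> the chains with index
  \<open>n \<ge> m\<close> also bound the cost for the smaller weight \<open>Gm m\<close>, and this
  bound passes to the limit.\<close>

lemma chain_limit_curve:
  fixes D K :: "'a::metric_space set" and Gm :: "nat \<Rightarrow> 'a \<Rightarrow> real"
  assumes D: "open D" "y \<in> D" and K: "compact K" "\<And>z w. z \<in> D \<Longrightarrow> dist z w \<le> 1 \<Longrightarrow> w \<in> K"
    and a: "0 < a" "\<And>m z. z \<in> D \<Longrightarrow> a \<le> Gm m z"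
    and lip: "\<And>m. \<exists>L. \<forall>y z. \<bar>Gm m y - Gm m z\<bar> \<le> L * dist y z"
    and nonneg: "\<And>m z. 0 \<le> Gm m z" and incr: "\<And>m z. Gm m z \<le> Gm (Suc m) z"
    and chains: "\<And>m. \<exists>c'\<le>c. chain_cost D (Gm m) (1 / real (Suc m)) y c'"
  obtains f \<tau> where "0 < \<tau>" "\<And>s t. dist (f s) (f t) \<le> \<bar>s - t\<bar>" "f 0 = y" "f \<tau> \<notin> D"
    "\<And>s. f s \<in> closure D" "\<And>m. integral {0..\<tau>} (\<lambda>s. Gm m (f s)) \<le> c"
proof -
  let ?Q = "\<lambda>m N p. p 0 = y \<and> (\<forall>i<N. p i \<in> D \<and> dist (p i) (p (Suc i)) < 1 / real (Suc m)) \<and> p N \<notin> D \<and>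
      (\<Sum>i<N. Gm m (p i) * dist (p i) (p (Suc i))) \<le> c"
  have "\<forall>m. \<exists>N p. ?Q m N p"
  proof
    fix m
    obtain c' where c': "c' \<le> c" "chain_cost D (Gm m) (1 / real (Suc m)) y c'" using chains by auto
    from chain_cost_path[OF c'(2)] obtain N p where
      "p 0 = y \<and> (\<forall>i<N. p i \<in> D \<and> dist (p i) (p (Suc i)) < 1 / real (Suc m)) \<and> p N \<notin> D \<and>
        c' = (\<Sum>i<N. Gm m (p i) * dist (p i) (p (Suc i)))" by (elim exE)
    then show "\<exists>N p. ?Q m N p" using c'(1) by (intro exI[of _ N] exI[of _ p]) simp
  qed
  from choice[OF this] obtain N where "\<forall>m. \<exists>p. ?Q m (N m) p" by (rule exE)
  from choice[OF this] obtain p where Q: "\<forall>m. ?Q m (N m) (p m)" by (rule exE)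
  have p: "\<And>m. p m 0 = y" "\<And>m i. i < N m \<Longrightarrow> p m i \<in> D"
    "\<And>m i. i < N m \<Longrightarrow> dist (p m i) (p m (Suc i)) < 1 / real (Suc m)" "\<And>m. p m (N m) \<notin> D"
    "\<And>m. (\<Sum>i<N m. Gm m (p m i) * dist (p m i) (p m (Suc i))) \<le> c"
    using Q by simp_all
  have N0: "N m > 0" for m using p(1,4)[of m] D by (metis gr0I)
  define \<sigma> where "\<sigma> m i = (\<Sum>k<i. dist (p m k) (p m (Suc k)))" for m i
  define len where "len m = \<sigma> m (N m)" for m
  have len0: "0 \<le> len m" for m by (simp add: len_def \<sigma>_def sum_nonneg)
  have sig_len: "0 \<le> \<sigma> m i \<and> \<sigma> m i \<le> len m" if "i \<le> N m" for m i
    unfolding len_def \<sigma>_def using that by (auto intro!: sum_nonneg sum_mono2)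
  have len_bound: "len m \<le> c / a" for m
  proof -
    have "a * len m = (\<Sum>i<N m. a * dist (p m i) (p m (Suc i)))"
      by (simp add: len_def \<sigma>_def sum_distrib_left)
    also have "\<dots> \<le> (\<Sum>i<N m. Gm m (p m i) * dist (p m i) (p m (Suc i)))"
      using a p(2) by (intro sum_mono mult_right_mono) auto
    also have "\<dots> \<le> c" by (rule p)
    finally show ?thesis using a by (simp add: pos_le_divide_eq mult.commute)
  qed
  let ?R = "\<lambda>m F. range F \<subseteq> p m ` {..N m} \<and> (\<forall>i\<le>N m. F (\<sigma> m i) = p m i) \<and>
      (\<forall>s t. \<bar>s - t\<bar> \<ge> dist (F s) (F t) - 1 / real (Suc m))"
  have "\<exists>F. ?R m F" for m
  proof (rule step_path[of "N m" "p m" "1 / real (Suc m)"])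
    fix F :: "real \<Rightarrow> 'a"
    assume "range F \<subseteq> p m ` {..N m}" "\<And>i. i \<le> N m \<Longrightarrow> F (\<Sum>k<i. dist (p m k) (p m (Suc k))) = p m i"
      "\<And>s t. \<bar>s - t\<bar> \<ge> dist (F s) (F t) - 1 / real (Suc m)"
    then show ?thesis unfolding \<sigma>_def by (intro exI[of _ F]) simp
  qed (use p(3) in \<open>auto intro: less_imp_le\<close>)
  then have "\<forall>m. \<exists>F. ?R m F" by (rule allI)
  from choice[OF this] obtain F where FR: "\<forall>m. ?R m (F m)" by (rule exE)
  have F: "\<And>m. range (F m) \<subseteq> p m ` {..N m}" "\<And>m i. i \<le> N m \<Longrightarrow> F m (\<sigma> m i) = p m i"
    "\<And>m s t. \<bar>s - t\<bar> \<ge> dist (F m s) (F m t) - 1 / real (Suc m)"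
    using FR by simp_all
  have near_D: "\<exists>w\<in>D. dist w (F m s) < 1 / real (Suc m)" for m s
  proof -
    have "F m s \<in> p m ` {..N m}" using F(1)[of m] by (rule subsetD) simp
    then obtain i where i: "i \<le> N m" "F m s = p m i" by auto
    show ?thesis
    proof (cases "i < N m")
      case True
      then show ?thesis using i p(2)[of i m] by (intro bexI[of _ "p m i"]) auto
    next
      case False
      then have "i = Suc (N m - 1)" "N m - 1 < N m" using i N0[of m] by auto
      then show ?thesis using i p(2)[of "N m - 1" m] p(3)[of "N m - 1" m]
        by (intro bexI[of _ "p m (N m - 1)"]) auto
    qed
  qed
  have F_K: "F m s \<in> K" for m s
  proof -
    obtain w where w: "w \<in> D" "dist w (F m s) < 1 / real (Suc m)" using near_D by blast
    have "1 / real (Suc m) \<le> 1" by simp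
    then have "dist w (F m s) \<le> 1" using w(2) by linarith
    then show ?thesis by (rule K(2)[OF w(1)])
  qed
  have "bounded (range len)"
    unfolding bounded_iff using len0 len_bound by (intro exI[of _ "c / a"]) auto
  then obtain \<tau> r where r: "strict_mono r" "(len \<circ> r) \<longlonglongrightarrow> \<tau>"
    using bounded_imp_convergent_subsequence by blast
  obtain f where f: "\<And>s. f s \<in> K"
    "\<And>S e n0. finite S \<Longrightarrow> 0 < e \<Longrightarrow> \<exists>n\<ge>n0. \<forall>s\<in>S. dist (F (r n) s) (f s) < e"
    using cluster_function[of K "\<lambda>n. F (r n)"] K(1) F_K by blast
  have approx: "\<exists>n\<ge>n0. (\<forall>s\<in>S. dist (F n s) (f s) < e) \<and> \<bar>len n - \<tau>\<bar> < e \<and> 1 / real (Suc n) < e"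
    if S: "finite S" and e: "0 < e" for S e n0
  proof -
    obtain n1 where n1: "\<And>n. n \<ge> n1 \<Longrightarrow> \<bar>len (r n) - \<tau>\<bar> < e"
      using LIMSEQ_D[OF r(2) e] by auto
    obtain n2 where n2: "1 / real (Suc n2) < e" using nat_approx_posE[OF e] by blast
    obtain n where n: "n \<ge> max n0 (max n1 n2)" "\<forall>s\<in>S. dist (F (r n) s) (f s) < e"
      using f(2)[OF S e] by blast
    have rn: "n \<le> r n" using r(1) by (rule seq_suble)
    have "1 / real (Suc (r n)) \<le> 1 / real (Suc n2)" using n rn by (intro divide_left_mono) auto
    then show ?thesis
      using n n1[of n] n2 rn by (intro exI[of _ "r n"]) auto
  qed
  have f_lip: "dist (f s) (f t) \<le> \<bar>s - t\<bar>" for s t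
  proof (rule field_le_epsilon)
    fix e :: real assume "0 < e"
    then obtain n where n: "\<forall>u\<in>{s, t}. dist (F n u) (f u) < e / 3" "1 / real (Suc n) < e / 3"
      using approx[of "{s, t}" "e / 3" 0] by auto
    have "dist (f s) (f t) \<le> dist (F n s) (f s) + dist (F n s) (F n t) + dist (F n t) (f t)"
      using dist_triangle[of "f s" "f t" "F n s"] dist_triangle[of "F n s" "f t" "F n t"]
      by (simp add: dist_commute)
    then show "dist (f s) (f t) \<le> \<bar>s - t\<bar> + e"
      using n F(3)[of n s t] by auto
  qed
  have F_0: "F m 0 = y" for m using F(2)[of 0 m] p(1) by (simp add: \<sigma>_def)
  have f_0: "f 0 = y"
  proof (rule ccontr)
    assume "f 0 \<noteq> y"
    then obtain n where "dist (F n 0) (f 0) < dist y (f 0)"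
      using approx[of "{0}" "dist y (f 0)" 0] by auto
    then show False using F_0 by simp
  qed
  \<comment> \<open>The end points of the chains lie outside the open set \<open>D\<close> and are
    approached by \<open>f \<tau>\<close>, because the chain lengths converge to
    \<open>\<tau>\<close>.\<close>
  have f_tau: "f \<tau> \<notin> D"
  proof
    assume "f \<tau> \<in> D"
    then obtain e where e: "e > 0" "ball (f \<tau>) e \<subseteq> D" using D(1) by (meson open_contains_ball)
    obtain n where n: "dist (F n \<tau>) (f \<tau>) < e / 3" "\<bar>len n - \<tau>\<bar> < e / 3" "1 / real (Suc n) < e / 3"
      using approx[of "{\<tau>}" "e / 3" 0] e by auto
    have "dist (f \<tau>) (F n (len n)) \<le> dist (F n \<tau>) (f \<tau>) + dist (F n (len n)) (F n \<tau>)"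
      using dist_triangle[of "f \<tau>" "F n (len n)" "F n \<tau>"] by (simp add: dist_commute)
    also have "\<dots> < e" using n F(3)[of n "len n" \<tau>] by linarith
    finally have "F n (len n) \<in> D" using e by auto
    then show False using F(2)[of "N n" n] p(4)[of n] by (simp add: len_def)
  qed
  have tau: "0 < \<tau>"
  proof -
    have "0 \<le> \<tau>" by (rule LIMSEQ_le_const[OF r(2)]) (use len0 in auto)
    moreover have "\<tau> \<noteq> 0" using f_tau f_0 D(2) by auto
    ultimately show ?thesis by simp
  qed
  have f_closure: "f s \<in> closure D" for s
    unfolding closure_approachable
  proof (intro allI impI)
    fix e :: real assume "0 < e"
    then obtain n where n: "dist (F n s) (f s) < e / 2" "1 / real (Suc n) < e / 2"
      using approx[of "{s}" "e / 2" 0] by auto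
    obtain w where "w \<in> D" "dist w (F n s) < 1 / real (Suc n)" using near_D by blast
    then show "\<exists>w\<in>D. dist w (f s) < e"
      using n dist_triangle[of w "f s" "F n s"] by (intro bexI[of _ w]) auto
  qed
  have incr': "Gm m z \<le> Gm n z" if "m \<le> n" for m n z
    using that incr by (rule lift_Suc_mono_le[rotated])
  have bound: "integral {0..\<tau>} (\<lambda>s. Gm m (f s)) \<le> c" for m
  proof -
    obtain L where L: "\<And>y z. \<bar>Gm m y - Gm m z\<bar> \<le> L * dist y z" using lip by blast
    define L' where "L' = max L 0"
    have L': "\<bar>Gm m y - Gm m z\<bar> \<le> L' * dist y z" "0 \<le> L'" for y z
      using L[of y z] mult_right_mono[of L L' "dist y z"] by (auto simp: L'_def)
    have "continuous_on UNIV (Gm m)" using L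
      by (intro Lipschitz_continuous_on[where K = L]) (auto simp: dist_real_def)
    moreover have "continuous_on S f" for S
      using f_lip by (intro Lipschitz_continuous_on[where K = 1]) (auto simp: dist_real_def)
    ultimately have cont: "continuous_on S (\<lambda>s. Gm m (f s))" for S
      by (auto intro: continuous_on_compose2)
    then have int: "(\<lambda>s. Gm m (f s)) integrable_on {u..v}" for u v
      by (rule integrable_continuous_real)
    show ?thesis
    proof (rule le_of_linear_error)
      fix e :: real assume e: "0 < e" "e \<le> 1"
      \<comment> \<open>Pointwise closeness on a grid of spacing \<open>e\<close> suffices: between
        grid points \<open>f\<close> moves by at most \<open>e\<close> and the step path by at most
        \<open>2 * e\<close>, which together with the error \<open>e\<close> at the grid point gives
        \<open>4 * e\<close>.\<close>
      define S where "S = (\<lambda>j. real j * e) ` {..nat \<lceil>(\<tau> + 1) / e\<rceil>}"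
      have "finite S" by (simp add: S_def)
      then obtain n where n: "n \<ge> m" "\<And>s. s \<in> S \<Longrightarrow> dist (F n s) (f s) < e" "\<bar>len n - \<tau>\<bar> < e" "1 / real (Suc n) < e"
        using approx[of S e m] e by blast
      have close: "dist (f s) (F n s) \<le> 4 * e" if s: "0 \<le> s" "s \<le> \<tau> + 1" for s
      proof -
        define j where "j = nat \<lfloor>s / e\<rfloor>"
        have "0 \<le> s / e" using s e by simp
        then have j: "real j \<le> s / e" "s / e < real j + 1" by (auto simp: j_def)
        then have j': "real j * e \<le> s" "s < real j * e + e"
          using e by (simp_all add: pos_le_divide_eq pos_divide_less_eq algebra_simps)
        have "s / e \<le> (\<tau> + 1) / e" using s e by (intro divide_right_mono) auto
        then have "j \<le> nat \<lceil>(\<tau> + 1) / e\<rceil>" unfolding j_def by linarith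
        then have "real j * e \<in> S" by (auto simp: S_def)
        then have "dist (F n (real j * e)) (f (real j * e)) < e" by (rule n)
        moreover have "dist (f s) (f (real j * e)) \<le> e" using f_lip[of s "real j * e"] j' by simp
        moreover have "dist (F n s) (F n (real j * e)) \<le> 2 * e"
          using F(3)[of n s "real j * e"] j' n(4) by simp
        moreover have "dist (f s) (F n s) \<le> dist (f s) (f (real j * e)) + dist (F n (real j * e)) (f (real j * e)) + dist (F n s) (F n (real j * e))"
          using dist_triangle[of "f s" "F n s" "f (real j * e)"] dist_triangle[of "f (real j * e)" "F n s" "F n (real j * e)"]
          by (simp add: dist_commute)
        ultimately show ?thesis by linarith
      qed
      have len_n: "len n \<le> \<tau> + 1" using n(3) e by linarith
      have "integral {0..\<sigma> n (N n)} (\<lambda>s. Gm m (f s)) \<le> (\<Sum>i<N n. Gm n (p n i) * dist (p n i) (p n (Suc i))) + 5 * L' * e * \<sigma> n (N n)"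
        unfolding \<sigma>_def
      proof (rule chain_integral_bound[OF f_lip L'])
        show "Gm m z \<le> Gm n z" for z by (rule incr'[OF n(1)])
        fix i assume i: "i < N n"
        show "dist (f (\<Sum>k<i. dist (p n k) (p n (Suc k)))) (p n i) \<le> 4 * e"
          using close[of "\<sigma> n i"] sig_len[of i n] F(2)[of i n] i len_n by (simp add: \<sigma>_def)
        show "dist (p n i) (p n (Suc i)) \<le> e" using p(3)[OF i] n(4) by linarith
      qed simp
      also have "\<dots> \<le> c + 5 * L' * e * (\<tau> + 1)"
        using p(5)[of n] L' e len_n by (intro add_mono mult_left_mono) (auto simp: len_def)
      finally have A: "integral {0..len n} (\<lambda>s. Gm m (f s)) \<le> c + 5 * L' * e * (\<tau> + 1)"
        by (simp add: len_def)
      \<comment> \<open>The chain length differs from \<open>\<tau>\<close> by less than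
        \<open>e\<close>; if it is shorter, the missing piece is bounded through the Lipschitz bound
        of \<open>Gm m\<close> around \<open>y\<close>.\<close>
      have "integral {0..\<tau>} (\<lambda>s. Gm m (f s)) \<le> integral {0..len n} (\<lambda>s. Gm m (f s)) + (Gm m y + L' * \<tau>) * e"
      proof (cases "\<tau> \<le> len n")
        case True
        then have "integral {0..\<tau>} (\<lambda>s. Gm m (f s)) \<le> integral {0..len n} (\<lambda>s. Gm m (f s))"
          by (intro integral_subset_le int) (auto simp: nonneg)
        moreover have "0 \<le> (Gm m y + L' * \<tau>) * e" using nonneg[of m y] L' tau e by simp
        ultimately show ?thesis by linarith
      next
        case False
        have "integral {len n..\<tau>} (\<lambda>s. Gm m (f s)) \<le> integral {len n..\<tau>} (\<lambda>_. Gm m y + L' * \<tau>)"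
        proof (rule integral_le[OF int])
          fix s assume s: "s \<in> {len n..\<tau>}"
          have "dist (f s) y \<le> \<tau>" using f_lip[of s 0] f_0 s len0[of n] by simp
          then have "L' * dist (f s) y \<le> L' * \<tau>" using L'(2) by (rule mult_left_mono)
          then show "Gm m (f s) \<le> Gm m y + L' * \<tau>" using L'(1)[of "f s" y] by linarith
        qed auto
        also have "\<dots> = (\<tau> - len n) * (Gm m y + L' * \<tau>)" using False by simp
        also have "\<dots> \<le> e * (Gm m y + L' * \<tau>)"
          using n(3) nonneg[of m y] L' tau by (intro mult_right_mono) auto
        finally have "integral {len n..\<tau>} (\<lambda>s. Gm m (f s)) \<le> (Gm m y + L' * \<tau>) * e" by (simp add: mult.commute)
        moreover have "integral {0..len n} (\<lambda>s. Gm m (f s)) + integral {len n..\<tau>} (\<lambda>s. Gm m (f s)) = integral {0..\<tau>} (\<lambda>s. Gm m (f s))"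
          using False len0 int by (intro Henstock_Kurzweil_Integration.integral_combine) auto
        ultimately show ?thesis by linarith
      qed
      then show "integral {0..\<tau>} (\<lambda>s. Gm m (f s)) \<le> c + (5 * L' * (\<tau> + 1) + (Gm m y + L' * \<tau>)) * e"
        using A by (simp add: algebra_simps)
    next
      show "0 \<le> 5 * L' * (\<tau> + 1) + (Gm m y + L' * \<tau>)"
        using nonneg[of m y] L' tau by (intro add_nonneg_nonneg mult_nonneg_nonneg) auto
    qed
  qed
  show thesis by (rule that[OF tau f_lip f_0 f_tau f_closure bound])
qed

text \<open>The limit curve is 1-Lipschitz but need not be parametrized by arc length. Its length
  function satisfies \<open>\<phi> t - \<phi> s \<le> t - s\<close>, so passing to arc length can
  only shrink the integral; \<open>growth_bound\<close> proves this without a change of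
  variables.\<close>

lemma Lipschitz_path_line_integral:
  fixes f :: "real \<Rightarrow> 'a::metric_space" and g :: "'a \<Rightarrow> real"
  assumes f: "\<And>s t. dist (f s) (f t) \<le> \<bar>s - t\<bar>" and \<tau>: "0 < \<tau>" "f \<tau> \<noteq> f 0"
    and g: "\<And>y z. \<bar>g y - g z\<bar> \<le> L * dist y z" "\<And>z. 0 \<le> g z"
  shows "rect_curve f 0 \<tau>"
    and "line_integral (\<lambda>z. ennreal (g z)) f 0 \<tau> \<le> ennreal (integral {0..\<tau>} (\<lambda>s. g (f s)))"
proof -
  have len: "curve_length f s t \<le> ennreal (t - s)" if "s \<le> t" for s t
    using f that by (intro length_Lipschitz) auto
  have f_cont: "continuous_on S f" for S
    using f by (intro Lipschitz_continuous_on[where K = 1]) (auto simp: dist_real_def)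
  have "curve_length f 0 \<tau> < \<infinity>" using len[of 0 \<tau>] \<tau> by (auto intro: le_less_trans)
  then show rc: "rect_curve f 0 \<tau>"
    using \<tau> f_cont by (auto simp: rect_curve_def intro!: bexI[of _ \<tau>])
  have g_cont: "continuous_on UNIV g" using g(1)
    by (intro Lipschitz_continuous_on[where K = L]) (auto simp: dist_real_def)
  show "line_integral (\<lambda>z. ennreal (g z)) f 0 \<tau> \<le> ennreal (integral {0..\<tau>} (\<lambda>s. g (f s)))"
  proof (rule arc_length_parametrization[OF rc])
    fix c l \<phi>
    assume l: "0 < l" and c: "\<And>s t. dist (c s) (c t) \<le> \<bar>s - t\<bar>"
      and line: "\<And>g. line_integral g f 0 \<tau> = (\<integral>\<^sup>+ s. g (c s) * indicator {0..l} s \<partial>lborel)"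
      and phi: "\<phi> 0 = 0" "\<phi> \<tau> = l" "\<And>t. t \<in> {0..\<tau>} \<Longrightarrow> c (\<phi> t) = f t"
      "\<And>s t. 0 \<le> s \<Longrightarrow> s \<le> t \<Longrightarrow> t \<le> \<tau> \<Longrightarrow> \<phi> s \<le> \<phi> t \<and> ennreal (\<phi> t - \<phi> s) = curve_length f s t"
    have c_cont: "continuous_on S c" for S
      using c by (intro Lipschitz_continuous_on[where K = 1]) (auto simp: dist_real_def)
    have gc: "continuous_on S (\<lambda>s. g (c s))" and gf: "continuous_on S (\<lambda>s. g (f s))" for S
      using c_cont f_cont g_cont by (auto intro: continuous_on_compose2)
    have int: "(\<lambda>s. g (c s)) integrable_on {u..v}" for u v
      using gc by (rule integrable_continuous_real)
    have phi_lip: "\<phi> t - \<phi> s \<le> t - s" if "0 \<le> s" "s \<le> t" "t \<le> \<tau>" for s t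
      using phi(4)[OF that] len[OF that(2)] that by (metis diff_ge_0_iff_ge ennreal_le_iff)
    have "\<bar>integral {0..\<phi> 0} (\<lambda>s. g (c s)) - integral {0..\<phi> \<tau>} (\<lambda>s. g (c s))\<bar> \<le> integral {0..\<tau>} (\<lambda>s. g (f s))"
    proof (rule growth_bound[OF \<tau>(1) gf])
      fix e :: real assume e: "0 < e"
      show "\<exists>d>0. \<forall>s\<in>{0..\<tau>}. \<forall>t\<in>{0..\<tau>}. s \<le> t \<longrightarrow> t - s < d \<longrightarrow>
          \<bar>integral {0..\<phi> s} (\<lambda>s. g (c s)) - integral {0..\<phi> t} (\<lambda>s. g (c s))\<bar> \<le> (g (f s) + e) * (t - s)"
      proof (intro exI[of _ "e / (\<bar>L\<bar> + 1)"] conjI ballI impI)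
        show "0 < e / (\<bar>L\<bar> + 1)" using e by (simp add: add_nonneg_pos)
        fix s t assume st: "s \<in> {0..\<tau>}" "t \<in> {0..\<tau>}" "s \<le> t" "t - s < e / (\<bar>L\<bar> + 1)"
        have ph: "0 \<le> \<phi> s" "\<phi> s \<le> \<phi> t" using phi(1) phi(4)[of 0 s] phi(4)[of s t] st by auto
        have "(t - s) * (\<bar>L\<bar> + 1) < e" using st(4) by (simp add: pos_less_divide_eq add_nonneg_pos)
        then have small: "\<bar>L\<bar> * (t - s) \<le> e" using st(3) by (simp add: algebra_simps)
        have "integral {0..\<phi> s} (\<lambda>s. g (c s)) + integral {\<phi> s..\<phi> t} (\<lambda>s. g (c s)) = integral {0..\<phi> t} (\<lambda>s. g (c s))"
          using ph int by (intro Henstock_Kurzweil_Integration.integral_combine) auto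
        moreover have "0 \<le> integral {\<phi> s..\<phi> t} (\<lambda>s. g (c s))"
          using g(2) int by (intro Henstock_Kurzweil_Integration.integral_nonneg) auto
        moreover have "integral {\<phi> s..\<phi> t} (\<lambda>s. g (c s)) \<le> integral {\<phi> s..\<phi> t} (\<lambda>_. g (f s) + e)"
        proof (rule integral_le[OF int])
          fix r assume r: "r \<in> {\<phi> s..\<phi> t}"
          have "dist (c r) (f s) \<le> t - s"
            using c[of r "\<phi> s"] phi(3)[of s] phi_lip[of s t] st r by auto
          then have "\<bar>L\<bar> * dist (c r) (f s) \<le> \<bar>L\<bar> * (t - s)" by (intro mult_left_mono) auto
          moreover have "L * dist (c r) (f s) \<le> \<bar>L\<bar> * dist (c r) (f s)" by (intro mult_right_mono) auto
          ultimately show "g (c r) \<le> g (f s) + e"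
            using g(1)[of "c r" "f s"] small by linarith
        qed auto
        moreover have "integral {\<phi> s..\<phi> t} (\<lambda>_. g (f s) + e) \<le> (g (f s) + e) * (t - s)"
          using ph phi_lip[of s t] st g(2)[of "f s"] e by (simp add: mult.commute mult_left_mono)
        ultimately show "\<bar>integral {0..\<phi> s} (\<lambda>s. g (c s)) - integral {0..\<phi> t} (\<lambda>s. g (c s))\<bar> \<le> (g (f s) + e) * (t - s)"
          by linarith
      qed
    qed
    then have "integral {0..l} (\<lambda>s. g (c s)) \<le> integral {0..\<tau>} (\<lambda>s. g (f s))"
      using phi(1,2) by simp
    then show ?thesis
      unfolding line using nn_integral_continuous_Icc[OF gc, of 0 l] g(2) by (simp add: ennreal_leI)
  qed
qed

section \<open>Capacitary functions with open superlevel sets\<close>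

context doubling_measure
begin

text \<open>The continuous chain functions \<open>vm\<close> increase with \<open>m\<close>, so
  their supremum \<open>v\<close> has open superlevel sets. If \<open>v y < 1\<close> at some
  \<open>y \<in> A\<close>, chains of cost at most \<open>k < 1\<close> exist at every scale, and
  their limit curve leaves the ball with line integral at most \<open>k\<close>, contradicting the
  assumption on curves. The limit curve may run through the closure of
  \<open>ball x (2 * r)\<close>, which is why \<open>g\<close> has to be dominated on
  \<open>ball x (3 * r)\<close>.\<close>

lemma capacitary_function:
  assumes r: "0 < r" and g: "g \<in> borel_measurable borel"
    and int: "(\<integral>\<^sup>+ z. g z * indicator (ball x (3 * r)) z \<partial>M) < ennreal c"
    and A: "A \<subseteq> ball x (2 * r)"
    and curves: "\<And>\<gamma> a b. rect_curve \<gamma> a b \<Longrightarrow> \<gamma> a \<in> A \<Longrightarrow> \<gamma> b \<notin> ball x (2 * r) \<Longrightarrow> 1 \<le> line_integral g \<gamma> a b"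
  obtains v :: "'a \<Rightarrow> real" and G :: "'a \<Rightarrow> ennreal"
  where "\<And>t. open {z. t < v z}" "\<And>z. 0 \<le> v z \<and> v z \<le> 1" "\<And>z. z \<notin> ball x (2 * r) \<Longrightarrow> v z = 0"
    "\<And>z. z \<in> A \<Longrightarrow> v z = 1" "upper_gradient v G" "(\<integral>\<^sup>+ z. G z \<partial>M) < ennreal c"
proof -
  let ?D = "ball x (2 * r)"
  have r3: "0 < 3 * r" using r by simp
  obtain G Gm a where a: "0 < a" and lip: "\<And>m. \<exists>L. \<forall>y z. \<bar>Gm m y - Gm m z\<bar> \<le> L * dist y z"
    and nonneg: "\<And>m z. 0 \<le> Gm m z" and incr: "\<And>m z. Gm m z \<le> Gm (Suc m) z"
    and low: "\<And>m z. z \<in> ball x (3 * r) \<Longrightarrow> a \<le> Gm m z"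
    and G: "\<And>z. G z = (SUP m. ennreal (Gm m z))" and dom: "\<And>z. z \<in> ball x (3 * r) \<Longrightarrow> g z \<le> G z"
    and G_int: "(\<integral>\<^sup>+ z. G z \<partial>M) < ennreal c"
    using lsc_majorant[OF r3 g int] by metis
  have Gm_cont: "continuous_on UNIV (Gm m)" for m
  proof -
    obtain L where "\<And>y z. \<bar>Gm m y - Gm m z\<bar> \<le> L * dist y z" using lip by blast
    then show ?thesis by (intro Lipschitz_continuous_on[where K = L]) (auto simp: dist_real_def)
  qed
  have Gm_meas [measurable]: "Gm m \<in> borel_measurable borel" for m
    using Gm_cont by (rule borel_measurable_continuous_onI)
  have G_meas: "G \<in> borel_measurable borel"
    unfolding G[abs_def] by measurable
  define \<delta> where "\<delta> m = 1 / real (Suc m)" for m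
  have \<delta>: "0 < \<delta> m" "\<delta> (Suc m) \<le> \<delta> m" for m by (auto simp: \<delta>_def frac_le)
  define vm where "vm m = chain_inf ?D (Gm m) (\<delta> m)" for m
  have vm01: "0 \<le> vm m z" "vm m z \<le> 1" for m z
    unfolding vm_def using chain_inf_nonneg chain_inf_le_1 nonneg by blast+
  have vm_incr: "vm m z \<le> vm (Suc m) z" for m z
  proof -
    have "vm m z \<le> k" if k: "k \<in> insert 1 {k. chain_cost ?D (Gm (Suc m)) (\<delta> (Suc m)) z k}" for k
    proof (cases "k = 1")
      case False
      then obtain k' where "k' \<le> k" "chain_cost ?D (Gm m) (\<delta> m) z k'"
        using k chain_cost_mono[of ?D "Gm (Suc m)" "\<delta> (Suc m)" z k "Gm m" "\<delta> m"] incr \<delta>(2) by auto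
      then show ?thesis unfolding vm_def using chain_inf_le[of "Gm m", OF nonneg] by (meson order_trans)
    qed (simp add: vm01)
    then show ?thesis
      unfolding vm_def[of "Suc m"] chain_inf_def by (intro cInf_greatest) auto
  qed
  have bdd: "bdd_above (range (\<lambda>m. vm m z))" for z
    using vm01 by (intro bdd_aboveI[of _ 1]) auto
  define v where "v z = (SUP m. vm m z)" for z
  have vm_v: "vm m z \<le> v z" for m z unfolding v_def by (rule cSUP_upper[OF _ bdd]) simp
  have v01: "0 \<le> v z \<and> v z \<le> 1" for z
  proof
    show "0 \<le> v z" using vm01(1)[of 0 z] vm_v[of 0 z] by linarith
    show "v z \<le> 1" unfolding v_def using vm01 by (intro cSUP_least) auto
  qed
  have vm_lim: "(\<lambda>m. vm m z) \<longlonglongrightarrow> v z" for z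
    unfolding v_def by (intro LIMSEQ_incseq_SUP bdd incseq_SucI vm_incr)
  have v_open: "open {z. t < v z}" for t
  proof -
    have "{z. t < v z} = (\<Union>m. {z. t < vm m z})"
      unfolding v_def by (auto simp: less_cSUP_iff[OF _ bdd])
    moreover have "continuous_on UNIV (vm m)" for m
      unfolding vm_def by (rule chain_inf_continuous[OF nonneg Gm_cont \<delta>(1)])
    then have "open {z. t < vm m z}" for m by (intro open_Collect_less continuous_intros)
    ultimately show ?thesis by auto
  qed
  have v_out: "v z = 0" if "z \<notin> ?D" for z
    unfolding v_def vm_def using chain_inf_outside[OF nonneg that] by simp
  have v_ug: "upper_gradient v G"
  proof (rule upper_gradientI[OF G_meas])
    fix \<gamma> :: "real \<Rightarrow> 'a" and l assume c: "arc_param \<gamma> l"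
    have le: "ennreal \<bar>vm m (\<gamma> 0) - vm m (\<gamma> l)\<bar> \<le> (\<integral>\<^sup>+ s. G (\<gamma> s) * indicator {0..l} s \<partial>lborel)" for m
    proof -
      have "upper_gradient (vm m) (\<lambda>z. ennreal (Gm m z))"
        unfolding vm_def by (rule chain_inf_upper_gradient[OF nonneg Gm_cont \<delta>(1)])
      then have "ennreal \<bar>vm m (\<gamma> 0) - vm m (\<gamma> l)\<bar> \<le> (\<integral>\<^sup>+ s. ennreal (Gm m (\<gamma> s)) * indicator {0..l} s \<partial>lborel)"
        using c by (intro upper_gradientD) (auto simp: arc_param_def)
      also have "\<dots> \<le> (\<integral>\<^sup>+ s. G (\<gamma> s) * indicator {0..l} s \<partial>lborel)"
        unfolding G by (intro nn_integral_mono mult_right_mono SUP_upper) auto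
      finally show ?thesis .
    qed
    have "(\<lambda>m. ennreal \<bar>vm m (\<gamma> 0) - vm m (\<gamma> l)\<bar>) \<longlonglongrightarrow> ennreal \<bar>v (\<gamma> 0) - v (\<gamma> l)\<bar>"
      by (intro tendsto_intros tendsto_ennrealI vm_lim)
    then show "ennreal \<bar>v (\<gamma> 0) - v (\<gamma> l)\<bar> \<le> (\<integral>\<^sup>+ s. G (\<gamma> s) * indicator {0..l} s \<partial>lborel)"
      by (rule LIMSEQ_le_const2) (intro exI[of _ 0] allI impI le)
  qed
  have v_A: "v y = 1" if y: "y \<in> A" for y
  proof (rule ccontr)
    assume "v y \<noteq> 1"
    then have "v y < 1" using v01[of y] by simp
    then obtain k where k: "v y < k" "k < 1" using dense by blast
    have chains: "\<exists>c'\<le>k. chain_cost ?D (Gm m) (1 / real (Suc m)) y c'" for m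
    proof -
      have "chain_inf ?D (Gm m) (\<delta> m) y < k" using vm_v[of m y] k by (simp add: vm_def)
      then obtain c' where "chain_cost ?D (Gm m) (\<delta> m) y c'" "c' < k"
        using chain_inf_less[of "Gm m" ?D "\<delta> m" y k] nonneg k by auto
      then show ?thesis by (auto simp: \<delta>_def intro: less_imp_le)
    qed
    have yD: "y \<in> ?D" using y A by auto
    have K: "w \<in> cball x (2 * r + 1)" if "z \<in> ?D" "dist z w \<le> 1" for z w
      using that dist_triangle[of x w z] by simp
    have lowD: "a \<le> Gm m z" if "z \<in> ?D" for m z using low[of z m] that r by simp
    show False
    proof (rule chain_limit_curve[OF open_ball yD compact_cball[of x "2 * r + 1"] K a lowD lip nonneg incr chains])
      fix f \<tau>
      assume tau: "0 < \<tau>" and f: "\<And>s t. dist (f s) (f t) \<le> \<bar>s - t\<bar>" "f 0 = y" "f \<tau> \<notin> ?D"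
        "\<And>s. f s \<in> closure ?D" and int_f: "\<And>m. integral {0..\<tau>} (\<lambda>s. Gm m (f s)) \<le> k"
      have ne: "f \<tau> \<noteq> f 0" using f yD by auto
      have "closure ?D \<subseteq> cball x (2 * r)" by (intro closure_minimal) auto
      then have f3: "f s \<in> ball x (3 * r)" for s using f(4)[of s] r by auto
      have rc: "rect_curve f 0 \<tau>" and line_m: "line_integral (\<lambda>z. ennreal (Gm m z)) f 0 \<tau> \<le> ennreal k" for m
      proof -
        obtain L where L: "\<And>y z. \<bar>Gm m y - Gm m z\<bar> \<le> L * dist y z" using lip by blast
        from Lipschitz_path_line_integral[OF f(1) tau ne L nonneg] int_f[of m]
        show "rect_curve f 0 \<tau>" "line_integral (\<lambda>z. ennreal (Gm m z)) f 0 \<tau> \<le> ennreal k"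
          by (auto intro: order_trans ennreal_leI)
      qed
      obtain c l where c: "arc_param c l" "range c \<subseteq> f ` {0..\<tau>}"
        "\<And>g. line_integral g f 0 \<tau> = (\<integral>\<^sup>+ s. g (c s) * indicator {0..l} s \<partial>lborel)"
        using arc_param_exists[OF rc] by metis
      note [measurable] = arc_param_measurable[OF c(1)]
      have "line_integral g f 0 \<tau> \<le> line_integral G f 0 \<tau>"
        unfolding c(3)
      proof (intro nn_integral_mono mult_right_mono dom)
        fix s
        have "c s \<in> f ` {0..\<tau>}" using c(2) by auto
        then show "c s \<in> ball x (3 * r)" using f3 by auto
      qed simp
      \<comment> \<open>Monotone convergence in \<open>m\<close> passes from the bounds for the
        Lipschitz weights to a bound for their supremum.\<close>
      also have "\<dots> = (\<integral>\<^sup>+ s. (SUP m. ennreal (Gm m (c s)) * indicator {0..l} s) \<partial>lborel)"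
        unfolding c(3) G by (simp add: SUP_mult_right_ennreal)
      also have "\<dots> = (SUP m. \<integral>\<^sup>+ s. ennreal (Gm m (c s)) * indicator {0..l} s \<partial>lborel)"
        using incr by (intro nn_integral_monotone_convergence_SUP)
          (auto intro!: incseq_SucI le_funI mult_right_mono ennreal_leI)
      also have "\<dots> \<le> ennreal k"
        using line_m unfolding c(3) by (intro SUP_least)
      finally have "line_integral g f 0 \<tau> \<le> ennreal k" .
      moreover have "1 \<le> line_integral g f 0 \<tau>"
        by (rule curves[OF rc]) (use f y in auto)
      ultimately have "1 \<le> ennreal k" by (rule order_trans[rotated])
      then show False using k by (simp add: ennreal_ge_1)
    qed
  qed
  show thesis by (rule that[OF v_open v01 v_out v_A v_ug G_int])
qed

end

section \<open>Coverings and the boxing inequality\<close>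

text \<open>Zorn's lemma is applied to disjoint subfamilies with an extra property: a ball that
  meets the subfamily meets a member of at least half its radius. Without this property a maximal
  disjoint family could consist of balls that are too small.\<close>

lemma vitali_covering:
  fixes \<rho> :: "'a::metric_space \<Rightarrow> real"
  assumes \<rho>: "\<And>z. z \<in> Z \<Longrightarrow> 0 < \<rho> z \<and> \<rho> z \<le> R"
  obtains W where "W \<subseteq> Z" "disjoint_family_on (\<lambda>z. ball z (\<rho> z)) W"
    "\<And>z. z \<in> Z \<Longrightarrow> \<exists>w\<in>W. dist w z < 4 * \<rho> w"
proof -
  define meets where "meets z w \<longleftrightarrow> ball z (\<rho> z) \<inter> ball w (\<rho> w) \<noteq> {}" for z w
  define \<W> where "\<W> = {W. W \<subseteq> Z \<and> disjoint_family_on (\<lambda>z. ball z (\<rho> z)) W \<and>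
      (\<forall>z\<in>Z. (\<exists>w\<in>W. meets z w) \<longrightarrow> (\<exists>w\<in>W. meets z w \<and> \<rho> z \<le> 2 * \<rho> w))}"
  have "\<Union>\<C> \<in> \<W>" if \<C>: "subset.chain \<W> \<C>" for \<C>
  proof -
    have sub: "\<And>C. C \<in> \<C> \<Longrightarrow> C \<in> \<W>" and total: "\<And>C C'. C \<in> \<C> \<Longrightarrow> C' \<in> \<C> \<Longrightarrow> C \<subseteq> C' \<or> C' \<subseteq> C"
      using \<C> by (auto simp: subset.chain_def subset_chain_def)
    have "disjoint_family_on (\<lambda>z. ball z (\<rho> z)) (\<Union>\<C>)"
      unfolding disjoint_family_on_def
    proof (intro ballI impI)
      fix z w assume "z \<in> \<Union>\<C>" "w \<in> \<Union>\<C>" "z \<noteq> w"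
      then obtain C where "C \<in> \<C>" "z \<in> C" "w \<in> C" using total by blast
      then show "ball z (\<rho> z) \<inter> ball w (\<rho> w) = {}"
        using sub[of C] \<open>z \<noteq> w\<close> by (auto simp: \<W>_def disjoint_family_on_def)
    qed
    moreover have "\<exists>w\<in>\<Union>\<C>. meets z w \<and> \<rho> z \<le> 2 * \<rho> w" if zw: "z \<in> Z" "w \<in> \<Union>\<C>" "meets z w" for z w
    proof -
      obtain C where C: "C \<in> \<C>" "w \<in> C" using zw(2) by blast
      then have "\<exists>w\<in>C. meets z w \<and> \<rho> z \<le> 2 * \<rho> w" using sub[of C] zw by (auto simp: \<W>_def)
      then show ?thesis using C by blast
    qed
    moreover have "\<Union>\<C> \<subseteq> Z" using sub by (auto simp: \<W>_def)
    ultimately show ?thesis unfolding \<W>_def mem_Collect_eq by blast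
  qed
  then obtain W where W: "W \<in> \<W>" and max: "\<And>X. X \<in> \<W> \<Longrightarrow> W \<subseteq> X \<Longrightarrow> X = W"
    using subset_Zorn'[of \<W>] by blast
  have all_meet: "\<exists>w\<in>W. meets z w" if z: "z \<in> Z" for z
  proof (rule ccontr)
    assume no: "\<not> ?thesis"
    define S where "S = {z\<in>Z. \<not> (\<exists>w\<in>W. meets z w)}"
    have zS: "z \<in> S" using z no by (simp add: S_def)
    have bdd: "bdd_above (\<rho> ` S)" using \<rho> by (intro bdd_aboveI[of _ R]) (auto simp: S_def)
    have "0 < \<rho> z" using \<rho>[OF z] by simp
    also have "\<rho> z \<le> Sup (\<rho> ` S)" using zS bdd by (intro cSup_upper) auto
    finally have "Sup (\<rho> ` S) / 2 < Sup (\<rho> ` S)" by simp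
    \<comment> \<open>A ball avoiding \<open>W\<close> whose radius is more than half the supremum
      of all such radii; adding it preserves the extra property.\<close>
    then obtain z0 where z0: "z0 \<in> S" "Sup (\<rho> ` S) / 2 < \<rho> z0"
      using less_cSupE[of "Sup (\<rho> ` S) / 2" "\<rho> ` S"] zS by blast
    have z0Z: "z0 \<in> Z" using z0 by (simp add: S_def)
    have meets_sym: "meets a b \<longleftrightarrow> meets b a" for a b by (auto simp: meets_def)
    have self: "meets z0 z0" using \<rho>[OF z0Z] by (auto simp: meets_def)
    have "insert z0 W \<in> \<W>"
    proof -
      have "disjoint_family_on (\<lambda>z. ball z (\<rho> z)) (insert z0 W)"
        unfolding disjoint_family_on_def
      proof (intro ballI impI)
        fix a b assume ab: "a \<in> insert z0 W" "b \<in> insert z0 W" "a \<noteq> b"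
        show "ball a (\<rho> a) \<inter> ball b (\<rho> b) = {}"
        proof (cases "a \<in> W \<and> b \<in> W")
          case True
          then show ?thesis using W ab(3) by (auto simp: \<W>_def disjoint_family_on_def)
        next
          case False
          then have "\<not> meets a b" using ab z0(1) meets_sym by (auto simp: S_def)
          then show ?thesis by (simp add: meets_def)
        qed
      qed
      moreover have "\<exists>w\<in>insert z0 W. meets u w \<and> \<rho> u \<le> 2 * \<rho> w"
        if u: "u \<in> Z" "w \<in> insert z0 W" "meets u w" for u w
      proof (cases "\<exists>w\<in>W. meets u w")
        case True
        then show ?thesis using W u(1) by (auto simp: \<W>_def)
      next
        case False
        then have "u \<in> S" "meets u z0" using u by (auto simp: S_def)
        then have "\<rho> u \<le> Sup (\<rho> ` S)" using bdd by (intro cSup_upper) auto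
        then show ?thesis using z0(2) \<open>meets u z0\<close> by (intro bexI[of _ z0]) auto
      qed
      moreover have "insert z0 W \<subseteq> Z" using W z0Z by (auto simp: \<W>_def)
      ultimately show ?thesis unfolding \<W>_def mem_Collect_eq by blast
    qed
    then have "z0 \<in> W" using max[of "insert z0 W"] by blast
    then show False using z0(1) self by (auto simp: S_def)
  qed
  show thesis
  proof (rule that[of W])
    show "W \<subseteq> Z" "disjoint_family_on (\<lambda>z. ball z (\<rho> z)) W" using W by (auto simp: \<W>_def)
    fix z assume z: "z \<in> Z"
    then have "\<exists>w\<in>W. meets z w \<and> \<rho> z \<le> 2 * \<rho> w" using W all_meet[OF z] by (auto simp: \<W>_def)
    then obtain w where w: "w \<in> W" "meets z w" "\<rho> z \<le> 2 * \<rho> w" by blast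
    then obtain u where "dist z u < \<rho> z" "dist w u < \<rho> w" by (auto simp: meets_def)
    \<comment> \<open>The factor obtained is 3; it is rounded up to 4, which is exactly two
      doublings.\<close>
    then have "dist w z < \<rho> w + \<rho> z" using dist_triangle[of w z u] by (simp add: dist_commute)
    moreover have "0 < \<rho> w" using \<rho> w(1) W by (auto simp: \<W>_def)
    ultimately show "\<exists>w\<in>W. dist w z < 4 * \<rho> w" using w by (intro bexI[of _ w]) auto
  qed
qed

section \<open>Families of balls and their cost\<close>

context doubling_measure
begin

text \<open>\<open>bounded_cost \<F> Q\<close>: the family \<open>\<F>\<close> of balls (centre, radius) has codimension-one content
  \<open>\<Sum> \<mu>(B)/rad(B)\<close> at most \<open>Q\<close>.\<close>

definition bounded_cost :: "('a \<times> real) set \<Rightarrow> real \<Rightarrow> bool" where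
  "bounded_cost \<F> Q \<longleftrightarrow> (\<forall>(p, s)\<in>\<F>. 0 < s) \<and>
     (\<forall>K. finite K \<longrightarrow> K \<subseteq> \<F> \<longrightarrow> (\<Sum>(p, s)\<in>K. vol p s / s) \<le> Q)"

definition balls :: "('a \<times> real) set \<Rightarrow> 'a set" where
  "balls \<F> = (\<Union>(p, s)\<in>\<F>. ball p s)"

text \<open>The cost has to be estimated only for disjoint balls, where measures and energies add
  up; the dilation by 4 is paid with \<open>Cd ^ 2\<close>.\<close>

lemma vitali_cover:
  assumes \<rho>: "\<And>z. z \<in> Z \<Longrightarrow> 0 < \<rho> z \<and> \<rho> z \<le> R"
    and Q: "\<And>K. finite K \<Longrightarrow> K \<subseteq> Z \<Longrightarrow> disjoint_family_on (\<lambda>z. ball z (\<rho> z)) K \<Longrightarrow>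
      (\<Sum>z\<in>K. vol z (\<rho> z) / \<rho> z) \<le> Q"
  obtains \<F> where "bounded_cost \<F> (Cd ^ 2 * Q)" "Z \<subseteq> balls \<F>" "\<And>p s. (p, s) \<in> \<F> \<Longrightarrow> s \<le> 4 * R"
proof -
  obtain W where W: "W \<subseteq> Z" "disjoint_family_on (\<lambda>z. ball z (\<rho> z)) W"
    "\<And>z. z \<in> Z \<Longrightarrow> \<exists>w\<in>W. dist w z < 4 * \<rho> w"
    using vitali_covering[of Z \<rho> R] \<rho> by metis
  define \<F> where "\<F> = (\<lambda>w. (w, 4 * \<rho> w)) ` W"
  show thesis
  proof (rule that[of \<F>])
    show "bounded_cost \<F> (Cd ^ 2 * Q)"
      unfolding bounded_cost_def
    proof (intro conjI allI impI)
      show "\<forall>(p, s)\<in>\<F>. 0 < s" using \<rho> W(1) by (auto simp: \<F>_def)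
      fix K assume K: "finite K" "K \<subseteq> \<F>"
      then obtain K' where K': "K' \<subseteq> W" "finite K'" "K = (\<lambda>w. (w, 4 * \<rho> w)) ` K'"
        unfolding \<F>_def by (meson finite_subset_image)
      have inj: "inj_on (\<lambda>w. (w, 4 * \<rho> w)) K'" by (auto simp: inj_on_def)
      have "(\<Sum>(p, s)\<in>K. vol p s / s) = (\<Sum>w\<in>K'. vol w (4 * \<rho> w) / (4 * \<rho> w))"
        unfolding K'(3) by (subst sum.reindex[OF inj]) (simp add: case_prod_beta o_def)
      also have "\<dots> \<le> (\<Sum>w\<in>K'. Cd ^ 2 * (vol w (\<rho> w) / \<rho> w))"
      proof (rule sum_mono)
        fix w assume "w \<in> K'"
        then have w: "0 < \<rho> w" using K' W(1) \<rho> by blast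
        have "vol w (4 * \<rho> w) \<le> Cd ^ 2 * vol w (\<rho> w)"
          using w by (intro vol_compare) auto
        then have "vol w (4 * \<rho> w) / (4 * \<rho> w) \<le> Cd ^ 2 * vol w (\<rho> w) / (4 * \<rho> w)"
          using w by (intro divide_right_mono) auto
        also have "\<dots> \<le> Cd ^ 2 * vol w (\<rho> w) / \<rho> w"
          using w by (intro divide_left_mono) auto
        finally show "vol w (4 * \<rho> w) / (4 * \<rho> w) \<le> Cd ^ 2 * (vol w (\<rho> w) / \<rho> w)" by simp
      qed
      also have "\<dots> = Cd ^ 2 * (\<Sum>w\<in>K'. vol w (\<rho> w) / \<rho> w)" by (simp add: sum_distrib_left)
      also have "\<dots> \<le> Cd ^ 2 * Q"
        using K' W disjoint_family_on_mono[OF K'(1) W(2)] by (intro mult_left_mono Q) auto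
      finally show "(\<Sum>(p, s)\<in>K. vol p s / s) \<le> Cd ^ 2 * Q" .
    qed
    show "Z \<subseteq> balls \<F>"
    proof
      fix z assume "z \<in> Z"
      then obtain w where "w \<in> W" "dist w z < 4 * \<rho> w" using W(3) by blast
      then show "z \<in> balls \<F>" by (auto simp: balls_def \<F>_def)
    qed
    show "s \<le> 4 * R" if "(p, s) \<in> \<F>" for p s
      using that \<rho> W(1) by (auto simp: \<F>_def)
  qed
qed

end

text \<open>A replacement for the coarea formula: some level carries at most its share of the energy,
  infinitesimally.\<close>

lemma level_selection:
  fixes \<Phi> :: "real \<Rightarrow> real"
  assumes mono: "mono \<Phi>" and c: "0 < c" "\<Phi> (1/2) - \<Phi> 0 \<le> c"
  obtains t where "0 \<le> t" "t < 1/2" "\<And>\<delta>. 0 < \<delta> \<Longrightarrow> \<exists>h. 0 < h \<and> h < \<delta> \<and> \<Phi> (t + h) - \<Phi> t \<le> 4 * c * h"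
proof (rule ccontr)
  assume "\<not> thesis"
  note sel = that
  have neg: "\<exists>\<delta>>0. \<forall>h. 0 < h \<longrightarrow> h < \<delta> \<longrightarrow> 4 * c * h < \<Phi> (t + h) - \<Phi> t" if t: "0 \<le> t" "t < 1/2" for t
  proof (rule ccontr)
    assume no: "\<not> ?thesis"
    have "\<exists>h. 0 < h \<and> h < \<delta> \<and> \<Phi> (t + h) - \<Phi> t \<le> 4 * c * h" if "0 < \<delta>" for \<delta>
      using no that by (meson not_le)
    from sel[OF t this] \<open>\<not> thesis\<close> show False by simp
  qed
  \<comment> \<open>The levels up to which \<open>\<Phi>\<close> has grown with average slope at
    least \<open>4 * c\<close>. If no level were good, this set would reach up to 1/2 and
    \<open>\<Phi>\<close> would have grown by \<open>2 * c\<close> instead of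
    \<open>c\<close>.\<close>
  define S where "S = {t\<in>{0..1/2}. \<Phi> 0 + 4 * c * t \<le> \<Phi> t}"
  have S0: "0 \<in> S" by (simp add: S_def)
  have bdd: "bdd_above S" by (rule bdd_aboveI[of _ "1/2"]) (auto simp: S_def)
  define T where "T = Sup S"
  have T0: "0 \<le> T" unfolding T_def by (rule cSup_upper[OF S0 bdd])
  have "S \<noteq> {}" using S0 by blast
  then have T1: "T \<le> 1/2" unfolding T_def by (rule cSup_least) (auto simp: S_def)
  have "\<Phi> 0 + 4 * c * T \<le> \<Phi> T"
  proof (rule field_le_epsilon)
    fix e :: real assume e: "0 < e"
    then have "T - e / (4 * c) < Sup S" using c by (simp add: T_def)
    then obtain t where t: "t \<in> S" "T - e / (4 * c) < t" using less_cSupE S0 by blast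
    have "\<Phi> t \<le> \<Phi> T" using mono t bdd by (auto simp: T_def intro!: monoD[OF mono] cSup_upper)
    moreover have "4 * c * (T - e / (4 * c)) \<le> 4 * c * t" using t c by (intro mult_left_mono) auto
    then have "4 * c * T - e \<le> 4 * c * t" using c by (simp add: right_diff_distrib)
    ultimately show "\<Phi> 0 + 4 * c * T \<le> \<Phi> T + e" using t by (simp add: S_def)
  qed
  moreover have "T = 1/2"
  proof (rule ccontr)
    assume "T \<noteq> 1/2"
    then have "T < 1/2" using T1 by simp
    with neg[OF T0] obtain \<delta> where \<delta>: "\<delta> > 0" "\<And>h. 0 < h \<Longrightarrow> h < \<delta> \<Longrightarrow> 4 * c * h < \<Phi> (T + h) - \<Phi> T" by blast
    define h where "h = min (\<delta> / 2) (1/2 - T)"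
    have h: "0 < h" "h < \<delta>" "h \<le> 1/2 - T" using \<delta>(1) \<open>T < 1/2\<close> by (auto simp: h_def)
    have "\<Phi> 0 + 4 * c * (T + h) \<le> \<Phi> (T + h)"
      using \<delta>(2)[OF h(1,2)] \<open>\<Phi> 0 + 4 * c * T \<le> \<Phi> T\<close> by (simp add: distrib_left)
    then have "T + h \<in> S" using h T0 by (simp add: S_def)
    then have "T + h \<le> T" using bdd unfolding T_def by (intro cSup_upper)
    then show False using h by simp
  qed
  ultimately show False using c by simp
qed

section \<open>The boxing inequality\<close>

context poincare_space
begin

text \<open>Small balls around \<open>y\<close> lie inside the open set \<open>E\<close>, while at
  radius \<open>R\<close> the density of \<open>E\<close> is at most 1/2. Halving the radius,
  \<open>\<rho>\<close> is the last radius before the density exceeds 1/2 for the first time;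
  doubling then bounds the density at \<open>\<rho>\<close> from below as well. Openness of
  \<open>E\<close> is what makes this work at every point rather than at almost every one.\<close>

lemma crossing_scale:
  assumes E: "open E" "y \<in> E" and R: "0 < R" and small: "measure M (E \<inter> ball y R) \<le> 1/2 * vol y R"
  obtains \<rho> where "0 < \<rho>" "\<rho> \<le> R" "vol y \<rho> / (2 * Cd) < measure M (E \<inter> ball y \<rho>)"
    "vol y \<rho> / 2 \<le> measure M (ball y \<rho> - E)"
proof -
  let ?P = "\<lambda>n. 1/2 * vol y (R / 2 ^ n) < measure M (E \<inter> ball y (R / 2 ^ n))"
  obtain e where e: "e > 0" "ball y e \<subseteq> E" using E by (meson open_contains_ball)
  obtain n :: nat where "R / e < 2 ^ n" using real_arch_pow[of 2 "R / e"] by auto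
  then have "R / 2 ^ n \<le> e" using e by (simp add: pos_divide_less_eq pos_divide_le_eq mult.commute less_imp_le)
  then have "E \<inter> ball y (R / 2 ^ n) = ball y (R / 2 ^ n)" using e by auto
  then have "?P n" using vol_pos[of "R / 2 ^ n" y] R by (simp add: vol_def)
  define i where "i = (LEAST n. ?P n)"
  have i: "?P i" unfolding i_def by (rule LeastI[of ?P, OF \<open>?P n\<close>])
  have "i \<noteq> 0" using i small by (metis div_by_1 not_le power_0)
  then obtain j where j: "i = Suc j" by (cases i) auto
  then have "j < i" by simp
  then have nj: "\<not> ?P j" unfolding i_def by (rule not_less_Least)
  define \<rho> where "\<rho> = R / 2 ^ j"
  have \<rho>: "0 < \<rho>" "\<rho> \<le> R" "R / 2 ^ i = \<rho> / 2"
    using R by (auto simp: \<rho>_def j divide_le_eq mult_le_cancel_left1)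
  have Em: "E \<in> sets M" using E by (simp add: sets_M)
  have "vol y \<rho> \<le> Cd * vol y (\<rho> / 2)" using vol_double[of "\<rho> / 2" y] \<rho> by simp
  then have "vol y \<rho> / (2 * Cd) \<le> 1/2 * vol y (\<rho> / 2)"
    using Cd_ge_1 by (simp add: pos_divide_le_eq mult.commute)
  also have "\<dots> < measure M (E \<inter> ball y (\<rho> / 2))" using i \<rho>(3) by simp
  also have "\<dots> \<le> measure M (E \<inter> ball y \<rho>)"
  proof (rule measure_mono_fmeasurable)
    have "\<rho> / 2 \<le> \<rho>" using \<rho>(1) by simp
    then show "E \<inter> ball y (\<rho> / 2) \<subseteq> E \<inter> ball y \<rho>" by (intro Int_mono subset_ball) auto
    show "E \<inter> ball y (\<rho> / 2) \<in> sets M" using Em by auto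
    show "E \<inter> ball y \<rho> \<in> fmeasurable M"
      using Em emeasure_inter_ball_finite[of E y \<rho>] by (auto simp: fmeasurable_def)
  qed
  finally have A: "vol y \<rho> / (2 * Cd) < measure M (E \<inter> ball y \<rho>)" .
  have "ball y \<rho> = (E \<inter> ball y \<rho>) \<union> (ball y \<rho> - E)" by auto
  then have "vol y \<rho> \<le> measure M (E \<inter> ball y \<rho>) + measure M (ball y \<rho> - E)"
    unfolding vol_def using Em measure_Un_le[of "E \<inter> ball y \<rho>" M "ball y \<rho> - E"] by auto
  then have "vol y \<rho> / 2 \<le> measure M (ball y \<rho> - E)"
    using nj by (simp add: \<rho>_def)
  then show thesis by (rule that[OF \<rho>(1,2) A])
qed

text \<open>The Poincare inequality is applied on each ball to the truncation of \<open>v\<close>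
  between the levels \<open>t\<close> and \<open>t + h\<close>, whose gradient, up to the term
  \<open>G\<close> itself, is \<open>G / h\<close> on the strip. The dilated balls are disjoint, so
  the energies add up to at most the total.\<close>

lemma boxing_sum:
  assumes v: "\<And>t. open {z. t < v z}" "\<And>z. 0 \<le> v z \<and> v z \<le> 1" and ug: "upper_gradient v G"
    and c: "0 < c" "(\<integral>\<^sup>+ z. G z \<partial>M) < ennreal c"
    and t: "\<And>\<delta>. 0 < \<delta> \<Longrightarrow> \<exists>h. 0 < h \<and> h < \<delta> \<and>
      (\<integral>\<^sup>+ z. G z * indicator {z. t < v z \<and> v z \<le> t + h} z \<partial>M) \<le> ennreal (4 * c * h)"
    and K: "finite K" "disjoint_family_on (\<lambda>y. ball y (lam * \<rho> y)) K"
    and \<rho>: "\<And>y. y \<in> K \<Longrightarrow> 0 < \<rho> y"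
      "\<And>y. y \<in> K \<Longrightarrow> vol y (\<rho> y) / (2 * Cd) < measure M ({z. t < v z} \<inter> ball y (\<rho> y))"
      "\<And>y. y \<in> K \<Longrightarrow> vol y (\<rho> y) / 2 \<le> measure M (ball y (\<rho> y) - {z. t < v z})"
  shows "(\<Sum>y\<in>K. vol y (\<rho> y) / \<rho> y) \<le> 40 * Cd * CP * c"
proof -
  have v_meas [measurable]: "v \<in> borel_measurable borel"
    using v(1) by (intro borel_measurableI_greater) auto
  note [measurable] = upper_gradient_borel[OF ug]
  \<comment> \<open>The truncation equals 1 only above \<open>t + h\<close>. By continuity of the
    measure from below that set still fills a fixed part of each ball once \<open>h\<close> is
    small, and a common \<open>h\<close> exists because \<open>K\<close> is finite.\<close>
  have "\<exists>\<delta>>0. \<forall>h. 0 < h \<longrightarrow> h < \<delta> \<longrightarrow> vol y (\<rho> y) / (4 * Cd) \<le> measure M ({z. t + h \<le> v z} \<inter> ball y (\<rho> y))"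
    if y: "y \<in> K" for y
  proof -
    define T where "T n = {z. t + 1 / real (Suc n) \<le> v z}" for n
    have T: "T n \<in> sets M" for n unfolding T_def sets_M by measurable
    have un: "(\<Union>n. T n \<inter> ball y (\<rho> y)) = {z. t < v z} \<inter> ball y (\<rho> y)"
    proof -
      have "\<exists>n. t + 1 / real (Suc n) \<le> v z" if "t < v z" for z
        using nat_approx_posE[of "v z - t"] that by (metis diff_gt_0_iff_gt less_diff_eq less_imp_le add.commute)
      moreover have "t < v z" if "t + 1 / real (Suc n) \<le> v z" for z n
      proof -
        have "0 < 1 / real (Suc n)" by simp
        then show ?thesis using that by linarith
      qed
      ultimately show ?thesis unfolding T_def by blast
    qed
    have "(\<lambda>n. measure M (T n \<inter> ball y (\<rho> y))) \<longlonglongrightarrow> measure M (\<Union>n. T n \<inter> ball y (\<rho> y))"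
    proof (rule Lim_measure_incseq)
      show "range (\<lambda>n. T n \<inter> ball y (\<rho> y)) \<subseteq> sets M" using T by auto
      show "incseq (\<lambda>n. T n \<inter> ball y (\<rho> y))"
      proof (intro incseq_SucI subsetI)
        fix n z assume "z \<in> T n \<inter> ball y (\<rho> y)"
        moreover have "1 / real (Suc (Suc n)) \<le> 1 / real (Suc n)" by (simp add: frac_le)
        ultimately show "z \<in> T (Suc n) \<inter> ball y (\<rho> y)" by (auto simp: T_def)
      qed
      show "emeasure M (\<Union>n. T n \<inter> ball y (\<rho> y)) \<noteq> \<infinity>"
        unfolding un using emeasure_inter_ball_finite[of "{z. t < v z}" y "\<rho> y"] by auto
    qed
    moreover have "vol y (\<rho> y) / (4 * Cd) < vol y (\<rho> y) / (2 * Cd)"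
      using vol_pos[OF \<rho>(1)[OF y], of y] Cd_ge_1 by (intro divide_strict_left_mono) auto
    then have "vol y (\<rho> y) / (4 * Cd) < measure M (\<Union>n. T n \<inter> ball y (\<rho> y))"
      unfolding un using \<rho>(2)[OF y] by (rule less_trans)
    ultimately have "\<forall>\<^sub>F n in sequentially. vol y (\<rho> y) / (4 * Cd) < measure M (T n \<inter> ball y (\<rho> y))"
      by (rule order_tendstoD(1))
    then obtain n where n: "vol y (\<rho> y) / (4 * Cd) < measure M (T n \<inter> ball y (\<rho> y))"
      by (auto simp: eventually_sequentially)
    show ?thesis
    proof (intro exI[of _ "1 / real (Suc n)"] conjI allI impI)
      fix h assume h: "0 < h" "h < 1 / real (Suc n)"
      have "measure M (T n \<inter> ball y (\<rho> y)) \<le> measure M ({z. t + h \<le> v z} \<inter> ball y (\<rho> y))"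
      proof (rule measure_mono_fmeasurable)
        show "T n \<inter> ball y (\<rho> y) \<subseteq> {z. t + h \<le> v z} \<inter> ball y (\<rho> y)" using h by (auto simp: T_def)
        show "T n \<inter> ball y (\<rho> y) \<in> sets M" using T by auto
        have "{z. t + h \<le> v z} \<in> sets M" unfolding sets_M by measurable
        then show "{z. t + h \<le> v z} \<inter> ball y (\<rho> y) \<in> fmeasurable M"
          using emeasure_inter_ball_finite[of "{z. t + h \<le> v z}" y "\<rho> y"] by (auto simp: fmeasurable_def)
      qed
      then show "vol y (\<rho> y) / (4 * Cd) \<le> measure M ({z. t + h \<le> v z} \<inter> ball y (\<rho> y))" using n by linarith
    qed simp
  qed
  then have "\<forall>y\<in>K. \<exists>\<delta>>0. \<forall>h. 0 < h \<longrightarrow> h < \<delta> \<longrightarrow> vol y (\<rho> y) / (4 * Cd) \<le> measure M ({z. t + h \<le> v z} \<inter> ball y (\<rho> y))"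
    by (rule ballI)
  from bchoice[OF this] obtain \<delta> where \<delta>: "\<forall>y\<in>K. \<delta> y > 0 \<and> (\<forall>h. 0 < h \<longrightarrow> h < \<delta> y \<longrightarrow>
      vol y (\<rho> y) / (4 * Cd) \<le> measure M ({z. t + h \<le> v z} \<inter> ball y (\<rho> y)))" by (rule exE)
  define \<delta>0 where "\<delta>0 = Min (insert 1 (\<delta> ` K))"
  have \<delta>0: "0 < \<delta>0" unfolding \<delta>0_def using K(1) \<delta> by (subst Min_gr_iff) auto
  obtain h where h: "0 < h" "h < \<delta>0"
    and h_int: "(\<integral>\<^sup>+ z. G z * indicator {z. t < v z \<and> v z \<le> t + h} z \<partial>M) \<le> ennreal (4 * c * h)"
    using t[OF \<delta>0] by blast
  have h_less: "h < \<delta> y" if "y \<in> K" for y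
  proof -
    have "\<delta>0 \<le> \<delta> y" unfolding \<delta>0_def using that K(1) by (intro Min_le) auto
    then show ?thesis using h by simp
  qed
  define f where "f z = min 1 (max 0 ((v z - t) / h))" for z
  define g where "g z = ennreal (1/h) * (G z * indicator {z. t < v z \<and> v z < t + h} z) + G z" for z
  have f_meas: "f \<in> borel_measurable borel" unfolding f_def[abs_def] by measurable
  have g_meas [measurable]: "g \<in> borel_measurable borel" unfolding g_def[abs_def] by measurable
  have f_ug: "upper_gradient f g"
    unfolding f_def[abs_def] g_def[abs_def] by (rule truncation_upper_gradient[OF ug v_meas h(1)])
  \<comment> \<open>\<open>4 * c\<close> comes from the strip by the choice of the level and
    \<open>c\<close> from the additional term \<open>G\<close> of the truncation.\<close>
  have g_int: "(\<integral>\<^sup>+ z. g z \<partial>M) \<le> ennreal (5 * c)"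
  proof -
    have "(\<integral>\<^sup>+ z. g z \<partial>M) = ennreal (1/h) * (\<integral>\<^sup>+ z. G z * indicator {z. t < v z \<and> v z < t + h} z \<partial>M) + (\<integral>\<^sup>+ z. G z \<partial>M)"
    proof -
      have [measurable]: "{z. t < v z \<and> v z < t + h} \<in> sets borel" by measurable
      have "(\<integral>\<^sup>+ z. g z \<partial>M) = (\<integral>\<^sup>+ z. ennreal (1/h) * (G z * indicator {z. t < v z \<and> v z < t + h} z) \<partial>M) + (\<integral>\<^sup>+ z. G z \<partial>M)"
        unfolding g_def by (rule nn_integral_add) measurable
      also have "(\<integral>\<^sup>+ z. ennreal (1/h) * (G z * indicator {z. t < v z \<and> v z < t + h} z) \<partial>M) =
          ennreal (1/h) * (\<integral>\<^sup>+ z. G z * indicator {z. t < v z \<and> v z < t + h} z \<partial>M)"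
        by (rule nn_integral_cmult) measurable
      finally show ?thesis .
    qed
    also have "\<dots> \<le> ennreal (1/h) * ennreal (4 * c * h) + ennreal c"
    proof (intro add_mono mult_left_mono)
      have "(\<integral>\<^sup>+ z. G z * indicator {z. t < v z \<and> v z < t + h} z \<partial>M) \<le> (\<integral>\<^sup>+ z. G z * indicator {z. t < v z \<and> v z \<le> t + h} z \<partial>M)"
        by (intro nn_integral_mono mult_left_mono) (auto simp: indicator_def)
      then show "(\<integral>\<^sup>+ z. G z * indicator {z. t < v z \<and> v z < t + h} z \<partial>M) \<le> ennreal (4 * c * h)"
        using h_int by (rule order_trans)
    qed (use c in auto)
    also have "\<dots> = ennreal (5 * c)"
      using h c by (simp add: ennreal_mult[symmetric] ennreal_plus[symmetric] del: ennreal_plus)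
    finally show ?thesis .
  qed
  \<comment> \<open>\<open>8 * Cd\<close> is the 2 of \<open>poincare_sets\<close> times the
    \<open>4 * Cd\<close> in the density bound; with the total energy \<open>5 * c\<close> this
    produces the constant 40.\<close>
  have single: "ennreal (vol y (\<rho> y) / (8 * Cd * CP * \<rho> y)) \<le> (\<integral>\<^sup>+ z. g z * indicator (ball y (lam * \<rho> y)) z \<partial>M)"
    if y: "y \<in> K" for y
  proof -
    note r = \<rho>(1)[OF y]
    let ?P = "{z. t + h \<le> v z} \<inter> ball y (\<rho> y)" and ?N = "ball y (\<rho> y) - {z. t < v z}"
    let ?\<kappa> = "vol y (\<rho> y) / (4 * Cd)"
    have "ennreal (?\<kappa> / 2) \<le> ennreal (CP * \<rho> y) * (\<integral>\<^sup>+ z. g z * indicator (ball y (lam * \<rho> y)) z \<partial>M)"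
    proof (rule poincare_sets[OF r f_meas _ f_ug, where P = ?P and N = ?N])
      show "0 \<le> f z \<and> f z \<le> 1" for z by (simp add: f_def)
      show "?P \<in> sets borel" "?N \<in> sets borel" by measurable
      show "f z = 1" if "z \<in> ?P" for z
      proof -
        have "1 \<le> (v z - t) / h" using that h by (simp add: pos_le_divide_eq)
        then show ?thesis by (simp add: f_def)
      qed
      show "f z = 0" if "z \<in> ?N" for z
      proof -
        have "(v z - t) / h \<le> 0" using that h by (simp add: divide_le_0_iff)
        then show ?thesis by (simp add: f_def)
      qed
      show "?\<kappa> \<le> measure M ?P" using \<delta> y h h_less[OF y] by blast
      have "?\<kappa> \<le> vol y (\<rho> y) / 2" using Cd_ge_1 by (intro divide_left_mono) auto
      then show "?\<kappa> \<le> measure M ?N" using \<rho>(3)[OF y] by linarith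
    qed auto
    then have "ennreal (1 / (CP * \<rho> y)) * ennreal (?\<kappa> / 2) \<le> ennreal (1 / (CP * \<rho> y)) * (ennreal (CP * \<rho> y) * (\<integral>\<^sup>+ z. g z * indicator (ball y (lam * \<rho> y)) z \<partial>M))"
      by (rule mult_left_mono) simp
    also have "\<dots> = (\<integral>\<^sup>+ z. g z * indicator (ball y (lam * \<rho> y)) z \<partial>M)"
      using CP_pos r by (simp add: mult.assoc[symmetric] ennreal_mult[symmetric])
    finally show ?thesis
      using CP_pos r Cd_ge_1 by (simp add: ennreal_mult[symmetric] mult_ac)
  qed
  have "ennreal (\<Sum>y\<in>K. vol y (\<rho> y) / (8 * Cd * CP * \<rho> y)) = (\<Sum>y\<in>K. ennreal (vol y (\<rho> y) / (8 * Cd * CP * \<rho> y)))"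
  proof (rule sum_ennreal[symmetric])
    fix y assume "y \<in> K"
    then show "0 \<le> vol y (\<rho> y) / (8 * Cd * CP * \<rho> y)" using CP_pos Cd_ge_1 \<rho>(1)[of y] by simp
  qed
  also have "\<dots> \<le> (\<Sum>y\<in>K. \<integral>\<^sup>+ z. g z * indicator (ball y (lam * \<rho> y)) z \<partial>M)"
    by (intro sum_mono single)
  also have "\<dots> = (\<integral>\<^sup>+ z. (\<Sum>y\<in>K. g z * indicator (ball y (lam * \<rho> y)) z) \<partial>M)"
    by (rule nn_integral_sum[symmetric]) measurable
  also have "\<dots> \<le> (\<integral>\<^sup>+ z. g z \<partial>M)"
  proof (rule nn_integral_mono)
    fix z
    have "(\<Sum>y\<in>K. g z * indicator (ball y (lam * \<rho> y)) z) = g z * (\<Sum>y\<in>K. indicator (ball y (lam * \<rho> y)) z)"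
      by (rule sum_distrib_left[symmetric])
    also have "(\<Sum>y\<in>K. indicator (ball y (lam * \<rho> y)) z) = (indicator (\<Union>y\<in>K. ball y (lam * \<rho> y)) z :: ennreal)"
      by (rule indicator_UN_disjoint[OF K(1,2), symmetric])
    also have "g z * indicator (\<Union>y\<in>K. ball y (lam * \<rho> y)) z \<le> g z * 1"
      by (intro mult_left_mono) (auto simp: indicator_def)
    finally show "(\<Sum>y\<in>K. g z * indicator (ball y (lam * \<rho> y)) z) \<le> g z" by simp
  qed
  also note g_int
  finally have "(\<Sum>y\<in>K. vol y (\<rho> y) / (8 * Cd * CP * \<rho> y)) \<le> 5 * c"
    using c by (simp add: ennreal_le_iff)
  moreover have "(\<Sum>y\<in>K. vol y (\<rho> y) / (8 * Cd * CP * \<rho> y)) = (\<Sum>y\<in>K. vol y (\<rho> y) / \<rho> y) / (8 * Cd * CP)"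
    by (simp add: sum_divide_distrib mult_ac)
  ultimately show ?thesis
    using CP_pos Cd_ge_1 by (simp add: pos_divide_le_eq mult_ac)
qed

text \<open>The hypothesis on curves is stated with a single function \<open>g\<close>, so that the
  result serves both for capacities of sets and for the capacity of a point, where \<open>g\<close>
  is not a gradient of one test function only.\<close>

lemma boxing_inequality:
  obtains C r0 :: real where "1 \<le> C" "0 < r0"
    "\<And>x r g c A. 0 < r \<Longrightarrow> r < r0 \<Longrightarrow> A \<subseteq> ball x r \<Longrightarrow> g \<in> borel_measurable borel \<Longrightarrow> 0 < c \<Longrightarrow>
      (\<integral>\<^sup>+ z. g z * indicator (ball x (3 * r)) z \<partial>M) < ennreal c \<Longrightarrow>
      (\<And>\<gamma> a b. rect_curve \<gamma> a b \<Longrightarrow> \<gamma> a \<in> A \<Longrightarrow> \<gamma> b \<notin> ball x (2 * r) \<Longrightarrow> 1 \<le> line_integral g \<gamma> a b) \<Longrightarrow>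
      \<exists>\<F>. bounded_cost \<F> (C * c) \<and> A \<subseteq> balls \<F> \<and> (\<forall>(p, s)\<in>\<F>. s \<le> C * r)"
proof -
  \<comment> \<open>Reverse doubling with factor 1/2: the level set lies in
    \<open>ball x (2 * r)\<close> and thus fills at most half of \<open>ball y (k * r)\<close>, the
    starting hypothesis of \<open>crossing_scale\<close>.\<close>
  have "0 < (1/2::real)" by simp
  then obtain k r0 where k: "1 \<le> k" and r0: "0 < r0"
    and rd: "\<And>x y r. 0 < r \<Longrightarrow> r < r0 \<Longrightarrow> y \<in> ball x r \<Longrightarrow> vol x (2 * r) \<le> 1/2 * vol y (k * r)"
    by (rule reverse_doubling) (rule that)
  obtain n :: nat where n: "lam < 2 ^ n" using real_arch_pow[of 2 lam] by auto
  \<comment> \<open>The first part bounds the radii, dilated by \<open>lam\<close> for the Poincare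
    inequality and by 4 for the covering lemma. The second bounds the cost: \<open>Cd ^ 2\<close>
    for the covering, \<open>Cd ^ n\<close> for the dilation by \<open>lam\<close>, the rest from
    \<open>boxing_sum\<close>.\<close>
  define C where "C = max (max 1 (4 * lam * k)) (Cd ^ 2 * (Cd ^ n * (40 * Cd * CP)))"
  have C: "1 \<le> C" "4 * lam * k \<le> C" "Cd ^ 2 * (Cd ^ n * (40 * Cd * CP)) \<le> C" by (auto simp: C_def)
  show thesis
  proof (rule that[OF C(1) r0])
    fix x r g c A
    assume r: "0 < r" "r < r0" and A: "A \<subseteq> ball x r" and g: "g \<in> borel_measurable borel" and c: "0 < c"
      and int: "(\<integral>\<^sup>+ z. g z * indicator (ball x (3 * r)) z \<partial>M) < ennreal c"
      and curves: "\<And>\<gamma> a b. rect_curve \<gamma> a b \<Longrightarrow> \<gamma> a \<in> A \<Longrightarrow> \<gamma> b \<notin> ball x (2 * r) \<Longrightarrow> 1 \<le> line_integral g \<gamma> a b"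
    have A2: "A \<subseteq> ball x (2 * r)" using A r by auto
    show "\<exists>\<F>. bounded_cost \<F> (C * c) \<and> A \<subseteq> balls \<F> \<and> (\<forall>(p, s)\<in>\<F>. s \<le> C * r)"
    proof (rule capacitary_function[OF r(1) g int A2 curves])
      fix v :: "'a \<Rightarrow> real" and G :: "'a \<Rightarrow> ennreal"
      assume v: "\<And>t. open {z. t < v z}" "\<And>z. 0 \<le> v z \<and> v z \<le> 1" "\<And>z. z \<notin> ball x (2 * r) \<Longrightarrow> v z = 0"
        "\<And>z. z \<in> A \<Longrightarrow> v z = 1" and ug: "upper_gradient v G" and G_int: "(\<integral>\<^sup>+ z. G z \<partial>M) < ennreal c"
      have v_meas [measurable]: "v \<in> borel_measurable borel"
        using v(1) by (intro borel_measurableI_greater) auto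
      note [measurable] = upper_gradient_borel[OF ug]
      \<comment> \<open>The energy at levels up to \<open>t\<close>; its increments are the energies
        of the strips, so level selection applies to it.\<close>
      define \<Phi> where "\<Phi> t = enn2real (\<integral>\<^sup>+ z. G z * indicator {z. v z \<le> t} z \<partial>M)" for t
      have fin: "(\<integral>\<^sup>+ z. G z * indicator S z \<partial>M) < ennreal c" for S
      proof -
        have "(\<integral>\<^sup>+ z. G z * indicator S z \<partial>M) \<le> (\<integral>\<^sup>+ z. G z \<partial>M)"
          by (intro nn_integral_mono) (auto simp: indicator_def)
        then show ?thesis using G_int by (rule le_less_trans)
      qed
      have fin': "(\<integral>\<^sup>+ z. G z * indicator S z \<partial>M) < \<infinity>" for S
        using fin[of S] by (rule less_trans) simp
      have Phi: "ennreal (\<Phi> t) = (\<integral>\<^sup>+ z. G z * indicator {z. v z \<le> t} z \<partial>M)" for t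
        unfolding \<Phi>_def using fin' by (intro ennreal_enn2real) auto
      have Phi0: "0 \<le> \<Phi> t" for t by (simp add: \<Phi>_def)
      have mono: "mono \<Phi>"
      proof (rule monoI)
        fix s t :: real assume "s \<le> t"
        then have "ennreal (\<Phi> s) \<le> ennreal (\<Phi> t)"
          unfolding Phi by (intro nn_integral_mono mult_left_mono) (auto simp: indicator_def)
        then show "\<Phi> s \<le> \<Phi> t" using Phi0 by (simp add: ennreal_le_iff)
      qed
      have "ennreal (\<Phi> (1/2)) \<le> ennreal c" unfolding Phi by (rule less_imp_le[OF fin])
      then have "\<Phi> (1/2) - \<Phi> 0 \<le> c" using Phi0[of 0] c by (simp add: ennreal_le_iff)
      then obtain t where t0: "0 \<le> t" "t < 1/2"
        and t1: "\<And>\<delta>. 0 < \<delta> \<Longrightarrow> \<exists>h. 0 < h \<and> h < \<delta> \<and> \<Phi> (t + h) - \<Phi> t \<le> 4 * c * h"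
        using level_selection[OF mono c] by blast
      have t: "\<exists>h. 0 < h \<and> h < \<delta> \<and> (\<integral>\<^sup>+ z. G z * indicator {z. t < v z \<and> v z \<le> t + h} z \<partial>M) \<le> ennreal (4 * c * h)"
        if "0 < \<delta>" for \<delta>
      proof -
        obtain h where h: "0 < h" "h < \<delta>" "\<Phi> (t + h) - \<Phi> t \<le> 4 * c * h" using t1[OF \<open>0 < \<delta>\<close>] by blast
        let ?I = "\<integral>\<^sup>+ z. G z * indicator {z. t < v z \<and> v z \<le> t + h} z \<partial>M"
        have "ennreal (\<Phi> (t + h)) = (\<integral>\<^sup>+ z. G z * indicator {z. v z \<le> t} z + G z * indicator {z. t < v z \<and> v z \<le> t + h} z \<partial>M)"
          unfolding Phi using h by (intro nn_integral_cong) (auto simp: indicator_def)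
        also have "\<dots> = ennreal (\<Phi> t) + ?I"
          unfolding Phi by (rule nn_integral_add) measurable
        finally have eq: "ennreal (\<Phi> (t + h)) = ennreal (\<Phi> t) + ?I" .
        have "?I = ennreal (enn2real ?I)" using fin'[of "{z. t < v z \<and> v z \<le> t + h}"] by (simp add: less_top)
        then have "ennreal (\<Phi> (t + h)) = ennreal (\<Phi> t) + ennreal (enn2real ?I)" using eq by simp
        also have "\<dots> = ennreal (\<Phi> t + enn2real ?I)"
          using Phi0 by (intro ennreal_plus[symmetric]) auto
        finally have "\<Phi> (t + h) = \<Phi> t + enn2real ?I"
          using Phi0 by (subst (asm) ennreal_inj) (auto intro!: add_nonneg_nonneg)
        then have "enn2real ?I = \<Phi> (t + h) - \<Phi> t" by simp
        then have "?I \<le> ennreal (4 * c * h)"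
          using h(3) \<open>?I = ennreal (enn2real ?I)\<close> by (metis ennreal_leI)
        then show ?thesis using h by blast
      qed
      let ?E = "{z. t < v z}"
      have E_sub: "?E \<subseteq> ball x (2 * r)" using v(3) t0 by force
      have "\<exists>\<rho>. 0 < \<rho> \<and> \<rho> \<le> k * r \<and> vol y \<rho> / (2 * Cd) < measure M (?E \<inter> ball y \<rho>) \<and>
          vol y \<rho> / 2 \<le> measure M (ball y \<rho> - ?E)" if y: "y \<in> A" for y
      proof -
        have yx: "y \<in> ball x r" using y A by blast
        have "measure M (?E \<inter> ball y (k * r)) \<le> vol x (2 * r)" using E_sub by (intro measure_le_vol) auto
        also have "\<dots> \<le> 1/2 * vol y (k * r)" by (rule rd[OF r yx])
        finally have small: "measure M (?E \<inter> ball y (k * r)) \<le> 1/2 * vol y (k * r)" .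
        have "y \<in> ?E" using v(4)[OF y] t0 by simp
        then show ?thesis
          using crossing_scale[OF v(1) _ _ small] k r by (metis mult_pos_pos less_le_trans zero_less_one)
      qed
      then have "\<forall>y\<in>A. \<exists>\<rho>. 0 < \<rho> \<and> \<rho> \<le> k * r \<and> vol y \<rho> / (2 * Cd) < measure M (?E \<inter> ball y \<rho>) \<and>
          vol y \<rho> / 2 \<le> measure M (ball y \<rho> - ?E)" by (rule ballI)
      from bchoice[OF this] obtain \<rho> where \<rho>: "\<forall>y\<in>A. 0 < \<rho> y \<and> \<rho> y \<le> k * r \<and>
          vol y (\<rho> y) / (2 * Cd) < measure M (?E \<inter> ball y (\<rho> y)) \<and> vol y (\<rho> y) / 2 \<le> measure M (ball y (\<rho> y) - ?E)"
        by (rule exE)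
      have lam0: "0 < lam" using lam_ge_1 by simp
      have cover: "(\<Sum>y\<in>K. vol y (lam * \<rho> y) / (lam * \<rho> y)) \<le> Cd ^ n * (40 * Cd * CP * c)"
        if K: "finite K" "K \<subseteq> A" "disjoint_family_on (\<lambda>y. ball y (lam * \<rho> y)) K" for K
      proof -
        have \<rho>K: "0 < \<rho> y" "vol y (\<rho> y) / (2 * Cd) < measure M (?E \<inter> ball y (\<rho> y))"
          "vol y (\<rho> y) / 2 \<le> measure M (ball y (\<rho> y) - ?E)" if "y \<in> K" for y
          using \<rho> K(2) that by blast+
        have "(\<Sum>y\<in>K. vol y (lam * \<rho> y) / (lam * \<rho> y)) \<le> (\<Sum>y\<in>K. Cd ^ n * (vol y (\<rho> y) / \<rho> y))"
        proof (rule sum_mono)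
          fix y assume y: "y \<in> K"
          have r0: "0 < \<rho> y" by (rule \<rho>K(1)[OF y])
          have "vol y (lam * \<rho> y) \<le> Cd ^ n * vol y (\<rho> y)"
            using n r0 by (intro vol_compare) (auto intro: mult_right_mono)
          then have "vol y (lam * \<rho> y) / (lam * \<rho> y) \<le> Cd ^ n * vol y (\<rho> y) / (lam * \<rho> y)"
            using r0 lam0 by (intro divide_right_mono) auto
          also have "\<dots> \<le> Cd ^ n * vol y (\<rho> y) / \<rho> y"
            using r0 lam_ge_1 Cd_ge_1 by (intro divide_left_mono) (auto simp: mult_le_cancel_right1)
          finally show "vol y (lam * \<rho> y) / (lam * \<rho> y) \<le> Cd ^ n * (vol y (\<rho> y) / \<rho> y)" by simp
        qed
        also have "\<dots> = Cd ^ n * (\<Sum>y\<in>K. vol y (\<rho> y) / \<rho> y)" by (simp add: sum_distrib_left)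
        also have "\<dots> \<le> Cd ^ n * (40 * Cd * CP * c)"
          using Cd_ge_1 by (intro mult_left_mono boxing_sum[OF v(1,2) ug c G_int t K(1,3) \<rho>K]) auto
        finally show ?thesis .
      qed
      have rad: "0 < lam * \<rho> y \<and> lam * \<rho> y \<le> lam * (k * r)" if "y \<in> A" for y
        using \<rho> that lam0 by (auto intro!: mult_left_mono)
      show ?thesis
      proof (rule vitali_cover[OF rad cover])
        fix \<F> assume \<F>: "bounded_cost \<F> (Cd ^ 2 * (Cd ^ n * (40 * Cd * CP * c)))" "A \<subseteq> balls \<F>"
          "\<And>p s. (p, s) \<in> \<F> \<Longrightarrow> s \<le> 4 * (lam * (k * r))"
        have "Cd ^ 2 * (Cd ^ n * (40 * Cd * CP * c)) = Cd ^ 2 * (Cd ^ n * (40 * Cd * CP)) * c" by simp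
        also have "\<dots> \<le> C * c" using C(3) c by (intro mult_right_mono) auto
        finally have le: "Cd ^ 2 * (Cd ^ n * (40 * Cd * CP * c)) \<le> C * c" .
        have "bounded_cost \<F> (C * c)"
          unfolding bounded_cost_def
        proof (intro conjI allI impI)
          show "\<forall>(p, s)\<in>\<F>. 0 < s" using \<F>(1) by (simp add: bounded_cost_def)
          fix K assume "finite K" "K \<subseteq> \<F>"
          then have "(\<Sum>(p, s)\<in>K. vol p s / s) \<le> Cd ^ 2 * (Cd ^ n * (40 * Cd * CP * c))"
            using \<F>(1) by (simp add: bounded_cost_def)
          then show "(\<Sum>(p, s)\<in>K. vol p s / s) \<le> C * c" using le by (rule order_trans)
        qed
        moreover have "s \<le> C * r" if "(p, s) \<in> \<F>" for p s
        proof -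
          have "s \<le> (4 * lam * k) * r" using \<F>(3)[OF that] by simp
          also have "\<dots> \<le> C * r" using C(2) r by (intro mult_right_mono) auto
          finally show ?thesis .
        qed
        ultimately show "\<exists>\<F>. bounded_cost \<F> (C * c) \<and> A \<subseteq> balls \<F> \<and> (\<forall>(p, s)\<in>\<F>. s \<le> C * r)"
          using \<F>(2) by (intro exI[of _ \<F>]) auto
      qed
    qed
  qed
qed

end

section \<open>Capacity and coverings\<close>

context doubling_measure
begin

lemma bounded_cost_pos: "bounded_cost \<F> Q \<Longrightarrow> (p, s) \<in> \<F> \<Longrightarrow> 0 < s"
  by (auto simp: bounded_cost_def)

lemma bounded_cost_sum: "bounded_cost \<F> Q \<Longrightarrow> finite K \<Longrightarrow> K \<subseteq> \<F> \<Longrightarrow> (\<Sum>(p, s)\<in>K. vol p s / s) \<le> Q"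
  by (auto simp: bounded_cost_def)

lemma bounded_cost_single: "bounded_cost \<F> Q \<Longrightarrow> (p, s) \<in> \<F> \<Longrightarrow> vol p s / s \<le> Q"
  using bounded_cost_sum[of \<F> Q "{(p, s)}"] by simp

lemma bounded_cost_subset: "bounded_cost \<F> Q \<Longrightarrow> \<G> \<subseteq> \<F> \<Longrightarrow> Q \<le> Q' \<Longrightarrow> bounded_cost \<G> Q'"
  unfolding bounded_cost_def by (meson order_trans subset_iff)

lemma bounded_cost_Un:
  assumes "bounded_cost \<F> Q" "bounded_cost \<G> Q'"
  shows "bounded_cost (\<F> \<union> \<G>) (Q + Q')"
  unfolding bounded_cost_def
proof (intro conjI allI impI)
  show "\<forall>(p, s)\<in>\<F> \<union> \<G>. 0 < s" using assms by (auto simp: bounded_cost_def)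
  fix K assume K: "finite K" "K \<subseteq> \<F> \<union> \<G>"
  have "(\<Sum>(p, s)\<in>K. vol p s / s) = (\<Sum>(p, s)\<in>K \<inter> \<F>. vol p s / s) + (\<Sum>(p, s)\<in>K - \<F>. vol p s / s)"
    using K by (rule_tac sum.Int_Diff) auto
  also have "\<dots> \<le> Q + Q'"
    using K by (intro add_mono bounded_cost_sum[OF assms(1)] bounded_cost_sum[OF assms(2)]) auto
  finally show "(\<Sum>(p, s)\<in>K. vol p s / s) \<le> Q + Q'" .
qed

lemma bounded_cost_UN:
  fixes \<F> :: "nat \<Rightarrow> ('a \<times> real) set"
  assumes "\<And>k. bounded_cost (\<F> k) (Q k)" and Qtot: "\<And>n. (\<Sum>k<n. Q k) \<le> Q'"
  shows "bounded_cost (\<Union>k. \<F> k) Q'"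
  unfolding bounded_cost_def
proof (intro conjI allI impI)
  have fin: "bounded_cost (\<Union>k<n. \<F> k) (\<Sum>k<n. Q k)" for n
  proof (induction n)
    case 0
    then show ?case by (simp add: bounded_cost_def)
  next
    case (Suc n)
    have "(\<Union>k<Suc n. \<F> k) = (\<Union>k<n. \<F> k) \<union> \<F> n" by (auto simp: less_Suc_eq)
    then show ?case using bounded_cost_Un[OF Suc assms(1)[of n]] by simp
  qed
  show "\<forall>(p, s)\<in>(\<Union>k. \<F> k). 0 < s" using assms(1) bounded_cost_pos by blast
  fix K assume K: "finite K" "K \<subseteq> (\<Union>k. \<F> k)"
  have "\<exists>n. K \<subseteq> (\<Union>k<n. \<F> k)" using K
  proof (induction K)
    case (insert B K)
    then obtain n where n: "K \<subseteq> (\<Union>k<n. \<F> k)" by auto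
    obtain m where "B \<in> \<F> m" using insert by auto
    then have "insert B K \<subseteq> (\<Union>k<max n (Suc m). \<F> k)" using n by fastforce
    then show ?case by blast
  qed auto
  then obtain n where "K \<subseteq> (\<Union>k<n. \<F> k)" by blast
  then have "(\<Sum>(p, s)\<in>K. vol p s / s) \<le> (\<Sum>k<n. Q k)"
    using bounded_cost_sum[OF fin K(1)] by blast
  then show "(\<Sum>(p, s)\<in>K. vol p s / s) \<le> Q'" using Qtot[of n] by (rule order_trans)
qed

lemma bounded_cost_double:
  assumes "bounded_cost \<F> Q"
  shows "bounded_cost ((\<lambda>(p, s). (p, 2 * s)) ` \<F>) (Cd * Q)"
  unfolding bounded_cost_def
proof (intro conjI allI impI)
  show "\<forall>(p, s)\<in>(\<lambda>(p, s). (p, 2 * s)) ` \<F>. 0 < s" using bounded_cost_pos[OF assms] by auto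
  fix K assume K: "finite K" "K \<subseteq> (\<lambda>(p, s). (p, 2 * s)) ` \<F>"
  then obtain K' where K': "K' \<subseteq> \<F>" "finite K'" "K = (\<lambda>(p, s). (p, 2 * s)) ` K'"
    by (meson finite_subset_image)
  have inj: "inj_on (\<lambda>(p, s). (p, 2 * s)) K'" by (auto simp: inj_on_def)
  have "(\<Sum>(p, s)\<in>K. vol p s / s) = (\<Sum>(p, s)\<in>K'. vol p (2 * s) / (2 * s))"
    unfolding K'(3) by (subst sum.reindex[OF inj]) (simp add: case_prod_beta o_def)
  also have "\<dots> \<le> (\<Sum>(p, s)\<in>K'. Cd * (vol p s / s))"
  proof (rule sum_mono, clarify)
    fix p s assume "(p, s) \<in> K'"
    then have s: "0 < s" using K' bounded_cost_pos[OF assms] by blast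
    have "vol p (2 * s) / (2 * s) \<le> vol p (2 * s) / s" using s by (intro divide_left_mono) auto
    also have "\<dots> \<le> Cd * vol p s / s" using s vol_double[OF s, of p] by (intro divide_right_mono) auto
    finally show "vol p (2 * s) / (2 * s) \<le> Cd * (vol p s / s)" by simp
  qed
  also have "\<dots> = Cd * (\<Sum>(p, s)\<in>K'. vol p s / s)" by (simp add: sum_distrib_left case_prod_beta)
  also have "\<dots> \<le> Cd * Q" using K' Cd_ge_1 by (intro mult_left_mono bounded_cost_sum[OF assms]) auto
  finally show "(\<Sum>(p, s)\<in>K. vol p s / s) \<le> Cd * Q" .
qed

lemma bounded_cost_finite_large:
  assumes "bounded_cost \<F> Q" "0 < c"
  shows "finite {(p, s)\<in>\<F>. c \<le> vol p s / s}"
proof (rule ccontr)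
  assume inf: "infinite {(p, s)\<in>\<F>. c \<le> vol p s / s}"
  obtain n :: nat where n: "Q / c < real n" using reals_Archimedean2 by blast
  obtain K where K: "finite K" "card K = n" "K \<subseteq> {(p, s)\<in>\<F>. c \<le> vol p s / s}"
    using infinite_arbitrarily_large[OF inf] by blast
  have "real n * c = (\<Sum>(p, s)\<in>K. c)" using K by simp
  also have "\<dots> \<le> (\<Sum>(p, s)\<in>K. vol p s / s)" using K by (intro sum_mono) auto
  also have "\<dots> \<le> Q" using K by (intro bounded_cost_sum[OF assms(1)]) auto
  finally show False using n assms(2) by (simp add: pos_divide_less_eq)
qed

lemma bounded_cost_countable:
  assumes "bounded_cost \<F> Q"
  shows "countable \<F>"
proof -
  have "\<F> \<subseteq> (\<Union>n. {(p, s)\<in>\<F>. 1 / real (Suc n) \<le> vol p s / s})"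
  proof clarify
    fix p s assume ps: "(p, s) \<in> \<F>"
    then have "0 < vol p s / s" using bounded_cost_pos[OF assms ps] vol_pos by simp
    then obtain n where "1 / real (Suc n) < vol p s / s" using nat_approx_posE by blast
    then show "(p, s) \<in> (\<Union>n. {(p, s)\<in>\<F>. 1 / real (Suc n) \<le> vol p s / s})"
      using ps by (intro UN_I[of n]) auto
  qed
  moreover have "countable (\<Union>n. {(p, s)\<in>\<F>. 1 / real (Suc n) \<le> vol p s / s})"
  proof (rule countable_UN)
    show "countable {(p, s)\<in>\<F>. 1 / real (Suc n) \<le> vol p s / s}" for n
      by (rule countable_finite[OF bounded_cost_finite_large[OF assms]]) simp
  qed simp
  ultimately show ?thesis by (rule countable_subset)
qed

text \<open>Remove a finite subfamily whose cost is within \<open>e\<close> of the supremum over all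
  finite subfamilies.\<close>

lemma bounded_cost_tail:
  assumes "bounded_cost \<F> Q" "0 < e"
  obtains K where "finite K" "K \<subseteq> \<F>" "bounded_cost (\<F> - K) e"
proof -
  let ?S = "(\<lambda>K. \<Sum>(p, s)\<in>K. vol p s / s) ` {K. finite K \<and> K \<subseteq> \<F>}"
  have bdd: "bdd_above ?S" using bounded_cost_sum[OF assms(1)] by (intro bdd_aboveI[of _ Q]) auto
  have ne: "?S \<noteq> {}" by auto
  have "Sup ?S - e < Sup ?S" using assms(2) by simp
  then obtain y where "y \<in> ?S" "Sup ?S - e < y" using less_cSupE[OF _ ne] by blast
  then obtain K where K: "finite K" "K \<subseteq> \<F>" "Sup ?S - e < (\<Sum>(p, s)\<in>K. vol p s / s)" by auto
  have "bounded_cost (\<F> - K) e"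
    unfolding bounded_cost_def
  proof (intro conjI allI impI)
    show "\<forall>(p, s)\<in>\<F> - K. 0 < s" using bounded_cost_pos[OF assms(1)] by auto
    fix L assume L: "finite L" "L \<subseteq> \<F> - K"
    have "(\<Sum>(p, s)\<in>K. vol p s / s) + (\<Sum>(p, s)\<in>L. vol p s / s) = (\<Sum>(p, s)\<in>K \<union> L. vol p s / s)"
      using K L by (intro sum.union_disjoint[symmetric]) auto
    also have "\<dots> \<le> Sup ?S" using K L by (intro cSup_upper[OF _ bdd]) auto
    finally show "(\<Sum>(p, s)\<in>L. vol p s / s) \<le> e" using K(3) by linarith
  qed
  then show thesis using that K by blast
qed

section \<open>Functions attached to a family of balls, and the capacities they bound\<close>

definition cutoff :: "'a \<Rightarrow> real \<Rightarrow> 'a \<Rightarrow> real" where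
  "cutoff p s z = max 0 (min 1 (2 - dist p z / s))"

lemma cutoff_bounds: "0 \<le> cutoff p s z" "cutoff p s z \<le> 1"
  by (auto simp: cutoff_def)

lemma cutoff_one: "0 < s \<Longrightarrow> z \<in> cball p s \<Longrightarrow> cutoff p s z = 1"
  by (simp add: cutoff_def pos_divide_le_eq)

lemma cutoff_zero: "0 < s \<Longrightarrow> z \<notin> ball p (2 * s) \<Longrightarrow> cutoff p s z = 0"
  by (simp add: cutoff_def pos_le_divide_eq)

lemma cutoff_Lipschitz:
  assumes "0 < s"
  shows "\<bar>cutoff p s y - cutoff p s z\<bar> \<le> 1 / s * dist y z"
proof -
  have "\<bar>cutoff p s y - cutoff p s z\<bar> \<le> \<bar>dist p y / s - dist p z / s\<bar>" by (auto simp: cutoff_def)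
  also have "\<dots> = \<bar>dist p y - dist p z\<bar> / s" using assms by (simp add: diff_divide_distrib[symmetric])
  also have "\<dots> \<le> dist y z / s"
    using assms abs_dist_diff_le[of y p z] by (intro divide_right_mono) (auto simp: dist_commute)
  finally show ?thesis by simp
qed

lemma cutoff_continuous: "0 < s \<Longrightarrow> continuous_on UNIV (cutoff p s)"
  using cutoff_Lipschitz[of s p]
  by (intro Lipschitz_continuous_on[where K = "1 / s"]) (auto simp: dist_real_def)

text \<open>The gradient is a cutoff at the doubled radius instead of an indicator because the local
  Lipschitz criterion asks for a continuous function.\<close>

lemma cutoff_upper_gradient:
  assumes s: "0 < s"
  shows "upper_gradient (cutoff p s) (\<lambda>z. ennreal (1 / s * cutoff p (2 * s) z))"
proof (rule local_Lipschitz_upper_gradient)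
  show "continuous_on UNIV (\<lambda>z. 1 / s * cutoff p (2 * s) z)"
    using cutoff_continuous[of "2 * s" p] s by (intro continuous_intros) auto
  show "0 \<le> 1 / s * cutoff p (2 * s) z" for z using s cutoff_bounds by simp
  show "0 < s" by fact
  fix y z :: 'a
  show "\<bar>cutoff p s y - cutoff p s z\<bar> \<le> max (1 / s * cutoff p (2 * s) y) (1 / s * cutoff p (2 * s) z) * dist y z"
  proof (cases "y \<in> cball p (2 * s) \<or> z \<in> cball p (2 * s)")
    case True
    then have "cutoff p (2 * s) y = 1 \<or> cutoff p (2 * s) z = 1"
      using cutoff_one[of "2 * s"] s by auto
    then have "1 / s \<le> max (1 / s * cutoff p (2 * s) y) (1 / s * cutoff p (2 * s) z)" by auto
    then have "1 / s * dist y z \<le> max (1 / s * cutoff p (2 * s) y) (1 / s * cutoff p (2 * s) z) * dist y z"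
      by (rule mult_right_mono) simp
    then show ?thesis using cutoff_Lipschitz[OF s, of p y z] by (rule order_trans[rotated])
  next
    case False
    then have "cutoff p s y = 0" "cutoff p s z = 0" using cutoff_zero[OF s] by auto
    moreover have "0 \<le> max (1 / s * cutoff p (2 * s) y) (1 / s * cutoff p (2 * s) z)"
      using s cutoff_bounds[of p "2 * s" y] by (simp add: le_max_iff_disj)
    ultimately show ?thesis by simp
  qed
qed

lemma cutoff_gradient_integral:
  assumes s: "0 < s"
  shows "(\<integral>\<^sup>+ z. ennreal (1 / s * cutoff p (2 * s) z) \<partial>M) \<le> ennreal (Cd ^ 2 * (vol p s / s))"
proof -
  have "(\<integral>\<^sup>+ z. ennreal (1 / s * cutoff p (2 * s) z) \<partial>M) \<le> (\<integral>\<^sup>+ z. ennreal (1 / s) * indicator (ball p (4 * s)) z \<partial>M)"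
  proof (rule nn_integral_mono)
    fix z
    show "ennreal (1 / s * cutoff p (2 * s) z) \<le> ennreal (1 / s) * indicator (ball p (4 * s)) z"
    proof (cases "z \<in> ball p (4 * s)")
      case True
      have "1 / s * cutoff p (2 * s) z \<le> 1 / s"
        using s cutoff_bounds(2) by (intro mult_left_le) auto
      then show ?thesis using True by (simp add: ennreal_leI)
    next
      case False
      then show ?thesis using cutoff_zero[of "2 * s" z p] s by simp
    qed
  qed
  also have "\<dots> = ennreal (1 / s) * ennreal (vol p (4 * s))"
    by (simp add: nn_integral_cmult_indicator emeasure_ball)
  also have "\<dots> = ennreal (vol p (4 * s) / s)" using s by (simp add: ennreal_mult[symmetric])
  also have "\<dots> \<le> ennreal (Cd ^ 2 * (vol p s / s))"
  proof (rule ennreal_leI)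
    have "vol p (4 * s) \<le> Cd ^ 2 * vol p s" using s by (intro vol_compare) auto
    then show "vol p (4 * s) / s \<le> Cd ^ 2 * (vol p s / s)" using s by (simp add: divide_right_mono)
  qed
  finally show ?thesis .
qed

text \<open>The supremum of the cutoffs changes along a curve by no more than some cutoff of the
  family does, so the sum of the single gradients is an upper gradient; its integral is the cost up
  to \<open>Cd ^ 2\<close>. As a supremum of continuous functions \<open>\<eta>\<close> has open
  superlevel sets, which gives Borel measurability.\<close>

lemma family_function:
  assumes cost: "bounded_cost \<F> Q"
  obtains \<eta> :: "'a \<Rightarrow> real" and G :: "'a \<Rightarrow> ennreal"
  where "\<And>t. open {z. t < \<eta> z}" "\<And>z. 0 \<le> \<eta> z \<and> \<eta> z \<le> 1"
    "\<And>p s z. (p, s) \<in> \<F> \<Longrightarrow> z \<in> cball p s \<Longrightarrow> \<eta> z = 1"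
    "\<And>z. (\<And>p s. (p, s) \<in> \<F> \<Longrightarrow> z \<notin> ball p (2 * s)) \<Longrightarrow> \<eta> z = 0"
    "upper_gradient \<eta> G" "(\<integral>\<^sup>+ z. G z \<partial>M) \<le> ennreal (Cd ^ 2 * Q)"
proof -
  have count: "countable \<F>" by (rule bounded_cost_countable[OF cost])
  have pos: "0 < s" if "(p, s) \<in> \<F>" for p s by (rule bounded_cost_pos[OF cost that])
  define u where "u z = (SUP B\<in>\<F>. ennreal (cutoff (fst B) (snd B) z))" for z
  have u_le: "u z \<le> 1" for z unfolding u_def using cutoff_bounds by (intro SUP_least) auto
  define \<eta> where "\<eta> z = enn2real (u z)" for z
  have eta: "ennreal (\<eta> z) = u z" for z
    unfolding \<eta>_def using le_less_trans[OF u_le ennreal_one_less_top] by (intro ennreal_enn2real)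
  define h where "h B z = ennreal (1 / snd B * cutoff (fst B) (2 * snd B) z)" for B :: "'a \<times> real" and z
  \<comment> \<open>An exhaustion of the countable family by finite subfamilies, so that
    \<open>G\<close> is an increasing limit of finite sums and monotone convergence applies.\<close>
  define K where "K n = {B\<in>\<F>. to_nat_on \<F> B < n}" for n
  have K: "finite (K n)" "K n \<subseteq> \<F>" for n
  proof -
    have "to_nat_on \<F> ` K n \<subseteq> {..<n}" by (auto simp: K_def)
    then have "finite (to_nat_on \<F> ` K n)" by (rule finite_subset) simp
    then show "finite (K n)"
      using inj_on_subset[OF inj_on_to_nat_on[OF count], of "K n"] by (rule finite_imageD) (auto simp: K_def)
  qed (auto simp: K_def)
  have K_mono: "K n \<subseteq> K (Suc n)" for n by (auto simp: K_def)
  define G where "G z = (SUP n. \<Sum>B\<in>K n. h B z)" for z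
  have h_meas [measurable]: "h B \<in> borel_measurable borel" if "B \<in> \<F>" for B
    using cutoff_upper_gradient[of "snd B" "fst B"] pos[of "fst B" "snd B"] that
    unfolding h_def[abs_def] by (auto dest: upper_gradient_borel)
  have sum_meas [measurable]: "(\<lambda>z. \<Sum>B\<in>K n. h B z) \<in> borel_measurable borel" for n
    using K(2) h_meas by (intro borel_measurable_sum) blast
  have G_meas: "G \<in> borel_measurable borel" unfolding G_def[abs_def] by measurable
  have h_G: "h B z \<le> G z" if "B \<in> \<F>" for B z
  proof -
    have "B \<in> K (Suc (to_nat_on \<F> B))" using that by (simp add: K_def)
    then have "h B z \<le> (\<Sum>B\<in>K (Suc (to_nat_on \<F> B)). h B z)"
      using K(1) by (intro member_le_sum) auto
    also have "\<dots> \<le> G z" unfolding G_def by (rule SUP_upper) simp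
    finally show ?thesis .
  qed
  have ug: "upper_gradient \<eta> G"
  proof (rule upper_gradientI[OF G_meas])
    fix c :: "real \<Rightarrow> 'a" and l assume c: "arc_param c l"
    let ?I = "\<integral>\<^sup>+ s. G (c s) * indicator {0..l} s \<partial>lborel"
    have cut: "ennreal \<bar>cutoff (fst B) (snd B) (c 0) - cutoff (fst B) (snd B) (c l)\<bar> \<le> ?I" if B: "B \<in> \<F>" for B
    proof -
      have "0 < snd B" using pos[of "fst B" "snd B"] B by simp
      from upper_gradientD[OF cutoff_upper_gradient[OF this, of "fst B"] c, of 0 l] c
      have "ennreal \<bar>cutoff (fst B) (snd B) (c 0) - cutoff (fst B) (snd B) (c l)\<bar> \<le> (\<integral>\<^sup>+ s. h B (c s) * indicator {0..l} s \<partial>lborel)"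
        by (auto simp: h_def arc_param_def)
      also have "\<dots> \<le> ?I" using h_G[OF B] by (intro nn_integral_mono mult_right_mono) auto
      finally show ?thesis .
    qed
    have one: "u x \<le> u y + ?I" if "(x = c 0 \<and> y = c l) \<or> (x = c l \<and> y = c 0)" for x y
      unfolding u_def[of x]
    proof (rule SUP_least)
      fix B assume B: "B \<in> \<F>"
      let ?f = "cutoff (fst B) (snd B)"
      have "?f x \<le> ?f y + \<bar>?f (c 0) - ?f (c l)\<bar>" using that by auto
      then have "ennreal (?f x) \<le> ennreal (?f y + \<bar>?f (c 0) - ?f (c l)\<bar>)" by (rule ennreal_leI)
      also have "\<dots> = ennreal (?f y) + ennreal \<bar>?f (c 0) - ?f (c l)\<bar>"
        using cutoff_bounds by (intro ennreal_plus) auto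
      also have "\<dots> \<le> u y + ?I"
        unfolding u_def using B cut[OF B] by (intro add_mono SUP_upper)
      finally show "ennreal (?f x) \<le> u y + ?I" .
    qed
    show "ennreal \<bar>\<eta> (c 0) - \<eta> (c l)\<bar> \<le> ?I"
    proof (cases "?I = \<infinity>")
      case False
      then obtain i where i: "?I = ennreal i" "0 \<le> i" by (cases ?I) auto
      have "0 \<le> \<eta> z" for z by (simp add: \<eta>_def)
      moreover have "ennreal (\<eta> (c 0)) \<le> ennreal (\<eta> (c l)) + ennreal i" "ennreal (\<eta> (c l)) \<le> ennreal (\<eta> (c 0)) + ennreal i"
        unfolding eta i(1)[symmetric] using one by auto
      ultimately have "\<eta> (c 0) \<le> \<eta> (c l) + i" "\<eta> (c l) \<le> \<eta> (c 0) + i"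
        using i(2) by (simp_all add: ennreal_plus[symmetric] ennreal_le_iff del: ennreal_plus)
      then show ?thesis unfolding i(1) by (intro ennreal_leI) auto
    qed simp
  qed
  have G_int: "(\<integral>\<^sup>+ z. G z \<partial>M) \<le> ennreal (Cd ^ 2 * Q)"
  proof -
    have [measurable]: "(\<lambda>z. \<Sum>B\<in>K n. h B z) \<in> borel_measurable M" for n using sum_meas by simp
    have "(\<integral>\<^sup>+ z. G z \<partial>M) = (SUP n. \<integral>\<^sup>+ z. (\<Sum>B\<in>K n. h B z) \<partial>M)"
      unfolding G_def
    proof (rule nn_integral_monotone_convergence_SUP)
      show "incseq (\<lambda>n z. \<Sum>B\<in>K n. h B z)"
        using K_mono K(1) by (intro incseq_SucI le_funI sum_mono2) auto
    qed measurable
    also have "\<dots> \<le> ennreal (Cd ^ 2 * Q)"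
    proof (rule SUP_least)
      fix n
      have "(\<integral>\<^sup>+ z. (\<Sum>B\<in>K n. h B z) \<partial>M) = (\<Sum>B\<in>K n. \<integral>\<^sup>+ z. h B z \<partial>M)"
        using K(2)[of n] h_meas by (intro nn_integral_sum) auto
      also have "\<dots> \<le> (\<Sum>B\<in>K n. ennreal (Cd ^ 2 * (vol (fst B) (snd B) / snd B)))"
      proof (rule sum_mono)
        fix B assume "B \<in> K n"
        then have "0 < snd B" using pos[of "fst B" "snd B"] K(2)[of n] by auto
        then show "(\<integral>\<^sup>+ z. h B z \<partial>M) \<le> ennreal (Cd ^ 2 * (vol (fst B) (snd B) / snd B))"
          unfolding h_def by (rule cutoff_gradient_integral)
      qed
      also have "\<dots> = ennreal (\<Sum>B\<in>K n. Cd ^ 2 * (vol (fst B) (snd B) / snd B))"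
      proof (rule sum_ennreal)
        fix B assume "B \<in> K n"
        then have "0 < snd B" using pos[of "fst B" "snd B"] K(2)[of n] by auto
        then show "0 \<le> Cd ^ 2 * (vol (fst B) (snd B) / snd B)" by simp
      qed
      also have "\<dots> \<le> ennreal (Cd ^ 2 * Q)"
        using bounded_cost_sum[OF cost K[of n]]
        unfolding sum_distrib_left[symmetric] case_prod_beta by (intro ennreal_leI mult_left_mono) auto
      finally show "(\<integral>\<^sup>+ z. (\<Sum>B\<in>K n. h B z) \<partial>M) \<le> ennreal (Cd ^ 2 * Q)" .
    qed
    finally show ?thesis .
  qed
  show thesis
  proof (rule that[of \<eta> G])
    show "open {z. t < \<eta> z}" for t
    proof (cases "t < 0")
      case True
      have "0 \<le> \<eta> z" for z by (simp add: \<eta>_def)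
      then have "{z. t < \<eta> z} = UNIV" using True by (auto intro: less_le_trans)
      then show ?thesis by simp
    next
      case False
      have "t < \<eta> z \<longleftrightarrow> (\<exists>B\<in>\<F>. t < cutoff (fst B) (snd B) z)" for z
      proof -
        have "t < \<eta> z \<longleftrightarrow> ennreal t < u z" unfolding eta[symmetric] using False by (simp add: ennreal_less_iff)
        then show ?thesis unfolding u_def less_SUP_iff using False by (simp add: ennreal_less_iff)
      qed
      then have "{z. t < \<eta> z} = (\<Union>B\<in>\<F>. {z. t < cutoff (fst B) (snd B) z})" by auto
      moreover have "open {z. t < cutoff (fst B) (snd B) z}" if "B \<in> \<F>" for B
        using cutoff_continuous[of "snd B" "fst B"] pos[of "fst B" "snd B"] that
        by (intro open_Collect_less continuous_intros) auto
      ultimately show ?thesis by auto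
    qed
    show "0 \<le> \<eta> z \<and> \<eta> z \<le> 1" for z
      using u_le[of z] unfolding eta[symmetric] by (simp add: \<eta>_def)
    show "\<eta> z = 1" if B: "(p, s) \<in> \<F>" "z \<in> cball p s" for p s z
    proof -
      have "ennreal (cutoff p s z) \<le> u z" unfolding u_def by (rule SUP_upper2[OF B(1)]) simp
      then have "u z = 1" using u_le[of z] cutoff_one[OF pos[OF B(1)] B(2)] by simp
      then show ?thesis by (simp add: \<eta>_def)
    qed
    show "\<eta> z = 0" if "\<And>p s. (p, s) \<in> \<F> \<Longrightarrow> z \<notin> ball p (2 * s)" for z
    proof -
      have "cutoff (fst B) (snd B) z = 0" if "B \<in> \<F>" for B
        using cutoff_zero[of "snd B" z "fst B"] pos[of "fst B" "snd B"] that
          \<open>\<And>p s. (p, s) \<in> \<F> \<Longrightarrow> z \<notin> ball p (2 * s)\<close>[of "fst B" "snd B"] by simp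
      then have "u z \<le> 0" unfolding u_def by (intro SUP_least) simp
      then show ?thesis by (simp add: \<eta>_def)
    qed
  qed (use ug G_int in auto)
qed

lemma upper_gradient_weak: "upper_gradient u g \<Longrightarrow> weak_ug M D u g"
  unfolding weak_ug_def upper_gradient_def zero_mod1_def
  by (auto intro!: exI[of _ "\<lambda>_. 0"])

lemma in_N11_bounded:
  assumes [measurable]: "u \<in> borel_measurable borel" and u: "\<And>z. 0 \<le> u z \<and> u z \<le> 1"
    and supp: "\<And>z. z \<notin> ball y R \<Longrightarrow> u z = 0" and ug: "upper_gradient u G" and G: "(\<integral>\<^sup>+ z. G z \<partial>M) \<le> ennreal q"
  shows "N11_norm M UNIV u \<le> ennreal (vol y R) + ennreal q" "in_N11 M UNIV u"
proof -
  have "(\<integral>\<^sup>+ z. ennreal \<bar>u z\<bar> * indicator UNIV z \<partial>completion M) \<le> (\<integral>\<^sup>+ z. indicator (ball y R) z \<partial>M)"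
    unfolding nn_integral_completion
  proof (rule nn_integral_mono)
    fix z
    have "ennreal \<bar>u z\<bar> \<le> 1" using u[of z] by (simp add: ennreal_le_1)
    then show "ennreal \<bar>u z\<bar> * indicator UNIV z \<le> indicator (ball y R) z"
      using supp[of z] by (cases "z \<in> ball y R") auto
  qed
  also have "\<dots> = ennreal (vol y R)" by (simp add: emeasure_ball)
  finally have 1: "(\<integral>\<^sup>+ z. ennreal \<bar>u z\<bar> * indicator UNIV z \<partial>completion M) \<le> ennreal (vol y R)" .
  have "(INF g \<in> {g. weak_ug M UNIV u g}. \<integral>\<^sup>+ z. g z * indicator UNIV z \<partial>M) \<le> (\<integral>\<^sup>+ z. G z * indicator UNIV z \<partial>M)"
    using upper_gradient_weak[OF ug] by (intro INF_lower) auto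
  also have "\<dots> \<le> ennreal q" using G by simp
  finally show norm: "N11_norm M UNIV u \<le> ennreal (vol y R) + ennreal q"
    unfolding N11_norm_def using 1 by (rule add_mono[rotated])
  have "(\<lambda>z. u z * indicator UNIV z) \<in> borel_measurable (completion M)"
    by (intro measurable_completion) measurable
  then show "in_N11 M UNIV u"
    unfolding in_N11_def using norm by (auto intro: le_less_trans)
qed

lemma cap1_le:
  assumes cost: "bounded_cost \<F> Q" and A: "\<And>z. z \<in> A \<Longrightarrow> \<exists>(p, s)\<in>\<F>. z \<in> cball p s"
    and sub: "\<And>p s. (p, s) \<in> \<F> \<Longrightarrow> ball p (2 * s) \<subseteq> ball y R"
  shows "cap1 M A (ball y R) \<le> ennreal (Cd ^ 2 * Q)"
proof (rule family_function[OF cost])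
  fix \<eta> :: "'a \<Rightarrow> real" and G :: "'a \<Rightarrow> ennreal"
  assume op: "\<And>t. open {z. t < \<eta> z}" and bounds: "\<And>z. 0 \<le> \<eta> z \<and> \<eta> z \<le> 1"
    and one: "\<And>p s z. (p, s) \<in> \<F> \<Longrightarrow> z \<in> cball p s \<Longrightarrow> \<eta> z = 1"
    and zero: "\<And>z. (\<And>p s. (p, s) \<in> \<F> \<Longrightarrow> z \<notin> ball p (2 * s)) \<Longrightarrow> \<eta> z = 0"
    and ug: "upper_gradient \<eta> G" and G: "(\<integral>\<^sup>+ z. G z \<partial>M) \<le> ennreal (Cd ^ 2 * Q)"
  have meas: "\<eta> \<in> borel_measurable borel" using op by (intro borel_measurableI_greater) auto
  have out: "\<eta> z = 0" if "z \<notin> ball y R" for z using zero[of z] sub that by blast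
  have "in_N11_0 M (ball y R) \<eta>"
    unfolding in_N11_0_def using in_N11_bounded(2)[OF meas bounds out ug G] out by auto
  moreover have "\<forall>z\<in>A. 1 \<le> \<eta> z" using A one by fastforce
  ultimately have "cap1 M A (ball y R) \<le> (INF g \<in> {g. weak_ug M UNIV \<eta> g}. \<integral>\<^sup>+ z. g z \<partial>M)"
    unfolding cap1_def by (intro INF_lower) auto
  also have "\<dots> \<le> (\<integral>\<^sup>+ z. G z \<partial>M)" using upper_gradient_weak[OF ug] by (intro INF_lower) auto
  finally show ?thesis using G by (rule order_trans)
qed

lemma thin1I:
  assumes "\<And>\<epsilon>. 0 < \<epsilon> \<Longrightarrow> \<exists>r0>0. \<forall>r. 0 < r \<longrightarrow> r < r0 \<longrightarrow>
    cap1 M (A \<inter> ball y r) (ball y (2 * r)) \<le> ennreal (\<epsilon> * (vol y r / r))"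
  shows "thin1 M A y"
  unfolding thin1_def
proof (rule order_tendstoI)
  fix a :: ennreal assume "0 < a"
  have "\<exists>\<epsilon>>0. ennreal \<epsilon> < a"
  proof (cases a)
    case (real x)
    then have "0 < x" using \<open>0 < a\<close> by simp
    then show ?thesis using real by (intro exI[of _ "x / 2"]) (auto intro: ennreal_lessI)
  next
    case top
    then show ?thesis by (intro exI[of _ 1]) (simp add: ennreal_one_less_top)
  qed
  then obtain \<epsilon> where \<epsilon>: "0 < \<epsilon>" "ennreal \<epsilon> < a" by blast
  obtain r0 where r0: "r0 > 0" "\<And>r. 0 < r \<Longrightarrow> r < r0 \<Longrightarrow> cap1 M (A \<inter> ball y r) (ball y (2 * r)) \<le> ennreal (\<epsilon> * (vol y r / r))"
    using assms[OF \<epsilon>(1)] by blast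
  have "ennreal r * cap1 M (A \<inter> ball y r) (ball y (2 * r)) / emeasure M (ball y r) < a" if r: "0 < r" "r < r0" for r
  proof -
    have v: "0 < vol y r" by (rule vol_pos[OF r(1)])
    have "ennreal r * cap1 M (A \<inter> ball y r) (ball y (2 * r)) / emeasure M (ball y r) \<le> ennreal r * ennreal (\<epsilon> * (vol y r / r)) / ennreal (vol y r)"
      unfolding emeasure_ball by (intro divide_right_mono_ennreal mult_left_mono r0 r) auto
    also have "\<dots> = ennreal \<epsilon>" using r v \<epsilon> by (simp add: ennreal_mult[symmetric] divide_ennreal)
    finally show ?thesis using \<epsilon>(2) by (rule le_less_trans)
  qed
  then show "\<forall>\<^sub>F r in at_right 0. ennreal r * cap1 M (A \<inter> ball y r) (ball y (2 * r)) / emeasure M (ball y r) < a"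
    unfolding eventually_at_right_field using r0(1) by blast
qed simp

lemma thin1D:
  assumes "thin1 M A y" "0 < \<epsilon>"
  shows "\<exists>r0>0. \<forall>r. 0 < r \<longrightarrow> r < r0 \<longrightarrow> cap1 M (A \<inter> ball y r) (ball y (2 * r)) < ennreal (\<epsilon> * (vol y r / r))"
proof -
  have "\<forall>\<^sub>F r in at_right 0. ennreal r * cap1 M (A \<inter> ball y r) (ball y (2 * r)) / emeasure M (ball y r) < ennreal \<epsilon>"
    using assms unfolding thin1_def by (intro order_tendstoD(2)) auto
  then obtain r0 where r0: "r0 > 0" "\<And>r. 0 < r \<Longrightarrow> r < r0 \<Longrightarrow>
      ennreal r * cap1 M (A \<inter> ball y r) (ball y (2 * r)) / emeasure M (ball y r) < ennreal \<epsilon>"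
    unfolding eventually_at_right_field by blast
  have "cap1 M (A \<inter> ball y r) (ball y (2 * r)) < ennreal (\<epsilon> * (vol y r / r))" if r: "0 < r" "r < r0" for r
  proof (rule ccontr)
    assume "\<not> ?thesis"
    then have le: "ennreal (\<epsilon> * (vol y r / r)) \<le> cap1 M (A \<inter> ball y r) (ball y (2 * r))" by simp
    have v: "0 < vol y r" by (rule vol_pos[OF r(1)])
    have "ennreal \<epsilon> = ennreal r * ennreal (\<epsilon> * (vol y r / r)) / ennreal (vol y r)"
      using r v assms(2) by (simp add: ennreal_mult[symmetric] divide_ennreal)
    also have "\<dots> \<le> ennreal r * cap1 M (A \<inter> ball y r) (ball y (2 * r)) / ennreal (vol y r)"
      by (intro divide_right_mono_ennreal mult_left_mono le) auto
    finally show False using r0(2)[OF r] by (simp add: emeasure_ball)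
  qed
  then show ?thesis using r0(1) by blast
qed

text \<open>The analogue of thinness for a family of balls: its cost near \<open>y\<close> is
  negligible against \<open>vol y r / r\<close>. The inclusion of the sets does not bound the radius
  in a general metric space, hence the separate condition \<open>s \<le> r\<close>.\<close>

definition dens_zero :: "('a \<times> real) set \<Rightarrow> 'a \<Rightarrow> bool" where
  "dens_zero \<F> y \<longleftrightarrow> (\<forall>\<epsilon>>0. \<exists>r0>0. \<forall>r. 0 < r \<longrightarrow> r < r0 \<longrightarrow>
     bounded_cost {(p, s)\<in>\<F>. s \<le> r \<and> ball p s \<subseteq> ball y r} (\<epsilon> * (vol y r / r)))"

text \<open>The point is that a doubled ball meeting \<open>ball y r\<close> has radius at most
  \<open>r / 10\<close>. Large balls of the family are finitely many and have positive distance from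
  \<open>y\<close> after doubling. A smaller ball with \<open>s > r / 10\<close> would lie in
  \<open>ball y (14 * s)\<close> and alone use a fixed fraction of
  \<open>vol y (14 * s) / (14 * s)\<close>, against density zero. Hence all relevant balls lie in
  \<open>ball y (2 * r)\<close>, where the density bounds their cost.\<close>

lemma cap1_doubled_balls:
  assumes cost: "bounded_cost \<F> Q" and dens: "dens_zero \<F> y" and bdd: "\<And>p s. (p, s) \<in> \<F> \<Longrightarrow> dist p x0 \<le> R0 \<and> s \<le> R0"
    and out: "\<And>p s. (p, s) \<in> \<F> \<Longrightarrow> 2 * s < dist p y" and \<epsilon>: "0 < \<epsilon>"
  shows "\<exists>r0>0. \<forall>r. 0 < r \<longrightarrow> r < r0 \<longrightarrow>
    (\<exists>\<G>. bounded_cost \<G> (\<epsilon> * (vol y r / r)) \<and> (\<forall>z\<in>(\<Union>(p, s)\<in>\<F>. cball p (2 * s)) \<inter> ball y r. \<exists>(p, s)\<in>\<G>. z \<in> cball p s) \<and>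
      (\<forall>(p, s)\<in>\<G>. ball p (2 * s) \<subseteq> ball y (2 * r)))"
proof -
  have C0: "0 < Cd" using Cd_ge_1 by simp
  \<comment> \<open>\<open>Cd ^ 5\<close> compares \<open>ball y (14 * s)\<close> with
    \<open>ball p s\<close>, the centres being less than \<open>12 * s\<close> apart;
    \<open>Cd ^ 2\<close> pays for passing from \<open>r\<close> to \<open>2 * r\<close> and for
    doubling the balls.\<close>
  define \<epsilon>' where "\<epsilon>' = min (1 / Cd ^ 5) (\<epsilon> / Cd ^ 2)"
  have \<epsilon>': "0 < \<epsilon>'" "\<epsilon>' * Cd ^ 5 \<le> 1" "\<epsilon>' * Cd ^ 2 \<le> \<epsilon>"
  proof -
    show "0 < \<epsilon>'" using \<epsilon> C0 by (simp add: \<epsilon>'_def)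
    have "\<epsilon>' \<le> 1 / Cd ^ 5" "\<epsilon>' \<le> \<epsilon> / Cd ^ 2" by (auto simp: \<epsilon>'_def)
    then show "\<epsilon>' * Cd ^ 5 \<le> 1" "\<epsilon>' * Cd ^ 2 \<le> \<epsilon>" using C0 by (simp_all add: pos_le_divide_eq)
  qed
  obtain r1 where r1: "r1 > 0" "\<And>r. 0 < r \<Longrightarrow> r < r1 \<Longrightarrow>
      bounded_cost {(p, s)\<in>\<F>. s \<le> r \<and> ball p s \<subseteq> ball y r} (\<epsilon>' * (vol y r / r))"
    using dens \<epsilon>'(1) unfolding dens_zero_def by blast
  define s1 where "s1 = r1 / 20"
  have s1: "0 < s1" using r1 by (simp add: s1_def)
  \<comment> \<open>Centres stay in a bounded region and radii between \<open>s1\<close> and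
    \<open>R0\<close>, so each of these balls costs at least a fixed amount.\<close>
  have fin: "finite {(p, s)\<in>\<F>. s1 \<le> s}"
  proof (cases "R0 > 0")
    case True
    obtain n :: nat where "2 * R0 / s1 < 2 ^ n" using real_arch_pow[of 2 "2 * R0 / s1"] by auto
    then have n: "2 * R0 \<le> 2 ^ n * s1" using s1 by (simp add: pos_divide_less_eq)
    define c where "c = vol x0 R0 / Cd ^ n / R0"
    have "0 < c" using True vol_pos C0 by (simp add: c_def)
    moreover have "{(p, s)\<in>\<F>. s1 \<le> s} \<subseteq> {(p, s)\<in>\<F>. c \<le> vol p s / s}"
    proof clarify
      fix p s assume ps: "(p, s) \<in> \<F>" "s1 \<le> s"
      have "vol x0 R0 \<le> Cd ^ n * vol p s1"
        using bdd[OF ps(1)] n s1 by (intro vol_compare) (auto simp: dist_commute)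
      then have "vol x0 R0 / Cd ^ n \<le> vol p s1" using C0 by (simp add: pos_divide_le_eq mult.commute)
      also have "\<dots> \<le> vol p s" using ps by (intro vol_mono subset_ball)
      finally have "c \<le> vol p s / R0" unfolding c_def using True by (intro divide_right_mono) auto
      also have "\<dots> \<le> vol p s / s" using bdd[OF ps(1)] ps s1 True by (intro divide_left_mono) auto
      finally show "c \<le> vol p s / s" .
    qed
    ultimately show ?thesis using bounded_cost_finite_large[OF cost] finite_subset by blast
  next
    case False
    then have "{(p, s)\<in>\<F>. s1 \<le> s} = {}" using bdd s1 by fastforce
    then show ?thesis by (simp only: finite.emptyI)
  qed
  define r2 where "r2 = Min (insert 1 ((\<lambda>(p, s). dist p y - 2 * s) ` {(p, s)\<in>\<F>. s1 \<le> s}))"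
  have r2: "0 < r2" unfolding r2_def using fin out by (subst Min_gr_iff) auto
  have r2_le: "r2 \<le> dist p y - 2 * s" if "(p, s) \<in> \<F>" "s1 \<le> s" for p s
    unfolding r2_def using fin that by (intro Min_le) force+
  show ?thesis
  proof (intro exI[of _ "min (r1 / 2) r2"] conjI allI impI)
    show "0 < min (r1 / 2) r2" using r1 r2 by simp
    fix r assume r: "0 < r" "r < min (r1 / 2) r2"
    define J where "J = {(p, s)\<in>\<F>. dist p y < 2 * s + r}"
    have small: "s \<le> r / 10" if J: "(p, s) \<in> J" for p s
    proof (rule ccontr)
      assume "\<not> ?thesis"
      then have sr: "r < 10 * s" by simp
      have F: "(p, s) \<in> \<F>" and d: "dist p y < 2 * s + r" using J by (auto simp: J_def)
      have s: "0 < s" by (rule bounded_cost_pos[OF cost F])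
      have "s < s1" using r2_le[OF F] d r by force
      then have "14 * s < r1" using r1 by (simp add: s1_def)
      then have "bounded_cost {(p, s')\<in>\<F>. s' \<le> 14 * s \<and> ball p s' \<subseteq> ball y (14 * s)} (\<epsilon>' * (vol y (14 * s) / (14 * s)))"
        using s by (intro r1(2)) auto
      moreover have "ball p s \<subseteq> ball y (14 * s)"
      proof
        fix z assume "z \<in> ball p s"
        then show "z \<in> ball y (14 * s)" using dist_triangle[of y z p] d sr s by (simp add: dist_commute)
      qed
      ultimately have "vol p s / s \<le> \<epsilon>' * (vol y (14 * s) / (14 * s))"
        using bounded_cost_single[of _ _ p s] F s by auto
      also have "\<dots> \<le> \<epsilon>' * (Cd ^ 5 * vol p s / (14 * s))"
        using d sr s \<epsilon>'(1) by (intro mult_left_mono divide_right_mono vol_compare) (auto simp: dist_commute)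
      also have "\<dots> = (\<epsilon>' * Cd ^ 5) * (vol p s / s) / 14" by simp
      also have "\<dots> \<le> 1 * (vol p s / s) / 14"
        using \<epsilon>'(2) s by (intro divide_right_mono mult_right_mono) auto
      finally have "vol p s / s \<le> 0" by simp
      then show False using vol_pos[OF s, of p] s by (simp add: divide_le_0_iff)
    qed
    have "bounded_cost {(p, s)\<in>\<F>. s \<le> 2 * r \<and> ball p s \<subseteq> ball y (2 * r)} (\<epsilon>' * (vol y (2 * r) / (2 * r)))"
      using r by (intro r1(2)) auto
    moreover have "J \<subseteq> {(p, s)\<in>\<F>. s \<le> 2 * r \<and> ball p s \<subseteq> ball y (2 * r)}"
    proof clarify
      fix p s assume J: "(p, s) \<in> J"
      have "ball p s \<subseteq> ball y (2 * r)"
      proof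
        fix z assume "z \<in> ball p s"
        then show "z \<in> ball y (2 * r)"
          using dist_triangle[of y z p] small[OF J] J r by (auto simp: J_def dist_commute)
      qed
      then show "(p, s) \<in> \<F> \<and> s \<le> 2 * r \<and> ball p s \<subseteq> ball y (2 * r)"
        using J small[OF J] r by (auto simp: J_def)
    qed
    moreover have "\<epsilon>' * (vol y (2 * r) / (2 * r)) \<le> \<epsilon>' * (Cd * (vol y r / r))"
    proof (rule mult_left_mono)
      have "vol y (2 * r) / (2 * r) \<le> vol y (2 * r) / r" using r by (intro divide_left_mono) auto
      also have "\<dots> \<le> Cd * vol y r / r" using r vol_double[OF r(1), of y] by (intro divide_right_mono) auto
      finally show "vol y (2 * r) / (2 * r) \<le> Cd * (vol y r / r)" by simp
    qed (use \<epsilon>' in simp)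
    ultimately have "bounded_cost J (\<epsilon>' * (Cd * (vol y r / r)))" by (rule bounded_cost_subset)
    then have "bounded_cost ((\<lambda>(p, s). (p, 2 * s)) ` J) (Cd * (\<epsilon>' * (Cd * (vol y r / r))))" by (rule bounded_cost_double)
    then have c: "bounded_cost ((\<lambda>(p, s). (p, 2 * s)) ` J) (\<epsilon> * (vol y r / r))"
    proof (rule bounded_cost_subset)
      have "Cd * (\<epsilon>' * (Cd * (vol y r / r))) = (\<epsilon>' * Cd ^ 2) * (vol y r / r)" by (simp add: power2_eq_square)
      also have "\<dots> \<le> \<epsilon> * (vol y r / r)" using \<epsilon>'(3) r by (intro mult_right_mono) auto
      finally show "Cd * (\<epsilon>' * (Cd * (vol y r / r))) \<le> \<epsilon> * (vol y r / r)" .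
    qed simp
    show "\<exists>\<G>. bounded_cost \<G> (\<epsilon> * (vol y r / r)) \<and> (\<forall>z\<in>(\<Union>(p, s)\<in>\<F>. cball p (2 * s)) \<inter> ball y r. \<exists>(p, s)\<in>\<G>. z \<in> cball p s) \<and>
      (\<forall>(p, s)\<in>\<G>. ball p (2 * s) \<subseteq> ball y (2 * r))"
    proof (intro exI[of _ "(\<lambda>(p, s). (p, 2 * s)) ` J"] conjI c ballI)
      fix z assume "z \<in> (\<Union>(p, s)\<in>\<F>. cball p (2 * s)) \<inter> ball y r"
      then obtain p s where ps: "(p, s) \<in> \<F>" "dist p z \<le> 2 * s" "dist y z < r" by auto
      then have "(p, s) \<in> J" using dist_triangle[of p y z] by (auto simp: J_def dist_commute)
      then show "\<exists>(p, s)\<in>(\<lambda>(p, s). (p, 2 * s)) ` J. z \<in> cball p s" using ps(2) by force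
    next
      fix B assume "B \<in> (\<lambda>(p, s). (p, 2 * s)) ` J"
      then obtain p s where B: "B = (p, 2 * s)" and J: "(p, s) \<in> J" by auto
      have "ball p (2 * (2 * s)) \<subseteq> ball y (2 * r)"
      proof
        fix z assume "z \<in> ball p (2 * (2 * s))"
        then show "z \<in> ball y (2 * r)"
          using dist_triangle[of y z p] small[OF J] J r by (auto simp: J_def dist_commute)
      qed
      then show "case B of (p, s) \<Rightarrow> ball p (2 * s) \<subseteq> ball y (2 * r)" using B by simp
    qed
  qed
qed

text \<open>The radii in \<open>dens_zero\<close> are at most \<open>r\<close>, so for small \<open>r\<close> only the tail of the family matters,
  and a covering argument bounds the exceptional set by the cost of the tail.\<close>

lemma dens_zero_exceptional:
  assumes cost: "bounded_cost \<F> Q" and "0 < e" "0 < \<kappa>"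
  obtains \<G> where "bounded_cost \<G> e" "{y. \<not> dens_zero \<F> y} \<subseteq> balls \<G>" "\<And>p s. (p, s) \<in> \<G> \<Longrightarrow> s \<le> \<kappa>"
proof -
  have C0: "0 < Cd" using Cd_ge_1 by simp
  let ?S = "\<lambda>z r. {(p, s)\<in>\<F>. s \<le> r \<and> ball p s \<subseteq> ball z r}"
  define Z where "Z k = {z. \<forall>r0>0. \<exists>r. 0 < r \<and> r < r0 \<and> \<not> bounded_cost (?S z r) (1 / real (Suc k) * (vol z r / r))}" for k
  have Z: "{y. \<not> dens_zero \<F> y} \<subseteq> (\<Union>k. Z k)"
  proof clarify
    fix y assume "\<not> dens_zero \<F> y"
    then obtain \<epsilon> where \<epsilon>: "\<epsilon> > 0" "\<And>r0. 0 < r0 \<Longrightarrow> \<exists>r. 0 < r \<and> r < r0 \<and> \<not> bounded_cost (?S y r) (\<epsilon> * (vol y r / r))"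
      unfolding dens_zero_def by blast
    obtain k where k: "1 / real (Suc k) < \<epsilon>" using nat_approx_posE[OF \<epsilon>(1)] by blast
    have "y \<in> Z k"
      unfolding Z_def
    proof (intro CollectI allI impI)
      fix r0 :: real assume "0 < r0"
      then obtain r where r: "0 < r" "r < r0" "\<not> bounded_cost (?S y r) (\<epsilon> * (vol y r / r))" using \<epsilon>(2) by blast
      have "1 / real (Suc k) * (vol y r / r) \<le> \<epsilon> * (vol y r / r)" using k r by (intro mult_right_mono) auto
      then have "\<not> bounded_cost (?S y r) (1 / real (Suc k) * (vol y r / r))"
        using r(3) bounded_cost_subset[OF _ subset_refl] by blast
      then show "\<exists>r. 0 < r \<and> r < r0 \<and> \<not> bounded_cost (?S y r) (1 / real (Suc k) * (vol y r / r))" using r by blast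
    qed
    then show "y \<in> (\<Union>k. Z k)" by blast
  qed
  have cover: "\<exists>\<G>. bounded_cost \<G> (e * (1/2) ^ Suc k) \<and> Z k \<subseteq> balls \<G> \<and> (\<forall>(p, s)\<in>\<G>. s \<le> \<kappa>)" for k
  proof -
    define e' where "e' = e * (1/2) ^ Suc k / (Cd ^ 2 * real (Suc k))"
    have e': "0 < e'" "Cd ^ 2 * (real (Suc k) * e') = e * (1/2) ^ Suc k"
      using \<open>0 < e\<close> C0 by (auto simp: e'_def)
    obtain K0 where K0: "finite K0" "K0 \<subseteq> \<F>" "bounded_cost (\<F> - K0) e'"
      by (rule bounded_cost_tail[OF cost e'(1)])
    \<comment> \<open>Below all radii of the finite part \<open>K0\<close>, so that balls of radius
      less than \<open>s0\<close> belong to the cheap tail; the bound \<open>\<kappa> / 4\<close>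
      anticipates the dilation by 4 in the covering lemma.\<close>
    define s0 where "s0 = Min (insert (\<kappa> / 4) (snd ` K0))"
    have s0: "0 < s0" unfolding s0_def using K0 \<open>0 < \<kappa>\<close> bounded_cost_pos[OF cost] by (subst Min_gr_iff) auto
    have s0_min: "s0 \<le> x" if "x \<in> insert (\<kappa> / 4) (snd ` K0)" for x
      unfolding s0_def using K0(1) that by (intro Min_le) auto
    have s0_le: "s0 \<le> \<kappa> / 4" by (rule s0_min) simp
    have s0_le': "s0 \<le> s" if "(p, s) \<in> K0" for p s using that by (intro s0_min) force
    have "\<exists>r L. 0 < r \<and> r < s0 \<and> finite L \<and> L \<subseteq> ?S z r \<and> 1 / real (Suc k) * (vol z r / r) < (\<Sum>(p, s)\<in>L. vol p s / s)"
      if z: "z \<in> Z k" for z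
    proof -
      obtain r where r: "0 < r" "r < s0" "\<not> bounded_cost (?S z r) (1 / real (Suc k) * (vol z r / r))"
        using z s0 unfolding Z_def by blast
      have "\<forall>(p, s)\<in>?S z r. 0 < s" using bounded_cost_pos[OF cost] by auto
      then obtain L where "finite L" "L \<subseteq> ?S z r" "1 / real (Suc k) * (vol z r / r) < (\<Sum>(p, s)\<in>L. vol p s / s)"
        using r(3) unfolding bounded_cost_def by (meson not_le)
      then show ?thesis using r by blast
    qed
    then have "\<forall>z\<in>Z k. \<exists>r L. 0 < r \<and> r < s0 \<and> finite L \<and> L \<subseteq> ?S z r \<and>
        1 / real (Suc k) * (vol z r / r) < (\<Sum>(p, s)\<in>L. vol p s / s)" by (rule ballI)
    from bchoice[OF this] obtain \<rho> where "\<forall>z\<in>Z k. \<exists>L. 0 < \<rho> z \<and> \<rho> z < s0 \<and> finite L \<and> L \<subseteq> ?S z (\<rho> z) \<and>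
        1 / real (Suc k) * (vol z (\<rho> z) / \<rho> z) < (\<Sum>(p, s)\<in>L. vol p s / s)" by (rule exE)
    from bchoice[OF this] obtain L where \<rho>L: "\<forall>z\<in>Z k. 0 < \<rho> z \<and> \<rho> z < s0 \<and> finite (L z) \<and> L z \<subseteq> ?S z (\<rho> z) \<and>
        1 / real (Suc k) * (vol z (\<rho> z) / \<rho> z) < (\<Sum>(p, s)\<in>L z. vol p s / s)" by (rule exE)
    have L_tail: "L z \<subseteq> \<F> - K0" if "z \<in> Z k" for z
    proof
      fix B assume B: "B \<in> L z"
      obtain p s where ps: "B = (p, s)" by (cases B)
      then have "(p, s) \<in> \<F>" "s < s0" using \<rho>L that B by force+
      then show "B \<in> \<F> - K0" using s0_le'[of p s] ps by auto
    qed
    show ?thesis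
    proof (rule vitali_cover[of "Z k" \<rho> "\<kappa> / 4" "real (Suc k) * e'"])
      show "0 < \<rho> z \<and> \<rho> z \<le> \<kappa> / 4" if "z \<in> Z k" for z
        using \<rho>L that s0_le by force
      fix K assume K: "finite K" "K \<subseteq> Z k" "disjoint_family_on (\<lambda>z. ball z (\<rho> z)) K"
      \<comment> \<open>A ball of the family contained in both \<open>ball z (\<rho> z)\<close> and
        \<open>ball w (\<rho> w)\<close> would make them intersect. So the subfamilies are disjoint
        and their costs together are bounded by the cost of the tail.\<close>
      have disj: "L z \<inter> L w = {}" if zw: "z \<in> K" "w \<in> K" "z \<noteq> w" for z w
      proof (rule ccontr)
        assume "L z \<inter> L w \<noteq> {}"
        then obtain p s where "(p, s) \<in> L z" "(p, s) \<in> L w" by auto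
        then have "ball p s \<subseteq> ball z (\<rho> z)" "ball p s \<subseteq> ball w (\<rho> w)" "(p, s) \<in> \<F>"
          using \<rho>L zw K(2) by blast+
        moreover have "p \<in> ball p s" using bounded_cost_pos[OF cost \<open>(p, s) \<in> \<F>\<close>] by simp
        ultimately have "p \<in> ball z (\<rho> z) \<inter> ball w (\<rho> w)" by blast
        then show False using K(3) zw unfolding disjoint_family_on_def by blast
      qed
      have "(\<Sum>z\<in>K. vol z (\<rho> z) / \<rho> z) \<le> (\<Sum>z\<in>K. real (Suc k) * (\<Sum>(p, s)\<in>L z. vol p s / s))"
      proof (rule sum_mono)
        fix z assume "z \<in> K"
        then have "1 / real (Suc k) * (vol z (\<rho> z) / \<rho> z) \<le> (\<Sum>(p, s)\<in>L z. vol p s / s)"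
          using \<rho>L K(2) by (meson less_imp_le subsetD)
        then have "real (Suc k) * (1 / real (Suc k) * (vol z (\<rho> z) / \<rho> z)) \<le> real (Suc k) * (\<Sum>(p, s)\<in>L z. vol p s / s)"
          by (rule mult_left_mono) simp
        then show "vol z (\<rho> z) / \<rho> z \<le> real (Suc k) * (\<Sum>(p, s)\<in>L z. vol p s / s)" by simp
      qed
      also have "\<dots> = real (Suc k) * (\<Sum>z\<in>K. \<Sum>(p, s)\<in>L z. vol p s / s)" by (simp add: sum_distrib_left)
      also have "(\<Sum>z\<in>K. \<Sum>(p, s)\<in>L z. vol p s / s) = (\<Sum>(p, s)\<in>(\<Union>z\<in>K. L z). vol p s / s)"
      proof (rule sum.UNION_disjoint[symmetric])
        show "\<forall>z\<in>K. finite (L z)" using \<rho>L K(2) by blast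
      qed (use K disj in auto)
      also have "\<dots> \<le> e'"
      proof (rule bounded_cost_sum[OF K0(3)])
        show "finite (\<Union>z\<in>K. L z)" using \<rho>L K by blast
        show "(\<Union>z\<in>K. L z) \<subseteq> \<F> - K0" using L_tail K(2) by blast
      qed
      finally show "(\<Sum>z\<in>K. vol z (\<rho> z) / \<rho> z) \<le> real (Suc k) * e'" by (simp add: mult_left_mono)
    next
      fix \<G> assume "bounded_cost \<G> (Cd ^ 2 * (real (Suc k) * e'))" "Z k \<subseteq> balls \<G>" "\<And>p s. (p, s) \<in> \<G> \<Longrightarrow> s \<le> 4 * (\<kappa> / 4)"
      then show ?thesis unfolding e'(2) by (intro exI[of _ \<G>]) auto
    qed
  qed
  then have "\<forall>k. \<exists>\<G>. bounded_cost \<G> (e * (1/2) ^ Suc k) \<and> Z k \<subseteq> balls \<G> \<and> (\<forall>(p, s)\<in>\<G>. s \<le> \<kappa>)" by (rule allI)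
  from choice[OF this] obtain \<G> where \<G>: "\<forall>k. bounded_cost (\<G> k) (e * (1/2) ^ Suc k) \<and> Z k \<subseteq> balls (\<G> k) \<and> (\<forall>(p, s)\<in>\<G> k. s \<le> \<kappa>)"
    by (rule exE)
  have "bounded_cost (\<Union>k. \<G> k) e"
  proof (rule bounded_cost_UN)
    show "bounded_cost (\<G> k) (e * (1/2) ^ Suc k)" for k using \<G> by blast
    fix n
    have "(\<Sum>k<n. (1/2::real) ^ Suc k) \<le> 1"
      using sum_le_suminf[OF sums_summable[OF power_half_series], of "{..<n}"] sums_unique[OF power_half_series] by simp
    then have "e * (\<Sum>k<n. (1/2::real) ^ Suc k) \<le> e * 1" using \<open>0 < e\<close> by (intro mult_left_mono) auto
    then show "(\<Sum>k<n. e * (1/2) ^ Suc k) \<le> e" by (simp add: sum_distrib_left)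
  qed
  moreover have "{y. \<not> dens_zero \<F> y} \<subseteq> balls (\<Union>k. \<G> k)"
  proof
    fix y assume "y \<in> {y. \<not> dens_zero \<F> y}"
    then obtain k where "y \<in> Z k" using Z by blast
    then have "y \<in> balls (\<G> k)" using \<G> by blast
    then show "y \<in> balls (\<Union>k. \<G> k)" by (auto simp: balls_def)
  qed
  moreover have "s \<le> \<kappa>" if "(p, s) \<in> (\<Union>k. \<G> k)" for p s using \<G> that by blast
  ultimately show thesis by (rule that)
qed

section \<open>From weak upper gradients to upper gradients\<close>

lemma line_integral_cmult_infinite:
  assumes rc: "rect_curve \<gamma> a b" and [measurable]: "\<rho> \<in> borel_measurable borel"
    and inf: "line_integral \<rho> \<gamma> a b = \<infinity>" and \<eta>: "0 < \<eta>"
  shows "line_integral (\<lambda>z. ennreal \<eta> * \<rho> z) \<gamma> a b = \<infinity>"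
proof (rule arc_param_exists[OF rc])
  fix c l assume c: "arc_param c l" and line: "\<And>g. line_integral g \<gamma> a b = (\<integral>\<^sup>+ s. g (c s) * indicator {0..l} s \<partial>lborel)"
  note [measurable] = arc_param_measurable[OF c]
  have "line_integral (\<lambda>z. ennreal \<eta> * \<rho> z) \<gamma> a b = (\<integral>\<^sup>+ s. ennreal \<eta> * (\<rho> (c s) * indicator {0..l} s) \<partial>lborel)"
    unfolding line by (simp add: mult.assoc)
  also have "\<dots> = ennreal \<eta> * (\<integral>\<^sup>+ s. \<rho> (c s) * indicator {0..l} s \<partial>lborel)"
    by (rule nn_integral_cmult) measurable
  also have "\<dots> = \<infinity>" using inf \<eta> unfolding line by (simp add: ennreal_mult_top)
  finally show ?thesis .
qed

text \<open>A small multiple of the function \<open>\<rho>\<close> witnessing zero modulus is added: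
  it has infinite line integral along every exceptional curve, so the inequality becomes trivial
  there. The multiple uses at most half of the slack between the integral of \<open>g\<close> and
  \<open>c\<close>.\<close>

lemma weak_ug_improve:
  assumes weak: "weak_ug M UNIV u g" and int: "(\<integral>\<^sup>+ z. g z \<partial>M) < ennreal c"
  obtains g' where "upper_gradient u g'" "(\<integral>\<^sup>+ z. g' z \<partial>M) < ennreal c"
proof -
  have g [measurable]: "g \<in> borel_measurable borel" using weak by (simp add: weak_ug_def)
  obtain \<rho> :: "'a \<Rightarrow> ennreal" where \<rho> [measurable]: "\<rho> \<in> borel_measurable borel" and fin: "(\<integral>\<^sup>+ z. \<rho> z \<partial>M) < \<infinity>"
    and bad: "\<And>\<gamma> a b. rect_curve \<gamma> a b \<Longrightarrow> \<not> (ennreal \<bar>u (\<gamma> a) - u (\<gamma> b)\<bar> \<le> line_integral g \<gamma> a b) \<Longrightarrow>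
      line_integral \<rho> \<gamma> a b = \<infinity>"
    using weak unfolding weak_ug_def zero_mod1_def by auto
  define I where "I = enn2real (\<integral>\<^sup>+ z. g z \<partial>M)"
  have I: "(\<integral>\<^sup>+ z. g z \<partial>M) = ennreal I"
    unfolding I_def using int by (intro ennreal_enn2real[symmetric]) (auto intro: less_trans)
  have I0: "0 \<le> I" by (simp add: I_def)
  then have Ic: "I < c" using int I by (simp add: ennreal_less_iff)
  define J where "J = enn2real (\<integral>\<^sup>+ z. \<rho> z \<partial>M)"
  have J: "(\<integral>\<^sup>+ z. \<rho> z \<partial>M) = ennreal J" "0 \<le> J" unfolding J_def using fin by auto
  define \<eta> where "\<eta> = (c - I) / (2 * (J + 1))"
  have \<eta>: "0 < \<eta>" using Ic J by (simp add: \<eta>_def)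
  have "\<eta> * J \<le> \<eta> * (J + 1)" using \<eta> by (intro mult_left_mono) auto
  also have "\<dots> = (c - I) / 2"
  proof -
    have "x / (2 * w) * w = x / 2" if "0 < w" for x w :: real using that by simp
    from this[of "J + 1" "c - I"] J(2) show ?thesis by (simp add: \<eta>_def)
  qed
  finally have \<eta>J: "\<eta> * J \<le> (c - I) / 2" .
  define g' where "g' z = g z + ennreal \<eta> * \<rho> z" for z
  show thesis
  proof (rule that[of g'])
    show "upper_gradient u g'"
      unfolding upper_gradient_def
    proof (intro conjI allI impI)
      show "g' \<in> borel_measurable borel" unfolding g'_def[abs_def] by measurable
      fix \<gamma> :: "real \<Rightarrow> 'a" and a b assume rc: "rect_curve \<gamma> a b"
      have mono: "line_integral h \<gamma> a b \<le> line_integral g' \<gamma> a b" if "\<And>z. h z \<le> g' z" for h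
        unfolding line_integral_def using that by (intro nn_integral_mono mult_right_mono) auto
      show "ennreal \<bar>u (\<gamma> a) - u (\<gamma> b)\<bar> \<le> line_integral g' \<gamma> a b"
      proof (cases "ennreal \<bar>u (\<gamma> a) - u (\<gamma> b)\<bar> \<le> line_integral g \<gamma> a b")
        case True
        then show ?thesis using mono[of g] by (rule order_trans) (simp add: g'_def)
      next
        case False
        have "line_integral (\<lambda>z. ennreal \<eta> * \<rho> z) \<gamma> a b = \<infinity>"
          by (rule line_integral_cmult_infinite[OF rc \<rho> bad[OF rc False] \<eta>])
        then have "line_integral g' \<gamma> a b = \<infinity>"
          using mono[of "\<lambda>z. ennreal \<eta> * \<rho> z"] by (simp add: g'_def top_unique)
        then show ?thesis by simp
      qed
    qed
    have "(\<integral>\<^sup>+ z. g' z \<partial>M) = (\<integral>\<^sup>+ z. g z \<partial>M) + (\<integral>\<^sup>+ z. ennreal \<eta> * \<rho> z \<partial>M)"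
      unfolding g'_def by (rule nn_integral_add) measurable
    also have "(\<integral>\<^sup>+ z. ennreal \<eta> * \<rho> z \<partial>M) = ennreal \<eta> * (\<integral>\<^sup>+ z. \<rho> z \<partial>M)"
      by (rule nn_integral_cmult) measurable
    also have "(\<integral>\<^sup>+ z. g z \<partial>M) + ennreal \<eta> * (\<integral>\<^sup>+ z. \<rho> z \<partial>M) = ennreal (I + \<eta> * J)"
      unfolding I J(1) using \<eta> I0 J(2) by (simp add: ennreal_mult[symmetric] ennreal_plus[symmetric] del: ennreal_plus)
    also have "\<dots> < ennreal c"
      using \<eta>J Ic I0 \<eta> J(2) by (intro ennreal_lessI) (auto simp: field_simps)
    finally show "(\<integral>\<^sup>+ z. g' z \<partial>M) < ennreal c" .
  qed
qed

end

section \<open>Covering a thin set\<close>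

lemma dyadic_scale:
  fixes d R :: real
  assumes "0 < d" "d < R"
  obtains n where "R / 2 ^ Suc n \<le> d" "d < R / 2 ^ n"
proof -
  obtain k :: nat where "R / d < 2 ^ k" using real_arch_pow[of 2 "R / d"] by auto
  then have k: "R / 2 ^ k \<le> d" using assms by (simp add: pos_divide_less_eq pos_divide_le_eq mult.commute less_imp_le)
  define n where "n = (LEAST k. R / 2 ^ k \<le> d)"
  have n: "R / 2 ^ n \<le> d" unfolding n_def by (rule LeastI[of "\<lambda>k. R / 2 ^ k \<le> d", OF k])
  have "n \<noteq> 0" using n assms by (intro notI) simp
  then obtain m where m: "n = Suc m" by (cases n) auto
  then have "m < n" by simp
  then have "\<not> R / 2 ^ m \<le> d" unfolding n_def by (rule not_less_Least)
  then show thesis using that[of m] n m by simp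
qed

text \<open>The index \<open>halving m i\<close> moves up to \<open>i\<close> only if \<open>m\<close> has dropped by a factor two, so that
  \<open>m\<close> is summable along the range of this index and stays comparable to \<open>m i\<close>.\<close>

fun halving :: "(nat \<Rightarrow> real) \<Rightarrow> nat \<Rightarrow> nat" where
  "halving m 0 = 0"
| "halving m (Suc i) = (if m (Suc i) \<le> m (halving m i) / 2 then Suc i else halving m i)"

lemma halving_le: "halving m i \<le> i"
  by (induction i) auto

lemma halving_bound:
  assumes "\<And>i. 0 < m i"
  shows "m (halving m i) \<le> 2 * m i"
  using assms[of i] assms[of 0] by (cases i) auto

lemma halving_const: "halving m i \<le> j \<Longrightarrow> j \<le> i \<Longrightarrow> halving m j = halving m i"
proof (induction i)
  case (Suc i)
  then show ?case by (cases "j = Suc i") (auto split: if_splits)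
qed simp

context doubling_measure
begin

text \<open>A new family enters only when the index jumps, and at each jump \<open>m\<close> at
  least halves, so the costs are dominated by a geometric series. The remaining factor 2 compares
  \<open>m\<close> at the index in force with \<open>m i\<close>.\<close>

lemma halving_union_cost:
  fixes \<C> :: "nat \<Rightarrow> ('a \<times> real) set"
  assumes m: "\<And>i. 0 < m i" and C: "0 \<le> C" and \<C>: "\<And>i. bounded_cost (\<C> i) (C * m i)"
  shows "bounded_cost (\<Union>n\<in>{i..}. \<C> (halving m n)) (4 * C * m i)"
proof -
  let ?b = "halving m"
  \<comment> \<open>\<open>l = 0\<close> counts as new because the family in force at
    \<open>i\<close> may have been chosen at an earlier scale.\<close>
  define new where "new l \<longleftrightarrow> l = 0 \<or> ?b (i + l) = i + l" for l
  define H where "H l = (if new l then \<C> (?b (i + l)) else {})" for l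
  define Q where "Q l = (if new l then C * m (?b (i + l)) else 0)" for l
  have "bounded_cost (H l) (Q l)" for l
    using \<C> by (auto simp: H_def Q_def bounded_cost_def)
  moreover have "(\<Sum>l<n. Q l) \<le> 4 * C * m i" for n
  proof -
    \<comment> \<open>The subtracted term carries the induction: a jump adds \<open>C * m\<close> at
      the new index, and twice that is at most \<open>C * m\<close> at the old one.\<close>
    have *: "(\<Sum>l<Suc n. Q l) \<le> 2 * C * m (?b i) - C * m (?b (i + n))" for n
    proof (induction n)
      case 0
      then show ?case by (simp add: Q_def new_def)
    next
      case (Suc n)
      show ?case
      proof (cases "m (Suc (i + n)) \<le> m (?b (i + n)) / 2")
        case True
        then have "C * m (Suc (i + n)) \<le> C * (m (?b (i + n)) / 2)" using C by (rule mult_left_mono)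
        then show ?thesis using Suc True by (simp add: Q_def new_def)
      next
        case False
        then have "\<not> new (Suc n)" using halving_le[of m "i + n"] by (simp add: new_def)
        then show ?thesis using Suc False by (simp add: Q_def)
      qed
    qed
    have le: "2 * C * m (?b i) \<le> 4 * C * m i"
      using mult_left_mono[OF halving_bound[where m = m and i = i, OF m], of "2 * C"] C by simp
    have nonneg: "0 \<le> C * m k" for k using C m[of k] by simp
    show ?thesis
    proof (cases n)
      case 0
      then show ?thesis using nonneg[of i] by simp
    next
      case (Suc k)
      have "(\<Sum>l<Suc k. Q l) \<le> 2 * C * m (?b i)" using *[of k] nonneg[of "?b (i + k)"] by linarith
      then show ?thesis using le Suc by simp
    qed
  qed
  ultimately have cost: "bounded_cost (\<Union>l. H l) (4 * C * m i)" by (rule bounded_cost_UN)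
  have "\<C> (?b (i + l)) \<subseteq> (\<Union>l. H l)" for l
  proof (induction l)
    case 0
    have "\<C> (?b (i + 0)) = H 0" by (simp add: H_def new_def)
    then show ?case by blast
  next
    case (Suc l)
    show ?case
    proof (cases "new (Suc l)")
      case True
      then have "\<C> (?b (i + Suc l)) = H (Suc l)" by (simp add: H_def)
      then show ?thesis by blast
    next
      case False
      then have "?b (i + Suc l) = ?b (i + l)" by (auto simp: new_def split: if_splits)
      then show ?thesis using Suc by simp
    qed
  qed
  then have "(\<Union>n\<in>{i..}. \<C> (?b n)) \<subseteq> (\<Union>l. H l)"
    by (metis (no_types, lifting) SUP_least atLeast_iff le_iff_add)
  with cost show ?thesis by (rule bounded_cost_subset) simp
qed

lemma thin_sequence:
  assumes thin: "thin1 M A x" and R: "0 < R" and e: "0 < e"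
  obtains R' \<epsilon> where "0 < R'" "R' \<le> R" "\<And>i. 0 < \<epsilon> i \<and> \<epsilon> i < e" "\<epsilon> \<longlonglongrightarrow> 0"
    "\<And>i. cap1 M (A \<inter> ball x (R' / 2 ^ i)) (ball x (2 * (R' / 2 ^ i))) < ennreal (\<epsilon> i * (vol x (R' / 2 ^ i) / (R' / 2 ^ i)))"
proof -
  define r where "r i = R / 2 ^ i" for i :: nat
  define q where "q i = vol x (r i) / r i" for i
  define cap where "cap i = cap1 M (A \<inter> ball x (r i)) (ball x (2 * r i))" for i
  have r: "0 < r i" for i using R by (simp add: r_def)
  have q: "0 < q i" for i using r vol_pos by (simp add: q_def)
  have r_lim: "r \<longlonglongrightarrow> 0"
    unfolding r_def using tendsto_mult[OF tendsto_const[of R] LIMSEQ_power_zero[of "1/2::real"]]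
    by (simp add: power_divide)
  have cap_small: "\<forall>\<^sub>F i in sequentially. cap i < ennreal (d * q i)" if d: "0 < d" for d
  proof -
    obtain r0 where "r0 > 0" "\<And>s. 0 < s \<Longrightarrow> s < r0 \<Longrightarrow> cap1 M (A \<inter> ball x s) (ball x (2 * s)) < ennreal (d * (vol x s / s))"
      using thin1D[OF thin d] by blast
    moreover have "\<forall>\<^sub>F i in sequentially. r i < r0" using r_lim \<open>r0 > 0\<close> by (rule order_tendstoD(2))
    ultimately show ?thesis using r by (auto elim!: eventually_mono simp: cap_def q_def)
  qed
  \<comment> \<open>The normalized capacity plus a null sequence, which makes
    \<open>\<epsilon>\<close> positive and the capacity bound strict. Dropping the first
    \<open>k\<close> scales then gives \<open>\<epsilon> i < e\<close>.\<close>
  define \<epsilon> where "\<epsilon> i = enn2real (cap i) / q i + 1 / real (Suc i)" for i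
  have \<epsilon>_pos: "0 < \<epsilon> i" for i unfolding \<epsilon>_def using q[of i] by (intro add_nonneg_pos) auto
  have \<epsilon>_lim: "\<epsilon> \<longlonglongrightarrow> 0"
  proof -
    have "(\<lambda>i. enn2real (cap i) / q i) \<longlonglongrightarrow> 0"
    proof (rule LIMSEQ_I)
      fix d :: real assume "0 < d"
      from cap_small[OF this] obtain N where N: "\<And>i. i \<ge> N \<Longrightarrow> cap i < ennreal (d * q i)"
        by (auto simp: eventually_sequentially)
      have "norm (enn2real (cap i) / q i - 0) < d" if "i \<ge> N" for i
      proof -
        have "enn2real (cap i) < d * q i"
          using N[OF that] q[of i] \<open>0 < d\<close> by (subst enn2real_less_iff) (auto intro: less_trans)
        then show ?thesis using q[of i] by (simp add: pos_divide_less_eq)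
      qed
      then show "\<exists>N. \<forall>i\<ge>N. norm (enn2real (cap i) / q i - 0) < d" by blast
    qed
    from tendsto_add[OF this LIMSEQ_Suc[OF lim_1_over_n]] show ?thesis by (simp add: \<epsilon>_def[abs_def])
  qed
  have "\<forall>\<^sub>F i in sequentially. \<epsilon> i < e" using \<epsilon>_lim e by (rule order_tendstoD(2))
  with cap_small[of 1] have "\<forall>\<^sub>F i in sequentially. \<epsilon> i < e \<and> cap i < ennreal (1 * q i)"
    by (simp add: eventually_conj)
  then obtain k where k: "\<And>i. i \<ge> k \<Longrightarrow> \<epsilon> i < e" "\<And>i. i \<ge> k \<Longrightarrow> cap i < ennreal (1 * q i)"
    by (auto simp: eventually_sequentially)
  have cap: "cap i < ennreal (\<epsilon> i * q i)" if "i \<ge> k" for i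
  proof -
    have "cap i < \<infinity>" using k(2)[OF that] by (rule less_trans) simp
    then have "cap i = ennreal (enn2real (cap i))" by simp
    also have "\<dots> < ennreal (\<epsilon> i * q i)"
    proof (rule ennreal_lessI)
      show "enn2real (cap i) < \<epsilon> i * q i" using q[of i] by (simp add: \<epsilon>_def distrib_right)
      show "0 < \<epsilon> i * q i" using \<epsilon>_pos q by simp
    qed
    finally show ?thesis .
  qed
  have rk: "r (i + k) = (R / 2 ^ k) / 2 ^ i" for i by (simp add: r_def power_add mult.commute)
  show thesis
  proof (rule that[of "R / 2 ^ k" "\<lambda>i. \<epsilon> (i + k)"])
    show "0 < R / 2 ^ k" using R by simp
    show "R / 2 ^ k \<le> R" using R by (simp add: divide_le_eq mult_le_cancel_left1)
    show "0 < \<epsilon> (i + k) \<and> \<epsilon> (i + k) < e" for i using \<epsilon>_pos k by simp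
    show "(\<lambda>i. \<epsilon> (i + k)) \<longlonglongrightarrow> 0" using \<epsilon>_lim by (rule LIMSEQ_ignore_initial_segment)
    show "cap1 M (A \<inter> ball x (R / 2 ^ k / 2 ^ i)) (ball x (2 * (R / 2 ^ k / 2 ^ i))) < ennreal (\<epsilon> (i + k) * (vol x (R / 2 ^ k / 2 ^ i) / (R / 2 ^ k / 2 ^ i)))" for i
      using cap[of "i + k"] by (simp add: cap_def q_def rk)
  qed
qed

end

section \<open>Covers of sets of small capacity and of thin sets\<close>

context poincare_space
begin

text \<open>An admissible function drops by at least 1 along every curve from \<open>A\<close> to
  the complement of \<open>ball x (2 * r)\<close>, so each of its upper gradients fulfils the curve
  condition of the boxing inequality.\<close>

lemma capacity_cover:
  obtains C r0 :: real where "1 \<le> C" "0 < r0"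
    "\<And>x r c A. 0 < r \<Longrightarrow> r < r0 \<Longrightarrow> A \<subseteq> ball x r \<Longrightarrow> 0 < c \<Longrightarrow> cap1 M A (ball x (2 * r)) < ennreal c \<Longrightarrow>
      \<exists>\<F>. bounded_cost \<F> (C * c) \<and> A \<subseteq> balls \<F> \<and> (\<forall>(p, s)\<in>\<F>. s \<le> C * r)"
proof (rule boxing_inequality)
  fix C r0 :: real
  assume C: "1 \<le> C" "0 < r0"
    and box: "\<And>x r g c A. 0 < r \<Longrightarrow> r < r0 \<Longrightarrow> A \<subseteq> ball x r \<Longrightarrow> g \<in> borel_measurable borel \<Longrightarrow> 0 < c \<Longrightarrow>
      (\<integral>\<^sup>+ z. g z * indicator (ball x (3 * r)) z \<partial>M) < ennreal c \<Longrightarrow>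
      (\<And>\<gamma> a b. rect_curve \<gamma> a b \<Longrightarrow> \<gamma> a \<in> A \<Longrightarrow> \<gamma> b \<notin> ball x (2 * r) \<Longrightarrow> 1 \<le> line_integral g \<gamma> a b) \<Longrightarrow>
      \<exists>\<F>. bounded_cost \<F> (C * c) \<and> A \<subseteq> balls \<F> \<and> (\<forall>(p, s)\<in>\<F>. s \<le> C * r)"
  show thesis
  proof (rule that[OF C])
    fix x r c A
    assume r: "0 < r" "r < r0" and A: "A \<subseteq> ball x r" and c: "0 < c" and cap: "cap1 M A (ball x (2 * r)) < ennreal c"
    obtain u g where u: "in_N11_0 M (ball x (2 * r)) u" "\<forall>z\<in>A. 1 \<le> u z" and g: "weak_ug M UNIV u g" "(\<integral>\<^sup>+ z. g z \<partial>M) < ennreal c"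
      using cap unfolding cap1_def INF_less_iff by blast
    show "\<exists>\<F>. bounded_cost \<F> (C * c) \<and> A \<subseteq> balls \<F> \<and> (\<forall>(p, s)\<in>\<F>. s \<le> C * r)"
    proof (rule weak_ug_improve[OF g])
      fix g' assume ug: "upper_gradient u g'" and int: "(\<integral>\<^sup>+ z. g' z \<partial>M) < ennreal c"
      have "(\<integral>\<^sup>+ z. g' z * indicator (ball x (3 * r)) z \<partial>M) \<le> (\<integral>\<^sup>+ z. g' z \<partial>M)"
        by (intro nn_integral_mono) (auto simp: indicator_def)
      then have int': "(\<integral>\<^sup>+ z. g' z * indicator (ball x (3 * r)) z \<partial>M) < ennreal c" using int by (rule le_less_trans)
      show ?thesis
      proof (rule box[OF r A upper_gradient_borel[OF ug] c int'])
        fix \<gamma> a b assume \<gamma>: "rect_curve \<gamma> a b" "\<gamma> a \<in> A" "\<gamma> b \<notin> ball x (2 * r)"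
        have "1 \<le> \<bar>u (\<gamma> a) - u (\<gamma> b)\<bar>" using u \<gamma> by (auto simp: in_N11_0_def)
        then have "1 \<le> ennreal \<bar>u (\<gamma> a) - u (\<gamma> b)\<bar>" by (simp add: ennreal_ge_1)
        also have "\<dots> \<le> line_integral g' \<gamma> a b" using ug \<gamma>(1) unfolding upper_gradient_def by blast
        finally show "1 \<le> line_integral g' \<gamma> a b" .
      qed
    qed
  qed
qed

text \<open>A curve from \<open>x\<close> either stays in \<open>{\<bar>u\<bar> \<ge> 1/2}\<close>, a set of small measure, or meets its complement,
  where \<open>u\<close> has dropped by \<open>1/2\<close>.\<close>

lemma point_capacity_zero:
  assumes cap: "Cap1 M {x} = 0" and \<delta>: "0 < \<delta>"
  shows "\<exists>s. 0 < s \<and> s < \<delta> \<and> vol x s / s < \<delta>"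
proof (rule boxing_inequality)
  fix C r0 :: real
  assume C: "1 \<le> C" "0 < r0"
    and box: "\<And>x r g c A. 0 < r \<Longrightarrow> r < r0 \<Longrightarrow> A \<subseteq> ball x r \<Longrightarrow> g \<in> borel_measurable borel \<Longrightarrow> 0 < c \<Longrightarrow>
      (\<integral>\<^sup>+ z. g z * indicator (ball x (3 * r)) z \<partial>M) < ennreal c \<Longrightarrow>
      (\<And>\<gamma> a b. rect_curve \<gamma> a b \<Longrightarrow> \<gamma> a \<in> A \<Longrightarrow> \<gamma> b \<notin> ball x (2 * r) \<Longrightarrow> 1 \<le> line_integral g \<gamma> a b) \<Longrightarrow>
      \<exists>\<F>. bounded_cost \<F> (C * c) \<and> A \<subseteq> balls \<F> \<and> (\<forall>(p, s)\<in>\<F>. s \<le> C * r)"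
  define r where "r = min (r0 / 2) (\<delta> / (2 * C))"
  have r: "0 < r" "r < r0" using C \<delta> by (auto simp: r_def)
  have "r \<le> \<delta> / (2 * C)" by (simp add: r_def)
  then have "2 * (C * r) \<le> \<delta>" using C by (simp add: pos_le_divide_eq mult_ac)
  moreover have "0 < C * r" using C r by simp
  ultimately have Cr: "C * r < \<delta>" by linarith
  \<comment> \<open>The cover ball containing \<open>x\<close> costs at most \<open>C * c\<close>;
    recentring it at \<open>x\<close> costs another factor \<open>Cd\<close>, and the product is
    half of \<open>\<delta>\<close>.\<close>
  define c where "c = \<delta> / (2 * C * Cd)"
  have c: "0 < c" using \<delta> C Cd_ge_1 by (simp add: c_def)
  have cC: "Cd * (C * c) = \<delta> / 2" using C Cd_ge_1 by (simp add: c_def)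
  \<comment> \<open>The test function below is \<open>2 * g'\<close> plus \<open>1 / r\<close> on a
    set of measure at most \<open>2 * e\<close>; its integral is at most
    \<open>(2 + 2 / r) * e\<close>, which this choice makes \<open>c / 2\<close>.\<close>
  define e where "e = c / (2 * (2 + 2 / r))"
  have r2: "0 < 2 + 2 / r" using r by (simp add: add_pos_pos)
  have e: "0 < e" using c r2 by (simp add: e_def)
  have e_sum: "(2 + 2 / r) * e = c / 2"
  proof -
    have "w * (y / (2 * w)) = y / 2" if "0 < w" for w y :: real using that by simp
    from this[OF r2] show ?thesis unfolding e_def .
  qed
  have "Cap1 M {x} < ennreal e" using cap e by simp
  then obtain u where u: "in_N11 M UNIV u" "1 \<le> u x" "N11_norm M UNIV u < ennreal e"
    unfolding Cap1_def INF_less_iff by auto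
  have u_meas: "u \<in> borel_measurable (completion M)" using u(1) by (simp add: in_N11_def)
  have u_int: "(\<integral>\<^sup>+ z. ennreal \<bar>u z\<bar> \<partial>completion M) < ennreal e"
    using u(3) unfolding N11_norm_def by (auto intro: le_less_trans[rotated])
  have "(INF g \<in> {g. weak_ug M UNIV u g}. \<integral>\<^sup>+ z. g z * indicator UNIV z \<partial>M) < ennreal e"
    using u(3) unfolding N11_norm_def by (rule le_less_trans[rotated]) simp
  then obtain g where g: "weak_ug M UNIV u g" "(\<integral>\<^sup>+ z. g z \<partial>M) < ennreal e"
    unfolding INF_less_iff by auto
  let ?T = "{z. 1/2 \<le> \<bar>u z\<bar>}"
  have T: "?T \<in> sets (completion M)"
  proof -
    have "{z \<in> space (completion M). 1/2 \<le> \<bar>u z\<bar>} \<in> sets (completion M)" using u_meas by measurable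
    then show ?thesis by simp
  qed
  \<comment> \<open>\<open>u\<close> is measurable only for the completion, but the function in the
    boxing inequality must be Borel; so the set is enlarged to a Borel set of equal measure.\<close>
  obtain S where S: "S \<in> sets M" "?T \<subseteq> S" "emeasure (completion M) ?T = emeasure M S"
    using completion_upper[OF T] by blast
  have S_small: "emeasure M S \<le> ennreal (2 * e)"
  proof -
    have "ennreal (1/2) * emeasure M S = (\<integral>\<^sup>+ z. ennreal (1/2) * indicator ?T z \<partial>completion M)"
      using T S(3) by (simp add: nn_integral_cmult_indicator)
    also have "\<dots> \<le> (\<integral>\<^sup>+ z. ennreal \<bar>u z\<bar> \<partial>completion M)"
    proof (rule nn_integral_mono)
      fix z
      show "ennreal (1/2) * indicator ?T z \<le> ennreal \<bar>u z\<bar>"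
        using ennreal_leI[of "1/2" "\<bar>u z\<bar>"] by (cases "z \<in> ?T") auto
    qed
    also have "\<dots> \<le> ennreal e" using u_int by simp
    finally have "ennreal 2 * (ennreal (1/2) * emeasure M S) \<le> ennreal 2 * ennreal e" by (rule mult_left_mono) simp
    moreover have "ennreal 2 * (ennreal (1/2) * emeasure M S) = emeasure M S"
      unfolding mult.assoc[symmetric] by (subst ennreal_mult[symmetric]) auto
    ultimately show ?thesis using e by (simp add: ennreal_mult)
  qed
  show ?thesis
  proof (rule weak_ug_improve[OF g])
    fix g' assume ug: "upper_gradient u g'" and g'_int: "(\<integral>\<^sup>+ z. g' z \<partial>M) < ennreal e"
    note g'_meas [measurable] = upper_gradient_borel[OF ug]
    have S_borel [measurable]: "S \<in> sets borel" using S(1) by (simp add: sets_M)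
    define h where "h z = ennreal 2 * g' z + ennreal (1 / r) * indicator S z" for z
    have h_meas: "h \<in> borel_measurable borel" unfolding h_def[abs_def] by measurable
    have "(\<integral>\<^sup>+ z. h z * indicator (ball x (3 * r)) z \<partial>M) \<le> (\<integral>\<^sup>+ z. h z \<partial>M)"
      by (intro nn_integral_mono) (auto simp: indicator_def)
    also have "(\<integral>\<^sup>+ z. h z \<partial>M) = (\<integral>\<^sup>+ z. ennreal 2 * g' z \<partial>M) + (\<integral>\<^sup>+ z. ennreal (1 / r) * indicator S z \<partial>M)"
      unfolding h_def by (rule nn_integral_add) measurable
    also have "\<dots> = ennreal 2 * (\<integral>\<^sup>+ z. g' z \<partial>M) + ennreal (1 / r) * emeasure M S"
    proof (intro arg_cong2[where f = "(+)"])
      show "(\<integral>\<^sup>+ z. ennreal 2 * g' z \<partial>M) = ennreal 2 * (\<integral>\<^sup>+ z. g' z \<partial>M)" by (rule nn_integral_cmult) measurable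
      show "(\<integral>\<^sup>+ z. ennreal (1 / r) * indicator S z \<partial>M) = ennreal (1 / r) * emeasure M S"
        using S(1) by (rule nn_integral_cmult_indicator)
    qed
    also have "\<dots> \<le> ennreal 2 * ennreal e + ennreal (1 / r) * ennreal (2 * e)"
      using g'_int S_small by (intro add_mono mult_left_mono) auto
    also have "\<dots> = ennreal (2 * e) + ennreal (1 / r * (2 * e))"
      using e r by (simp only: ennreal_mult[symmetric] less_imp_le zero_le_divide_1_iff mult_nonneg_nonneg zero_le_numeral)
    also have "\<dots> = ennreal ((2 + 2 / r) * e)"
      using e r by (subst ennreal_plus[symmetric]) (auto simp: algebra_simps)
    also have "\<dots> < ennreal c" unfolding e_sum using c by (intro ennreal_lessI) auto
    finally have h_int: "(\<integral>\<^sup>+ z. h z * indicator (ball x (3 * r)) z \<partial>M) < ennreal c" .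
    have xr: "{x} \<subseteq> ball x r" using r by simp
    have "\<exists>\<F>. bounded_cost \<F> (C * c) \<and> {x} \<subseteq> balls \<F> \<and> (\<forall>(p, s)\<in>\<F>. s \<le> C * r)"
    proof (rule box[OF r xr h_meas c h_int])
      fix \<gamma> a b assume rc: "rect_curve \<gamma> a b" and ends: "\<gamma> a \<in> {x}" "\<gamma> b \<notin> ball x (2 * r)"
      show "1 \<le> line_integral h \<gamma> a b"
      proof (rule arc_param_exists[OF rc])
        fix k l assume k: "arc_param k l" "k 0 = \<gamma> a" "k l = \<gamma> b"
          and line: "\<And>g. line_integral g \<gamma> a b = (\<integral>\<^sup>+ s. g (k s) * indicator {0..l} s \<partial>lborel)"
        have l: "0 < l" using k(1) by (simp add: arc_param_def)
        note [measurable] = arc_param_measurable[OF k(1)]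
        show ?thesis
        proof (cases "\<forall>s\<in>{0..l}. k s \<in> S")
          case True
          have "2 * r \<le> dist (k 0) (k l)" using ends k by simp
          also have "\<dots> \<le> l" using arc_param_dist[OF k(1), of 0 l] l by simp
          finally have "1 \<le> 1 / r * l" using r by (simp add: pos_le_divide_eq)
          then have "1 \<le> ennreal (1 / r * l)" by (simp add: ennreal_ge_1)
          also have "\<dots> = ennreal (1 / r) * emeasure lborel {0..l}" using r l ennreal_mult[of "1 / r" l] by simp
          also have "\<dots> = (\<integral>\<^sup>+ s. ennreal (1 / r) * indicator {0..l} s \<partial>lborel)"
            by (rule nn_integral_cmult_indicator[symmetric]) simp
          also have "\<dots> \<le> line_integral h \<gamma> a b"
            unfolding line using True by (intro nn_integral_mono) (auto simp: indicator_def h_def)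
          finally show ?thesis .
        next
          case False
          then obtain s where s: "s \<in> {0..l}" "k s \<notin> S" by blast
          then have "\<bar>u (k s)\<bar> < 1/2" using S(2) by force
          then have "1/2 \<le> \<bar>u (k 0) - u (k s)\<bar>" using u(2) ends k by auto
          then have "ennreal (1/2) \<le> ennreal \<bar>u (k 0) - u (k s)\<bar>" by (rule ennreal_leI)
          also have "\<dots> \<le> (\<integral>\<^sup>+ t. g' (k t) * indicator {0..s} t \<partial>lborel)"
            using s by (intro upper_gradientD[OF ug k(1)]) auto
          also have "\<dots> \<le> (\<integral>\<^sup>+ t. g' (k t) * indicator {0..l} t \<partial>lborel)"
            using s by (intro nn_integral_mono) (auto simp: indicator_def)
          finally have "ennreal 2 * ennreal (1/2) \<le> ennreal 2 * (\<integral>\<^sup>+ t. g' (k t) * indicator {0..l} t \<partial>lborel)"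
            by (rule mult_left_mono) simp
          also have "\<dots> = (\<integral>\<^sup>+ t. ennreal 2 * (g' (k t) * indicator {0..l} t) \<partial>lborel)"
            by (rule nn_integral_cmult[symmetric]) measurable
          also have "\<dots> \<le> line_integral h \<gamma> a b"
            unfolding line by (intro nn_integral_mono) (auto simp: indicator_def h_def)
          finally show ?thesis by (subst (asm) ennreal_mult[symmetric]) auto
        qed
      qed
    qed
    then obtain \<F> p s where \<F>: "bounded_cost \<F> (C * c)" "(p, s) \<in> \<F>" "x \<in> ball p s" "s \<le> C * r"
      by (auto simp: balls_def)
    have s: "0 < s" by (rule bounded_cost_pos[OF \<F>(1,2)])
    have "vol x s \<le> Cd ^ 1 * vol p s"
      using \<F>(3) s by (intro vol_compare) (auto simp: dist_commute)
    then have "vol x s / s \<le> Cd * (vol p s / s)" using s by (simp add: divide_right_mono)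
    also have "\<dots> \<le> Cd * (C * c)"
      using bounded_cost_single[OF \<F>(1,2)] Cd_ge_1 by (intro mult_left_mono) auto
    also have "\<dots> < \<delta>" using cC \<delta> by simp
    finally show ?thesis using s \<F>(4) Cr by (intro exI[of _ s]) auto
  qed
qed

text \<open>The cost bound, the density at \<open>x\<close> and the position of the balls all come
  from the same sequence \<open>m\<close>. Density holds because a ball lying in
  \<open>ball x \<rho>\<close> was selected for a point of \<open>A\<close> closer to
  \<open>x\<close> than \<open>\<rho>\<close>, hence belongs to the part of the family starting at
  the scale of \<open>\<rho>\<close>, which costs at most a multiple of \<open>m\<close>
  there.\<close>

lemma thin_cover:
  assumes thin: "thin1 M A x" and xA: "x \<notin> A"
  obtains C R where "0 < C" "0 < R" "R \<le> 1"
    "\<And>\<rho>. 0 < \<rho> \<Longrightarrow> \<rho> < R \<Longrightarrow> \<exists>\<F> B. bounded_cost \<F> (C * (vol x \<rho> / \<rho>)) \<and> A \<inter> ball x \<rho> \<subseteq> balls \<F> \<and> dens_zero \<F> x \<and>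
      (\<forall>(p, s)\<in>\<F>. 2 * s < dist p x \<and> dist p x \<le> B \<and> s \<le> B)"
proof (rule capacity_cover)
  fix C r0 :: real
  assume C: "1 \<le> C" "0 < r0"
    and cover: "\<And>x r c A. 0 < r \<Longrightarrow> r < r0 \<Longrightarrow> A \<subseteq> ball x r \<Longrightarrow> 0 < c \<Longrightarrow> cap1 M A (ball x (2 * r)) < ennreal c \<Longrightarrow>
      \<exists>\<F>. bounded_cost \<F> (C * c) \<and> A \<subseteq> balls \<F> \<and> (\<forall>(p, s)\<in>\<F>. s \<le> C * r)"
  have Cd0: "0 < Cd" using Cd_ge_1 by simp
  \<comment> \<open>Adjusted to the exclusion of \<open>x\<close> below: there a ball costs at least
    \<open>q j / (Cd ^ 3 * C)\<close> and less than \<open>2 * C * e * q j\<close>, and this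
    \<open>e\<close> makes both equal.\<close>
  define e where "e = 1 / (2 * C * (Cd ^ 3 * C))"
  have e: "0 < e" using C Cd0 by (simp add: e_def)
  have R0: "0 < min 1 (r0 / 2)" using C by simp
  show thesis
  proof (rule thin_sequence[OF thin R0 e])
    fix R \<epsilon>
    assume R: "0 < R" "R \<le> min 1 (r0 / 2)" and \<epsilon>: "\<And>i. 0 < \<epsilon> i \<and> \<epsilon> i < e" and \<epsilon>_lim: "\<epsilon> \<longlonglongrightarrow> 0"
      and cap: "\<And>i. cap1 M (A \<inter> ball x (R / 2 ^ i)) (ball x (2 * (R / 2 ^ i))) < ennreal (\<epsilon> i * (vol x (R / 2 ^ i) / (R / 2 ^ i)))"
    define r where "r i = R / 2 ^ i" for i :: nat
    have r: "0 < r i" "r i < r0" for i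
    proof -
      have "r i \<le> R" using R(1) by (simp add: r_def divide_le_eq mult_le_cancel_left1)
      then show "r i < r0" using R(2) C(2) by linarith
    qed (use R in \<open>simp add: r_def\<close>)
    have r_Suc: "r i = 2 * r (Suc i)" for i by (simp add: r_def)
    have r_less: "r j < r i \<longleftrightarrow> i < j" for i j
      using R(1) by (simp add: r_def field_simps)
    have r_anti: "r j \<le> r i" if "i \<le> j" for i j
      using r_less[of i j] that by (cases "i = j") (auto intro: less_imp_le)
    define q where "q i = vol x (r i) / r i" for i
    have q: "0 < q i" for i using r vol_pos by (simp add: q_def)
    define m where "m i = \<epsilon> i * q i" for i
    have m: "0 < m i" for i using \<epsilon> q by (simp add: m_def)
    have "\<forall>i. \<exists>\<F>. bounded_cost \<F> (C * m i) \<and> A \<inter> ball x (r i) \<subseteq> balls \<F> \<and> (\<forall>(p, s)\<in>\<F>. s \<le> C * r i)"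
      using cap m r by (intro allI cover) (auto simp: m_def q_def r_def)
    from choice[OF this] obtain \<C> where "\<forall>i. bounded_cost (\<C> i) (C * m i) \<and> A \<inter> ball x (r i) \<subseteq> balls (\<C> i) \<and> (\<forall>(p, s)\<in>\<C> i. s \<le> C * r i)"
      by (rule exE)
    then have \<C>: "\<And>i. bounded_cost (\<C> i) (C * m i)" "\<And>i. A \<inter> ball x (r i) \<subseteq> balls (\<C> i)"
      "\<And>i p s. (p, s) \<in> \<C> i \<Longrightarrow> s \<le> C * r i" by blast+
    let ?b = "halving m"
    \<comment> \<open>From the cover in force at scale \<open>n\<close>, only balls containing a
      point of \<open>A\<close> in the \<open>n\<close>-th annulus are kept. This ties each ball to
      a scale even though the cover was made for a larger ball around \<open>x\<close>.\<close>
    define \<F> where "\<F> i = {(p, s). \<exists>n\<ge>i. (p, s) \<in> \<C> (?b n) \<and> (\<exists>a\<in>A \<inter> ball p s. r (Suc n) \<le> dist x a \<and> dist x a < r n)}" for i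
    have cost: "bounded_cost (\<F> i) (4 * C * m i)" for i
    proof (rule bounded_cost_subset)
      show "bounded_cost (\<Union>n\<in>{i..}. \<C> (?b n)) (4 * C * m i)"
        using m C \<C>(1) by (intro halving_union_cost) auto
    qed (auto simp: \<F>_def)
    have q_compare: "q n \<le> Cd * (vol x \<rho> / \<rho>)" if \<rho>: "r (Suc n) \<le> \<rho>" "\<rho> < r n" for n \<rho>
    proof -
      have \<rho>0: "0 < \<rho>" using r(1)[of "Suc n"] \<rho> by linarith
      have "vol x (r n) \<le> vol x (2 * \<rho>)" using \<rho> r_Suc[of n] by (intro vol_mono subset_ball) auto
      also have "\<dots> \<le> Cd * vol x \<rho>" by (rule vol_double[OF \<rho>0])
      finally have "q n \<le> Cd * vol x \<rho> / r n" unfolding q_def using r(1)[of n] by (intro divide_right_mono) auto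
      also have "\<dots> \<le> Cd * vol x \<rho> / \<rho>" using \<rho> \<rho>0 Cd0 by (intro divide_left_mono) auto
      finally show ?thesis by simp
    qed
    have dens: "dens_zero (\<F> i) x" for i
      unfolding dens_zero_def
    proof (intro allI impI)
      fix d :: real assume d: "0 < d"
      have K: "0 < 4 * C * Cd" using C Cd0 by simp
      have "\<forall>\<^sub>F n in sequentially. \<epsilon> n < d / (4 * C * Cd)"
        using \<epsilon>_lim d K by (intro order_tendstoD(2)) auto
      then obtain N where N: "\<And>n. n \<ge> N \<Longrightarrow> \<epsilon> n < d / (4 * C * Cd)" by (auto simp: eventually_sequentially)
      show "\<exists>r0>0. \<forall>\<rho>. 0 < \<rho> \<longrightarrow> \<rho> < r0 \<longrightarrow> bounded_cost {(p, s)\<in>\<F> i. s \<le> \<rho> \<and> ball p s \<subseteq> ball x \<rho>} (d * (vol x \<rho> / \<rho>))"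
      proof (intro exI[of _ "r N"] conjI allI impI)
        fix \<rho> assume \<rho>: "0 < \<rho>" "\<rho> < r N"
        have "r N \<le> R" using r_anti[of 0 N] by (simp add: r_def)
        then have "\<rho> < R" using \<rho> by linarith
        obtain n where n: "r (Suc n) \<le> \<rho>" "\<rho> < r n"
          using dyadic_scale[OF \<rho>(1) \<open>\<rho> < R\<close>] unfolding r_def by blast
        have "r (Suc n) < r N" using n(1) \<rho>(2) by linarith
        then have "N < Suc n" by (simp add: r_less)
        then have nN: "N \<le> n" by simp
        have "{(p, s)\<in>\<F> i. s \<le> \<rho> \<and> ball p s \<subseteq> ball x \<rho>} \<subseteq> \<F> n"
        proof clarify
          fix p s assume ps: "(p, s) \<in> \<F> i" "ball p s \<subseteq> ball x \<rho>"
          then obtain n' a where n': "(p, s) \<in> \<C> (?b n')" "a \<in> A \<inter> ball p s" "r (Suc n') \<le> dist x a" "dist x a < r n'"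
            by (auto simp: \<F>_def)
          have "dist x a < \<rho>" using n'(2) ps(2) by auto
          then have "r (Suc n') < r n" using n'(3) n(2) by linarith
          then have "n \<le> n'" by (simp add: r_less)
          then show "(p, s) \<in> \<F> n" unfolding \<F>_def using n' by blast
        qed
        moreover have "4 * C * m n \<le> d * (vol x \<rho> / \<rho>)"
        proof -
          have "4 * C * m n \<le> 4 * C * (\<epsilon> n * (Cd * (vol x \<rho> / \<rho>)))"
            unfolding m_def using q_compare[OF n] \<epsilon>[of n] C by (intro mult_left_mono) auto
          also have "\<dots> = (4 * C * Cd * \<epsilon> n) * (vol x \<rho> / \<rho>)" by simp
          also have "\<dots> \<le> d * (vol x \<rho> / \<rho>)"
          proof (rule mult_right_mono)
            show "4 * C * Cd * \<epsilon> n \<le> d" using N[OF nN] K by (simp add: pos_less_divide_eq mult.commute)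
          qed (use \<rho> in auto)
          finally show ?thesis .
        qed
        ultimately show "bounded_cost {(p, s)\<in>\<F> i. s \<le> \<rho> \<and> ball p s \<subseteq> ball x \<rho>} (d * (vol x \<rho> / \<rho>))"
          by (rule bounded_cost_subset[OF cost])
      qed (rule r)
    qed
    have out: "2 * s < dist p x" if ps: "(p, s) \<in> \<F> i" for p s i
    proof (rule ccontr)
      assume "\<not> ?thesis"
      then have px: "dist p x \<le> 2 * s" by simp
      obtain n a where n: "(p, s) \<in> \<C> (?b n)" "a \<in> ball p s" "r (Suc n) \<le> dist x a"
        using ps by (auto simp: \<F>_def)
      have s: "0 < s" by (rule bounded_cost_pos[OF cost ps])
      have "dist x a < 3 * s" using px n(2) dist_triangle[of x a p] by (simp add: dist_commute)
      then have rn: "r n < 6 * s" using n(3) r_Suc[of n] by linarith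
      \<comment> \<open>A scale comparable to \<open>s\<close> is needed at which the same cover is
        still in force: at \<open>?b n\<close> the scale is large enough by the radius bound of the
        cover, and at \<open>n\<close> it is less than \<open>6 * s\<close>.\<close>
      have "\<exists>j. ?b n \<le> j \<and> j \<le> n \<and> s \<le> C * r j \<and> r j < 6 * s"
      proof (cases "s \<le> C * r n")
        case True
        then show ?thesis using rn halving_le by blast
      next
        case False
        \<comment> \<open>The first scale that is too small for \<open>s\<close>; the one just
          before is large enough and only twice as big, hence comparable to
          \<open>s\<close>.\<close>
        define j where "j = (LEAST j. ?b n \<le> j \<and> \<not> s \<le> C * r j)"
        have Pn: "?b n \<le> n \<and> \<not> s \<le> C * r n" using False halving_le by blast
        have j: "?b n \<le> j \<and> \<not> s \<le> C * r j" unfolding j_def by (rule LeastI[of "\<lambda>j. ?b n \<le> j \<and> \<not> s \<le> C * r j", OF Pn])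
        have jn: "j \<le> n" unfolding j_def by (rule Least_le[where P = "\<lambda>j. ?b n \<le> j \<and> \<not> s \<le> C * r j", OF Pn])
        have "j \<noteq> ?b n" using j \<C>(3)[OF n(1)] by auto
        then obtain k where k: "j = Suc k" "?b n \<le> k" using j by (cases j) auto
        then have "k < j" by simp
        then have "\<not> (?b n \<le> k \<and> \<not> s \<le> C * r k)" unfolding j_def by (rule not_less_Least)
        then have sk: "s \<le> C * r k" using k by blast
        have "C * r j < s" using j by simp
        moreover have "1 * r j \<le> C * r j" using C r(1)[of j] by (intro mult_right_mono) auto
        ultimately have "r k < 6 * s" using r_Suc[of k] k(1) s by simp
        then show ?thesis using sk k jn by (intro exI[of _ k]) auto
      qed
      then obtain j where j: "?b n \<le> j" "j \<le> n" "s \<le> C * r j" "r j < 6 * s" by blast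
      have "vol x (r j) \<le> Cd ^ 3 * vol p s"
        using px j(4) s by (intro vol_compare) (auto simp: dist_commute)
      then have "vol x (r j) / (Cd ^ 3) \<le> vol p s" using Cd0 by (simp add: pos_divide_le_eq mult.commute)
      then have "vol x (r j) / (Cd ^ 3) / s \<le> vol p s / s" using s by (intro divide_right_mono) auto
      moreover have "vol x (r j) / (Cd ^ 3) / (C * r j) \<le> vol x (r j) / (Cd ^ 3) / s"
        using j(3) s C r(1)[of j] Cd0 by (intro divide_left_mono) auto
      moreover have "vol x (r j) / (Cd ^ 3) / (C * r j) = q j / (Cd ^ 3 * C)" by (simp add: q_def)
      moreover have "vol p s / s \<le> C * m (?b n)" by (rule bounded_cost_single[OF \<C>(1) n(1)])
      \<comment> \<open>Between \<open>?b n\<close> and \<open>n\<close> the index does not change,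
        so \<open>m\<close> at the index in force is at most twice \<open>m j\<close>.\<close>
      moreover have "C * m (?b n) \<le> C * (2 * m j)"
        using halving_bound[where m = m and i = j, OF m] halving_const[OF j(1,2)] C by (intro mult_left_mono) auto
      ultimately have "q j / (Cd ^ 3 * C) \<le> 2 * C * \<epsilon> j * q j" by (simp add: m_def mult_ac)
      then have "1 / (Cd ^ 3 * C) * q j \<le> 2 * C * \<epsilon> j * q j" by simp
      then have "1 / (Cd ^ 3 * C) \<le> 2 * C * \<epsilon> j" using q[of j] by (rule mult_right_le_imp_le)
      moreover have "2 * C * \<epsilon> j < 2 * C * e" using \<epsilon>[of j] C by simp
      moreover have "2 * C * e = 1 / (Cd ^ 3 * C)" using C Cd0 by (simp add: e_def)
      ultimately show False by simp
    qed
    \<comment> \<open>\<open>4 * C\<close> is the cost factor of the glued family, \<open>e\<close>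
      bounds \<open>\<epsilon> i\<close>, and \<open>Cd\<close> compares the dyadic scale with
      \<open>\<rho>\<close>.\<close>
    have K0: "0 < 4 * C * e * Cd" using C e Cd0 by simp
    show thesis
    proof (rule that[OF K0 R(1)])
      show "R \<le> 1" using R(2) by simp
      fix \<rho> assume \<rho>: "0 < \<rho>" "\<rho> < R"
      obtain i where i: "r (Suc i) \<le> \<rho>" "\<rho> < r i"
        using dyadic_scale[OF \<rho>] unfolding r_def by blast
      have "4 * C * m i \<le> 4 * C * (e * (Cd * (vol x \<rho> / \<rho>)))"
        unfolding m_def using q_compare[OF i] \<epsilon>[of i] q[of i] C e by (intro mult_left_mono mult_mono) auto
      then have c: "bounded_cost (\<F> i) (4 * C * e * Cd * (vol x \<rho> / \<rho>))"
        by (intro bounded_cost_subset[OF cost subset_refl]) (simp add: mult_ac)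
      have sub: "A \<inter> ball x \<rho> \<subseteq> balls (\<F> i)"
      proof
        fix a assume a: "a \<in> A \<inter> ball x \<rho>"
        then have d: "0 < dist x a" "dist x a < \<rho>" using xA by auto
        then have "dist x a < R" using \<rho> by linarith
        obtain n where n: "r (Suc n) \<le> dist x a" "dist x a < r n"
          using dyadic_scale[OF d(1) \<open>dist x a < R\<close>] unfolding r_def by blast
        have "r (Suc n) < r i" using n(1) d(2) i(2) by linarith
        then have ni: "i \<le> n" by (simp add: r_less)
        have "a \<in> A \<inter> ball x (r (?b n))" using a n(2) r_anti[OF halving_le[of m n]] by auto
        then have "a \<in> balls (\<C> (?b n))" using \<C>(2) by blast
        then obtain p s where ps: "(p, s) \<in> \<C> (?b n)" "a \<in> ball p s" by (auto simp: balls_def)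
        then have "(p, s) \<in> \<F> i" unfolding \<F>_def using ni n a by blast
        then show "a \<in> balls (\<F> i)" unfolding balls_def using ps(2) by (intro UN_I[of "(p, s)"]) simp_all
      qed
      have bdd: "dist p x \<le> C * R + R \<and> s \<le> C * R + R" if ps: "(p, s) \<in> \<F> i" for p s
      proof -
        obtain n a where n: "(p, s) \<in> \<C> (?b n)" "a \<in> ball p s" "dist x a < r n"
          using ps by (auto simp: \<F>_def)
        have rR: "r k \<le> R" for k using r_anti[of 0 k] by (simp add: r_def)
        have "s \<le> C * r (?b n)" by (rule \<C>(3)[OF n(1)])
        also have "\<dots> \<le> C * R" using rR C by (intro mult_left_mono) auto
        finally have "s \<le> C * R" .
        moreover have "dist p x \<le> dist p a + dist x a" using dist_triangle[of p x a] by (simp add: dist_commute)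
        ultimately show ?thesis using n(2,3) rR[of n] R(1) by auto
      qed
      show "\<exists>\<F> B. bounded_cost \<F> (4 * C * e * Cd * (vol x \<rho> / \<rho>)) \<and> A \<inter> ball x \<rho> \<subseteq> balls \<F> \<and> dens_zero \<F> x \<and>
        (\<forall>(p, s)\<in>\<F>. 2 * s < dist p x \<and> dist p x \<le> B \<and> s \<le> B)"
        using c sub dens[of i] out bdd by (intro exI[of _ "\<F> i"] exI[of _ "C * R + R"]) auto
    qed
  qed
qed

section \<open>Finely open neighbourhoods\<close>

text \<open>Near a point of the set its complement consists of two pieces: the closed doubled balls,
  whose cost near \<open>y\<close> is negligible by \<open>cap1_doubled_balls\<close>, and the
  points of nonzero density, which have covers of arbitrarily small cost. Both covers yield one
  admissible function for the variational capacity.\<close>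

lemma fine_complement:
  assumes cost: "bounded_cost \<F> Q" and bdd: "\<And>p s. (p, s) \<in> \<F> \<Longrightarrow> dist p x0 \<le> B \<and> s \<le> B" and V: "open V"
  shows "finely_open1 M {y\<in>V. dens_zero \<F> y \<and> (\<forall>(p, s)\<in>\<F>. 2 * s < dist p y)}" (is "finely_open1 M ?W")
  unfolding finely_open1_def
proof
  fix y assume y: "y \<in> ?W"
  have Cd0: "0 < Cd" using Cd_ge_1 by simp
  obtain d where d: "0 < d" "ball y d \<subseteq> V" using V y by (auto simp: open_contains_ball)
  show "thin1 M (- ?W) y"
  proof (rule thin1I)
    fix \<epsilon> :: real assume "0 < \<epsilon>"
    \<comment> \<open>Two covers of cost \<open>\<epsilon>1 * (vol y r / r)\<close> each, and the
      factor \<open>Cd ^ 2\<close> from cost to capacity.\<close>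
    define \<epsilon>1 where "\<epsilon>1 = \<epsilon> / (2 * Cd ^ 2)"
    have \<epsilon>1: "0 < \<epsilon>1" "Cd ^ 2 * (2 * \<epsilon>1) = \<epsilon>" using \<open>0 < \<epsilon>\<close> Cd0 by (auto simp: \<epsilon>1_def)
    have out: "2 * s < dist p y" if "(p, s) \<in> \<F>" for p s using y that by auto
    obtain r0 where r0: "r0 > 0" "\<And>r. 0 < r \<Longrightarrow> r < r0 \<Longrightarrow>
        \<exists>\<G>. bounded_cost \<G> (\<epsilon>1 * (vol y r / r)) \<and> (\<forall>z\<in>(\<Union>(p, s)\<in>\<F>. cball p (2 * s)) \<inter> ball y r. \<exists>(p, s)\<in>\<G>. z \<in> cball p s) \<and>
          (\<forall>(p, s)\<in>\<G>. ball p (2 * s) \<subseteq> ball y (2 * r))"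
      using cap1_doubled_balls[OF cost _ bdd out \<epsilon>1(1)] y by blast
    show "\<exists>r0>0. \<forall>r. 0 < r \<longrightarrow> r < r0 \<longrightarrow> cap1 M (- ?W \<inter> ball y r) (ball y (2 * r)) \<le> ennreal (\<epsilon> * (vol y r / r))"
    proof (intro exI[of _ "min r0 d"] conjI allI impI)
      show "0 < min r0 d" using r0 d by simp
      fix r assume r: "0 < r" "r < min r0 d"
      from r have "0 < r" "r < r0" by auto
      from r0(2)[OF this] obtain \<G> where \<G>': "bounded_cost \<G> (\<epsilon>1 * (vol y r / r)) \<and>
          (\<forall>z\<in>(\<Union>(p, s)\<in>\<F>. cball p (2 * s)) \<inter> ball y r. \<exists>(p, s)\<in>\<G>. z \<in> cball p s) \<and>
          (\<forall>(p, s)\<in>\<G>. ball p (2 * s) \<subseteq> ball y (2 * r))" by (rule exE)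
      then have \<G>: "bounded_cost \<G> (\<epsilon>1 * (vol y r / r))"
        "\<And>z. z \<in> (\<Union>(p, s)\<in>\<F>. cball p (2 * s)) \<inter> ball y r \<Longrightarrow> \<exists>(p, s)\<in>\<G>. z \<in> cball p s"
        "\<And>p s. (p, s) \<in> \<G> \<Longrightarrow> ball p (2 * s) \<subseteq> ball y (2 * r)"
        by blast+
      \<comment> \<open>Radii at most \<open>r / 8\<close> keep the doubled balls that are centred
        close to \<open>ball y r\<close> inside \<open>ball y (2 * r)\<close>.\<close>
      have "0 < \<epsilon>1 * (vol y r / r)" "0 < r / 8" using \<epsilon>1 r vol_pos[of r y] by auto
      then obtain \<H> where \<H>: "bounded_cost \<H> (\<epsilon>1 * (vol y r / r))" "{y. \<not> dens_zero \<F> y} \<subseteq> balls \<H>"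
        "\<And>p s. (p, s) \<in> \<H> \<Longrightarrow> s \<le> r / 8"
        by (rule dens_zero_exceptional[OF cost]) (rule that)
      let ?H = "{(p, s)\<in>\<H>. dist p y < s + r}"
      have "bounded_cost ?H (\<epsilon>1 * (vol y r / r))" by (rule bounded_cost_subset[OF \<H>(1)]) auto
      then have "bounded_cost (\<G> \<union> ?H) (\<epsilon>1 * (vol y r / r) + \<epsilon>1 * (vol y r / r))"
        by (rule bounded_cost_Un[OF \<G>(1)])
      then have "cap1 M (- ?W \<inter> ball y r) (ball y (2 * r)) \<le> ennreal (Cd ^ 2 * (\<epsilon>1 * (vol y r / r) + \<epsilon>1 * (vol y r / r)))"
      proof (rule cap1_le)
        fix z assume z: "z \<in> - ?W \<inter> ball y r"
        then have "z \<in> V" using d r by auto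
        then consider "\<not> dens_zero \<F> z" | p s where "(p, s) \<in> \<F>" "dist p z \<le> 2 * s" using z by force
        then show "\<exists>(p, s)\<in>\<G> \<union> ?H. z \<in> cball p s"
        proof cases
          case 1
          then obtain p s where ps: "(p, s) \<in> \<H>" "z \<in> ball p s" using \<H>(2) by (auto simp: balls_def)
          have "dist p y < s + r" using ps(2) z dist_triangle[of p y z] by (simp add: dist_commute)
          then show ?thesis using ps by (intro bexI[of _ "(p, s)"]) auto
        next
          case (2 p s)
          then have "z \<in> (\<Union>(p, s)\<in>\<F>. cball p (2 * s)) \<inter> ball y r"
            using z by (intro IntI UN_I[of "(p, s)"]) auto
          then show ?thesis using \<G>(2) by blast
        qed
      next
        fix p s assume "(p, s) \<in> \<G> \<union> ?H"
        then show "ball p (2 * s) \<subseteq> ball y (2 * r)"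
        proof
          assume ps: "(p, s) \<in> ?H"
          show ?thesis
          proof
            fix z assume "z \<in> ball p (2 * s)"
            then show "z \<in> ball y (2 * r)"
              using ps \<H>(3)[of p s] dist_triangle[of y z p] r by (auto simp: dist_commute)
          qed
        qed (rule \<G>(3))
      qed
      also have "Cd ^ 2 * (\<epsilon>1 * (vol y r / r) + \<epsilon>1 * (vol y r / r)) = Cd ^ 2 * (2 * \<epsilon>1) * (vol y r / r)" by simp
      finally show "cap1 M (- ?W \<inter> ball y r) (ball y (2 * r)) \<le> ennreal (\<epsilon> * (vol y r / r))"
        unfolding \<epsilon>1(2) .
    qed
  qed
qed

text \<open>The norm is bounded by \<open>vol x \<rho> / \<rho>\<close> with a constant independent
  of \<open>\<rho>\<close>. This serves both claims of the theorem: any small \<open>\<rho>\<close>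
  gives existence, and radii along which the quotient tends to zero give small norm.\<close>

lemma fine_neighbourhood:
  assumes fopen: "finely_open1 M U" and xU: "x \<in> U"
  obtains C R where "0 < C" "0 < R"
    "\<And>\<rho>. 0 < \<rho> \<Longrightarrow> \<rho> < R \<Longrightarrow> \<exists>W w. finely_open1 M W \<and> x \<in> W \<and> W \<subseteq> U \<and> in_N11_0 M U w
      \<and> (\<forall>z. 0 \<le> w z \<and> w z \<le> 1) \<and> (\<forall>z\<in>W. w z = 1) \<and> compact (supp w) \<and> supp w \<subseteq> U
      \<and> N11_norm M UNIV w \<le> ennreal (C * (vol x \<rho> / \<rho>))"
proof -
  have thin: "thin1 M (- U) x" using fopen xU by (simp add: finely_open1_def)
  have xA: "x \<notin> - U" using xU by simp
  show thesis
  proof (rule thin_cover[OF thin xA])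
    fix C R
    assume C: "0 < C" and R: "0 < R" "R \<le> 1"
      and cover: "\<And>\<rho>. 0 < \<rho> \<Longrightarrow> \<rho> < R \<Longrightarrow> \<exists>\<F> B. bounded_cost \<F> (C * (vol x \<rho> / \<rho>)) \<and> - U \<inter> ball x \<rho> \<subseteq> balls \<F> \<and> dens_zero \<F> x \<and>
        (\<forall>(p, s)\<in>\<F>. 2 * s < dist p x \<and> dist p x \<le> B \<and> s \<le> B)"
    \<comment> \<open>The 1 pays for the integral of \<open>w\<close>, as \<open>\<rho> < 1\<close>;
      \<open>4 * Cd ^ 2\<close> for the gradient of the cutoff at radius \<open>\<rho> / 4\<close>;
      \<open>Cd ^ 2 * C\<close> for that of the family.\<close>
    have C': "0 < 1 + (4 * Cd ^ 2 + Cd ^ 2 * C)" using C Cd_ge_1 by (simp add: add_pos_nonneg)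
    show thesis
    proof (rule that[OF C' R(1)])
      fix \<rho> assume \<rho>: "0 < \<rho>" "\<rho> < R"
      obtain \<F> B where cost: "bounded_cost \<F> (C * (vol x \<rho> / \<rho>))" and sub: "- U \<inter> ball x \<rho> \<subseteq> balls \<F>"
        and dens: "dens_zero \<F> x" and \<F>: "\<And>p s. (p, s) \<in> \<F> \<Longrightarrow> 2 * s < dist p x \<and> dist p x \<le> B \<and> s \<le> B"
        using cover[OF \<rho>] by blast
      \<comment> \<open>Outside the closed doubled balls the family function vanishes, and in
        \<open>ball x (\<rho> / 4)\<close> the cutoff is 1, so \<open>w = 1\<close> on this set. It
        contains \<open>x\<close> because the thin cover keeps \<open>x\<close> outside the closed
        doubled balls.\<close>
      define W where "W = {y\<in>ball x (\<rho> / 4). dens_zero \<F> y \<and> (\<forall>(p, s)\<in>\<F>. 2 * s < dist p y)}"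
      have W_open: "finely_open1 M W"
        unfolding W_def using \<F> by (intro fine_complement[OF cost, of x B]) auto
      have xW: "x \<in> W" unfolding W_def using \<rho> dens \<F> by auto
      have s_pos: "0 < s" if "(p, s) \<in> \<F>" for p s by (rule bounded_cost_pos[OF cost that])
      have balls_U: "z \<in> U" if "z \<in> ball x \<rho>" "z \<notin> balls \<F>" for z using sub that by blast
      have WU: "W \<subseteq> U"
      proof
        fix z assume z: "z \<in> W"
        have "z \<notin> balls \<F>" using z s_pos by (fastforce simp: W_def balls_def)
        moreover have "z \<in> ball x \<rho>" using z \<rho> by (auto simp: W_def)
        ultimately show "z \<in> U" using balls_U by blast
      qed
      show "\<exists>W w. finely_open1 M W \<and> x \<in> W \<and> W \<subseteq> U \<and> in_N11_0 M U w
        \<and> (\<forall>z. 0 \<le> w z \<and> w z \<le> 1) \<and> (\<forall>z\<in>W. w z = 1) \<and> compact (supp w) \<and> supp w \<subseteq> U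
        \<and> N11_norm M UNIV w \<le> ennreal ((1 + (4 * Cd ^ 2 + Cd ^ 2 * C)) * (vol x \<rho> / \<rho>))"
      proof (rule family_function[OF cost])
        fix \<eta> :: "'a \<Rightarrow> real" and G :: "'a \<Rightarrow> ennreal"
        assume \<eta>_open: "\<And>t. open {z. t < \<eta> z}" and \<eta>01: "\<And>z. 0 \<le> \<eta> z \<and> \<eta> z \<le> 1"
          and \<eta>1: "\<And>p s z. (p, s) \<in> \<F> \<Longrightarrow> z \<in> cball p s \<Longrightarrow> \<eta> z = 1"
          and \<eta>0: "\<And>z. (\<And>p s. (p, s) \<in> \<F> \<Longrightarrow> z \<notin> ball p (2 * s)) \<Longrightarrow> \<eta> z = 0"
          and ug: "upper_gradient \<eta> G" and G_int: "(\<integral>\<^sup>+ z. G z \<partial>M) \<le> ennreal (Cd ^ 2 * (C * (vol x \<rho> / \<rho>)))"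
        have [measurable]: "\<eta> \<in> borel_measurable borel" using \<eta>_open by (intro borel_measurableI_greater) auto
        define s where "s = \<rho> / 4"
        have s: "0 < s" using \<rho> by (simp add: s_def)
        let ?\<phi> = "cutoff x s"
        let ?g = "\<lambda>z. ennreal (1 / s * cutoff x (2 * s) z)"
        have ug\<phi>: "upper_gradient ?\<phi> ?g" by (rule cutoff_upper_gradient[OF s])
        have [measurable]: "?\<phi> \<in> borel_measurable borel"
          by (rule borel_measurable_continuous_onI[OF cutoff_continuous[OF s]])
        note [measurable] = upper_gradient_borel[OF ug] upper_gradient_borel[OF ug\<phi>]
        define w where "w z = min (?\<phi> z) (1 - \<eta> z)" for z
        have w01: "0 \<le> w z \<and> w z \<le> 1" for z
          using cutoff_bounds[of x s z] \<eta>01[of z] by (auto simp: w_def)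
        have w_meas: "w \<in> borel_measurable borel" unfolding w_def[abs_def] by measurable
        have w_supp: "z \<in> cball x (2 * s) \<inter> - balls \<F>" if "w z \<noteq> 0" for z
        proof -
          have "?\<phi> z \<noteq> 0" using that \<eta>01[of z] by (auto simp: w_def)
          then have "z \<in> ball x (2 * s)" using cutoff_zero[OF s] by blast
          moreover have "\<eta> z \<noteq> 1" using that cutoff_bounds[of x s z] by (auto simp: w_def)
          then have "z \<notin> balls \<F>" using \<eta>1 by (fastforce simp: balls_def)
          ultimately show ?thesis by auto
        qed
        have "open (balls \<F>)" by (auto simp: balls_def)
        \<comment> \<open>The support avoids the open set \<open>balls \<F>\<close>, which covers
          the complement of \<open>U\<close> in \<open>ball x \<rho>\<close>. So even the closure of
          the set where \<open>w\<close> is nonzero stays inside \<open>U\<close>.\<close>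
        then have closed: "closed (cball x (2 * s) \<inter> - balls \<F>)" by (intro closed_Int) auto
        have supp_sub: "supp w \<subseteq> cball x (2 * s) \<inter> - balls \<F>"
          unfolding supp_def using w_supp by (intro closure_minimal closed) auto
        have compact: "compact (supp w)"
        proof -
          have "compact (cball x (2 * s) \<inter> supp w)"
            by (intro compact_Int_closed compact_cball) (simp add: supp_def)
          moreover have "cball x (2 * s) \<inter> supp w = supp w" using supp_sub by blast
          ultimately show ?thesis by simp
        qed
        have core_U: "cball x (2 * s) \<inter> - balls \<F> \<subseteq> U"
        proof
          fix z assume "z \<in> cball x (2 * s) \<inter> - balls \<F>"
          then show "z \<in> U" using \<rho> by (intro balls_U) (auto simp: s_def)
        qed
        have w_ug: "upper_gradient w (\<lambda>z. ?g z + G z)"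
        proof (rule upper_gradientI)
          show "(\<lambda>z. ?g z + G z) \<in> borel_measurable borel" by measurable
          fix c :: "real \<Rightarrow> 'a" and l assume c: "arc_param c l"
          note [measurable] = arc_param_measurable[OF c]
          have l: "0 \<le> l" using c by (simp add: arc_param_def)
          have "\<bar>w (c 0) - w (c l)\<bar> \<le> \<bar>?\<phi> (c 0) - ?\<phi> (c l)\<bar> + \<bar>\<eta> (c 0) - \<eta> (c l)\<bar>"
            unfolding w_def by linarith
          then have "ennreal \<bar>w (c 0) - w (c l)\<bar> \<le> ennreal (\<bar>?\<phi> (c 0) - ?\<phi> (c l)\<bar> + \<bar>\<eta> (c 0) - \<eta> (c l)\<bar>)"
            by (rule ennreal_leI)
          also have "\<dots> = ennreal \<bar>?\<phi> (c 0) - ?\<phi> (c l)\<bar> + ennreal \<bar>\<eta> (c 0) - \<eta> (c l)\<bar>"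
            by (rule ennreal_plus) auto
          also have "\<dots> \<le> (\<integral>\<^sup>+ t. ?g (c t) * indicator {0..l} t \<partial>lborel) + (\<integral>\<^sup>+ t. G (c t) * indicator {0..l} t \<partial>lborel)"
            using l by (intro add_mono upper_gradientD[OF ug\<phi> c] upper_gradientD[OF ug c]) auto
          also have "\<dots> = (\<integral>\<^sup>+ t. ?g (c t) * indicator {0..l} t + G (c t) * indicator {0..l} t \<partial>lborel)"
            by (rule nn_integral_add[symmetric]) measurable
          also have "\<dots> = (\<integral>\<^sup>+ t. (?g (c t) + G (c t)) * indicator {0..l} t \<partial>lborel)"
            by (simp add: distrib_right)
          finally show "ennreal \<bar>w (c 0) - w (c l)\<bar> \<le> \<dots>" .
        qed
        have w_int: "(\<integral>\<^sup>+ z. ?g z + G z \<partial>M) \<le> ennreal ((4 * Cd ^ 2 + Cd ^ 2 * C) * (vol x \<rho> / \<rho>))"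
        proof -
          have "(\<integral>\<^sup>+ z. ?g z + G z \<partial>M) = (\<integral>\<^sup>+ z. ?g z \<partial>M) + (\<integral>\<^sup>+ z. G z \<partial>M)"
            by (rule nn_integral_add) measurable
          also have "\<dots> \<le> ennreal (Cd ^ 2 * (vol x s / s)) + ennreal (Cd ^ 2 * (C * (vol x \<rho> / \<rho>)))"
            by (intro add_mono cutoff_gradient_integral[OF s] G_int)
          also have "\<dots> = ennreal (Cd ^ 2 * (vol x s / s) + Cd ^ 2 * (C * (vol x \<rho> / \<rho>)))"
            using s \<rho> C by (intro ennreal_plus[symmetric]) auto
          also have "\<dots> \<le> ennreal ((4 * Cd ^ 2 + Cd ^ 2 * C) * (vol x \<rho> / \<rho>))"
          proof (rule ennreal_leI)
            have "vol x s \<le> vol x \<rho>" using \<rho> by (intro vol_mono subset_ball) (simp add: s_def)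
            then have "vol x s / s \<le> vol x \<rho> / s" using s by (intro divide_right_mono) auto
            then have "vol x s / s \<le> 4 * (vol x \<rho> / \<rho>)" by (simp add: s_def mult.commute)
            then have "Cd ^ 2 * (vol x s / s) \<le> Cd ^ 2 * (4 * (vol x \<rho> / \<rho>))" by (intro mult_left_mono) auto
            then show "Cd ^ 2 * (vol x s / s) + Cd ^ 2 * (C * (vol x \<rho> / \<rho>)) \<le> (4 * Cd ^ 2 + Cd ^ 2 * C) * (vol x \<rho> / \<rho>)"
              by (simp add: algebra_simps)
          qed
          finally show ?thesis .
        qed
        have w_out: "w z = 0" if "z \<notin> ball x \<rho>" for z
          using w_supp[of z] that \<rho> by (auto simp: s_def)
        note N11 = in_N11_bounded[OF w_meas w01 w_out w_ug w_int]
        have "N11_norm M UNIV w \<le> ennreal (vol x \<rho> + (4 * Cd ^ 2 + Cd ^ 2 * C) * (vol x \<rho> / \<rho>))"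
          using N11(1) C \<rho> by (simp add: ennreal_plus)
        also have "\<dots> \<le> ennreal ((1 + (4 * Cd ^ 2 + Cd ^ 2 * C)) * (vol x \<rho> / \<rho>))"
        proof (rule ennreal_leI)
          have "vol x \<rho> * \<rho> \<le> vol x \<rho> * 1" using \<rho> R by (intro mult_left_mono) auto
          then have "vol x \<rho> \<le> vol x \<rho> / \<rho>" using \<rho> by (simp add: pos_le_divide_eq)
          then show "vol x \<rho> + (4 * Cd ^ 2 + Cd ^ 2 * C) * (vol x \<rho> / \<rho>) \<le> (1 + (4 * Cd ^ 2 + Cd ^ 2 * C)) * (vol x \<rho> / \<rho>)"
            by (simp only: distrib_right mult_1 add_right_mono)
        qed
        finally have norm: "N11_norm M UNIV w \<le> ennreal ((1 + (4 * Cd ^ 2 + Cd ^ 2 * C)) * (vol x \<rho> / \<rho>))" .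
        have w_U: "w z = 0" if "z \<notin> U" for z using w_supp[of z] core_U that by blast
        have "in_N11_0 M U w" unfolding in_N11_0_def using N11(2) w_U by blast
        moreover have "w z = 1" if z: "z \<in> W" for z
        proof -
          have "?\<phi> z = 1" using z s by (intro cutoff_one) (auto simp: W_def s_def)
          moreover have "\<eta> z = 0" using z by (intro \<eta>0) (force simp: W_def)
          ultimately show ?thesis by (simp add: w_def)
        qed
        moreover have "supp w \<subseteq> U" using supp_sub core_U by (rule subset_trans)
        ultimately show ?thesis
          using W_open xW WU w01 compact norm by blast
      qed
    qed
  qed
qed

end

theorem theorem4p3:
  fixes M :: "'a::{metric_space, complete_space} measure"
    and U :: "'a set" and x :: 'a
  assumes two_points: "\<exists>p q::'a. p \<noteq> q"
    and borel_sets: "sets M = sets borel"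
    and doubling: "doubling M"
    and poincare: "poincare_11 M"
    and fopen: "finely_open1 M U"
    and xU: "x \<in> U"
  shows "(\<exists>W w. finely_open1 M W \<and> x \<in> W \<and> W \<subseteq> U \<and> in_N11_0 M U w
            \<and> (\<forall>z. 0 \<le> w z \<and> w z \<le> 1) \<and> (\<forall>z\<in>W. w z = 1)
            \<and> compact (supp w) \<and> supp w \<subseteq> U)
       \<and> (Cap1 M {x} = 0 \<longrightarrow>
           (\<forall>\<epsilon>>0. \<exists>W w. finely_open1 M W \<and> x \<in> W \<and> W \<subseteq> U \<and> in_N11_0 M U w
            \<and> (\<forall>z. 0 \<le> w z \<and> w z \<le> 1) \<and> (\<forall>z\<in>W. w z = 1)
            \<and> compact (supp w) \<and> supp w \<subseteq> U
            \<and> N11_norm M UNIV w < ennreal \<epsilon>))"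
proof -
  obtain Cd where Cd: "\<And>y r. r > 0 \<Longrightarrow> 0 < emeasure M (ball y (2 * r)) \<and>
      emeasure M (ball y (2 * r)) \<le> ennreal Cd * emeasure M (ball y r) \<and> emeasure M (ball y (2 * r)) < \<infinity>"
    using doubling unfolding doubling_def by blast
  obtain CP lam where P: "CP > 0" "lam \<ge> (1::real)"
    "\<And>y r u g. r > 0 \<Longrightarrow> L1_loc M u \<Longrightarrow> upper_gradient u g \<Longrightarrow>
        (\<integral>\<^sup>+ z. ennreal \<bar>u z - (\<integral>w\<in>ball y r. u w \<partial>completion M) / measure M (ball y r)\<bar>
              * indicator (ball y r) z \<partial>completion M) / emeasure M (ball y r)
        \<le> ennreal (CP * r) * ((\<integral>\<^sup>+ z. g z * indicator (ball y (lam * r)) z \<partial>M)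
              / emeasure M (ball y (lam * r)))"
    using poincare unfolding poincare_11_def by blast
  obtain p q :: 'a where pq: "p \<noteq> q" using two_points by blast
  have far: "\<exists>z. dist p q / 2 \<le> dist y z" for y :: 'a
  proof -
    have "dist p q \<le> dist y p + dist y q" using dist_triangle[of p q y] by (simp add: dist_commute)
    then have "dist p q / 2 \<le> dist y p \<or> dist p q / 2 \<le> dist y q" by linarith
    then show ?thesis by blast
  qed
  interpret poincare_space M Cd CP lam "dist p q / 2"
    by unfold_locales (use borel_sets Cd P pq far in auto)
  show ?thesis
  proof (rule fine_neighbourhood[OF fopen xU])
    fix C R
    assume C: "0 < C" and R: "0 < R" and ex: "\<And>\<rho>. 0 < \<rho> \<Longrightarrow> \<rho> < R \<Longrightarrow> \<exists>W w. finely_open1 M W \<and> x \<in> W \<and> W \<subseteq> U \<and> in_N11_0 M U w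
      \<and> (\<forall>z. 0 \<le> w z \<and> w z \<le> 1) \<and> (\<forall>z\<in>W. w z = 1) \<and> compact (supp w) \<and> supp w \<subseteq> U
      \<and> N11_norm M UNIV w \<le> ennreal (C * (vol x \<rho> / \<rho>))"
    show ?thesis
    proof (intro conjI impI allI)
      show "\<exists>W w. finely_open1 M W \<and> x \<in> W \<and> W \<subseteq> U \<and> in_N11_0 M U w
            \<and> (\<forall>z. 0 \<le> w z \<and> w z \<le> 1) \<and> (\<forall>z\<in>W. w z = 1)
            \<and> compact (supp w) \<and> supp w \<subseteq> U"
        using ex[of "R / 2"] R by auto
      fix \<epsilon> :: real assume cap: "Cap1 M {x} = 0" and \<epsilon>: "0 < \<epsilon>"
      \<comment> \<open>One threshold for both conclusions of \<open>point_capacity_zero\<close>: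
        the radius must be below \<open>R\<close> and the quotient below
        \<open>\<epsilon> / C\<close>.\<close>
      have "0 < min R (\<epsilon> / C)" using R C \<epsilon> by simp
      then obtain \<rho> where \<rho>: "0 < \<rho>" "\<rho> < min R (\<epsilon> / C)" "vol x \<rho> / \<rho> < min R (\<epsilon> / C)"
        using point_capacity_zero[OF cap] by blast
      then have "C * (vol x \<rho> / \<rho>) < \<epsilon>" using C by (simp add: pos_less_divide_eq mult.commute)
      then have less: "ennreal (C * (vol x \<rho> / \<rho>)) < ennreal \<epsilon>" using \<epsilon> by (intro ennreal_lessI)
      obtain W w where W: "finely_open1 M W \<and> x \<in> W \<and> W \<subseteq> U \<and> in_N11_0 M U w
            \<and> (\<forall>z. 0 \<le> w z \<and> w z \<le> 1) \<and> (\<forall>z\<in>W. w z = 1)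
            \<and> compact (supp w) \<and> supp w \<subseteq> U \<and> N11_norm M UNIV w \<le> ennreal (C * (vol x \<rho> / \<rho>))"
        using ex[of \<rho>] \<rho> by auto
      then have "N11_norm M UNIV w < ennreal \<epsilon>" using less by (blast intro: le_less_trans)
      then show "\<exists>W w. finely_open1 M W \<and> x \<in> W \<and> W \<subseteq> U \<and> in_N11_0 M U w
            \<and> (\<forall>z. 0 \<le> w z \<and> w z \<le> 1) \<and> (\<forall>z\<in>W. w z = 1)
            \<and> compact (supp w) \<and> supp w \<subseteq> U \<and> N11_norm M UNIV w < ennreal \<epsilon>"
        using W by blast
    qed
  qed
qed

end
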